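(* Let $(q,h,\beta,\gamma)$ and $(\tilde q,\tilde h,\tilde\beta,\tilde\gamma)$ be two sets of coefficients, with the same $H\in\mathbb{C}$ and the same $d\in(0,\pi)$, and let $B,B^\infty$ and $\tilde B,\tilde B^\infty$ be the corresponding boundary value problems (see context). Let $m\in\mathbb{N}_0\cup\{-1\}$, suppose that $q,\tilde q$ are $C^m$ near $\pi$ and that $q^{(j)}(\pi)=\tilde q^{(j)}(\pi)$ for $j=0,1,\dots,m$. Suppose that (1) or (2) holds: (1) $\lambda_n=\tilde\lambda_n$ for all $n\in\mathbb{N}_0$, and there are a set $\Lambda\subset S_B$ and integers $0\le k_n\le m_n-1$ ($n\in S_B\setminus\Lambda$) with $$\sum_{n\in\Lambda}m_n+\sum_{n\in S_B\setminus\Lambda}(m_n-k_n-1)=\left[\frac{m+3}{2}\right]$$ such that $\alpha_{n+\nu}=\tilde\alpha_{n+\nu}$ for all $n\in S_B\setminus\Lambda$ and $\nu=0,1,\dots,k_n$; (2) $\lambda_n^\infty=\tilde\lambda_n^\infty$ for all $n\in\mathbb{N}_0$, and there are a set $\Lambda^\infty\subset S_{B^\infty}$ and integers $0\le k_n^\infty\le m_n^\infty-1$ ($n\in S_{B^\infty}\setminus\Lambda^\infty$) with $$\sum_{n\in\Lambda^\infty}m_n^\infty+\sum_{n\in S_{B^\infty}\setminus\Lambda^\infty}(m_n^\infty-k_n^\infty-1)=\left[\frac{m+1}{2}\right]$$ such that $\alpha^\infty_{n+\nu}=\tilde\alpha^\infty_{n+\nu}$ for all $n\in S_{B^\infty}\setminus\Lambda^\infty$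 and $\nu=0,1,\dots,k_n^\infty$. Then $h=\tilde h$, $\beta=\tilde\beta$, $\gamma=\tilde\gamma$ and $q=\tilde q$ a.e. on $[0,\pi]$.
   Context: For coefficients $q\in L^1([0,\pi];\mathbb{C})$, $h,H,\gamma\in\mathbb{C}$, $\beta\in\mathbb{R}$ with $\beta>0$, and $d\in(0,\pi)$, consider the equation $-y''+q(x)y=\lambda y$ on $(0,\pi)$ with the boundary condition $y'(0)-hy(0)=0$ and the jump conditions $y(d+0)=\beta y(d-0)$, $y'(d+0)=\beta^{-1}y'(d-0)+\gamma y(d-0)$. Problem $B$ has in addition the condition $y'(\pi)+Hy(\pi)=0$; problem $B^\infty$ has instead the condition $y(\pi)=0$. Let $\varphi(x,\lambda),\psi(x,\lambda),\psi^\infty(x,\lambda)$ be the solutions of the equation satisfying the jump conditions and $\varphi(0,\lambda)=1,\varphi'(0,\lambda)=h$; $\psi(\pi,\lambda)=1,\psi'(\pi,\lambda)=-H$; $\psi^\infty(\pi,\lambda)=0,(\psi^{\infty})'(\pi,\lambda)=1$ (prime denotes $d/dx$). The eigenvalues of $B$ and $B^\infty$ are the zeros of the entire functions $\Delta(\lambda)=\varphi'(\pi,\lambda)+H\varphi(\pi,\lambda)$ and $\Delta^\infty(\lambda)=-\varphi(\pi,\lambda)$, respectively; the algebraic multiplicity of an eigenvalue is its order as a zero. $\sigma(B)=\{\lambda_n\}_{n\in\mathbb{N}_0}$ and $\sigma(B^\infty)=\{\lambda_n^\infty\}_{n\in\mathbb{N}_0}$ are the sequences of all eigenvalues, repeated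 according to algebraic multiplicity, ordered by nondecreasing modulus, with identical eigenvalues adjacent. $S_B=\{n\in\mathbb{N}:\lambda_{n-1}\ne\lambda_n\}\cup\{0\}$ and $S_{B^\infty}=\{n\in\mathbb{N}:\lambda^\infty_{n-1}\ne\lambda^\infty_n\}\cup\{0\}$. For $n\in S_B$ (resp. $n\in S_{B^\infty}$), $m_n$ (resp. $m_n^\infty$) is the algebraic multiplicity of $\lambda_n$ (resp. $\lambda_n^\infty$). Generalized normalizing constants: for $n\in S_B$, $\nu=0,\dots,m_n-1$, put $\psi_{n+\nu}(x)=\frac1{\nu!}\frac{d^\nu}{d\lambda^\nu}\psi(x,\lambda)|_{\lambda=\lambda_n}$ and $\alpha_{n+\nu}=\int_0^\pi\psi_{n+\nu}(x)\psi_{n+m_n-1}(x)\,dx$. For $n\in S_{B^\infty}$, $\nu=0,\dots,m_n^\infty-1$, put $\psi^\infty_{n+\nu}(x)=\frac1{\nu!}\frac{d^\nu}{d\lambda^\nu}\psi^\infty(x,\lambda)|_{\lambda=\lambda_n^\infty}$ and $\alpha^\infty_{n+\nu}=\int_0^\pi\psi^\infty_{n+\nu}(x)\psi^\infty_{n+m_n^\infty-1}(x)\,dx$. Symbols with a tilde denote the corresponding objects for $(\tilde q,\tilde h,H,\tilde\beta,\tilde\gamma,d)$. "$C^m$ near $\pi$" means $C^m$ on $[\pi-\delta,\pi]$ for some $\delta>0$; by convention $C^{-1}$ means $L^1$ (no extra smoothness, and no condition on derivatives at $\pi$). $[\,\cdot\,]$ denotes the integer part. *)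

theory Defs
  imports "HOL-Complex_Analysis.Complex_Analysis"
begin

text \<open>
  Derivative relative to \<^term>\<open>{0..pi}\<close>: one-sided at \<open>0\<close> and \<open>\<pi>\<close>, two-sided in between.
  It never looks at values outside \<^term>\<open>{0..pi}\<close>.
\<close>

definition dx :: "(real \<Rightarrow> complex) \<Rightarrow> real \<Rightarrow> complex" where
  "dx y x = vector_derivative y (at x within {0..pi})"

text \<open>
  \<open>C\<^sup>m\<close> on some \<open>[\<pi> - \<delta>, \<pi>]\<close>. At \<open>\<pi> - \<delta>\<close> the derivatives are two-sided; since \<open>\<delta>\<close> may be
  shrunk, this is the same as using one-sided ones. For \<open>m = -1\<close> there is no condition.
\<close>

definition C_near_pi :: "int \<Rightarrow> (real \<Rightarrow> complex) \<Rightarrow> bool" where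
  "C_near_pi m q \<longleftrightarrow> (\<exists>\<delta>. 0 < \<delta> \<and> \<delta> < pi \<and>
     (\<forall>j::nat. int j < m \<longrightarrow>
        (\<forall>x\<in>{pi - \<delta>..pi}. (dx ^^ j) q differentiable (at x within {0..pi}))) \<and>
     (\<forall>j::nat. int j \<le> m \<longrightarrow> continuous_on {pi - \<delta>..pi} ((dx ^^ j) q)))"

text \<open>
  Absolute continuity of functions (the library's \<^const>\<open>absolutely_continuous\<close> is about measures).
  The members of \<open>D\<close> are nonoverlapping compact intervals, with endpoints \<open>Inf I\<close> and \<open>Sup I\<close>.
\<close>

definition abs_cont_on :: "real set \<Rightarrow> (real \<Rightarrow> complex) \<Rightarrow> bool" where
  "abs_cont_on S f \<longleftrightarrow> (\<forall>\<epsilon>>0. \<exists>\<delta>>0. \<forall>D T. D division_of T \<and> T \<subseteq> S \<and> (\<Sum>I\<in>D. Sup I - Inf I) < \<delta>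
     \<longrightarrow> (\<Sum>I\<in>D. norm (f (Sup I) - f (Inf I))) < \<epsilon>)"

text \<open>
  Solutions of \<open>-y'' + q y = lam y\<close> for integrable \<open>q\<close>: \<open>y'\<close> exists off \<open>d\<close>, is locally absolutely
  continuous on \<open>[0, d)\<close> and \<open>(d, \<pi>]\<close>, and the equation holds almost everywhere. In the jump
  conditions \<open>a = y(d - 0)\<close> and \<open>b = y'(d - 0)\<close>; the value of \<open>y\<close> at \<open>d\<close> itself is irrelevant.
\<close>

definition jump_solution ::
  "(real \<Rightarrow> complex) \<Rightarrow> real \<Rightarrow> real \<Rightarrow> complex \<Rightarrow> complex \<Rightarrow> (real \<Rightarrow> complex) \<Rightarrow> bool" where
  "jump_solution q d \<beta> \<gamma> lam y \<longleftrightarrow>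
     (\<forall>x\<in>{0..pi} - {d}. y differentiable (at x within {0..pi})) \<and>
     (\<forall>u v. {u..v} \<subseteq> {0..pi} - {d} \<longrightarrow> abs_cont_on {u..v} (dx y)) \<and>
     (AE x in lebesgue. x \<in> {0..pi} \<longrightarrow>
        (\<exists>y2. (dx y has_vector_derivative y2) (at x within {0..pi}) \<and>
              - y2 + q x * y x = lam * y x)) \<and>
     (\<exists>a b. (y \<longlongrightarrow> a) (at_left d) \<and> (dx y \<longlongrightarrow> b) (at_left d) \<and>
        (y \<longlongrightarrow> of_real \<beta> * a) (at_right d) \<and>
        (dx y \<longlongrightarrow> of_real (inverse \<beta>) * b + \<gamma> * a) (at_right d))"

text \<open>
  For integrable \<open>q\<close>, \<open>\<beta> > 0\<close> and \<open>0 < d < \<pi>\<close> the following solutions exist and are unique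
  on \<open>[0, \<pi>]\<close> without \<open>d\<close>. The arbitrary values at \<open>d\<close> and outside \<open>[0, \<pi>]\<close> do not enter
  the quantities defined from them.
\<close>

definition phi ::
  "(real \<Rightarrow> complex) \<Rightarrow> complex \<Rightarrow> real \<Rightarrow> complex \<Rightarrow> real \<Rightarrow> complex \<Rightarrow> real \<Rightarrow> complex" where
  "phi q h \<beta> \<gamma> d lam = (SOME y. jump_solution q d \<beta> \<gamma> lam y \<and> y 0 = 1 \<and> dx y 0 = h)"

definition psi ::
  "(real \<Rightarrow> complex) \<Rightarrow> complex \<Rightarrow> real \<Rightarrow> complex \<Rightarrow> real \<Rightarrow> complex \<Rightarrow> real \<Rightarrow> complex" where
  "psi q H \<beta> \<gamma> d lam = (SOME y. jump_solution q d \<beta> \<gamma> lam y \<and> y pi = 1 \<and> dx y pi = - H)"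

definition psi_inf ::
  "(real \<Rightarrow> complex) \<Rightarrow> real \<Rightarrow> complex \<Rightarrow> real \<Rightarrow> complex \<Rightarrow> real \<Rightarrow> complex" where
  "psi_inf q \<beta> \<gamma> d lam = (SOME y. jump_solution q d \<beta> \<gamma> lam y \<and> y pi = 0 \<and> dx y pi = 1)"

definition Delta ::
  "(real \<Rightarrow> complex) \<Rightarrow> complex \<Rightarrow> complex \<Rightarrow> real \<Rightarrow> complex \<Rightarrow> real \<Rightarrow> complex \<Rightarrow> complex" where
  "Delta q h H \<beta> \<gamma> d lam = dx (phi q h \<beta> \<gamma> d lam) pi + H * phi q h \<beta> \<gamma> d lam pi"

definition Delta_inf ::
  "(real \<Rightarrow> complex) \<Rightarrow> complex \<Rightarrow> real \<Rightarrow> complex \<Rightarrow> real \<Rightarrow> complex \<Rightarrow> complex" where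
  "Delta_inf q h \<beta> \<gamma> d lam = - phi q h \<beta> \<gamma> d lam pi"

text \<open>
  Below, \<open>F\<close> is a characteristic function (\<^const>\<open>Delta\<close> or \<^const>\<open>Delta_inf\<close>) and \<open>l\<close> an
  enumeration of its zeros. The ordering is not unique when distinct zeros have equal modulus, so
  admissible enumerations are described by a predicate.
\<close>

definition eigenvalue_seq :: "(complex \<Rightarrow> complex) \<Rightarrow> (nat \<Rightarrow> complex) \<Rightarrow> bool" where
  "eigenvalue_seq F l \<longleftrightarrow>
     range l = {z. F z = 0} \<and>
     (\<forall>z. F z = 0 \<longrightarrow> finite {n. l n = z} \<and> int (card {n. l n = z}) = zorder F z) \<and>
     (\<forall>i j. i \<le> j \<longrightarrow> norm (l i) \<le> norm (l j)) \<and>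
     (\<forall>i j k. i \<le> j \<and> j \<le> k \<and> l i = l k \<longrightarrow> l j = l i)"

definition block_starts :: "(nat \<Rightarrow> complex) \<Rightarrow> nat set" where
  "block_starts l = {n. 1 \<le> n \<and> l (n - 1) \<noteq> l n} \<union> {0}"

definition alg_mult :: "(complex \<Rightarrow> complex) \<Rightarrow> (nat \<Rightarrow> complex) \<Rightarrow> nat \<Rightarrow> nat" where
  "alg_mult F l n = nat (zorder F (l n))"

text \<open>
  The sequences \<open>\<psi>\<^bsub>n+\<nu>\<^esub>\<close> and \<open>\<alpha>\<^bsub>n+\<nu>\<^esub>\<close> are represented with the two indices
  \<open>n \<in> block_starts l\<close> and \<open>\<nu> < alg_mult F l n\<close> kept apart.
\<close>

definition root_fun ::
  "(complex \<Rightarrow> real \<Rightarrow> complex) \<Rightarrow> (nat \<Rightarrow> complex) \<Rightarrow> nat \<Rightarrow> nat \<Rightarrow> real \<Rightarrow> complex" where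
  "root_fun \<psi> l n \<nu> x = (deriv ^^ \<nu>) (\<lambda>z. \<psi> z x) (l n) / fact \<nu>"

definition norming_const ::
  "(complex \<Rightarrow> complex) \<Rightarrow> (complex \<Rightarrow> real \<Rightarrow> complex) \<Rightarrow> (nat \<Rightarrow> complex) \<Rightarrow> nat \<Rightarrow> nat \<Rightarrow> complex" where
  "norming_const F \<psi> l n \<nu> =
     (LINT x:{0..pi}|lebesgue. root_fun \<psi> l n \<nu> x * root_fun \<psi> l n (alg_mult F l n - 1) x)"

text \<open>
  The hypothesis that two problems share all eigenvalues and, with \<open>N\<close> exceptions, their
  generalized norming constants. The sums live in \<^typ>\<open>ennreal\<close> because the index sets are
  infinite in general; the subtraction on \<^typ>\<open>nat\<close> does not truncate as \<open>k n < alg_mult F l n\<close>.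
\<close>

definition spectral_data_agree ::
  "(complex \<Rightarrow> complex) \<Rightarrow> (complex \<Rightarrow> real \<Rightarrow> complex) \<Rightarrow> (nat \<Rightarrow> complex) \<Rightarrow>
   (complex \<Rightarrow> complex) \<Rightarrow> (complex \<Rightarrow> real \<Rightarrow> complex) \<Rightarrow> (nat \<Rightarrow> complex) \<Rightarrow> nat \<Rightarrow> bool" where
  "spectral_data_agree F \<psi> l F' \<psi>' l' N \<longleftrightarrow>
     (\<forall>n. l n = l' n) \<and>
     (\<exists>\<Lambda> k. \<Lambda> \<subseteq> block_starts l \<and>
        (\<forall>n\<in>block_starts l - \<Lambda>. k n \<le> alg_mult F l n - 1) \<and>
        infsum (\<lambda>n. of_nat (alg_mult F l n) :: ennreal) \<Lambda> +
          infsum (\<lambda>n. of_nat (alg_mult F l n - k n - 1)) (block_starts l - \<Lambda>) = of_nat N \<and>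
        (\<forall>n\<in>block_starts l - \<Lambda>. \<forall>\<nu>\<in>{0..k n}.
           norming_const F \<psi> l n \<nu> = norming_const F' \<psi>' l' n \<nu>))"

end

theory Submission
  imports Defs
begin

text \<open>
  Write \<open>\<Delta>(\<lambda>) = \<phi>'(\<pi>, \<lambda>) + H \<phi>(\<pi>, \<lambda>)\<close> and \<open>N(\<lambda>) = \<phi>(\<pi>, \<lambda>)\<close>. Then \<open>N / \<Delta>\<close> is a Weyl function at \<open>\<pi>\<close>, and
  \<open>\<psi>(0) N = 1 - \<Delta> \<psi>\<^sup>\<infinity>(0)\<close>; so the norming constants at a zero \<open>\<lambda>\<^sub>n\<close> of order \<open>k\<close>, which up to sign are
  Taylor coefficients of \<open>\<psi>(0) \<Delta> / (\<lambda> - \<lambda>\<^sub>n)\<^sup>k\<close>, determine the principal part of \<open>N / \<Delta>\<close> at \<open>\<lambda>\<^sub>n\<close>.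
  If they agree up to \<open>p\<close> exceptions, some polynomial \<open>Q\<close> of degree at most \<open>p\<close> makes
  \<open>g = Q (N / \<Delta> - N~ / \<Delta>~)\<close> entire. On the contours \<open>max |Re \<rho>| |Im \<rho>| = n + 1/2\<close> with \<open>\<rho>\<^sup>2 = \<lambda>\<close>
  the quotients are bounded, so \<open>g(\<rho>\<^sup>2)\<close> is a polynomial in \<open>\<rho>\<close>.
  On the imaginary axis \<open>N \<Delta>~ - N~ \<Delta>\<close> is the Wronskian of \<open>\<phi>\<close> and \<open>\<phi>~\<close> at \<open>\<pi>\<close>. It is, up to smaller terms, an integral of
  \<open>(q~ - q) \<phi> \<phi>~\<close> over a small neighbourhood of \<open>\<pi>\<close>, and \<open>q~ - q = o((\<pi> - x)\<^sup>m)\<close> there; this gives just enough decay for \<open>g \<longlongrightarrow> 0\<close>,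
  hence \<open>g = 0\<close>. Interchanging the roles of \<open>N\<close> and \<open>\<Delta>\<close> settles the second case.

  From \<open>N \<Delta>~ = N~ \<Delta>\<close> the coefficients are recovered as in Borg-Marchenko theory: for fixed \<open>x\<close> the entire
  function \<open>\<psi>\<^sup>\<infinity> \<psi>~ - \<psi> \<psi>~\<^sup>\<infinity>\<close> tends to \<open>0\<close> on the same contours, hence vanishes, so both fundamental systems
  agree up to a sign that is constant on each side of \<open>d\<close>; the data at \<open>\<pi>\<close> and \<open>\<beta>, \<beta>~ > 0\<close> make it \<open>+\<close>.
\<close>

subsection \<open>Absolutely continuous functions\<close>

text \<open>The two integer parts come from a balance of powers at \<rho> = i \<kappa>. The
  Wronskian there is o(\<kappa>^(-m-1) e^(2 \<kappa> \<pi>)), while at the sampled points Delta is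
  at least of size \<kappa> e^(\<kappa> \<pi>) and N at least of size e^(\<kappa> \<pi>). So N /
  Delta - N~ / Delta~ is o(\<kappa>^(-m-3)), and the difference of the inverted quotients is
  o(\<kappa>^(-m-1)). A polynomial Q of degree p in \<lambda> costs \<kappa>^(2p), which leaves room
  for p up to [(m+3)/2] and [(m+1)/2]. Three obstacles shape the proof. Eigenvalues may be multiple
  and non-real, so principal parts are compared through formal power series instead of residues at
  simple poles. The potential is merely integrable, so y' has a derivative only almost everywhere,
  and calculus is done with absolutely continuous functions. The solutions in the definitions are
  chosen by a choice operator and are arbitrary at \<open>d\<close>; they are therefore identified
  with explicitly constructed families that depend holomorphically on \<lambda>.\<close>

lemma division_Inf_Sup:
  fixes D :: "real set set"
  assumes "D division_of T" "I \<in> D"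
  shows "I = {Inf I..Sup I}" "Inf I \<le> Sup I" "Inf I \<in> T" "Sup I \<in> T" "measure lborel I = Sup I - Inf I"
    "measure lebesgue I = Sup I - Inf I"
proof -
  obtain u v where I: "I = {u..v}" using assms(1,2) by (metis box_real(2) division_ofD(4))
  moreover have "I \<noteq> {}" "I \<subseteq> T" using assms(1,2) by auto
  ultimately have *: "u \<le> v" "Inf I = u" "Sup I = v" by auto
  with I \<open>I \<subseteq> T\<close> show "I = {Inf I..Sup I}" "Inf I \<le> Sup I" "Inf I \<in> T" "Sup I \<in> T" "measure lborel I = Sup I - Inf I"
    "measure lebesgue I = Sup I - Inf I"
    by auto
qed

lemma abs_cont_onE:
  assumes "abs_cont_on S f" "0 < e"
  obtains \<delta> where "\<delta> > 0" "\<forall>D T. D division_of T \<and> T \<subseteq> S \<and> (\<Sum>I\<in>D. Sup I - Inf I) < \<delta> \<longrightarrow> (\<Sum>I\<in>D. norm (f (Sup I) - f (Inf I))) < e"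
  using assms(1)[unfolded abs_cont_on_def, THEN spec, THEN mp, OF assms(2)]
  by (elim exE conjE) (rule that)

lemma abs_cont_on_cong:
  assumes "\<And>x. x \<in> S \<Longrightarrow> f x = g x"
  shows "abs_cont_on S f \<longleftrightarrow> abs_cont_on S g"
proof -
  have "abs_cont_on S g" if ac: "abs_cont_on S f" and eq: "\<And>x. x \<in> S \<Longrightarrow> f x = g x" for f g
    unfolding abs_cont_on_def
  proof (intro allI impI)
    fix e :: real assume e: "e > 0"
    obtain \<delta> where "\<delta> > 0" and \<delta>0: "\<forall>D T. D division_of T \<and> T \<subseteq> S \<and> (\<Sum>I\<in>D. Sup I - Inf I) < \<delta> \<longrightarrow> (\<Sum>I\<in>D. norm (f (Sup I) - f (Inf I))) < e"
      by (rule abs_cont_onE[OF ac e]) (rule that)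
    note \<delta> = \<delta>0[THEN spec, THEN spec, THEN mp]
    have "(\<Sum>I\<in>D. norm (g (Sup I) - g (Inf I))) < e"
      if *: "D division_of T \<and> T \<subseteq> S \<and> (\<Sum>I\<in>D. Sup I - Inf I) < \<delta>" for D T
    proof -
      have "f (Sup I) = g (Sup I)" "f (Inf I) = g (Inf I)" if "I \<in> D" for I
        using division_Inf_Sup(3,4)[of D T I] that * eq by auto
      then have "(\<Sum>I\<in>D. norm (g (Sup I) - g (Inf I))) = (\<Sum>I\<in>D. norm (f (Sup I) - f (Inf I)))"
        by (intro sum.cong) auto
      with \<delta>[OF *] show ?thesis by simp
    qed
    with \<open>\<delta> > 0\<close> show "\<exists>\<delta>>0. \<forall>D T. D division_of T \<and> T \<subseteq> S \<and> (\<Sum>I\<in>D. Sup I - Inf I) < \<delta> \<longrightarrow> (\<Sum>I\<in>D. norm (g (Sup I) - g (Inf I))) < e"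
      by (intro exI[of _ \<delta>] conjI allI impI)
  qed
  from this[of f g] this[of g f] assms show ?thesis by auto
qed

lemma abs_cont_on_subset: "abs_cont_on S f \<Longrightarrow> T \<subseteq> S \<Longrightarrow> abs_cont_on T f"
  unfolding abs_cont_on_def by (meson subset_trans)

lemma abs_cont_on_imp_continuous_on:
  fixes a b :: real
  assumes "abs_cont_on {a..b} f"
  shows "continuous_on {a..b} f"
  unfolding continuous_on_iff
proof (intro ballI allI impI)
  fix x e :: real assume x: "x \<in> {a..b}" and "0 < e"
  obtain \<delta> where "\<delta> > 0" and \<delta>0: "\<forall>D T. D division_of T \<and> T \<subseteq> {a..b} \<and> (\<Sum>I\<in>D. Sup I - Inf I) < \<delta> \<longrightarrow> (\<Sum>I\<in>D. norm (f (Sup I) - f (Inf I))) < e"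
    by (rule abs_cont_onE[OF assms \<open>e > 0\<close>]) (rule that)
    note \<delta> = \<delta>0[THEN spec, THEN spec, THEN mp]
  have *: "norm (f v - f u) < e" if "u \<in> {a..b}" "v \<in> {a..b}" "u \<le> v" "v - u < \<delta>" for u v
    using \<delta>[of "{{u..v}}" "{u..v}"] that division_of_self[of u v] by (auto simp: )
  show "\<exists>d>0. \<forall>x'\<in>{a..b}. dist x' x < d \<longrightarrow> dist (f x') (f x) < e"
  proof (intro exI conjI ballI impI)
    fix y assume "y \<in> {a..b}" "dist y x < \<delta>"
    then show "dist (f y) (f x) < e"
      using *[of x y] *[of y x] x by (cases "x \<le> y") (auto simp: dist_norm norm_minus_commute)
  qed (use \<open>\<delta> > 0\<close> in auto)
qed

lemma abs_cont_on_lipschitz: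
  fixes f :: "real \<Rightarrow> complex"
  assumes "\<And>x y. x \<in> S \<Longrightarrow> y \<in> S \<Longrightarrow> norm (f y - f x) \<le> B * \<bar>y - x\<bar>"
  shows "abs_cont_on S f"
  unfolding abs_cont_on_def
proof (intro allI impI)
  fix e :: real assume "e > 0"
  define \<delta> where "\<delta> = e / (\<bar>B\<bar> + 1)"
  have "\<delta> > 0" using \<open>e > 0\<close> by (simp add: \<delta>_def add_nonneg_pos)
  have "(\<Sum>I\<in>D. norm (f (Sup I) - f (Inf I))) < e"
    if *: "D division_of T" "T \<subseteq> S" "(\<Sum>I\<in>D. Sup I - Inf I) < \<delta>" for D T
  proof -
    have "(\<Sum>I\<in>D. norm (f (Sup I) - f (Inf I))) \<le> (\<Sum>I\<in>D. (\<bar>B\<bar> + 1) * (Sup I - Inf I))"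
    proof (rule sum_mono)
      fix I assume "I \<in> D"
      note I = division_Inf_Sup[OF *(1) this]
      have "norm (f (Sup I) - f (Inf I)) \<le> B * \<bar>Sup I - Inf I\<bar>"
        using assms[of "Inf I" "Sup I"] I(3,4) \<open>T \<subseteq> S\<close> by auto
      also have "\<dots> \<le> (\<bar>B\<bar> + 1) * (Sup I - Inf I)" using I(2) by (intro mult_mono) auto
      finally show "norm (f (Sup I) - f (Inf I)) \<le> (\<bar>B\<bar> + 1) * (Sup I - Inf I)" .
    qed
    also have "\<dots> = (\<bar>B\<bar> + 1) * (\<Sum>I\<in>D. Sup I - Inf I)" by (simp add: sum_distrib_left)
    also have "\<dots> < (\<bar>B\<bar> + 1) * \<delta>" using *(3) by (intro mult_strict_left_mono) auto
    also have "\<dots> = e" by (simp add: \<delta>_def)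
    finally show ?thesis .
  qed
  with \<open>\<delta> > 0\<close> show "\<exists>\<delta>>0. \<forall>D T. D division_of T \<and> T \<subseteq> S \<and> (\<Sum>I\<in>D. Sup I - Inf I) < \<delta> \<longrightarrow> (\<Sum>I\<in>D. norm (f (Sup I) - f (Inf I))) < e"
    by blast
qed

text \<open>Sums and products share one pattern: an increment of the new function is dominated by a
  fixed multiple of the increments of the two given ones. For products the factor comes from
  boundedness on a compact interval.\<close>

lemma abs_cont_on_combine:
  fixes f g k :: "real \<Rightarrow> complex"
  assumes "abs_cont_on S f" "abs_cont_on S g"
    and "\<And>x y. x \<in> S \<Longrightarrow> y \<in> S \<Longrightarrow> norm (k y - k x) \<le> B * (norm (f y - f x) + norm (g y - g x))"
  shows "abs_cont_on S k"
  unfolding abs_cont_on_def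
proof (intro allI impI)
  fix e :: real assume "e > 0"
  \<comment> \<open>Half of the tolerance goes to each function; dividing by |B| + 1 covers every
    real B.\<close>
  define e' where "e' = e / (2 * (\<bar>B\<bar> + 1))"
  have "e' > 0" using \<open>e > 0\<close> by (simp add: e'_def add_nonneg_pos)
  obtain \<delta>1 where "\<delta>1 > 0" and \<delta>10: "\<forall>D T. D division_of T \<and> T \<subseteq> S \<and> (\<Sum>I\<in>D. Sup I - Inf I) < \<delta>1 \<longrightarrow> (\<Sum>I\<in>D. norm (f (Sup I) - f (Inf I))) < e'"
    by (rule abs_cont_onE[OF assms(1) \<open>e' > 0\<close>]) (rule that)
    note \<delta>1 = \<delta>10[THEN spec, THEN spec, THEN mp]
  obtain \<delta>2 where "\<delta>2 > 0" and \<delta>20: "\<forall>D T. D division_of T \<and> T \<subseteq> S \<and> (\<Sum>I\<in>D. Sup I - Inf I) < \<delta>2 \<longrightarrow> (\<Sum>I\<in>D. norm (g (Sup I) - g (Inf I))) < e'"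
    by (rule abs_cont_onE[OF assms(2) \<open>e' > 0\<close>]) (rule that)
    note \<delta>2 = \<delta>20[THEN spec, THEN spec, THEN mp]
  have "(\<Sum>I\<in>D. norm (k (Sup I) - k (Inf I))) < e"
    if *: "D division_of T" "T \<subseteq> S" "(\<Sum>I\<in>D. Sup I - Inf I) < min \<delta>1 \<delta>2" for D T
  proof -
    have "(\<Sum>I\<in>D. norm (k (Sup I) - k (Inf I))) \<le> (\<Sum>I\<in>D. (\<bar>B\<bar> + 1) * (norm (f (Sup I) - f (Inf I)) + norm (g (Sup I) - g (Inf I))))"
    proof (rule sum_mono)
      fix I assume "I \<in> D"
      note I = division_Inf_Sup[OF *(1) this]
      have "norm (k (Sup I) - k (Inf I)) \<le> B * (norm (f (Sup I) - f (Inf I)) + norm (g (Sup I) - g (Inf I)))"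
        using assms(3)[of "Inf I" "Sup I"] I(3,4) \<open>T \<subseteq> S\<close> by auto
      also have "\<dots> \<le> (\<bar>B\<bar> + 1) * (norm (f (Sup I) - f (Inf I)) + norm (g (Sup I) - g (Inf I)))" by (intro mult_right_mono) auto
      finally show "norm (k (Sup I) - k (Inf I)) \<le> \<dots>" .
    qed
    also have "\<dots> = (\<bar>B\<bar> + 1) * ((\<Sum>I\<in>D. norm (f (Sup I) - f (Inf I))) + (\<Sum>I\<in>D. norm (g (Sup I) - g (Inf I))))"
      by (simp add: sum_distrib_left sum.distrib ring_distribs)
    also have "\<dots> < (\<bar>B\<bar> + 1) * (e' + e')"
      using \<delta>1[of D T] \<delta>2[of D T] * by (intro mult_strict_left_mono add_strict_mono) auto
    also have "\<dots> = e" proof -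
      have "e' * (2 * (\<bar>B\<bar> + 1)) = e" by (simp add: e'_def)
      then show ?thesis by (simp add: algebra_simps)
    qed
    finally show ?thesis .
  qed
  then show "\<exists>\<delta>>0. \<forall>D T. D division_of T \<and> T \<subseteq> S \<and> (\<Sum>I\<in>D. Sup I - Inf I) < \<delta> \<longrightarrow> (\<Sum>I\<in>D. norm (k (Sup I) - k (Inf I))) < e"
    using \<open>\<delta>1 > 0\<close> \<open>\<delta>2 > 0\<close> by (intro exI[of _ "min \<delta>1 \<delta>2"]) auto
qed

lemma abs_cont_on_add: "abs_cont_on S f \<Longrightarrow> abs_cont_on S g \<Longrightarrow> abs_cont_on S (\<lambda>x. f x + g x)"
  by (rule abs_cont_on_combine[of S f g _ 1])
     (auto simp: algebra_simps intro: order_trans[OF _ norm_triangle_ineq] arg_cong[where f=norm]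
        order_trans[OF eq_refl norm_triangle_ineq])

lemma abs_cont_on_mult:
  fixes f g :: "real \<Rightarrow> complex" and a b :: real
  assumes f: "abs_cont_on {a..b} f" and g: "abs_cont_on {a..b} g"
  shows "abs_cont_on {a..b} (\<lambda>x. f x * g x)"
proof -
  have "bounded (f ` {a..b})" "bounded (g ` {a..b})"
    using f g abs_cont_on_imp_continuous_on compact_continuous_image compact_imp_bounded by blast+
  then obtain Bf Bg where B: "\<And>x. x \<in> {a..b} \<Longrightarrow> norm (f x) \<le> Bf" "\<And>x. x \<in> {a..b} \<Longrightarrow> norm (g x) \<le> Bg"
    unfolding bounded_iff by blast
  show ?thesis
  proof (rule abs_cont_on_combine[OF f g, where B = "max Bf Bg"])
    fix x y assume xy: "x \<in> {a..b}" "y \<in> {a..b}"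
    have "f y * g y - f x * g x = (f y - f x) * g y + f x * (g y - g x)" by (simp add: algebra_simps)
    then have "norm (f y * g y - f x * g x) \<le> norm (f y - f x) * norm (g y) + norm (f x) * norm (g y - g x)"
      by (metis norm_mult norm_triangle_ineq)
    also have "\<dots> \<le> norm (f y - f x) * max Bf Bg + max Bf Bg * norm (g y - g x)"
      using B(1)[OF xy(1)] B(2)[OF xy(2)] by (intro add_mono mult_left_mono mult_right_mono) auto
    finally show "norm (f y * g y - f x * g x) \<le> max Bf Bg * (norm (f y - f x) + norm (g y - g x))"
      by (simp add: algebra_simps)
  qed
qed

text \<open>The gauge integral delivers the integrability of \<open>f'\<close> along with the value.
  Off the null set \<open>N\<close> the gauge comes from differentiability (the straddle estimate).
  On \<open>N\<close> the integrand is set to 0 and the gauge confines the intervals to an open set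
  of measure below \<delta>, so that absolute continuity, instead of a derivative, controls the
  increments of \<open>f\<close>.\<close>

lemma fundamental_theorem_of_calculus_abs_cont:
  fixes f f' :: "real \<Rightarrow> complex" and a b :: real
  assumes "a \<le> b" and ac: "abs_cont_on {a..b} f" and N: "negligible N"
    and der: "\<And>x. x \<in> {a..b} - N \<Longrightarrow> (f has_vector_derivative f' x) (at x within {a..b})"
  shows "(f' has_integral f b - f a) {a..b}"
proof (cases "a = b")
  case True then show ?thesis by (simp add: has_integral_refl)
next
  case False
  with \<open>a \<le> b\<close> have "a < b" by simp
  define g where "g x = (if x \<in> N then 0 else f' x)" for x
  have "(g has_integral f b - f a) {a..b}"
    unfolding has_integral_factor_content_real
  proof (intro allI impI)
    fix e :: real assume "e > 0"
    \<comment> \<open>The tolerance for a partition is \<open>e\<close> times the length b - a; one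
      half is spent on tags outside \<open>N\<close>, the other, \<open>e'\<close>, on tags
      inside.\<close>
    define e' where "e' = e * (b - a) / 2"
    have "e' > 0" using \<open>e > 0\<close> \<open>a < b\<close> by (simp add: e'_def)
    obtain \<delta> where "\<delta> > 0" and \<delta>0: "\<forall>D T. D division_of T \<and> T \<subseteq> {a..b} \<and> (\<Sum>I\<in>D. Sup I - Inf I) < \<delta> \<longrightarrow> (\<Sum>I\<in>D. norm (f (Sup I) - f (Inf I))) < e'"
      by (rule abs_cont_onE[OF ac \<open>e' > 0\<close>]) (rule that)
    note \<delta> = \<delta>0[THEN spec, THEN spec, THEN mp]
    have "N \<in> lmeasurable" "measure lebesgue N = 0" using N by (auto simp: negligible_imp_measurable negligible_imp_measure0)
    obtain U where U: "open U" "N \<subseteq> U" and U': "U - N \<in> lmeasurable" "emeasure lebesgue (U - N) < ennreal \<delta>"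
      using sets_lebesgue_outer_open[of N \<delta>] \<open>\<delta> > 0\<close> fmeasurableD[OF \<open>N \<in> lmeasurable\<close>] by blast
    have "U = (U - N) \<union> N" using U by auto
    have U3: "U \<in> lmeasurable" using fmeasurable.Un[OF U'(1) \<open>N \<in> lmeasurable\<close>] \<open>U = (U - N) \<union> N\<close> by simp
    have "measure lebesgue U \<le> measure lebesgue (U - N) + measure lebesgue N"
      using measure_Un_le[of "U - N" lebesgue N] fmeasurableD[OF U'(1)] fmeasurableD[OF \<open>N \<in> lmeasurable\<close>]
      by (subst \<open>U = (U - N) \<union> N\<close>) auto
    moreover have "measure lebesgue (U - N) < \<delta>"
      using U' \<open>\<delta> > 0\<close> by (simp add: emeasure_eq_measure2 ennreal_less_iff)
    ultimately have U4: "measure lebesgue U < \<delta>" using \<open>measure lebesgue N = 0\<close> by simp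
    have "\<forall>x. \<exists>d>0. x \<in> {a..b} - N \<longrightarrow>
         (\<forall>y\<in>{a..b}. norm (y-x) < d \<longrightarrow> norm (f y - f x - (y-x) *\<^sub>R f' x) \<le> e/2 * norm (y-x))"
      using der[unfolded has_vector_derivative_def has_derivative_within_alt] \<open>e > 0\<close>
      by (meson half_gt_zero zero_less_one)
    then obtain d where d: "\<And>x. 0 < d x"
      "\<And>x y. \<lbrakk>x \<in> {a..b} - N; y \<in> {a..b}; norm (y-x) < d x\<rbrakk> \<Longrightarrow> norm (f y - f x - (y-x) *\<^sub>R f' x) \<le> e/2 * norm (y-x)"
      by metis
    define G where "G x = (if x \<in> N then U else ball x (d x))" for x
    have gG: "gauge G" unfolding gauge_def G_def using U(1,2) d(1) by auto
    have main: "norm ((\<Sum>(x, K)\<in>p. measure lborel K *\<^sub>R g x) - (f b - f a)) \<le> e * measure lborel {a..b}"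
      if p: "p tagged_division_of {a..b}" "G fine p" for p
    proof -
      note td = tagged_division_ofD[OF p(1)]
      have K: "\<exists>u v. K = {u..v} \<and> u \<le> v \<and> Inf K = u \<and> Sup K = v \<and> x \<in> {u..v} \<and> {u..v} \<subseteq> {a..b} \<and> measure lborel K = v - u" if xKp: "(x, K) \<in> p" for x K
      proof -
        have "x \<in> K" "K \<subseteq> {a..b}" using td(2,3) xKp by auto
        moreover obtain u v where "K = cbox u v" using td(4)[OF xKp] by auto
        ultimately show ?thesis by (intro exI[of _ u] exI[of _ v]) auto
      qed
      define pN where "pN = {xk \<in> p. fst xk \<in> N}"
      have fin: "finite p" using td(1) .
      have split: "p = (p - pN) \<union> pN" "(p - pN) \<inter> pN = {}" unfolding pN_def by auto
      have "(\<Sum>(x, K)\<in>p. measure lborel K *\<^sub>R g x) - (f b - f a) = (\<Sum>(x, K)\<in>p. measure lborel K *\<^sub>R g x - (f (Sup K) - f (Inf K)))"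
        using additive_tagged_division_1[OF \<open>a \<le> b\<close> p(1), of f] by (simp add: sum_subtractf case_prod_unfold)
      also have "norm \<dots> \<le> (\<Sum>(x, K)\<in>p. norm (measure lborel K *\<^sub>R g x - (f (Sup K) - f (Inf K))))"
        by (rule order_trans[OF norm_sum]) (auto simp: case_prod_unfold)
      also have "\<dots> = (\<Sum>(x, K)\<in>p-pN. norm (measure lborel K *\<^sub>R g x - (f (Sup K) - f (Inf K)))) + (\<Sum>(x, K)\<in>pN. norm (measure lborel K *\<^sub>R g x - (f (Sup K) - f (Inf K))))"
        using fin split by (subst split(1), subst sum.union_disjoint) (auto simp: pN_def)
      finally have F0: "norm ((\<Sum>(x, K)\<in>p. measure lborel K *\<^sub>R g x) - (f b - f a)) \<le>
          (\<Sum>(x, K)\<in>p-pN. norm (measure lborel K *\<^sub>R g x - (f (Sup K) - f (Inf K)))) +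
          (\<Sum>(x, K)\<in>pN. norm (measure lborel K *\<^sub>R g x - (f (Sup K) - f (Inf K))))" .
      have "(\<Sum>(x, K)\<in>p-pN. norm (measure lborel K *\<^sub>R g x - (f (Sup K) - f (Inf K)))) \<le> (\<Sum>(x, K)\<in>p-pN. e/2 * measure lborel K)"
      proof (rule sum_mono, clarify)
        fix x K assume xK: "(x, K) \<in> p" "(x, K) \<notin> pN"
        then have xN: "x \<notin> N" unfolding pN_def by auto
        obtain u v where uv: "K = {u..v}" "u \<le> v" "Inf K = u" "Sup K = v" "x \<in> {u..v}" "{u..v} \<subseteq> {a..b}" "measure lborel K = v - u"
          using K[OF xK(1)] by blast
        have "K \<subseteq> ball x (d x)" using p(2) xK(1) xN unfolding fine_def G_def by fastforce
        moreover have "u \<in> K" "v \<in> K" using uv by auto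
        ultimately have "norm (u - x) < d x" "norm (v - x) < d x"
          by (auto simp: dist_norm norm_minus_commute subset_iff simp del: real_norm_def)
        moreover have "u \<in> {a..b}" "v \<in> {a..b}" "x \<in> {a..b} - N" using uv xN by auto
        ultimately have "norm (f u - f x - (u-x) *\<^sub>R f' x) \<le> e/2 * norm (u - x)" "norm (f v - f x - (v-x) *\<^sub>R f' x) \<le> e/2 * norm (v - x)"
          using d(2) by blast+
        moreover have "norm (u - x) = x - u" "norm (v - x) = v - x" using uv by auto
        ultimately have "norm (f u - f x - (u-x) *\<^sub>R f' x) \<le> e/2 * (x - u)" "norm (f v - f x - (v-x) *\<^sub>R f' x) \<le> e/2 * (v - x)"
          by simp_all
        moreover have "measure lborel K *\<^sub>R g x - (f (Sup K) - f (Inf K)) = (f u - f x - (u-x) *\<^sub>R f' x) - (f v - f x - (v-x) *\<^sub>R f' x)"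
          using xN uv by (simp add: g_def algebra_simps)
        ultimately have "norm (measure lborel K *\<^sub>R g x - (f (Sup K) - f (Inf K))) \<le> e/2 * (x - u) + e/2 * (v - x)"
          using norm_triangle_ineq4[of "f u - f x - (u-x) *\<^sub>R f' x" "f v - f x - (v-x) *\<^sub>R f' x"] by simp
        also have "e/2 * (x - u) + e/2 * (v - x) = e/2 * measure lborel K"
          unfolding uv(7) by (simp add: field_simps)
        finally show "norm (measure lborel K *\<^sub>R g x - (f (Sup K) - f (Inf K))) \<le> e/2 * measure lborel K" .
      qed
      also have "(\<Sum>(x, K)\<in>p-pN. e/2 * measure lborel K) \<le> (\<Sum>(x, K)\<in>p. e/2 * measure lborel K)"
        using fin \<open>e > 0\<close> by (intro sum_mono2) auto
      also have "\<dots> = e / 2 * (\<Sum>(x, K)\<in>p. measure lborel K)" by (simp add: sum_distrib_left case_prod_unfold)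
      also have "(\<Sum>(x, K)\<in>p. measure lborel K) = measure lborel {a..b}"
        using additive_content_tagged_division[of p a b] p(1) by simp
      finally have F1: "(\<Sum>(x, K)\<in>p-pN. norm (measure lborel K *\<^sub>R g x - (f (Sup K) - f (Inf K)))) \<le> e / 2 * measure lborel {a..b}" .
      have "(\<Sum>(x, K)\<in>pN. norm (measure lborel K *\<^sub>R g x - (f (Sup K) - f (Inf K)))) = (\<Sum>(x, K)\<in>pN. norm (f (Sup K) - f (Inf K)))"
        by (rule sum.cong) (auto simp: g_def pN_def norm_minus_commute)
      also have "\<dots> \<le> e'"
      proof -
        have pNp: "pN tagged_partial_division_of {a..b}"
          using p(1) tagged_partial_division_subset[of p "{a..b}" pN] tagged_division_of_def[of p] pN_def by auto
        define D where "D = snd ` pN"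
        have D: "D division_of \<Union>D" unfolding D_def by (rule partial_division_of_tagged_division[OF pNp])
        have sub: "\<Union>D \<subseteq> {a..b}" using td(3) unfolding D_def pN_def by force
        have "(\<Sum>(x, K)\<in>pN. norm (f (Sup K) - f (Inf K))) = (\<Sum>K\<in>D. norm (f (Sup K) - f (Inf K)))"
        proof -
          \<comment> \<open>Two different tags of one interval would give it interior points,
            against the disjointness of interiors. Hence summing over the tagged intervals in
            \<open>pN\<close> is the same as summing over the division \<open>D\<close>.\<close>
          have "\<not> (\<exists>x y. x \<noteq> y \<and> (x, K) \<in> pN \<and> (y, K) \<in> pN)" for K
          proof clarify
            fix x y assume *: "x \<noteq> y" "(x, K) \<in> pN" "(y, K) \<in> pN"
            then obtain u v where uv: "K = {u..v}" "x \<in> {u..v}" using K[of x K] pN_def by auto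
            have "y \<in> {u..v}" using K[of y K] * uv pN_def by auto
            then have "interior K \<noteq> {}" using uv * by auto
            then show False using td(5)[of x K y K] * pN_def by auto
          qed
          then have "inj_on snd pN" unfolding inj_on_def by (metis prod.collapse)
          then show ?thesis unfolding D_def by (simp add: sum.reindex case_prod_unfold)
        qed
        also have "\<dots> \<le> e'"
        proof -
          have "(\<Sum>I\<in>D. Sup I - Inf I) = (\<Sum>I\<in>D. measure lebesgue I)"
            using division_Inf_Sup(6)[OF D] by (intro sum.cong) auto
          also have "\<dots> = measure lebesgue (\<Union>D)" by (rule content_division[OF D])
          also have "\<dots> \<le> measure lebesgue U"
          proof (rule measure_mono_fmeasurable[OF _ _ U3])
            show "\<Union>D \<subseteq> U" proof
              fix y assume "y \<in> \<Union>D"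
              then obtain x K where xK: "(x, K) \<in> p" "x \<in> N" "y \<in> K" unfolding D_def pN_def by auto
              then have "y \<in> G x" using fineD[OF p(2) xK(1)] by blast
              then show "y \<in> U" using xK(2) by (simp add: G_def)
            qed
            show "\<Union>D \<in> sets lebesgue" using lmeasurable_division[OF D] by (rule fmeasurableD)
          qed
          finally have "(\<Sum>I\<in>D. Sup I - Inf I) < \<delta>" using U4 by simp
          with D sub have "(\<Sum>I\<in>D. norm (f (Sup I) - f (Inf I))) < e'" by (intro \<delta>) (rule conjI, assumption)+
          then show ?thesis by (rule less_imp_le)
        qed
        finally show ?thesis .
      qed
      finally have F2: "(\<Sum>(x, K)\<in>pN. norm (measure lborel K *\<^sub>R g x - (f (Sup K) - f (Inf K)))) \<le> e'" .
      have F3: "e / 2 * measure lborel {a..b} + e' = e * measure lborel {a..b}" using \<open>a \<le> b\<close> by (simp add: e'_def)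
      show ?thesis using F0 F1 F2 F3 by linarith
    qed
    show "\<exists>d. gauge d \<and> (\<forall>p. p tagged_division_of {a..b} \<and> d fine p \<longrightarrow> norm ((\<Sum>(x, K)\<in>p. measure lborel K *\<^sub>R g x) - (f b - f a)) \<le> e * measure lborel {a..b})"
    proof (intro exI[of _ G] conjI allI impI gG)
      fix p assume "p tagged_division_of {a..b} \<and> G fine p"
      then show "norm ((\<Sum>(x, K)\<in>p. measure lborel K *\<^sub>R g x) - (f b - f a)) \<le> e * measure lborel {a..b}"
        by (elim conjE) (rule main)
    qed
  qed
  then show ?thesis
    by (rule has_integral_spike[OF N, rotated]) (auto simp: g_def)
qed

text \<open>Truncation: \<open>g n\<close> is |f| cut off at height n. Its defect \<open>r\<close>
  has small integral by dominated convergence, whatever the intervals are, and the bounded part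
  contributes at most n times their total length.\<close>

lemma abs_cont_on_indefinite_integral:
  fixes f :: "real \<Rightarrow> complex" and a b :: real
  assumes f: "f absolutely_integrable_on {a..b}"
  shows "abs_cont_on {a..b} (\<lambda>x. integral {a..x} f)"
  unfolding abs_cont_on_def
proof (intro allI impI)
  fix e :: real assume "e > 0"
  have fi: "f integrable_on {a..b}" and nf: "(\<lambda>x. norm (f x)) absolutely_integrable_on {a..b}"
    using f by (auto simp: absolutely_integrable_on_def)
  define g where "g n x = min (norm (f x)) (real n)" for n x
  have gi: "g n absolutely_integrable_on {a..b}" for n
    unfolding g_def by (intro absolutely_integrable_min_1 nf absolutely_integrable_continuous_real continuous_intros)
  have "(\<lambda>n. integral {a..b} (g n)) \<longlonglongrightarrow> integral {a..b} (\<lambda>x. norm (f x))"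
  proof (rule dominated_convergence(2))
    show "g n integrable_on {a..b}" for n using gi absolutely_integrable_on_def by blast
    show "(\<lambda>x. norm (f x)) integrable_on {a..b}" using f absolutely_integrable_on_def by blast
    show "norm (g n x) \<le> norm (f x)" for n x by (auto simp: g_def)
    show "(\<lambda>n. g n x) \<longlonglongrightarrow> norm (f x)" for x
    proof (rule tendsto_eventually)
      show "\<forall>\<^sub>F n in sequentially. g n x = norm (f x)"
        using eventually_ge_at_top[of "nat \<lceil>norm (f x)\<rceil>"] by eventually_elim (auto simp: g_def min_def; linarith)
    qed
  qed
  then have "\<forall>\<^sub>F n in sequentially. dist (integral {a..b} (g n)) (integral {a..b} (\<lambda>x. norm (f x))) < e / 2"
    using \<open>e > 0\<close> tendstoD half_gt_zero by blast
  then obtain n where n: "dist (integral {a..b} (g n)) (integral {a..b} (\<lambda>x. norm (f x))) < e / 2"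
    by (auto simp: eventually_sequentially)
  define r where "r x = norm (f x) - g n x" for x
  have ri: "r absolutely_integrable_on {a..b}" unfolding r_def by (intro set_integral_diff nf gi)
  have r0: "r x \<ge> 0" for x by (auto simp: r_def g_def)
  have "integral {a..b} r = integral {a..b} (\<lambda>x. norm (f x)) - integral {a..b} (g n)"
    unfolding r_def using nf gi by (intro integral_diff) (auto simp: absolutely_integrable_on_def)
  then have rb: "integral {a..b} r < e / 2" using n unfolding dist_real_def by linarith
  define \<delta> where "\<delta> = e / (2 * (real n + 1))"
  have "\<delta> > 0" using \<open>e > 0\<close> by (simp add: \<delta>_def)
  have "(\<Sum>I\<in>D. norm (integral {a..Sup I} f - integral {a..Inf I} f)) < e"
    if D: "D division_of T" "T \<subseteq> {a..b}" "(\<Sum>I\<in>D. Sup I - Inf I) < \<delta>" for D T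
  proof -
    have sub: "I \<subseteq> {a..b}" if "I \<in> D" for I using D(1,2) that by blast
    have ra: "r absolutely_integrable_on I" if "I \<in> D" for I
    proof -
      have "{Inf I..Sup I} \<subseteq> {a..b}" using sub[OF that] division_Inf_Sup(1)[OF D(1) that] by blast
      then have "r absolutely_integrable_on {Inf I..Sup I}" by (rule absolutely_integrable_on_subinterval[OF ri])
      then show ?thesis using arg_cong[OF division_Inf_Sup(1)[OF D(1) that], where f="\<lambda>I. r absolutely_integrable_on I"] by blast
    qed
    have rT: "r integrable_on T"
      by (rule integrable_combine_division[OF D(1)]) (use ra in \<open>simp add: absolutely_integrable_on_def\<close>)
    have "norm (integral {a..Sup I} f - integral {a..Inf I} f) \<le> integral {Inf I..Sup I} r + real n * (Sup I - Inf I)" if "I \<in> D" for I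
    proof -
      define u v where "u = Inf I" "v = Sup I"
      note I = division_Inf_Sup[OF D(1) that, folded u_v_def]
      have uv: "a \<le> u" "u \<le> v" "v \<le> b" using I D(2) by auto
      have fuv: "f integrable_on {u..v}" "f integrable_on {a..v}" "(\<lambda>x. norm (f x)) integrable_on {u..v}" "g n integrable_on {u..v}" "r integrable_on {u..v}"
        using f nf gi[of n] ri uv by (auto simp: absolutely_integrable_on_def intro: integrable_on_subinterval)
      have "integral {a..v} f - integral {a..u} f = integral {u..v} f"
        using Henstock_Kurzweil_Integration.integral_combine[OF uv(1,2) fuv(2)] by (simp add: algebra_simps)
      also have "norm \<dots> \<le> integral {u..v} (\<lambda>x. r x + real n)"
      proof (rule Henstock_Kurzweil_Integration.integral_norm_bound_integral)
        show "(\<lambda>x. r x + real n) integrable_on {u..v}" using fuv(5) by (intro integrable_add) auto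
      qed (use fuv in \<open>auto simp: r_def g_def\<close>)
      also have "\<dots> = integral {u..v} r + real n * (v - u)"
        using fuv uv by (subst Henstock_Kurzweil_Integration.integral_add) auto
      finally show ?thesis unfolding u_v_def .
    qed
    then have "(\<Sum>I\<in>D. norm (integral {a..Sup I} f - integral {a..Inf I} f)) \<le> (\<Sum>I\<in>D. integral {Inf I..Sup I} r + real n * (Sup I - Inf I))"
      by (rule sum_mono)
    also have "\<dots> = (\<Sum>I\<in>D. integral I r + real n * (Sup I - Inf I))"
    proof (rule sum.cong)
      fix I assume "I \<in> D"
      have "integral I r = integral {Inf I..Sup I} r"
        by (rule arg_cong[OF division_Inf_Sup(1)[OF D(1) \<open>I \<in> D\<close>], where f="\<lambda>I. integral I r"])
      then show "integral {Inf I..Sup I} r + real n * (Sup I - Inf I) = integral I r + real n * (Sup I - Inf I)" by simp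
    qed simp
    also have "\<dots> = (\<Sum>I\<in>D. integral I r) + real n * (\<Sum>I\<in>D. Sup I - Inf I)"
      by (simp add: sum.distrib sum_distrib_left)
    also have "(\<Sum>I\<in>D. integral I r) = integral T r"
      by (rule integral_combine_division_topdown[OF rT D(1), symmetric])
    also have "integral T r \<le> integral {a..b} r"
      using ri r0 by (intro integral_subset_le[OF D(2) rT]) (auto simp: absolutely_integrable_on_def)
    also have "integral {a..b} r + real n * (\<Sum>I\<in>D. Sup I - Inf I) < e / 2 + real n * (\<Sum>I\<in>D. Sup I - Inf I)"
      using rb by simp
    also have "\<dots> \<le> e / 2 + (real n + 1) * \<delta>"
      using D(3) \<open>\<delta> > 0\<close> sum_nonneg[of D "\<lambda>I. Sup I - Inf I"] division_Inf_Sup(2)[OF D(1)]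
      by (intro add_left_mono mult_mono) (auto simp del: Sup_le_iff)
    also have "(real n + 1) * \<delta> = e / 2" unfolding \<delta>_def by (simp add: field_simps)
    finally show ?thesis by simp
  qed
  then show "\<exists>\<delta>>0. \<forall>D T. D division_of T \<and> T \<subseteq> {a..b} \<and> (\<Sum>I\<in>D. Sup I - Inf I) < \<delta> \<longrightarrow>
      (\<Sum>I\<in>D. norm (integral {a..Sup I} f - integral {a..Inf I} f)) < e"
    by (intro exI[of _ \<delta>] conjI allI impI \<open>\<delta> > 0\<close>) (elim conjE)
qed

section \<open>Almost everywhere differentiation of indefinite integrals\<close>

lemma right_difference_quotient_ae:
  fixes g :: "real \<Rightarrow> complex"
  assumes "\<And>a b. g integrable_on {a..b}"
  obtains N where "negligible N"
    "\<And>x e. x \<notin> N \<Longrightarrow> e > 0 \<Longrightarrow> \<exists>d>0. \<forall>h. 0 < h \<and> h < d \<longrightarrow> norm (integral {x..x+h} g - of_real h * g x) \<le> e * h"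
proof -
  obtain N where N: "negligible N"
    "\<And>x e. \<lbrakk>x \<notin> N; 0 < e\<rbrakk> \<Longrightarrow> \<exists>d>0. \<forall>h. 0 < h \<and> h < d \<longrightarrow> norm(integral (cbox x (x + h *\<^sub>R One)) g /\<^sub>R h ^ DIM(real) - g x) < e"
    using integrable_ccontinuous_explicit[of g] assms by (metis box_real(2))
  show ?thesis
  proof (rule that[OF N(1)])
    fix x e :: real assume "x \<notin> N" "e > 0"
    then obtain d where d: "d > 0" "\<And>h. 0 < h \<and> h < d \<Longrightarrow> norm(integral {x..x+h} g /\<^sub>R h - g x) < e"
      using N(2)[of x e] by auto
    have "norm (integral {x..x+h} g - of_real h * g x) \<le> e * h" if h: "0 < h" "h < d" for h
    proof -
      have "integral {x..x+h} g - of_real h * g x = h *\<^sub>R (integral {x..x+h} g /\<^sub>R h - g x)"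
        using h unfolding scaleR_diff_right by (simp add: scaleR_conv_of_real)
      then have "norm (integral {x..x+h} g - of_real h * g x) = h * norm (integral {x..x+h} g /\<^sub>R h - g x)"
        using h by simp
      also have "\<dots> \<le> h * e" using d(2)[of h] h by (intro mult_left_mono) auto
      finally show ?thesis by (simp add: mult.commute)
    qed
    with \<open>d > 0\<close> show "\<exists>d>0. \<forall>h. 0 < h \<and> h < d \<longrightarrow> norm (integral {x..x+h} g - of_real h * g x) \<le> e * h" by blast
  qed
qed

text \<open>Quotients from the left are quotients from the right for the reflected function, whence
  the reflected copy of the exceptional set \<open>N2\<close>. Extending \<open>f\<close> by 0 to
  \<open>g\<close> removes the restriction on the increment near the endpoints.\<close>

lemma has_vector_derivative_indefinite_integral_ae:
  fixes f :: "real \<Rightarrow> complex" and a b :: real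
  assumes f: "f integrable_on {a..b}"
  obtains N where "negligible N"
    "\<And>x. x \<in> {a..b} - N \<Longrightarrow> ((\<lambda>x. integral {a..x} f) has_vector_derivative f x) (at x within {a..b})"
proof -
  define g where "g x = (if x \<in> {a..b} then f x else 0)" for x
  have "g integrable_on UNIV" unfolding g_def using f integrable_restrict_UNIV by blast
  then have gi: "g integrable_on {u..v}" for u v by (rule integrable_on_subinterval) auto
  have gr: "(\<lambda>x. g (- x)) integrable_on {u..v}" for u v
    using gi[of "-v" "-u"] Henstock_Kurzweil_Integration.integrable_reflect_real[where f=g and a="-v" and b="-u"] by simp
  obtain N1 where N1: "negligible N1"
    "\<And>x e. x \<notin> N1 \<Longrightarrow> e > 0 \<Longrightarrow> \<exists>d>0. \<forall>h. 0 < h \<and> h < d \<longrightarrow> norm (integral {x..x+h} g - of_real h * g x) \<le> e * h"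
    using right_difference_quotient_ae[OF gi] by blast
  obtain N2 where N2: "negligible N2"
    "\<And>x e. x \<notin> N2 \<Longrightarrow> e > 0 \<Longrightarrow> \<exists>d>0. \<forall>h. 0 < h \<and> h < d \<longrightarrow> norm (integral {x..x+h} (\<lambda>x. g (- x)) - of_real h * g (- x)) \<le> e * h"
    using right_difference_quotient_ae[OF gr] by blast
  have "negligible (uminus ` N2)"
    by (rule negligible_differentiable_image_negligible[OF _ N2(1)]) (auto intro!: differentiable_on_minus differentiable_on_ident)
  then have "negligible (N1 \<union> uminus ` N2)" using N1(1) by (intro negligible_Un)
  moreover have "((\<lambda>x. integral {a..x} f) has_vector_derivative f x) (at x within {a..b})"
    if x: "x \<in> {a..b} - (N1 \<union> uminus ` N2)" for x
    unfolding has_vector_derivative_def has_derivative_within_alt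
  proof (intro conjI allI impI)
    show "bounded_linear (\<lambda>h. h *\<^sub>R f x)" by (rule bounded_linear_scaleR_left)
    fix e :: real assume "e > 0"
    have "x \<notin> N1" "- x \<notin> N2" using x by (auto simp: image_iff)
    obtain d1 where d1: "d1 > 0" "\<And>h. 0 < h \<Longrightarrow> h < d1 \<Longrightarrow> norm (integral {x..x+h} g - of_real h * g x) \<le> e * h"
      using N1(2)[OF \<open>x \<notin> N1\<close> \<open>e > 0\<close>] by blast
    obtain d2 where d2: "d2 > 0" "\<And>h. 0 < h \<Longrightarrow> h < d2 \<Longrightarrow> norm (integral {-x..-x+h} (\<lambda>x. g (- x)) - of_real h * g x) \<le> e * h"
      using N2(2)[OF \<open>- x \<notin> N2\<close> \<open>e > 0\<close>] by auto
    have gx: "g x = f x" using x by (simp add: g_def)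
    show "\<exists>d>0. \<forall>y\<in>{a..b}. norm (y - x) < d \<longrightarrow>
        norm (integral {a..y} f - integral {a..x} f - (y - x) *\<^sub>R f x) \<le> e * norm (y - x)"
    proof (intro exI[of _ "min d1 d2"] conjI ballI impI)
      fix y assume y: "y \<in> {a..b}" "norm (y - x) < min d1 d2"
      consider "y = x" | "y > x" | "y < x" by linarith
      then show "norm (integral {a..y} f - integral {a..x} f - (y - x) *\<^sub>R f x) \<le> e * norm (y - x)"
      proof cases
        case 2
        have "integral {a..y} f - integral {a..x} f = integral {x..y} f"
          using Henstock_Kurzweil_Integration.integral_combine[of a x y f] x y 2 integrable_on_subinterval[OF f, of a y]
          by (auto simp: algebra_simps)
        also have "\<dots> = integral {x..x+(y-x)} g"
          using x y 2 by (auto intro!: Henstock_Kurzweil_Integration.integral_cong simp: g_def)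
        finally show ?thesis using d1(2)[of "y - x"] 2 y gx by (simp add: scaleR_conv_of_real)
      next
        case 3
        have "integral {a..x} f - integral {a..y} f = integral {y..x} f"
          using Henstock_Kurzweil_Integration.integral_combine[of a y x f] x y 3 integrable_on_subinterval[OF f, of a x]
          by (auto simp: algebra_simps)
        also have "\<dots> = integral {y..x} g"
          using x y 3 by (auto intro!: Henstock_Kurzweil_Integration.integral_cong simp: g_def)
        also have "\<dots> = integral {-x..-x+(x-y)} (\<lambda>x. g (- x))"
          using Henstock_Kurzweil_Integration.integral_reflect_real[where f=g and a=y and b=x] by simp
        finally have "integral {a..y} f - integral {a..x} f - (y - x) *\<^sub>R f x = - (integral {-x..-x+(x-y)} (\<lambda>x. g (- x)) - of_real (x - y) * g x)"
          using gx by (simp add: scaleR_conv_of_real algebra_simps)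
        then show ?thesis using d2(2)[of "x - y"] 3 y by (simp only: norm_minus_cancel) simp
      qed simp
    qed (use d1 d2 in auto)
  qed
  ultimately show ?thesis using that by blast
qed

text \<open>The function \<open>f'\<close> is a derivative only outside a null set; together with
  absolute continuity this still makes \<open>f\<close> an indefinite integral of \<open>f'\<close>.
  It is the regularity that y' has for an integrable potential, and it survives sums, products and
  restriction.\<close>

definition ac_deriv :: "real \<Rightarrow> real \<Rightarrow> (real \<Rightarrow> complex) \<Rightarrow> (real \<Rightarrow> complex) \<Rightarrow> bool" where
  "ac_deriv a b f f' \<longleftrightarrow> abs_cont_on {a..b} f \<and>
     (\<exists>N. negligible N \<and> (\<forall>x\<in>{a..b} - N. (f has_vector_derivative f' x) (at x within {a..b})))"

lemma ac_deriv_has_integral: "ac_deriv a b f f' \<Longrightarrow> a \<le> b \<Longrightarrow> (f' has_integral f b - f a) {a..b}"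
  unfolding ac_deriv_def using fundamental_theorem_of_calculus_abs_cont by blast

lemma ac_deriv_continuous_on: "ac_deriv a b f f' \<Longrightarrow> continuous_on {a..b} f"
  unfolding ac_deriv_def using abs_cont_on_imp_continuous_on by blast

lemma ac_deriv_subinterval:
  assumes "ac_deriv a b f f'" "{u..v} \<subseteq> {a..b}"
  shows "ac_deriv u v f f'"
proof -
  obtain N where "negligible N" "\<forall>x\<in>{a..b} - N. (f has_vector_derivative f' x) (at x within {a..b})"
    using assms unfolding ac_deriv_def by blast
  then have "\<forall>x\<in>{u..v} - N. (f has_vector_derivative f' x) (at x within {u..v})"
    using assms(2) by (meson DiffD1 DiffD2 DiffI has_vector_derivative_within_subset subsetD)
  then show ?thesis using assms \<open>negligible N\<close> abs_cont_on_subset unfolding ac_deriv_def by blast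
qed

lemma ac_deriv_integral:
  assumes f': "f' absolutely_integrable_on {a..b}"
    and eq: "\<And>x. x \<in> {a..b} \<Longrightarrow> f x = f a + integral {a..x} f'"
  shows "ac_deriv a b f f'"
proof -
  define F where "F x = integral {a..x} f'" for x
  have "abs_cont_on {a..b} (\<lambda>x. f a + F x)"
    unfolding F_def by (intro abs_cont_on_add abs_cont_on_indefinite_integral[OF f']) (rule abs_cont_on_lipschitz[of _ _ 0], simp)
  moreover have "abs_cont_on {a..b} f \<longleftrightarrow> abs_cont_on {a..b} (\<lambda>x. f a + F x)"
    by (rule abs_cont_on_cong) (unfold F_def, rule eq)
  ultimately have 1: "abs_cont_on {a..b} f" by blast
  have "f' integrable_on {a..b}" using f' by (simp add: absolutely_integrable_on_def)
  then obtain N where N: "negligible N" "\<And>x. x \<in> {a..b} - N \<Longrightarrow> (F has_vector_derivative f' x) (at x within {a..b})"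
    unfolding F_def using has_vector_derivative_indefinite_integral_ae by blast
  have "(f has_vector_derivative f' x) (at x within {a..b})" if "x \<in> {a..b} - N" for x
  proof -
    have "((\<lambda>x. f a + F x) has_vector_derivative 0 + f' x) (at x within {a..b})"
      using N(2)[OF that] by (intro has_vector_derivative_add) auto
    then have "((\<lambda>x. f a + F x) has_vector_derivative f' x) (at x within {a..b})" by simp
    moreover have "x \<in> {a..b}" using that by blast
    ultimately show ?thesis
      by (rule has_vector_derivative_transform[rotated 2]) (unfold F_def, rule eq)
  qed
  with 1 N(1) show ?thesis unfolding ac_deriv_def by blast
qed

lemma ac_deriv_const: "ac_deriv a b (\<lambda>x. c) (\<lambda>x. 0)"
  unfolding ac_deriv_def by (auto intro!: abs_cont_on_lipschitz[of _ _ 0] exI[of _ "{}"])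

lemma ac_deriv_C1:
  assumes "\<And>x. x \<in> {a..b} \<Longrightarrow> (f has_vector_derivative f' x) (at x within {a..b})" "continuous_on {a..b} f'"
  shows "ac_deriv a b f f'"
proof -
  have "bounded (f' ` {a..b})" using assms(2) compact_continuous_image compact_imp_bounded by blast
  then obtain B where B: "\<And>x. x \<in> {a..b} \<Longrightarrow> norm (f' x) \<le> B" unfolding bounded_iff by blast
  have "norm (f y - f x) \<le> B * \<bar>y - x\<bar>" if "x \<in> {a..b}" "y \<in> {a..b}" for x y
  proof -
    have "norm (f y - f x) \<le> B * norm (y - x)"
    proof (rule differentiable_bound[of "{a..b}" f "\<lambda>x h. h *\<^sub>R f' x"])
      show "(f has_derivative (\<lambda>h. h *\<^sub>R f' x)) (at x within {a..b})" if "x \<in> {a..b}" for x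
        using assms(1)[OF that] by (simp add: has_vector_derivative_def)
      show "onorm (\<lambda>h. h *\<^sub>R f' x) \<le> B" if "x \<in> {a..b}" for x
        using B[OF that] by (intro onorm_bound) (auto simp: mult.commute[of B] mult_left_mono intro: order_trans[OF norm_ge_zero])
    qed (use that in auto)
    then show ?thesis by simp
  qed
  then have "abs_cont_on {a..b} f" by (rule abs_cont_on_lipschitz)
  with assms(1) show ?thesis unfolding ac_deriv_def by (auto intro!: exI[of _ "{}"])
qed

lemma ac_deriv_add:
  assumes "ac_deriv a b f f'" "ac_deriv a b g g'"
  shows "ac_deriv a b (\<lambda>x. f x + g x) (\<lambda>x. f' x + g' x)"
proof -
  obtain M N where "negligible M" "\<forall>x\<in>{a..b} - M. (f has_vector_derivative f' x) (at x within {a..b})"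
    "negligible N" "\<forall>x\<in>{a..b} - N. (g has_vector_derivative g' x) (at x within {a..b})"
    using assms unfolding ac_deriv_def by blast
  then have "negligible (M \<union> N)"
    "\<forall>x\<in>{a..b} - (M \<union> N). ((\<lambda>x. f x + g x) has_vector_derivative f' x + g' x) (at x within {a..b})"
    by (auto intro!: negligible_Un has_vector_derivative_add)
  then show ?thesis using assms abs_cont_on_add unfolding ac_deriv_def by blast
qed

lemma ac_deriv_mult:
  assumes "ac_deriv a b f f'" "ac_deriv a b g g'"
  shows "ac_deriv a b (\<lambda>x. f x * g x) (\<lambda>x. f x * g' x + f' x * g x)"
proof -
  obtain M N where "negligible M" "\<forall>x\<in>{a..b} - M. (f has_vector_derivative f' x) (at x within {a..b})"
    "negligible N" "\<forall>x\<in>{a..b} - N. (g has_vector_derivative g' x) (at x within {a..b})"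
    using assms unfolding ac_deriv_def by blast
  then have "negligible (M \<union> N)"
    "\<forall>x\<in>{a..b} - (M \<union> N). ((\<lambda>x. f x * g x) has_vector_derivative f x * g' x + f' x * g x) (at x within {a..b})"
    by (auto intro!: negligible_Un has_vector_derivative_mult)
  then show ?thesis using assms abs_cont_on_mult unfolding ac_deriv_def by blast
qed

lemma ac_deriv_cmult: "ac_deriv a b f f' \<Longrightarrow> ac_deriv a b (\<lambda>x. c * f x) (\<lambda>x. c * f' x)"
  using ac_deriv_mult[OF ac_deriv_const[of a b c], of f f'] by simp

lemma ac_deriv_diff:
  assumes "ac_deriv a b f f'" "ac_deriv a b g g'"
  shows "ac_deriv a b (\<lambda>x. f x - g x) (\<lambda>x. f' x - g' x)"
  using ac_deriv_add[OF assms(1) ac_deriv_cmult[OF assms(2), of "-1"]] by simp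

lemma ac_deriv_cong:
  assumes "ac_deriv a b f f'" and fg: "\<And>x. x \<in> {a..b} \<Longrightarrow> g x = f x" and fg': "\<And>x. x \<in> {a..b} \<Longrightarrow> g' x = f' x"
  shows "ac_deriv a b g g'"
proof -
  obtain N where N: "negligible N" "\<forall>x\<in>{a..b} - N. (f has_vector_derivative f' x) (at x within {a..b})"
    using assms(1) unfolding ac_deriv_def by blast
  have "(g has_vector_derivative g' x) (at x within {a..b})" if x: "x \<in> {a..b} - N" for x
  proof -
    have "x \<in> {a..b}" using x by blast
    then have "(g has_vector_derivative f' x) (at x within {a..b})"
      using N(2) x by (intro has_vector_derivative_transform[where f=f and g=g, OF _ fg]) auto
    then show ?thesis using fg'[OF \<open>x \<in> {a..b}\<close>] by simp
  qed
  moreover have "abs_cont_on {a..b} g"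
    using abs_cont_on_cong[of "{a..b}" g f, OF fg] assms(1) ac_deriv_def by blast
  ultimately show ?thesis using N(1) unfolding ac_deriv_def by blast
qed

lemma absolutely_integrable_mult_continuous:
  fixes q y :: "real \<Rightarrow> complex"
  assumes "q absolutely_integrable_on {a..b}" "continuous_on {a..b} y"
  shows "(\<lambda>t. q t * y t) absolutely_integrable_on {a..b}"
proof -
  have "bilinear (times :: complex \<Rightarrow> complex \<Rightarrow> complex)"
    by (simp add: bilinear_conv_bounded_bilinear bounded_bilinear_mult)
  moreover have "bounded (y ` {a..b})" using assms(2) compact_continuous_image compact_imp_bounded by blast
  ultimately have "(\<lambda>t. y t * q t) absolutely_integrable_on {a..b}"
    by (intro absolutely_integrable_bounded_measurable_product[of times, OF _ _ _ _ assms(1)]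
      continuous_imp_measurable_on_sets_lebesgue assms(2)) simp_all
  then show ?thesis by (simp add: mult.commute)
qed

subsection \<open>Solutions on an interval and jump conditions\<close>

text \<open>The function \<open>z\<close> is the derivative of \<open>y\<close>; the equation is stated in integrated form.\<close>

definition sl_piece :: "(real \<Rightarrow> complex) \<Rightarrow> complex \<Rightarrow> real \<Rightarrow> real \<Rightarrow> (real \<Rightarrow> complex) \<Rightarrow> (real \<Rightarrow> complex) \<Rightarrow> bool" where
  "sl_piece q lam a b y z \<longleftrightarrow> continuous_on {a..b} y \<and> continuous_on {a..b} z \<and>
     (\<forall>x\<in>{a..b}. y x = y a + integral {a..x} z) \<and>
     (\<forall>x\<in>{a..b}. z x = z a + integral {a..x} (\<lambda>t. (q t - lam) * y t))"

lemma potential_times_absolutely_integrable: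
  fixes q y :: "real \<Rightarrow> complex"
  assumes "q absolutely_integrable_on {a..b}" "continuous_on {a..b} y"
  shows "(\<lambda>t. (q t - lam) * y t) absolutely_integrable_on {a..b}"
  by (rule absolutely_integrable_mult_continuous[OF _ assms(2)])
     (intro set_integral_diff(1) assms(1) absolutely_integrable_continuous_real continuous_on_const)

lemma sl_piece_ac_deriv:
  assumes "sl_piece q lam a b y z" "q absolutely_integrable_on {a..b}"
  shows "ac_deriv a b y z" "ac_deriv a b z (\<lambda>t. (q t - lam) * y t)"
proof -
  have "continuous_on {a..b} y" "continuous_on {a..b} z" using assms(1) unfolding sl_piece_def by blast+
  then have i: "z absolutely_integrable_on {a..b}" "(\<lambda>t. (q t - lam) * y t) absolutely_integrable_on {a..b}"
    using absolutely_integrable_continuous_real potential_times_absolutely_integrable[OF assms(2)] by blast+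
  show "ac_deriv a b y z" "ac_deriv a b z (\<lambda>t. (q t - lam) * y t)"
    using assms(1) unfolding sl_piece_def by (blast intro: ac_deriv_integral[OF i(1)] ac_deriv_integral[OF i(2)])+
qed

lemma sl_piece_continuous:
  assumes "sl_piece q lam a b y z"
  shows "continuous_on {a..b} y" "continuous_on {a..b} z"
  using assms unfolding sl_piece_def by blast+

lemma sl_piece_derivative:
  assumes "sl_piece q lam a b y z" "x \<in> {a..b}"
  shows "(y has_vector_derivative z x) (at x within {a..b})"
proof -
  have z: "continuous_on {a..b} z" and y: "\<And>x. x \<in> {a..b} \<Longrightarrow> y x = y a + integral {a..x} z"
    using assms(1) unfolding sl_piece_def by blast+
  have "((\<lambda>x. y a + integral {a..x} z) has_vector_derivative 0 + z x) (at x within {a..b})"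
    using integral_has_vector_derivative[OF z assms(2)] by (intro has_vector_derivative_add) auto
  then have "((\<lambda>x. y a + integral {a..x} z) has_vector_derivative z x) (at x within {a..b})" by simp
  from this assms(2) show ?thesis by (rule has_vector_derivative_transform[rotated 2]) (rule y)
qed

text \<open>The differential information is asked for only on compact subintervals of the open
  interval, where a jump solution provides it. There \<open>f\<close> minus the integral of
  \<open>f'\<close> is constant, and continuity up to the ends carries the constancy to the closed
  interval.\<close>

lemma sl_pieceI:
  assumes "a < b" and cont: "continuous_on {a..b} y" "continuous_on {a..b} z"
    and q: "q absolutely_integrable_on {a..b}"
    and "\<And>u v. a < u \<Longrightarrow> u \<le> v \<Longrightarrow> v < b \<Longrightarrow> ac_deriv u v y z"
    and "\<And>u v. a < u \<Longrightarrow> u \<le> v \<Longrightarrow> v < b \<Longrightarrow> ac_deriv u v z (\<lambda>t. (q t - lam) * y t)"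
  shows "sl_piece q lam a b y z"
proof -
  have *: "\<forall>x\<in>{a..b}. f x = f a + integral {a..x} f'"
    if f: "continuous_on {a..b} f" and f': "f' integrable_on {a..b}"
      and ac: "\<And>u v. a < u \<Longrightarrow> u \<le> v \<Longrightarrow> v < b \<Longrightarrow> ac_deriv u v f f'" for f f' :: "real \<Rightarrow> complex"
  proof -
    define F where "F x = f x - integral {a..x} f'" for x
    have F: "continuous_on {a..b} F"
      unfolding F_def by (intro continuous_on_diff f indefinite_integral_continuous_1 f')
    define c where "c = (a + b) / 2"
    have c: "a < c" "c < b" using \<open>a < b\<close> by (auto simp: c_def)
    have eq: "F u = F v" if "a < u" "u \<le> v" "v < b" for u v
    proof -
      have "integral {u..v} f' = f v - f u"
        using ac_deriv_has_integral[OF ac[OF that] that(2)] by (rule integral_unique)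
      moreover have "integral {a..u} f' + integral {u..v} f' = integral {a..v} f'"
        using that by (intro Henstock_Kurzweil_Integration.integral_combine integrable_on_subinterval[OF f']) auto
      ultimately have "integral {a..v} f' = integral {a..u} f' + (f v - f u)" by simp
      then show ?thesis unfolding F_def by simp
    qed
    have const: "F x = F c" if x: "x \<in> {a<..<b}" for x
    proof (cases "x \<le> c")
      case True
      show ?thesis by (rule eq) (use x c True in auto)
    next
      case False
      show ?thesis by (rule eq[symmetric]) (use x c False in auto)
    qed
    have cl: "closure {a<..<b} = {a..b}" using \<open>a < b\<close> by simp
    have const': "F x = F c" if "x \<in> {a..b}" for x
      by (rule continuous_constant_on_closure[of "{a<..<b}"]) (use F const that cl in auto)
    have "f x - integral {a..x} f' = f a" if x: "x \<in> {a..b}" for x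
    proof -
      have "F x = F a" using const'[OF x] const'[of a] \<open>a < b\<close> by simp
      then show ?thesis unfolding F_def by simp
    qed
    then show ?thesis by (metis diff_add_cancel add.commute)
  qed
  show ?thesis unfolding sl_piece_def
  proof (intro conjI cont *)
    show "z integrable_on {a..b}" by (rule integrable_continuous_real[OF cont(2)])
    show "(\<lambda>t. (q t - lam) * y t) integrable_on {a..b}"
      using potential_times_absolutely_integrable[OF q cont(1)] by (rule set_lebesgue_integral_eq_integral(1))
  qed (use assms in blast)+
qed

text \<open>The restrictions of a solution to the two sides of \<open>d\<close> are kept as separate functions, each continuous up to \<open>d\<close>.\<close>

definition jump_pair ::
  "(real \<Rightarrow> complex) \<Rightarrow> real \<Rightarrow> real \<Rightarrow> complex \<Rightarrow> complex \<Rightarrow>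
   (real \<Rightarrow> complex) \<Rightarrow> (real \<Rightarrow> complex) \<Rightarrow> (real \<Rightarrow> complex) \<Rightarrow> (real \<Rightarrow> complex) \<Rightarrow> bool" where
  "jump_pair q d \<beta> \<gamma> lam yl zl yr zr \<longleftrightarrow>
     sl_piece q lam 0 d yl zl \<and> sl_piece q lam d pi yr zr \<and>
     yr d = of_real \<beta> * yl d \<and> zr d = of_real (inverse \<beta>) * zl d + \<gamma> * yl d"

lemma dx_eqI:
  assumes "(y has_vector_derivative D) (at x within {0..pi})" "x \<in> {0..pi}"
  shows "dx y x = D"
  unfolding dx_def using vector_derivative_within_cbox[of 0 pi x y D] assms by simp

text \<open>The one-sided limits in the jump conditions serve as values at \<open>d\<close>: with
  them \<open>y\<close> and \<open>dx y\<close> become continuous on each closed side, which is what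
  \<open>sl_pieceI\<close> asks for besides the regularity away from \<open>d\<close>. The arbitrary
  value \<open>y d\<close> drops out.\<close>

lemma jump_solution_imp_jump_pair:
  assumes q: "q absolutely_integrable_on {0..pi}" and d: "0 < d" "d < pi" and y: "jump_solution q d \<beta> \<gamma> lam y"
  obtains yl zl yr zr where "jump_pair q d \<beta> \<gamma> lam yl zl yr zr"
    "\<And>x. x \<in> {0..<d} \<Longrightarrow> y x = yl x" "\<And>x. x \<in> {0..<d} \<Longrightarrow> dx y x = zl x"
    "\<And>x. x \<in> {d<..pi} \<Longrightarrow> y x = yr x" "\<And>x. x \<in> {d<..pi} \<Longrightarrow> dx y x = zr x"
proof -
  have diff: "\<And>x. x \<in> {0..pi} - {d} \<Longrightarrow> y differentiable (at x within {0..pi})"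
    and ac: "\<And>u v. {u..v} \<subseteq> {0..pi} - {d} \<Longrightarrow> abs_cont_on {u..v} (dx y)"
    and ae: "AE x in lebesgue. x \<in> {0..pi} \<longrightarrow> (\<exists>y2. (dx y has_vector_derivative y2) (at x within {0..pi}) \<and> - y2 + q x * y x = lam * y x)"
    using y unfolding jump_solution_def by blast+
  obtain A B where lim: "(y \<longlongrightarrow> A) (at_left d)" "(dx y \<longlongrightarrow> B) (at_left d)"
     "(y \<longlongrightarrow> of_real \<beta> * A) (at_right d)" "(dx y \<longlongrightarrow> of_real (inverse \<beta>) * B + \<gamma> * A) (at_right d)"
    using y unfolding jump_solution_def by blast
  have der: "(y has_vector_derivative dx y x) (at x within {0..pi})" if "x \<in> {0..pi} - {d}" for x
    using diff[OF that] vector_derivative_works unfolding dx_def by blast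
  obtain N where N: "negligible N" "\<And>x. x \<in> {0..pi} - N \<Longrightarrow> (dx y has_vector_derivative (q x - lam) * y x) (at x within {0..pi})"
  proof -
    obtain N where "N \<in> null_sets lebesgue" and sub: "{x \<in> space lebesgue. \<not> (x \<in> {0..pi} \<longrightarrow> (\<exists>y2. (dx y has_vector_derivative y2) (at x within {0..pi}) \<and> - y2 + q x * y x = lam * y x))} \<subseteq> N"
      using ae by (rule AE_E3) blast
    then have "negligible N" by (simp add: negligible_iff_null_sets)
    moreover have "(dx y has_vector_derivative (q x - lam) * y x) (at x within {0..pi})" if x: "x \<in> {0..pi} - N" for x
    proof -
      obtain y2 where "(dx y has_vector_derivative y2) (at x within {0..pi})" "- y2 + q x * y x = lam * y x"
        using sub x by auto
      moreover from this(2) have "y2 = (q x - lam) * y x" by (simp add: algebra_simps)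
      ultimately show ?thesis by simp
    qed
    ultimately show ?thesis using that by blast
  qed
  have acd1: "ac_deriv u v y (dx y)" if "{u..v} \<subseteq> {0..pi} - {d}" for u v
  proof (rule ac_deriv_C1)
    show "continuous_on {u..v} (dx y)" using ac[OF that] by (rule abs_cont_on_imp_continuous_on)
    fix x assume "x \<in> {u..v}"
    then show "(y has_vector_derivative dx y x) (at x within {u..v})"
      using der[of x] that by (meson Diff_subset has_vector_derivative_within_subset subsetD subset_trans)
  qed
  have acd2: "ac_deriv u v (dx y) (\<lambda>t. (q t - lam) * y t)" if "{u..v} \<subseteq> {0..pi} - {d}" for u v
    unfolding ac_deriv_def
  proof (intro conjI exI[of _ N] ballI N(1) ac[OF that])
    fix x assume "x \<in> {u..v} - N"
    then show "(dx y has_vector_derivative (q x - lam) * y x) (at x within {u..v})"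
      using N(2)[of x] that by (meson DiffD1 DiffD2 DiffI Diff_subset has_vector_derivative_within_subset subsetD subset_trans)
  qed
  have conty: "continuous_on {u..v} y" and contz: "continuous_on {u..v} (dx y)" if "{u..v} \<subseteq> {0..pi} - {d}" for u v
    using acd1[OF that] acd2[OF that] ac_deriv_continuous_on by blast+
  \<comment> \<open>Continuity is known on compact intervals that avoid \<open>d\<close>; a small
    interval around x that keeps clear of 0, \<open>d\<close> and \<pi> turns it into a two-sided
    limit.\<close>
  have limI: "(f \<longlongrightarrow> f x) (at x)" if "\<And>u v. {u..v} \<subseteq> {0..pi} - {d} \<Longrightarrow> continuous_on {u..v} f" "0 < x" "x < pi" "x \<noteq> d" for f :: "real \<Rightarrow> complex" and x
  proof -
    define e where "e = min (min (x/2) ((pi - x)/2)) (\<bar>x - d\<bar> / 2)"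
    have "e > 0" "e < x" "e < pi - x" "e < \<bar>x - d\<bar>" using that by (auto simp: e_def min_less_iff_disj)
    then have "continuous_on {x-e..x+e} f" by (intro that(1)) auto
    then show ?thesis using \<open>e > 0\<close>
      by (metis add_less_same_cancel1 atLeastAtMost_iff continuous_on_interior continuous_within interior_atLeastAtMost_real greaterThanLessThan_iff diff_less_eq less_add_same_cancel1)
  qed
  have lim0: "(f \<longlongrightarrow> f 0) (at_right 0)" if "\<And>u v. {u..v} \<subseteq> {0..pi} - {d} \<Longrightarrow> continuous_on {u..v} f" for f :: "real \<Rightarrow> complex"
  proof -
    have "continuous_on {0..d/2} f" using d by (intro that) auto
    then show ?thesis using continuous_on_Icc_at_rightD[of 0 "d/2" f] d by auto
  qed
  have limpi: "(f \<longlongrightarrow> f pi) (at_left pi)" if "\<And>u v. {u..v} \<subseteq> {0..pi} - {d} \<Longrightarrow> continuous_on {u..v} f" for f :: "real \<Rightarrow> complex"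
  proof -
    have "continuous_on {(d+pi)/2..pi} f" using d by (intro that) (auto simp: field_simps)
    then show ?thesis using continuous_on_Icc_at_leftD[of "(d+pi)/2" pi f] d by auto
  qed
  have contl: "continuous_on {0..d} (\<lambda>x. if x < d then f x else l)"
    if f: "\<And>u v. {u..v} \<subseteq> {0..pi} - {d} \<Longrightarrow> continuous_on {u..v} f" and l: "(f \<longlongrightarrow> l) (at_left d)" for f :: "real \<Rightarrow> complex" and l
  proof (rule continuous_on_IccI)
    have ev: "\<forall>\<^sub>F x in at_left d. f x = (if x < d then f x else l)" by (auto simp: eventually_at_filter)
    show "((\<lambda>x. if x < d then f x else l) \<longlongrightarrow> (if d < d then f d else l)) (at_left d)"
      using tendsto_cong[OF ev, of l] l by simp
    have ev: "\<forall>\<^sub>F x in at_right 0. f x = (if x < d then f x else l)"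
      using eventually_at_right_less[of 0] d by (auto simp: eventually_at_right_field intro!: exI[of _ d])
    show "((\<lambda>x. if x < d then f x else l) \<longlongrightarrow> (if 0 < d then f 0 else l)) (at_right 0)"
      using tendsto_cong[OF ev, of "f 0"] lim0[OF f] d by simp
    fix x assume x: "0 < x" "x < d"
    have ev: "\<forall>\<^sub>F t in at x. f t = (if t < d then f t else l)"
      using x eventually_at_topological[of _ x UNIV] by (auto intro!: exI[of _ "{..<d}"] simp: eventually_at_topological)
    show "((\<lambda>x. if x < d then f x else l) \<longlongrightarrow> (if x < d then f x else l)) (at x)"
      using tendsto_cong[OF ev, of "f x"] limI[of f x, OF f] x d by simp
  qed (use d in auto)
  have contr: "continuous_on {d..pi} (\<lambda>x. if x > d then f x else l)"
    if f: "\<And>u v. {u..v} \<subseteq> {0..pi} - {d} \<Longrightarrow> continuous_on {u..v} f" and l: "(f \<longlongrightarrow> l) (at_right d)" for f :: "real \<Rightarrow> complex" and l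
  proof (rule continuous_on_IccI)
    have ev: "\<forall>\<^sub>F x in at_right d. f x = (if x > d then f x else l)" by (auto simp: eventually_at_filter)
    show "((\<lambda>x. if x > d then f x else l) \<longlongrightarrow> (if d > d then f d else l)) (at_right d)"
      using tendsto_cong[OF ev, of l] l by simp
    have ev: "\<forall>\<^sub>F x in at_left pi. f x = (if x > d then f x else l)"
      using d by (auto simp: eventually_at_left_field intro!: exI[of _ d])
    show "((\<lambda>x. if x > d then f x else l) \<longlongrightarrow> (if pi > d then f pi else l)) (at_left pi)"
      using tendsto_cong[OF ev, of "f pi"] limpi[OF f] d by simp
    fix x assume x: "d < x" "x < pi"
    have ev: "\<forall>\<^sub>F t in at x. f t = (if t > d then f t else l)"
      using x by (auto intro!: exI[of _ "{d<..}"] simp: eventually_at_topological)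
    show "((\<lambda>x. if x > d then f x else l) \<longlongrightarrow> (if x > d then f x else l)) (at x)"
      using tendsto_cong[OF ev, of "f x"] limI[of f x, OF f] x d by simp
  qed (use d in auto)
  define yl where "yl x = (if x < d then y x else A)" for x
  define zl where "zl x = (if x < d then dx y x else B)" for x
  define yr where "yr x = (if x > d then y x else of_real \<beta> * A)" for x
  define zr where "zr x = (if x > d then dx y x else of_real (inverse \<beta>) * B + \<gamma> * A)" for x
  have "sl_piece q lam 0 d yl zl"
  proof (rule sl_pieceI[OF d(1)])
    show "continuous_on {0..d} yl" "continuous_on {0..d} zl"
      unfolding yl_def zl_def using contl[OF conty lim(1)] contl[OF contz lim(2)] by auto
    show "q absolutely_integrable_on {0..d}" using q d by (auto intro: absolutely_integrable_on_subinterval)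
    fix u v assume uv: "0 < u" "u \<le> v" "v < d"
    then have sub: "{u..v} \<subseteq> {0..pi} - {d}" using d by auto
    show "ac_deriv u v yl zl" by (rule ac_deriv_cong[OF acd1[OF sub]]) (use uv in \<open>auto simp: yl_def zl_def\<close>)
    show "ac_deriv u v zl (\<lambda>t. (q t - lam) * yl t)" by (rule ac_deriv_cong[OF acd2[OF sub]]) (use uv in \<open>auto simp: yl_def zl_def\<close>)
  qed
  moreover have "sl_piece q lam d pi yr zr"
  proof (rule sl_pieceI[OF d(2)])
    show "continuous_on {d..pi} yr" "continuous_on {d..pi} zr"
      unfolding yr_def zr_def using contr[OF conty lim(3)] contr[OF contz lim(4)] by auto
    show "q absolutely_integrable_on {d..pi}" using q d by (auto intro: absolutely_integrable_on_subinterval)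
    fix u v assume uv: "d < u" "u \<le> v" "v < pi"
    then have sub: "{u..v} \<subseteq> {0..pi} - {d}" using d by auto
    show "ac_deriv u v yr zr" by (rule ac_deriv_cong[OF acd1[OF sub]]) (use uv in \<open>auto simp: yr_def zr_def\<close>)
    show "ac_deriv u v zr (\<lambda>t. (q t - lam) * yr t)" by (rule ac_deriv_cong[OF acd2[OF sub]]) (use uv in \<open>auto simp: yr_def zr_def\<close>)
  qed
  ultimately have "jump_pair q d \<beta> \<gamma> lam yl zl yr zr"
    unfolding jump_pair_def by (auto simp: yl_def zl_def yr_def zr_def)
  then show ?thesis by (rule that) (auto simp: yl_def zl_def yr_def zr_def)
qed

lemma jump_pair_derivative:
  assumes d: "0 < d" "d < pi" and p: "jump_pair q d \<beta> \<gamma> lam yl zl yr zr"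
    and yl: "\<And>x. x \<in> {0..<d} \<Longrightarrow> y x = yl x" and yr: "\<And>x. x \<in> {d<..pi} \<Longrightarrow> y x = yr x"
  shows "x \<in> {0..<d} \<Longrightarrow> (y has_vector_derivative zl x) (at x within {0..pi})"
    "x \<in> {d<..pi} \<Longrightarrow> (y has_vector_derivative zr x) (at x within {0..pi})"
proof -
  assume x: "x \<in> {0..<d}"
  have "(yl has_vector_derivative zl x) (at x within {0..d})"
    using p x unfolding jump_pair_def by (intro sl_piece_derivative) auto
  moreover have "at x within {0..d} = at x within {0..pi}"
    by (rule at_within_nhd[of x "{..<d}"]) (use x d in auto)
  ultimately have "(yl has_vector_derivative zl x) (at x within {0..pi})" by simp
  then show "(y has_vector_derivative zl x) (at x within {0..pi})"
    using x yl d by (intro has_vector_derivative_transform_within[of yl _ x _ "d - x" y]) (auto simp: dist_real_def)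
next
  assume x: "x \<in> {d<..pi}"
  have "(yr has_vector_derivative zr x) (at x within {d..pi})"
    using p x unfolding jump_pair_def by (intro sl_piece_derivative) auto
  moreover have "at x within {d..pi} = at x within {0..pi}"
    by (rule at_within_nhd[of x "{d<..}"]) (use x d in auto)
  ultimately have "(yr has_vector_derivative zr x) (at x within {0..pi})" by simp
  then show "(y has_vector_derivative zr x) (at x within {0..pi})"
    using x yr d by (intro has_vector_derivative_transform_within[of yr _ x _ "x - d" y]) (auto simp: dist_real_def)
qed

lemma jump_pair_dx:
  assumes d: "0 < d" "d < pi" and p: "jump_pair q d \<beta> \<gamma> lam yl zl yr zr"
    and yl: "\<And>x. x \<in> {0..<d} \<Longrightarrow> y x = yl x" and yr: "\<And>x. x \<in> {d<..pi} \<Longrightarrow> y x = yr x"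
  shows "x \<in> {0..<d} \<Longrightarrow> dx y x = zl x" "x \<in> {d<..pi} \<Longrightarrow> dx y x = zr x"
  using jump_pair_derivative[OF assms, of x] d by (auto intro!: dx_eqI)

text \<open>This direction gives existence: only because a jump solution exists does the choice
  operator in \<open>phi\<close>, \<open>psi\<close> and \<open>psi_inf\<close> return one. Near a
  point off \<open>d\<close>, derivatives within its side of \<open>d\<close> and within [0, \<pi>]
  coincide, and both exceptional sets together with \<open>d\<close> form a null set.\<close>

lemma jump_pair_imp_jump_solution:
  assumes q: "q absolutely_integrable_on {0..pi}" and d: "0 < d" "d < pi"
    and p: "jump_pair q d \<beta> \<gamma> lam yl zl yr zr"
    and yl: "\<And>x. x \<in> {0..<d} \<Longrightarrow> y x = yl x" and yr: "\<And>x. x \<in> {d<..pi} \<Longrightarrow> y x = yr x"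
  shows "jump_solution q d \<beta> \<gamma> lam y"
proof -
  note der = jump_pair_derivative[OF d p yl yr]
  note zl = jump_pair_dx(1)[OF d p yl yr] and zr = jump_pair_dx(2)[OF d p yl yr]
  have pl: "sl_piece q lam 0 d yl zl" and pr: "sl_piece q lam d pi yr zr"
    and j: "yr d = of_real \<beta> * yl d" "zr d = of_real (inverse \<beta>) * zl d + \<gamma> * yl d"
    using p unfolding jump_pair_def by blast+
  have ql: "q absolutely_integrable_on {0..d}" and qr: "q absolutely_integrable_on {d..pi}"
    using q d by (auto intro: absolutely_integrable_on_subinterval)
  have 1: "\<forall>x\<in>{0..pi} - {d}. y differentiable (at x within {0..pi})"
    using der by (metis DiffE atLeastAtMost_iff atLeastLessThan_iff greaterThanAtMost_iff has_vector_derivative_def differentiable_def insertI1 linorder_neqE_linordered_idom)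
  have 2: "abs_cont_on {u..v} (dx y)" if uv: "{u..v} \<subseteq> {0..pi} - {d}" for u v
  proof (cases "u \<le> v")
    case True
    then have "u \<in> {0..pi} - {d}" "v \<in> {0..pi} - {d}" "d \<notin> {u..v}" using uv by auto
    then have "0 \<le> u" "v \<le> pi" "v < d \<or> d < u" by auto
    then consider "0 \<le> u" "v < d" | "d < u" "v \<le> pi" by blast
    then show ?thesis
    proof cases
      case 1
      then have "abs_cont_on {u..v} zl"
        using sl_piece_ac_deriv(2)[OF pl ql] d by - (rule abs_cont_on_subset[of "{0..d}"], auto simp: ac_deriv_def)
      then show ?thesis using abs_cont_on_cong[of "{u..v}" "dx y" zl] zl 1 by auto
    next
      case 2
      then have "abs_cont_on {u..v} zr"
        using sl_piece_ac_deriv(2)[OF pr qr] d by - (rule abs_cont_on_subset[of "{d..pi}"], auto simp: ac_deriv_def)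
      then show ?thesis using abs_cont_on_cong[of "{u..v}" "dx y" zr] zr 2 by auto
    qed
  qed (auto intro: abs_cont_on_lipschitz)
  obtain N1 where N1: "negligible N1" "\<forall>x\<in>{0..d} - N1. (zl has_vector_derivative (q x - lam) * yl x) (at x within {0..d})"
    using sl_piece_ac_deriv(2)[OF pl ql] unfolding ac_deriv_def by blast
  obtain N2 where N2: "negligible N2" "\<forall>x\<in>{d..pi} - N2. (zr has_vector_derivative (q x - lam) * yr x) (at x within {d..pi})"
    using sl_piece_ac_deriv(2)[OF pr qr] unfolding ac_deriv_def by blast
  have 3: "\<exists>y2. (dx y has_vector_derivative y2) (at x within {0..pi}) \<and> - y2 + q x * y x = lam * y x"
    if x: "x \<in> {0..pi}" "x \<notin> N1 \<union> N2 \<union> {d}" for x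
  proof -
    have "(dx y has_vector_derivative (q x - lam) * y x) (at x within {0..pi})"
    proof (cases "x < d")
      case True
      have "(zl has_vector_derivative (q x - lam) * yl x) (at x within {0..d})" using N1(2) x True by auto
      moreover have "at x within {0..d} = at x within {0..pi}"
        by (rule at_within_nhd[of x "{..<d}"]) (use x d True in auto)
      ultimately have "(zl has_vector_derivative (q x - lam) * y x) (at x within {0..pi})" using yl[of x] x True by simp
      then show ?thesis
        using x True zl d by (intro has_vector_derivative_transform_within[of zl _ x _ "d - x" "dx y"]) (auto simp: dist_real_def)
    next
      case False
      then have "x > d" using x by auto
      have "(zr has_vector_derivative (q x - lam) * yr x) (at x within {d..pi})" using N2(2) x False by auto
      moreover have "at x within {d..pi} = at x within {0..pi}"
        by (rule at_within_nhd[of x "{d<..}"]) (use x d \<open>x > d\<close> in auto)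
      ultimately have "(zr has_vector_derivative (q x - lam) * y x) (at x within {0..pi})" using yr[of x] x \<open>x > d\<close> by simp
      then show ?thesis
        using x \<open>x > d\<close> zr d by (intro has_vector_derivative_transform_within[of zr _ x _ "x - d" "dx y"]) (auto simp: dist_real_def)
    qed
    then show ?thesis by (intro exI[of _ "(q x - lam) * y x"]) (auto simp: algebra_simps)
  qed
  have "negligible (N1 \<union> N2 \<union> {d})" using N1(1) N2(1) by (intro negligible_Un) auto
  then have null: "N1 \<union> N2 \<union> {d} \<in> null_sets lebesgue" by (simp add: negligible_iff_null_sets)
  have ae: "AE x in lebesgue. x \<in> {0..pi} \<longrightarrow> (\<exists>y2. (dx y has_vector_derivative y2) (at x within {0..pi}) \<and> - y2 + q x * y x = lam * y x)"
    by (rule AE_I'[OF null]) (use 3 in blast)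
  have limits: "(y \<longlongrightarrow> yl d) (at_left d)" "(dx y \<longlongrightarrow> zl d) (at_left d)" "(y \<longlongrightarrow> yr d) (at_right d)" "(dx y \<longlongrightarrow> zr d) (at_right d)"
  proof -
    have evl: "\<forall>\<^sub>F x in at_left d. x \<in> {0..<d}" using d by (auto simp: eventually_at_left_field intro!: exI[of _ 0])
    have evr: "\<forall>\<^sub>F x in at_right d. x \<in> {d<..pi}" using d by (auto simp: eventually_at_right_field intro!: exI[of _ pi])
    have "(yl \<longlongrightarrow> yl d) (at_left d)" "(zl \<longlongrightarrow> zl d) (at_left d)" "(yr \<longlongrightarrow> yr d) (at_right d)" "(zr \<longlongrightarrow> zr d) (at_right d)"
      using sl_piece_continuous[OF pl] sl_piece_continuous[OF pr] d
      by (auto intro: continuous_on_Icc_at_leftD continuous_on_Icc_at_rightD)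
    moreover have "\<forall>\<^sub>F x in at_left d. yl x = y x"
      by (rule eventually_mono[OF evl]) (rule yl[symmetric])
    moreover have "\<forall>\<^sub>F x in at_left d. zl x = dx y x"
      by (rule eventually_mono[OF evl]) (rule zl[symmetric])
    moreover have "\<forall>\<^sub>F x in at_right d. yr x = y x"
      by (rule eventually_mono[OF evr]) (rule yr[symmetric])
    moreover have "\<forall>\<^sub>F x in at_right d. zr x = dx y x"
      by (rule eventually_mono[OF evr]) (rule zr[symmetric])
    ultimately show "(y \<longlongrightarrow> yl d) (at_left d)" "(dx y \<longlongrightarrow> zl d) (at_left d)" "(y \<longlongrightarrow> yr d) (at_right d)" "(dx y \<longlongrightarrow> zr d) (at_right d)"
      by (blast intro: Lim_transform_eventually)+
  qed
  show ?thesis unfolding jump_solution_def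
    using 1 2 ae limits j by auto
qed

subsection \<open>Holomorphic dependence on the spectral parameter\<close>

text \<open>Domination in a form suited to iteration: the constant may depend on the disc in the
  parameter plane, the integrable majorant \<open>g\<close> may not. Cauchy's inequality then keeps
  the same \<open>g\<close> for all parameter derivatives.\<close>

definition param_family :: "real set \<Rightarrow> (real \<Rightarrow> complex \<Rightarrow> complex) \<Rightarrow> (real \<Rightarrow> real) \<Rightarrow> bool" where
  "param_family S f g \<longleftrightarrow> (\<forall>x\<in>S. f x holomorphic_on UNIV) \<and> (\<forall>z. (\<lambda>x. f x z) absolutely_integrable_on S) \<and>
     g integrable_on S \<and> (\<forall>x\<in>S. 0 \<le> g x) \<and>
     (\<forall>R. \<exists>K. \<forall>x\<in>S. \<forall>z. norm z \<le> R \<longrightarrow> norm (f x z) \<le> K * g x)"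

text \<open>Cauchy's inequality on the unit circle about z, which explains the use of the bound on
  the disc of radius R + 1.\<close>

lemma param_family_bound_deriv:
  assumes "param_family S f g"
  obtains K where "\<And>x (z::complex). x \<in> S \<Longrightarrow> norm z \<le> R \<Longrightarrow> norm (deriv (f x) z) \<le> K * g x"
proof -
  obtain K where K: "\<forall>x\<in>S. \<forall>z. norm z \<le> R + 1 \<longrightarrow> norm (f x z) \<le> K * g x"
    using assms unfolding param_family_def by blast
  show ?thesis
  proof (rule that[of K])
    fix x and z :: complex assume x: "x \<in> S" and z: "norm z \<le> R"
    have hol: "f x holomorphic_on UNIV" using assms x unfolding param_family_def by blast
    have "norm ((deriv ^^ 1) (f x) z) \<le> fact 1 * (K * g x) / 1 ^ 1"
    proof (rule Cauchy_inequality)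
      show "f x holomorphic_on ball z 1" "continuous_on (cball z 1) (f x)"
        using hol holomorphic_on_subset holomorphic_on_imp_continuous_on by blast+
      fix w assume "norm (z - w) = 1"
      then have "norm w \<le> R + 1" using z norm_triangle_ineq4[of z "z - w"] by simp
      then show "norm (f x w) \<le> K * g x" using K x by blast
    qed auto
    then show "norm (deriv (f x) z) \<le> K * g x" by simp
  qed
qed

text \<open>Dominated convergence works along sequences, so the difference quotients are taken along
  \<open>X\<close>. They are dominated by the bound for the derivative on a disc that contains z and
  the whole sequence. The integrability of the derivative comes out as that of the limit
  function.\<close>

lemma param_family_quotient_limit:
  assumes pf: "param_family S f g" and X: "\<And>n. X n \<noteq> z" "X \<longlonglongrightarrow> z"
  shows "(\<lambda>x. deriv (f x) z) integrable_on S"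
    "(\<lambda>n. (integral S (\<lambda>x. f x (X n)) - integral S (\<lambda>x. f x z)) / (X n - z)) \<longlonglongrightarrow> integral S (\<lambda>x. deriv (f x) z)"
proof -
  obtain B where B: "\<And>n. norm (X n) \<le> B"
    using convergent_imp_Bseq[of X] X(2) unfolding convergent_def Bseq_def by blast
  obtain K where K: "\<And>x (w::complex). x \<in> S \<Longrightarrow> norm w \<le> max B (norm z) \<Longrightarrow> norm (deriv (f x) w) \<le> K * g x"
    using param_family_bound_deriv[OF pf, of "max B (norm z)"] by blast
  have int: "(\<lambda>x. f x w) integrable_on S" for w
    using pf unfolding param_family_def by (blast intro: set_lebesgue_integral_eq_integral(1))
  have 1: "(\<lambda>x. (f x (X n) - f x z) / (X n - z)) integrable_on S" for n
    using int by (intro integrable_on_divide integrable_diff)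
  have 2: "(\<lambda>x. K * g x) integrable_on S"
    using pf integrable_on_cmult_left[of g S K] unfolding param_family_def by simp
  have 3: "norm ((f x (X n) - f x z) / (X n - z)) \<le> K * g x" if x: "x \<in> S" for x n
  proof -
    have hol: "f x holomorphic_on UNIV" using pf x unfolding param_family_def by blast
    have "norm (f x (X n) - f x z) \<le> K * g x * norm (X n - z)"
    proof (rule field_differentiable_bound[of "cball 0 (max B (norm z))" "f x" "deriv (f x)"])
      show "(f x has_field_derivative deriv (f x) w) (at w within cball 0 (max B (norm z)))" for w
        using holomorphic_derivI[OF hol open_UNIV, of w] has_field_derivative_at_within by blast
      show "norm (deriv (f x) w) \<le> K * g x" if "w \<in> cball 0 (max B (norm z))" for w
        using K[OF x, of w] that by simp
      have "norm (X n) \<le> max B (norm z)" using B[of n] by simp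
      then show "X n \<in> cball 0 (max B (norm z))" "z \<in> cball 0 (max B (norm z))" by simp_all
    qed simp
    then show ?thesis using X(1)[of n] by (simp add: norm_divide divide_le_eq)
  qed
  have 4: "(\<lambda>n. (f x (X n) - f x z) / (X n - z)) \<longlonglongrightarrow> deriv (f x) z" if x: "x \<in> S" for x
  proof -
    have hol: "f x holomorphic_on UNIV" using pf x unfolding param_family_def by blast
    have "((\<lambda>w. (f x w - f x z) / (w - z)) \<longlongrightarrow> deriv (f x) z) (at z)"
      using holomorphic_derivI[OF hol open_UNIV, of z] unfolding has_field_derivative_iff by simp
    then have "((\<lambda>w. (f x w - f x z) / (w - z)) \<circ> X) \<longlonglongrightarrow> deriv (f x) z"
      using X unfolding tendsto_at_iff_sequentially by blast
    then show ?thesis by (simp add: o_def)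
  qed
  show "(\<lambda>x. deriv (f x) z) integrable_on S" by (rule dominated_convergence(1)[OF 1 2 3 4])
  have "(\<lambda>n. integral S (\<lambda>x. (f x (X n) - f x z) / (X n - z))) \<longlonglongrightarrow> integral S (\<lambda>x. deriv (f x) z)"
    by (rule dominated_convergence(2)[OF 1 2 3 4])
  moreover have "integral S (\<lambda>x. (f x (X n) - f x z) / (X n - z)) = (integral S (\<lambda>x. f x (X n)) - integral S (\<lambda>x. f x z)) / (X n - z)" for n
    unfolding Henstock_Kurzweil_Integration.integral_divide Henstock_Kurzweil_Integration.integral_diff[OF int int] ..
  ultimately show "(\<lambda>n. (integral S (\<lambda>x. f x (X n)) - integral S (\<lambda>x. f x z)) / (X n - z)) \<longlonglongrightarrow> integral S (\<lambda>x. deriv (f x) z)"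
    by (simp only:)
qed

lemma param_family_has_field_derivative:
  assumes pf: "param_family S f g"
  shows "((\<lambda>z. integral S (\<lambda>x. f x z)) has_field_derivative integral S (\<lambda>x. deriv (f x) z)) (at z)"
  unfolding has_field_derivative_iff tendsto_at_iff_sequentially
proof (intro allI impI)
  fix X :: "nat \<Rightarrow> complex" assume X: "\<forall>i. X i \<in> UNIV - {z}" "X \<longlonglongrightarrow> z"
  then have "(\<lambda>n. (integral S (\<lambda>x. f x (X n)) - integral S (\<lambda>x. f x z)) / (X n - z)) \<longlonglongrightarrow> integral S (\<lambda>x. deriv (f x) z)"
    by (intro param_family_quotient_limit(2)[OF pf]) auto
  then show "((\<lambda>w. (integral S (\<lambda>x. f x w) - integral S (\<lambda>x. f x z)) / (w - z)) \<circ> X) \<longlonglongrightarrow> integral S (\<lambda>x. deriv (f x) z)"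
    by (simp add: o_def)
qed

lemma param_family_holomorphic: "param_family S f g \<Longrightarrow> (\<lambda>z. integral S (\<lambda>x. f x z)) holomorphic_on A"
  using param_family_has_field_derivative by (meson field_differentiable_at_within field_differentiable_def holomorphic_on_def)

lemma param_family_deriv:
  assumes pf: "param_family S f g"
  shows "param_family S (\<lambda>x. deriv (f x)) g"
  unfolding param_family_def
proof (intro conjI ballI allI)
  fix R
  obtain K where K: "\<And>x (z::complex). x \<in> S \<Longrightarrow> norm z \<le> R \<Longrightarrow> norm (deriv (f x) z) \<le> K * g x"
    using param_family_bound_deriv[OF pf, of R] by blast
  then show "\<exists>K. \<forall>x\<in>S. \<forall>z. norm z \<le> R \<longrightarrow> norm (deriv (f x) z) \<le> K * g x" by blast
next
  fix z :: complex
  obtain K where K: "\<And>x (w::complex). x \<in> S \<Longrightarrow> norm w \<le> norm z \<Longrightarrow> norm (deriv (f x) w) \<le> K * g x"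
    using param_family_bound_deriv[OF pf, of "norm z"] by blast
  \<comment> \<open>A sequence tending to z without reaching it; it serves to obtain the
    integrability of the derivative.\<close>
  have "(\<lambda>n. z + of_real (inverse (real (Suc n)))) \<longlonglongrightarrow> z + of_real 0"
    by (intro tendsto_intros LIMSEQ_inverse_real_of_nat)
  then have "(\<lambda>x. deriv (f x) z) integrable_on S"
    by (intro param_family_quotient_limit(1)[OF pf, of "\<lambda>n. z + of_real (inverse (real (Suc n)))"]) (auto simp del: of_nat_Suc)
  moreover have "(\<lambda>x. K * g x) integrable_on S"
    using pf integrable_on_cmult_left[of g S K] unfolding param_family_def by simp
  ultimately show "(\<lambda>x. deriv (f x) z) absolutely_integrable_on S"
    using K by (intro absolutely_integrable_integrable_bound[of S _ "\<lambda>x. K * g x"]) auto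
qed (use pf in \<open>auto simp: param_family_def intro!: holomorphic_deriv\<close>)

lemma param_family_higher_deriv:
  assumes "param_family S f g"
  shows "param_family S (\<lambda>x. (deriv ^^ n) (f x)) g"
    "(deriv ^^ n) (\<lambda>z. integral S (\<lambda>x. f x z)) = (\<lambda>z. integral S (\<lambda>x. (deriv ^^ n) (f x) z))"
proof -
  show *: "param_family S (\<lambda>x. (deriv ^^ n) (f x)) g" for n
    by (induction n) (use assms param_family_deriv in auto)
  show "(deriv ^^ n) (\<lambda>z. integral S (\<lambda>x. f x z)) = (\<lambda>z. integral S (\<lambda>x. (deriv ^^ n) (f x) z))"
    by (induction n) (use param_family_has_field_derivative[OF *] in \<open>auto intro!: DERIV_imp_deriv\<close>)
qed

text \<open>The n-th components are the terms, not the partial sums, of the series solving the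
  first-order system y' = z, z' = (q - \<lambda>) y; the terms for n = 0 are the initial values
  \<open>c0\<close> and \<open>c1\<close>.\<close>

primrec picard :: "(real \<Rightarrow> complex) \<Rightarrow> real \<Rightarrow> complex \<Rightarrow> complex \<Rightarrow> nat \<Rightarrow> (complex \<Rightarrow> real \<Rightarrow> complex) \<times> (complex \<Rightarrow> real \<Rightarrow> complex)" where
  "picard q a c0 c1 0 = (\<lambda>lam x. c0, \<lambda>lam x. c1)"
| "picard q a c0 c1 (Suc n) = (\<lambda>lam x. integral {a..x} (snd (picard q a c0 c1 n) lam),
     \<lambda>lam x. integral {a..x} (\<lambda>t. (q t - lam) * fst (picard q a c0 c1 n) lam t))"

lemma ac_deriv_power:
  assumes "ac_deriv a b w w'"
  shows "ac_deriv a b (\<lambda>x. w x ^ Suc n / fact (Suc n)) (\<lambda>x. w x ^ n / fact n * w' x)"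
proof -
  have *: "ac_deriv a b (\<lambda>x. w x ^ Suc n) (\<lambda>x. of_nat (Suc n) * (w x ^ n * w' x))" for n
  proof (induction n)
    case 0 then show ?case using assms by simp
  next
    case (Suc n)
    have "ac_deriv a b (\<lambda>x. w x * w x ^ Suc n) (\<lambda>x. w x * (of_nat (Suc n) * (w x ^ n * w' x)) + w' x * w x ^ Suc n)"
      by (rule ac_deriv_mult[OF assms Suc])
    then show ?case by (rule ac_deriv_cong) (auto simp: algebra_simps)
  qed
  show ?thesis
  proof (rule ac_deriv_cong[OF ac_deriv_cmult[OF *[of n], of "1 / fact (Suc n)"]])
    have "(of_nat (Suc n) :: complex) \<noteq> 0" by (simp only: of_nat_eq_0_iff)
    then show "w x ^ n / fact n * w' x = 1 / fact (Suc n) * (of_nat (Suc n) * (w x ^ n * w' x))" for x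
      unfolding fact_Suc by (simp del: of_nat_Suc)
  qed simp
qed

text \<open>An antiderivative of |q| + R + 1, which for |\<lambda>| \<le> R bounds both coefficients
  of the first-order system, 1 and q - \<lambda>.\<close>

definition weight :: "(real \<Rightarrow> complex) \<Rightarrow> real \<Rightarrow> real \<Rightarrow> real \<Rightarrow> real" where
  "weight q a R x = integral {a..x} (\<lambda>t. norm (q t) + R + 1)"

text \<open>With w for the weight, w^n / n! times w' has the antiderivative w^(n+1) / (n+1)!. As w
  is only absolutely continuous, this is derived from the product rule for \<open>ac_deriv\<close>,
  in complex form. It makes the iterated integrals behave like the terms of an exponential
  series.\<close>

lemma weight_integral_power:
  assumes q: "q absolutely_integrable_on {a..b}" and R: "0 \<le> R"
  shows "a \<le> x \<Longrightarrow> x \<le> b \<Longrightarrow> 0 \<le> weight q a R x"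
    "a \<le> x \<Longrightarrow> x \<le> b \<Longrightarrow> weight q a R x \<le> weight q a R b"
    "a \<le> x \<Longrightarrow> x \<le> b \<Longrightarrow> ((\<lambda>t. weight q a R t ^ n / fact n * (norm (q t) + R + 1)) has_integral weight q a R x ^ Suc n / fact (Suc n)) {a..x}"
proof -
  have abs: "(\<lambda>t. norm (q t) + R + 1) absolutely_integrable_on {a..b}"
    by (intro set_integral_add(1) absolutely_integrable_norm[OF q, unfolded o_def] absolutely_integrable_continuous_real continuous_on_const)
  have int: "(\<lambda>t. norm (q t) + R + 1) integrable_on {a..x}" if "x \<le> b" for x
    using that by (intro integrable_on_subinterval[OF set_lebesgue_integral_eq_integral(1)[OF abs]]) auto
  show "0 \<le> weight q a R x" if "x \<le> b" for x
    unfolding weight_def using R by (intro Henstock_Kurzweil_Integration.integral_nonneg int that) auto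
  show "weight q a R x \<le> weight q a R b" if "a \<le> x" "x \<le> b"
    unfolding weight_def using R that by (intro integral_subset_le int) auto
  have cabs: "(\<lambda>t. complex_of_real (norm (q t) + R + 1)) absolutely_integrable_on {a..b}"
    using absolutely_integrable_linear[OF abs bounded_linear_of_real] by (simp add: o_def)
  have cw: "complex_of_real (weight q a R x) = integral {a..x} (\<lambda>t. complex_of_real (norm (q t) + R + 1))" if "x \<le> b" for x
    unfolding weight_def using integral_linear[OF int[OF that], of complex_of_real, OF bounded_linear_of_real]
    unfolding o_def by (rule sym)
  have ac: "ac_deriv a b (\<lambda>x. complex_of_real (weight q a R x)) (\<lambda>t. complex_of_real (norm (q t) + R + 1))"
  proof (rule ac_deriv_integral[OF cabs])
    fix x assume "x \<in> {a..b}"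
    then have "complex_of_real (weight q a R x) = integral {a..x} (\<lambda>t. complex_of_real (norm (q t) + R + 1))" by (intro cw) auto
    moreover have "weight q a R a = 0" by (simp add: weight_def)
    ultimately show "complex_of_real (weight q a R x) = complex_of_real (weight q a R a) + integral {a..x} (\<lambda>t. complex_of_real (norm (q t) + R + 1))"
      by (simp only: of_real_0 add_0)
  qed
  show "((\<lambda>t. weight q a R t ^ n / fact n * (norm (q t) + R + 1)) has_integral weight q a R x ^ Suc n / fact (Suc n)) {a..x}" if x: "a \<le> x" "x \<le> b"
  proof -
    have "ac_deriv a x (\<lambda>x. complex_of_real (weight q a R x) ^ Suc n / fact (Suc n)) (\<lambda>t. complex_of_real (weight q a R t) ^ n / fact n * complex_of_real (norm (q t) + R + 1))"
      by (rule ac_deriv_subinterval[OF ac_deriv_power[OF ac]]) (use x in auto)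
    from has_integral_linear[OF ac_deriv_has_integral[OF this x(1)] bounded_linear_Re]
    have *: "((\<lambda>t. Re (complex_of_real (weight q a R t) ^ n / fact n * complex_of_real (norm (q t) + R + 1))) has_integral
      Re (complex_of_real (weight q a R x) ^ Suc n / fact (Suc n) - complex_of_real (weight q a R a) ^ Suc n / fact (Suc n))) {a..x}"
      by (simp only: o_def)
    have "weight q a R a = 0" by (simp add: weight_def)
    then have "complex_of_real (weight q a R x) ^ Suc n / fact (Suc n) - complex_of_real (weight q a R a) ^ Suc n / fact (Suc n)
      = complex_of_real (weight q a R x ^ Suc n / fact (Suc n))" by (simp del: fact_Suc)
    moreover have "complex_of_real (weight q a R t) ^ n / fact n * complex_of_real (norm (q t) + R + 1)
      = complex_of_real (weight q a R t ^ n / fact n * (norm (q t) + R + 1))" for t by simp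
    ultimately show ?thesis using * by (simp only: Re_complex_of_real)
  qed
qed

section \<open>Convergence of the successive approximations\<close>

context
  fixes q :: "real \<Rightarrow> complex" and a b :: real and c0 c1 :: complex
  assumes q: "q absolutely_integrable_on {a..b}" and ab: "a \<le> b"
begin

abbreviation (input) "picard_y n \<equiv> fst (picard q a c0 c1 n)"
abbreviation (input) "picard_z n \<equiv> snd (picard q a c0 c1 n)"
abbreviation (input) "init_size \<equiv> norm c0 + norm c1"

lemma picard_continuous: "continuous_on {a..b} (picard_y n lam)" "continuous_on {a..b} (picard_z n lam)"
proof (induction n)
  case (Suc n)
  show "continuous_on {a..b} (picard_y (Suc n) lam)"
    using indefinite_integral_continuous_1[OF integrable_continuous_real[OF Suc(2)]] by simp
  show "continuous_on {a..b} (picard_z (Suc n) lam)"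
    using indefinite_integral_continuous_1[OF set_lebesgue_integral_eq_integral(1)[OF potential_times_absolutely_integrable[OF q Suc(1), of lam]]] by simp
qed auto

lemma picard_bound:
  assumes R: "0 \<le> R" and lam: "norm lam \<le> R" and x: "x \<in> {a..b}"
  shows "norm (picard_y n lam x) \<le> init_size * (weight q a R x ^ n / fact n) \<and> norm (picard_z n lam x) \<le> init_size * (weight q a R x ^ n / fact n)"
  using x
proof (induction n arbitrary: x)
  case (Suc n)
  let ?g = "\<lambda>t. init_size * (weight q a R t ^ n / fact n * (norm (q t) + R + 1))"
  have x: "a \<le> x" "x \<le> b" using Suc.prems by auto
  have g: "(?g has_integral init_size * (weight q a R x ^ Suc n / fact (Suc n))) {a..x}"
    by (intro has_integral_mult_right weight_integral_power(3)[OF q R x])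
  have w: "0 \<le> init_size * (weight q a R t ^ n / fact n)" if "t \<in> {a..x}" for t
    using weight_integral_power(1)[OF q R, of t] that x by simp
  have c: "continuous_on {a..x} (picard_y n lam)" "continuous_on {a..x} (picard_z n lam)"
    by (rule continuous_on_subset[OF picard_continuous(1)] continuous_on_subset[OF picard_continuous(2)], use x in simp)+
  have qx: "q absolutely_integrable_on {a..x}" using q x by (auto intro: absolutely_integrable_on_subinterval)
  have "norm (picard_y (Suc n) lam x) \<le> integral {a..x} ?g"
    unfolding picard.simps fst_conv
  proof (rule Henstock_Kurzweil_Integration.integral_norm_bound_integral)
    show "?g integrable_on {a..x}" using g by blast
    show "picard_z n lam integrable_on {a..x}" by (rule integrable_continuous_real[OF c(2)])
    fix t assume t: "t \<in> {a..x}"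
    have "norm (picard_z n lam t) \<le> init_size * (weight q a R t ^ n / fact n) * 1" using Suc.IH[of t] t x by simp
    also have "\<dots> \<le> init_size * (weight q a R t ^ n / fact n) * (norm (q t) + R + 1)"
      using R by (intro mult_left_mono w t) auto
    finally show "norm (picard_z n lam t) \<le> ?g t" by (simp only: mult.assoc)
  qed
  then have 1: "norm (picard_y (Suc n) lam x) \<le> init_size * (weight q a R x ^ Suc n / fact (Suc n))"
    unfolding integral_unique[OF g] .
  have "norm (picard_z (Suc n) lam x) \<le> integral {a..x} ?g"
    unfolding picard.simps snd_conv
  proof (rule Henstock_Kurzweil_Integration.integral_norm_bound_integral)
    show "?g integrable_on {a..x}" using g by blast
    show "(\<lambda>t. (q t - lam) * picard_y n lam t) integrable_on {a..x}"
      by (rule set_lebesgue_integral_eq_integral(1)[OF potential_times_absolutely_integrable[OF qx c(1)]])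
    fix t assume t: "t \<in> {a..x}"
    have "norm (q t - lam) \<le> norm (q t) + R + 1" using norm_triangle_ineq4[of "q t" lam] lam by simp
    then have "norm ((q t - lam) * picard_y n lam t) \<le> (norm (q t) + R + 1) * (init_size * (weight q a R t ^ n / fact n))"
      unfolding norm_mult using Suc.IH[of t] t x R by (intro mult_mono) auto
    then show "norm ((q t - lam) * picard_y n lam t) \<le> ?g t" by (simp only: mult_ac)
  qed
  then have "norm (picard_z (Suc n) lam x) \<le> init_size * (weight q a R x ^ Suc n / fact (Suc n))"
    unfolding integral_unique[OF g] .
  with 1 show ?case by (rule conjI)
qed auto

lemma picard_bound':
  assumes R: "0 \<le> R" and lam: "norm lam \<le> R" and x: "x \<in> {a..b}"
  shows "norm (picard_y n lam x) \<le> init_size * (weight q a R b ^ n / fact n)" "norm (picard_z n lam x) \<le> init_size * (weight q a R b ^ n / fact n)"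
proof -
  have "init_size * (weight q a R x ^ n / fact n) \<le> init_size * (weight q a R b ^ n / fact n)"
    using weight_integral_power(1,2)[OF q R, of x] x by (intro mult_left_mono divide_right_mono power_mono) auto
  then show "norm (picard_y n lam x) \<le> init_size * (weight q a R b ^ n / fact n)" "norm (picard_z n lam x) \<le> init_size * (weight q a R b ^ n / fact n)"
    using picard_bound[OF assms, of n] by (meson order_trans)+
qed

text \<open>Induction through integrals over [a, x]: both integrands are dominated, uniformly for
  \<lambda> in a disc, by a multiple of |q| + 1.\<close>

lemma picard_holomorphic:
  assumes "x \<in> {a..b}"
  shows "(\<lambda>lam. picard_y n lam x) holomorphic_on UNIV \<and> (\<lambda>lam. picard_z n lam x) holomorphic_on UNIV"
  using assms
proof (induction n arbitrary: x)
  case (Suc n)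
  have x: "a \<le> x" "x \<le> b" using Suc.prems by auto
  have c: "continuous_on {a..x} (picard_y n lam)" "continuous_on {a..x} (picard_z n lam)" for lam
    by (rule continuous_on_subset[OF picard_continuous(1)] continuous_on_subset[OF picard_continuous(2)], use x in simp)+
  have qx: "q absolutely_integrable_on {a..x}" using q x by (auto intro: absolutely_integrable_on_subinterval)
  have g: "(\<lambda>t. norm (q t) + 1) integrable_on {a..x}"
    using qx by (intro integrable_add) (auto simp: absolutely_integrable_on_def)
  have bd: "norm (picard_y n lam t) \<le> init_size * (weight q a (max R 0) b ^ n / fact n)" "norm (picard_z n lam t) \<le> init_size * (weight q a (max R 0) b ^ n / fact n)"
    if "t \<in> {a..x}" "norm lam \<le> R" for t lam R
    using picard_bound'[of "max R 0" lam t n] that x by auto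
  have "param_family {a..x} (\<lambda>t lam. picard_z n lam t) (\<lambda>t. norm (q t) + 1)"
    unfolding param_family_def
  proof (intro conjI ballI allI g)
    fix R
    let ?B = "init_size * (weight q a (max R 0) b ^ n / fact n)"
    have "norm (picard_z n z t) \<le> ?B * (norm (q t) + 1)" if "t \<in> {a..x}" "norm z \<le> R" for t z
    proof -
      have "0 \<le> ?B" using weight_integral_power(1)[OF q, of "max R 0" b] ab by simp
      then have "?B * 1 \<le> ?B * (norm (q t) + 1)" by (intro mult_left_mono) auto
      with bd(2)[OF that] show ?thesis by simp
    qed
    then show "\<exists>K. \<forall>t\<in>{a..x}. \<forall>z. norm z \<le> R \<longrightarrow> norm (picard_z n z t) \<le> K * (norm (q t) + 1)" by blast
  qed (use Suc x c in \<open>auto intro!: absolutely_integrable_continuous_real\<close>)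
  from param_family_holomorphic[OF this] have 1: "(\<lambda>lam. picard_y (Suc n) lam x) holomorphic_on UNIV" by simp
  have "param_family {a..x} (\<lambda>t lam. (q t - lam) * picard_y n lam t) (\<lambda>t. norm (q t) + 1)"
    unfolding param_family_def
  proof (intro conjI ballI allI g)
    fix R
    let ?B = "init_size * (weight q a (max R 0) b ^ n / fact n)"
    have "norm ((q t - z) * picard_y n z t) \<le> ((\<bar>R\<bar> + 1) * ?B) * (norm (q t) + 1)" if "t \<in> {a..x}" "norm z \<le> R" for t z
    proof -
      have "norm (q t - z) \<le> norm (q t) + \<bar>R\<bar>" using norm_triangle_ineq4[of "q t" z] that by simp
      also have "\<dots> \<le> (\<bar>R\<bar> + 1) * (norm (q t) + 1)" by (simp add: algebra_simps)
      finally have "norm ((q t - z) * picard_y n z t) \<le> ((\<bar>R\<bar> + 1) * (norm (q t) + 1)) * ?B"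
        unfolding norm_mult using bd(1)[OF that] by (intro mult_mono) auto
      then show ?thesis by (simp only: mult_ac)
    qed
    then show "\<exists>K. \<forall>t\<in>{a..x}. \<forall>z. norm z \<le> R \<longrightarrow> norm ((q t - z) * picard_y n z t) \<le> K * (norm (q t) + 1)" by blast
  next
    fix z show "(\<lambda>t. (q t - z) * picard_y n z t) absolutely_integrable_on {a..x}"
      by (rule potential_times_absolutely_integrable[OF qx c(1)])
  qed (use Suc x in \<open>auto intro!: holomorphic_intros\<close>)
  from param_family_holomorphic[OF this] have "(\<lambda>lam. picard_z (Suc n) lam x) holomorphic_on UNIV" by simp
  with 1 show ?case by (rule conjI)
qed auto

text \<open>The M-test is applied in two ways to the same series: uniformly in x for fixed \<lambda>
  it gives continuity, uniformly on discs in \<lambda> for fixed x it gives holomorphy. Dominated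
  convergence passes to the limit in the integral equations.\<close>

lemma sl_piece_family_exists:
  obtains Y Z :: "complex \<Rightarrow> real \<Rightarrow> complex"
  where "\<And>lam. sl_piece q lam a b (Y lam) (Z lam)" "\<And>lam. Y lam a = c0" "\<And>lam. Z lam a = c1"
    "\<And>x. x \<in> {a..b} \<Longrightarrow> (\<lambda>lam. Y lam x) holomorphic_on UNIV" "\<And>x. x \<in> {a..b} \<Longrightarrow> (\<lambda>lam. Z lam x) holomorphic_on UNIV"
    "\<And>R. \<exists>K. \<forall>lam. norm lam \<le> R \<longrightarrow> (\<forall>x\<in>{a..b}. norm (Y lam x) \<le> K)"
proof -
  define M where "M R n = init_size * (weight q a R b ^ n / fact n)" for R n
  have sM: "summable (M R)" for R
    unfolding M_def using summable_exp[of "weight q a R b"] by (intro summable_mult) (simp add: field_simps)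
  have M0: "0 \<le> M R n" if "0 \<le> R" for R n
    unfolding M_def using weight_integral_power(1)[OF q that, of b] ab by simp
  note bd = picard_bound'[folded M_def]
  define Y where "Y lam x = (\<Sum>n. picard_y n lam x)" for lam x
  define Z where "Z lam x = (\<Sum>n. picard_z n lam x)" for lam x
  have partial: "norm (\<Sum>n<N. f n) \<le> suminf (M R)" if "\<And>n. norm (f n) \<le> M R n" "0 \<le> R" for f :: "nat \<Rightarrow> complex" and N R
  proof -
    have "norm (\<Sum>n<N. f n) \<le> (\<Sum>n<N. M R n)" using that(1) by (rule sum_norm_le)
    also have "\<dots> \<le> suminf (M R)" using sM M0[OF that(2)] by (intro sum_le_suminf) auto
    finally show ?thesis .
  qed
  have ulx: "uniform_limit {a..b} (\<lambda>N x. \<Sum>n<N. picard_y n lam x) (Y lam) sequentially"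
       "uniform_limit {a..b} (\<lambda>N x. \<Sum>n<N. picard_z n lam x) (Z lam) sequentially" for lam
    unfolding Y_def Z_def using bd[of "norm lam" lam] by (intro Weierstrass_m_test[OF _ sM[of "norm lam"]]; simp)+
  have cont: "continuous_on {a..b} (Y lam)" "continuous_on {a..b} (Z lam)" for lam
    using picard_continuous by (intro uniform_limit_theorem[OF _ ulx(1)] uniform_limit_theorem[OF _ ulx(2)] always_eventually allI continuous_on_sum; simp)+
  have lim: "(\<lambda>N. \<Sum>n<N. picard_y n lam x) \<longlonglongrightarrow> Y lam x" "(\<lambda>N. \<Sum>n<N. picard_z n lam x) \<longlonglongrightarrow> Z lam x" if "x \<in> {a..b}" for lam x
    using tendsto_uniform_limitI[OF ulx(1) that] tendsto_uniform_limitI[OF ulx(2) that] by auto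
  have eqY: "Y lam x = c0 + integral {a..x} (Z lam)" if x: "x \<in> {a..b}" for lam x
  proof -
    have czx: "continuous_on {a..x} (picard_z n lam)" for n
      by (rule continuous_on_subset[OF picard_continuous(2)]) (use x in auto)
    have "(\<lambda>N. integral {a..x} (\<lambda>t. \<Sum>n<N. picard_z n lam t)) \<longlonglongrightarrow> integral {a..x} (Z lam)"
    proof (rule dominated_convergence(2))
      show "(\<lambda>t. \<Sum>n<N. picard_z n lam t) integrable_on {a..x}" for N
        by (intro integrable_continuous_real continuous_on_sum czx)
      show "(\<lambda>t. suminf (M (norm lam))) integrable_on {a..x}" by (rule integrable_continuous_real) simp
      show "norm (\<Sum>n<N. picard_z n lam t) \<le> suminf (M (norm lam))" if "t \<in> {a..x}" for N t
        using bd(2)[of "norm lam" lam t] that x by (intro partial) auto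
      show "(\<lambda>N. \<Sum>n<N. picard_z n lam t) \<longlonglongrightarrow> Z lam t" if "t \<in> {a..x}" for t using lim(2) that x by simp
    qed
    moreover have "integral {a..x} (\<lambda>t. \<Sum>n<N. picard_z n lam t) = (\<Sum>n<N. picard_y (Suc n) lam x)" for N
      by (subst Henstock_Kurzweil_Integration.integral_sum) (auto intro!: integrable_continuous_real czx)
    moreover have "(\<Sum>n<Suc N. picard_y n lam x) = c0 + (\<Sum>n<N. picard_y (Suc n) lam x)" for N
      by (subst sum.lessThan_Suc_shift) simp
    moreover have "(\<lambda>N. \<Sum>n<Suc N. picard_y n lam x) \<longlonglongrightarrow> Y lam x" using lim(1)[OF x] by (rule LIMSEQ_Suc)
    ultimately have "(\<lambda>N. c0 + integral {a..x} (\<lambda>t. \<Sum>n<N. picard_z n lam t)) \<longlonglongrightarrow> Y lam x"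
      "(\<lambda>N. c0 + integral {a..x} (\<lambda>t. \<Sum>n<N. picard_z n lam t)) \<longlonglongrightarrow> c0 + integral {a..x} (Z lam)"
      by (auto intro: tendsto_add)
    then show ?thesis by (rule LIMSEQ_unique)
  qed
  have eqZ: "Z lam x = c1 + integral {a..x} (\<lambda>t. (q t - lam) * Y lam t)" if x: "x \<in> {a..b}" for lam x
  proof -
    have qx: "q absolutely_integrable_on {a..x}" using q x by (auto intro: absolutely_integrable_on_subinterval)
    have c: "continuous_on {a..x} (picard_y n lam)" for n
      by (rule continuous_on_subset[OF picard_continuous(1)]) (use x in auto)
    have i: "(\<lambda>t. (q t - lam) * picard_y n lam t) integrable_on {a..x}" for n
      by (rule set_lebesgue_integral_eq_integral(1)[OF potential_times_absolutely_integrable[OF qx c]])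
    have "(\<lambda>N. integral {a..x} (\<lambda>t. \<Sum>n<N. (q t - lam) * picard_y n lam t)) \<longlonglongrightarrow> integral {a..x} (\<lambda>t. (q t - lam) * Y lam t)"
    proof (rule dominated_convergence(2))
      show "(\<lambda>t. \<Sum>n<N. (q t - lam) * picard_y n lam t) integrable_on {a..x}" for N
        by (intro integrable_sum i) auto
      have "(\<lambda>t. norm (q t)) integrable_on {a..x}" using qx by (simp add: absolutely_integrable_on_def)
      then have "(\<lambda>t. (norm (q t) + norm lam) * suminf (M (norm lam))) integrable_on {a..x}"
        by (intro integrable_on_mult_left integrable_add) auto
      then show "(\<lambda>t. (norm (q t) + norm lam) * suminf (M (norm lam))) integrable_on {a..x}" .
      show "norm (\<Sum>n<N. (q t - lam) * picard_y n lam t) \<le> (norm (q t) + norm lam) * suminf (M (norm lam))" if "t \<in> {a..x}" for N t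
      proof -
        have "norm (\<Sum>n<N. picard_y n lam t) \<le> suminf (M (norm lam))"
          using bd(1)[of "norm lam" lam t] that x by (intro partial) auto
        then show ?thesis unfolding sum_distrib_left[symmetric] norm_mult
          by (intro mult_mono norm_triangle_ineq4) auto
      qed
      show "(\<lambda>N. \<Sum>n<N. (q t - lam) * picard_y n lam t) \<longlonglongrightarrow> (q t - lam) * Y lam t" if "t \<in> {a..x}" for t
        unfolding sum_distrib_left[symmetric] using lim(1)[of t lam] that x by (intro tendsto_mult) auto
    qed
    moreover have "integral {a..x} (\<lambda>t. \<Sum>n<N. (q t - lam) * picard_y n lam t) = (\<Sum>n<N. picard_z (Suc n) lam x)" for N
      using i by (subst Henstock_Kurzweil_Integration.integral_sum) auto
    moreover have "(\<Sum>n<Suc N. picard_z n lam x) = c1 + (\<Sum>n<N. picard_z (Suc n) lam x)" for N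
      by (subst sum.lessThan_Suc_shift) simp
    moreover have "(\<lambda>N. \<Sum>n<Suc N. picard_z n lam x) \<longlonglongrightarrow> Z lam x" using lim(2)[OF x] by (rule LIMSEQ_Suc)
    ultimately have "(\<lambda>N. c1 + integral {a..x} (\<lambda>t. \<Sum>n<N. (q t - lam) * picard_y n lam t)) \<longlonglongrightarrow> Z lam x"
      "(\<lambda>N. c1 + integral {a..x} (\<lambda>t. \<Sum>n<N. (q t - lam) * picard_y n lam t)) \<longlonglongrightarrow> c1 + integral {a..x} (\<lambda>t. (q t - lam) * Y lam t)"
      by (auto intro: tendsto_add)
    then show ?thesis by (rule LIMSEQ_unique)
  qed
  have Ya: "Y lam a = c0" and Za: "Z lam a = c1" for lam using eqY[of a lam] eqZ[of a lam] ab by auto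
  have piece: "sl_piece q lam a b (Y lam) (Z lam)" for lam
    unfolding sl_piece_def Ya Za using cont eqY eqZ by blast
  have ball: "f holomorphic_on UNIV" if ul: "\<And>R. R > 0 \<Longrightarrow> uniform_limit (ball 0 R) F f sequentially"
    and hol: "\<And>N. F N holomorphic_on UNIV" for F :: "nat \<Rightarrow> complex \<Rightarrow> complex" and f
  proof (rule holomorphic_uniform_sequence[OF open_UNIV, of F])
    fix z :: complex
    have "cball z 1 \<subseteq> ball 0 (norm z + 2)"
      using norm_triangle_ineq2 by (auto simp: dist_norm norm_minus_commute) (smt (verit) norm_triangle_sub norm_minus_commute)
    then have "uniform_limit (cball z 1) F f sequentially"
      using uniform_limit_on_subset[OF ul[of "norm z + 2"]] by (smt (verit) norm_ge_zero)
    then show "\<exists>d>0. cball z d \<subseteq> UNIV \<and> uniform_limit (cball z d) F f sequentially" by (intro exI[of _ 1]) auto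
  qed (rule hol)
  have holY: "(\<lambda>lam. Y lam x) holomorphic_on UNIV" if x: "x \<in> {a..b}" for x
  proof (rule ball)
    show "(\<lambda>lam. \<Sum>n<N. picard_y n lam x) holomorphic_on UNIV" for N using picard_holomorphic[OF x] by (intro holomorphic_on_sum) blast
    fix R :: real assume R: "R > 0"
    show "uniform_limit (ball 0 R) (\<lambda>N lam. \<Sum>n<N. picard_y n lam x) (\<lambda>lam. Y lam x) sequentially"
      unfolding Y_def using bd(1)[of R _ x] x R by (intro Weierstrass_m_test[OF _ sM[of R]]) auto
  qed
  have holZ: "(\<lambda>lam. Z lam x) holomorphic_on UNIV" if x: "x \<in> {a..b}" for x
  proof (rule ball)
    show "(\<lambda>lam. \<Sum>n<N. picard_z n lam x) holomorphic_on UNIV" for N using picard_holomorphic[OF x] by (intro holomorphic_on_sum) blast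
    fix R :: real assume R: "R > 0"
    show "uniform_limit (ball 0 R) (\<lambda>N lam. \<Sum>n<N. picard_z n lam x) (\<lambda>lam. Z lam x) sequentially"
      unfolding Z_def using bd(2)[of R _ x] x R by (intro Weierstrass_m_test[OF _ sM[of R]]) auto
  qed
  have "norm (Y lam x) \<le> suminf (M (max R 0))" if "norm lam \<le> R" "x \<in> {a..b}" for lam x R
  proof (rule Lim_norm_ubound[OF _ lim(1)[OF that(2)]])
    show "\<forall>\<^sub>F N in sequentially. norm (\<Sum>n<N. picard_y n lam x) \<le> suminf (M (max R 0))"
      using bd(1)[of "max R 0" lam x] that by (intro always_eventually allI partial) auto
  qed simp
  then have "\<exists>K. \<forall>lam. norm lam \<le> R \<longrightarrow> (\<forall>x\<in>{a..b}. norm (Y lam x) \<le> K)" for R by blast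
  with piece Ya Za holY holZ show ?thesis by (rule that)
qed

end

subsection \<open>Wronskians and fundamental systems\<close>

lemma sl_piece_lincomb:
  assumes "sl_piece q lam a b y z" "sl_piece q lam a b y' z'" "q absolutely_integrable_on {a..b}"
  shows "sl_piece q lam a b (\<lambda>x. c * y x + c' * y' x) (\<lambda>x. c * z x + c' * z' x)"
proof -
  have c: "continuous_on {a..b} y" "continuous_on {a..b} z" "continuous_on {a..b} y'" "continuous_on {a..b} z'"
    using assms(1,2) sl_piece_continuous by blast+
  have eq: "c * y x + c' * y' x = c * y a + c' * y' a + integral {a..x} (\<lambda>t. c * z t + c' * z' t)"
    "c * z x + c' * z' x = c * z a + c' * z' a + integral {a..x} (\<lambda>t. (q t - lam) * (c * y t + c' * y' t))"
    if x: "x \<in> {a..b}" for x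
  proof -
    have sub: "{a..x} \<subseteq> {a..b}" using x by auto
    have i: "z integrable_on {a..x}" "z' integrable_on {a..x}"
      using c sub by (auto intro!: integrable_continuous_real intro: continuous_on_subset)
    have qx: "q absolutely_integrable_on {a..x}" by (rule absolutely_integrable_on_subinterval[OF assms(3) sub])
    have i': "(\<lambda>t. (q t - lam) * y t) integrable_on {a..x}" "(\<lambda>t. (q t - lam) * y' t) integrable_on {a..x}"
      using continuous_on_subset[OF c(1) sub] continuous_on_subset[OF c(3) sub]
      by (auto intro!: set_lebesgue_integral_eq_integral(1) potential_times_absolutely_integrable[OF qx])
    have y: "y x = y a + integral {a..x} z" "z x = z a + integral {a..x} (\<lambda>t. (q t - lam) * y t)"
      "y' x = y' a + integral {a..x} z'" "z' x = z' a + integral {a..x} (\<lambda>t. (q t - lam) * y' t)"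
      using assms(1,2) x unfolding sl_piece_def by blast+
    have "integral {a..x} (\<lambda>t. c * z t + c' * z' t) = c * integral {a..x} z + c' * integral {a..x} z'"
      using i by (subst Henstock_Kurzweil_Integration.integral_add) (auto intro: integrable_on_mult_right)
    then show "c * y x + c' * y' x = c * y a + c' * y' a + integral {a..x} (\<lambda>t. c * z t + c' * z' t)"
      unfolding y(1) y(3) by (simp add: algebra_simps)
    have "integral {a..x} (\<lambda>t. (q t - lam) * (c * y t + c' * y' t)) = integral {a..x} (\<lambda>t. c * ((q t - lam) * y t) + c' * ((q t - lam) * y' t))"
      by (simp add: algebra_simps)
    also have "\<dots> = c * integral {a..x} (\<lambda>t. (q t - lam) * y t) + c' * integral {a..x} (\<lambda>t. (q t - lam) * y' t)"
      using i' by (subst Henstock_Kurzweil_Integration.integral_add) (auto intro: integrable_on_mult_right)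
    finally show "c * z x + c' * z' x = c * z a + c' * z' a + integral {a..x} (\<lambda>t. (q t - lam) * (c * y t + c' * y' t))"
      unfolding y(2) y(4) by (simp add: algebra_simps)
  qed
  have "continuous_on {a..b} (\<lambda>x. c * y x + c' * y' x)" "continuous_on {a..b} (\<lambda>x. c * z x + c' * z' x)"
    using c by (auto intro!: continuous_intros)
  with eq show ?thesis unfolding sl_piece_def by blast
qed

text \<open>In the derivative of y z' - z y' the products of derivatives cancel, and only the
  difference of the two coefficients q - \<lambda> remains. One identity thus serves equal data
  (constant Wronskian), different parameters (spectral identity) and different potentials
  (comparison of the two problems).\<close>

lemma wronskian_piece:
  assumes "sl_piece q lam a b y z" "sl_piece q' mu a b y' z'"
    and q: "q absolutely_integrable_on {a..b}" "q' absolutely_integrable_on {a..b}"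
    and uv: "a \<le> u" "u \<le> v" "v \<le> b"
  shows "((\<lambda>t. ((q' t - mu) - (q t - lam)) * (y t * y' t)) has_integral
    (y v * z' v - z v * y' v) - (y u * z' u - z u * y' u)) {u..v}"
proof -
  note ac = sl_piece_ac_deriv[OF assms(1) q(1)] sl_piece_ac_deriv[OF assms(2) q(2)]
  have "ac_deriv a b (\<lambda>t. y t * z' t - z t * y' t) (\<lambda>t. ((q' t - mu) - (q t - lam)) * (y t * y' t))"
  proof (rule ac_deriv_cong[OF ac_deriv_diff[OF ac_deriv_mult[OF ac(1) ac(4)] ac_deriv_mult[OF ac(2) ac(3)]]])
    show "((q' t - mu) - (q t - lam)) * (y t * y' t) =
      y t * ((q' t - mu) * y' t) + z t * z' t - (z t * z' t + (q t - lam) * y t * y' t)" for t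
      by (simp add: algebra_simps)
  qed (rule refl)
  then have "ac_deriv u v (\<lambda>t. y t * z' t - z t * y' t) (\<lambda>t. ((q' t - mu) - (q t - lam)) * (y t * y' t))"
    by (rule ac_deriv_subinterval[of a b]) (use uv in auto)
  from ac_deriv_has_integral[OF this uv(2)] show ?thesis .
qed

lemma wronskian_piece_constant:
  assumes "sl_piece q lam a b y z" "sl_piece q lam a b y' z'"
    and q: "q absolutely_integrable_on {a..b}" and x: "x \<in> {a..b}"
  shows "y x * z' x - z x * y' x = y a * z' a - z a * y' a"
  using wronskian_piece[OF assms(1,2) q q, of a x] x by (simp add: has_integral_0_eq)

lemma jump_pair_lincomb:
  assumes "jump_pair q d \<beta> \<gamma> lam yl zl yr zr" "jump_pair q d \<beta> \<gamma> lam yl' zl' yr' zr'"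
    and q: "q absolutely_integrable_on {0..pi}" and d: "0 < d" "d < pi"
  shows "jump_pair q d \<beta> \<gamma> lam (\<lambda>x. c * yl x + c' * yl' x) (\<lambda>x. c * zl x + c' * zl' x)
    (\<lambda>x. c * yr x + c' * yr' x) (\<lambda>x. c * zr x + c' * zr' x)"
proof -
  have "q absolutely_integrable_on {0..d}" "q absolutely_integrable_on {d..pi}"
    using q d by (auto intro: absolutely_integrable_on_subinterval)
  then show ?thesis using assms(1,2) unfolding jump_pair_def
    by (auto intro!: sl_piece_lincomb simp: algebra_simps)
qed

text \<open>The jump acts on (y, y') by the matrix with rows (\<beta>, 0) and (\<gamma>, 1/\<beta>),
  whose determinant is 1.\<close>

lemma wronskian_jump:
  assumes "yr d = of_real \<beta> * yl d" "zr d = of_real (inverse \<beta>) * zl d + \<gamma> * yl d"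
    "yr' d = of_real \<beta> * yl' d" "zr' d = of_real (inverse \<beta>) * zl' d + \<gamma> * (yl' d :: complex)" "\<beta> \<noteq> 0"
  shows "yr d * zr' d - zr d * yr' d = yl d * zl' d - zl d * yl' d"
  using assms(5) unfolding assms(1-4) by (simp add: field_simps)

lemma wronskian_jump_pair:
  assumes p: "jump_pair q d \<beta> \<gamma> lam yl zl yr zr" "jump_pair q d \<beta> \<gamma> lam yl' zl' yr' zr'"
    and q: "q absolutely_integrable_on {0..pi}" and d: "0 < d" "d < pi" and \<beta>: "\<beta> \<noteq> 0"
  shows "x \<in> {0..d} \<Longrightarrow> yl x * zl' x - zl x * yl' x = yl 0 * zl' 0 - zl 0 * yl' 0"
    "x \<in> {d..pi} \<Longrightarrow> yr x * zr' x - zr x * yr' x = yl 0 * zl' 0 - zl 0 * yl' 0"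
proof -
  have q': "q absolutely_integrable_on {0..d}" "q absolutely_integrable_on {d..pi}"
    using q d by (auto intro: absolutely_integrable_on_subinterval)
  have l: "x \<in> {0..d} \<Longrightarrow> yl x * zl' x - zl x * yl' x = yl 0 * zl' 0 - zl 0 * yl' 0" for x
    using p q' unfolding jump_pair_def by (intro wronskian_piece_constant) blast+
  then show "x \<in> {0..d} \<Longrightarrow> yl x * zl' x - zl x * yl' x = yl 0 * zl' 0 - zl 0 * yl' 0" .
  assume x: "x \<in> {d..pi}"
  have "yr x * zr' x - zr x * yr' x = yr d * zr' d - zr d * yr' d"
    using p q' x unfolding jump_pair_def by (intro wronskian_piece_constant) blast+
  also have "\<dots> = yl d * zl' d - zl d * yl' d"
    using p \<beta> unfolding jump_pair_def by (intro wronskian_jump) blast+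
  also have "\<dots> = yl 0 * zl' 0 - zl 0 * yl' 0" using l[of d] d by simp
  finally show "yr x * zr' x - zr x * yr' x = yl 0 * zl' 0 - zl 0 * yl' 0" .
qed

text \<open>The Wronskian passes through the jump unchanged, so the contributions at
  \<open>d\<close> cancel and only the endpoints 0 and \<pi> remain. The identities behind the
  norming constants are instances of this one.\<close>

lemma wronskian_jump_pair_spectral:
  assumes p: "jump_pair q d \<beta> \<gamma> lam yl zl yr zr" "jump_pair q d \<beta> \<gamma> mu yl' zl' yr' zr'"
    and q: "q absolutely_integrable_on {0..pi}" and d: "0 < d" "d < pi" and \<beta>: "\<beta> \<noteq> 0"
  shows "(lam - mu) * (integral {0..d} (\<lambda>x. yl x * yl' x) + integral {d..pi} (\<lambda>x. yr x * yr' x)) =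
    (yr pi * zr' pi - zr pi * yr' pi) - (yl 0 * zl' 0 - zl 0 * yl' 0)"
proof -
  have q': "q absolutely_integrable_on {0..d}" "q absolutely_integrable_on {d..pi}"
    using q d by (auto intro: absolutely_integrable_on_subinterval)
  have "((\<lambda>t. ((q t - mu) - (q t - lam)) * (yl t * yl' t)) has_integral
    (yl d * zl' d - zl d * yl' d) - (yl 0 * zl' 0 - zl 0 * yl' 0)) {0..d}"
    by (rule wronskian_piece[where a=0 and b=d]) (use p q' d in \<open>auto simp: jump_pair_def\<close>)
  then have "integral {0..d} (\<lambda>t. (lam - mu) * (yl t * yl' t)) = (yl d * zl' d - zl d * yl' d) - (yl 0 * zl' 0 - zl 0 * yl' 0)"
    by (intro integral_unique) (simp add: algebra_simps)
  then have l: "(lam - mu) * integral {0..d} (\<lambda>t. yl t * yl' t) = (yl d * zl' d - zl d * yl' d) - (yl 0 * zl' 0 - zl 0 * yl' 0)"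
    by simp
  have "((\<lambda>t. ((q t - mu) - (q t - lam)) * (yr t * yr' t)) has_integral
    (yr pi * zr' pi - zr pi * yr' pi) - (yr d * zr' d - zr d * yr' d)) {d..pi}"
    by (rule wronskian_piece[where a=d and b=pi]) (use p q' d in \<open>auto simp: jump_pair_def\<close>)
  then have "integral {d..pi} (\<lambda>t. (lam - mu) * (yr t * yr' t)) = (yr pi * zr' pi - zr pi * yr' pi) - (yr d * zr' d - zr d * yr' d)"
    by (intro integral_unique) (simp add: algebra_simps)
  then have r: "(lam - mu) * integral {d..pi} (\<lambda>t. yr t * yr' t) = (yr pi * zr' pi - zr pi * yr' pi) - (yr d * zr' d - zr d * yr' d)"
    by simp
  have "yr d * zr' d - zr d * yr' d = yl d * zl' d - zl d * yl' d"
    using p \<beta> unfolding jump_pair_def by (intro wronskian_jump) blast+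
  with l r show ?thesis by (simp add: distrib_left)
qed

text \<open>Bundles what differentiation of integrals of solutions under the integral sign asks for:
  holomorphy in \<lambda> at each x, and bounds uniform in x for \<lambda> in a disc.\<close>

definition sl_family ::
  "(real \<Rightarrow> complex) \<Rightarrow> real \<Rightarrow> real \<Rightarrow> complex \<Rightarrow> (complex \<Rightarrow> real \<Rightarrow> complex) \<Rightarrow> (complex \<Rightarrow> real \<Rightarrow> complex) \<Rightarrow>
   (complex \<Rightarrow> real \<Rightarrow> complex) \<Rightarrow> (complex \<Rightarrow> real \<Rightarrow> complex) \<Rightarrow> bool" where
  "sl_family q d \<beta> \<gamma> yl zl yr zr \<longleftrightarrow>
     (\<forall>lam. jump_pair q d \<beta> \<gamma> lam (yl lam) (zl lam) (yr lam) (zr lam)) \<and>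
     (\<forall>x\<in>{0..d}. (\<lambda>lam. yl lam x) holomorphic_on UNIV \<and> (\<lambda>lam. zl lam x) holomorphic_on UNIV) \<and>
     (\<forall>x\<in>{d..pi}. (\<lambda>lam. yr lam x) holomorphic_on UNIV \<and> (\<lambda>lam. zr lam x) holomorphic_on UNIV) \<and>
     (\<forall>R. \<exists>K. \<forall>lam. norm lam \<le> R \<longrightarrow> (\<forall>x\<in>{0..d}. norm (yl lam x) \<le> K) \<and> (\<forall>x\<in>{d..pi}. norm (yr lam x) \<le> K))"

lemma entire_bounded:
  fixes f :: "complex \<Rightarrow> complex"
  assumes "f holomorphic_on UNIV"
  obtains K where "0 \<le> K" "\<And>z. norm z \<le> R \<Longrightarrow> norm (f z) \<le> K"
proof -
  have "compact (f ` cball 0 R)"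
    using assms by (intro compact_continuous_image holomorphic_on_imp_continuous_on) (auto intro: holomorphic_on_subset)
  then obtain K where K: "0 < K" "\<And>w. w \<in> f ` cball 0 R \<Longrightarrow> norm w \<le> K"
    using compact_imp_bounded bounded_pos by metis
  show ?thesis by (rule that[of K]) (use K in auto)
qed

lemma norm_lincomb_le:
  fixes c c' y y' :: complex
  assumes "norm c \<le> A" "norm c' \<le> A'" "norm y \<le> K" "norm y' \<le> K'"
  shows "norm (c * y + c' * y') \<le> A * K + A' * K'"
proof -
  have "norm (c * y) \<le> A * K" "norm (c' * y') \<le> A' * K'"
    unfolding norm_mult using assms by (auto intro!: mult_mono order_trans[OF norm_ge_zero])
  then show ?thesis using norm_triangle_ineq[of "c * y" "c' * y'"] by linarith
qed

lemma sl_family_lincomb: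
  assumes f: "sl_family q d \<beta> \<gamma> yl zl yr zr" and f': "sl_family q d \<beta> \<gamma> yl' zl' yr' zr'"
    and q: "q absolutely_integrable_on {0..pi}" and d: "0 < d" "d < pi"
    and c: "c holomorphic_on UNIV" "c' holomorphic_on UNIV"
  shows "sl_family q d \<beta> \<gamma> (\<lambda>lam x. c lam * yl lam x + c' lam * yl' lam x) (\<lambda>lam x. c lam * zl lam x + c' lam * zl' lam x)
    (\<lambda>lam x. c lam * yr lam x + c' lam * yr' lam x) (\<lambda>lam x. c lam * zr lam x + c' lam * zr' lam x)"
  unfolding sl_family_def
proof (intro conjI allI)
  fix lam
  show "jump_pair q d \<beta> \<gamma> lam (\<lambda>x. c lam * yl lam x + c' lam * yl' lam x) (\<lambda>x. c lam * zl lam x + c' lam * zl' lam x)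
    (\<lambda>x. c lam * yr lam x + c' lam * yr' lam x) (\<lambda>x. c lam * zr lam x + c' lam * zr' lam x)"
    using f f' unfolding sl_family_def by (intro jump_pair_lincomb q d) blast+
next
  fix R
  obtain A A' where A: "\<And>z. norm z \<le> R \<Longrightarrow> norm (c z) \<le> A" "\<And>z. norm z \<le> R \<Longrightarrow> norm (c' z) \<le> A'"
    using entire_bounded[OF c(1), of R] entire_bounded[OF c(2), of R] by metis
  obtain K where K: "\<forall>lam. norm lam \<le> R \<longrightarrow> (\<forall>x\<in>{0..d}. norm (yl lam x) \<le> K) \<and> (\<forall>x\<in>{d..pi}. norm (yr lam x) \<le> K)"
    using f unfolding sl_family_def by blast
  obtain K' where K': "\<forall>lam. norm lam \<le> R \<longrightarrow> (\<forall>x\<in>{0..d}. norm (yl' lam x) \<le> K') \<and> (\<forall>x\<in>{d..pi}. norm (yr' lam x) \<le> K')"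
    using f' unfolding sl_family_def by blast
  show "\<exists>K. \<forall>lam. norm lam \<le> R \<longrightarrow> (\<forall>x\<in>{0..d}. norm (c lam * yl lam x + c' lam * yl' lam x) \<le> K) \<and> (\<forall>x\<in>{d..pi}. norm (c lam * yr lam x + c' lam * yr' lam x) \<le> K)"
    using A K K' by (intro exI[of _ "A * K + A' * K'"] allI impI conjI ballI norm_lincomb_le) blast+
qed (use f f' c in \<open>auto simp: sl_family_def intro!: holomorphic_intros\<close>)

text \<open>To the right of \<open>d\<close> the solution is a combination of a fundamental system
  normalized at \<open>d\<close>. The coefficients \<open>A\<close> and \<open>B\<close> are the
  transformed left values at \<open>d\<close>, hence entire in \<lambda>, so holomorphy and local
  bounds carry over.\<close>

lemma sl_family_exists_0:
  assumes q: "q absolutely_integrable_on {0..pi}" and d: "0 < d" "d < pi"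
  obtains yl zl yr zr where "sl_family q d \<beta> \<gamma> yl zl yr zr" "\<And>lam. yl lam 0 = c0" "\<And>lam. zl lam 0 = c1"
proof -
  have q': "q absolutely_integrable_on {0..d}" "q absolutely_integrable_on {d..pi}"
    using q d by (auto intro: absolutely_integrable_on_subinterval)
  obtain Y Z where Y: "\<And>lam. sl_piece q lam 0 d (Y lam) (Z lam)" "\<And>lam. Y lam 0 = c0" "\<And>lam. Z lam 0 = c1"
    "\<And>x. x \<in> {0..d} \<Longrightarrow> (\<lambda>lam. Y lam x) holomorphic_on UNIV" "\<And>x. x \<in> {0..d} \<Longrightarrow> (\<lambda>lam. Z lam x) holomorphic_on UNIV"
    "\<And>R. \<exists>K. \<forall>lam. norm lam \<le> R \<longrightarrow> (\<forall>x\<in>{0..d}. norm (Y lam x) \<le> K)"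
    using sl_piece_family_exists[OF q'(1), of c0 c1] d by (metis less_imp_le)
  obtain C C' where C: "\<And>lam. sl_piece q lam d pi (C lam) (C' lam)" "\<And>lam. C lam d = 1" "\<And>lam. C' lam d = 0"
    "\<And>x. x \<in> {d..pi} \<Longrightarrow> (\<lambda>lam. C lam x) holomorphic_on UNIV" "\<And>x. x \<in> {d..pi} \<Longrightarrow> (\<lambda>lam. C' lam x) holomorphic_on UNIV"
    "\<And>R. \<exists>K. \<forall>lam. norm lam \<le> R \<longrightarrow> (\<forall>x\<in>{d..pi}. norm (C lam x) \<le> K)"
    using sl_piece_family_exists[OF q'(2), of 1 0] d by (metis less_imp_le)
  obtain S S' where S: "\<And>lam. sl_piece q lam d pi (S lam) (S' lam)" "\<And>lam. S lam d = 0" "\<And>lam. S' lam d = 1"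
    "\<And>x. x \<in> {d..pi} \<Longrightarrow> (\<lambda>lam. S lam x) holomorphic_on UNIV" "\<And>x. x \<in> {d..pi} \<Longrightarrow> (\<lambda>lam. S' lam x) holomorphic_on UNIV"
    "\<And>R. \<exists>K. \<forall>lam. norm lam \<le> R \<longrightarrow> (\<forall>x\<in>{d..pi}. norm (S lam x) \<le> K)"
    using sl_piece_family_exists[OF q'(2), of 0 1] d by (metis less_imp_le)
  define A where "A lam = of_real \<beta> * Y lam d" for lam
  define B where "B lam = of_real (inverse \<beta>) * Z lam d + \<gamma> * Y lam d" for lam
  have AB: "A holomorphic_on UNIV" "B holomorphic_on UNIV"
    unfolding A_def B_def using Y(4,5)[of d] d by (auto intro!: holomorphic_intros)
  define yr where "yr lam x = A lam * C lam x + B lam * S lam x" for lam x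
  define zr where "zr lam x = A lam * C' lam x + B lam * S' lam x" for lam x
  have jp: "jump_pair q d \<beta> \<gamma> lam (Y lam) (Z lam) (yr lam) (zr lam)" for lam
    unfolding jump_pair_def
  proof (intro conjI Y(1))
    show "sl_piece q lam d pi (yr lam) (zr lam)"
      unfolding yr_def zr_def by (intro sl_piece_lincomb C S q')
  qed (simp_all add: yr_def zr_def C S A_def B_def)
  have "sl_family q d \<beta> \<gamma> Y Z yr zr"
    unfolding sl_family_def
  proof (intro conjI allI jp)
    fix R
    obtain K0 where K0: "\<forall>lam. norm lam \<le> R \<longrightarrow> (\<forall>x\<in>{0..d}. norm (Y lam x) \<le> K0)" using Y(6) by blast
    obtain K1 where K1: "\<forall>lam. norm lam \<le> R \<longrightarrow> (\<forall>x\<in>{d..pi}. norm (C lam x) \<le> K1)" using C(6) by blast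
    obtain K2 where K2: "\<forall>lam. norm lam \<le> R \<longrightarrow> (\<forall>x\<in>{d..pi}. norm (S lam x) \<le> K2)" using S(6) by blast
    obtain a b where ab: "\<And>z. norm z \<le> R \<Longrightarrow> norm (A z) \<le> a" "\<And>z. norm z \<le> R \<Longrightarrow> norm (B z) \<le> b"
      using entire_bounded[OF AB(1), of R] entire_bounded[OF AB(2), of R] by metis
    have "norm (yr lam x) \<le> a * K1 + b * K2" if "norm lam \<le> R" "x \<in> {d..pi}" for lam x
      unfolding yr_def using ab K1 K2 that by (intro norm_lincomb_le) blast+
    then show "\<exists>K. \<forall>lam. norm lam \<le> R \<longrightarrow> (\<forall>x\<in>{0..d}. norm (Y lam x) \<le> K) \<and> (\<forall>x\<in>{d..pi}. norm (yr lam x) \<le> K)"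
      using K0 by (intro exI[of _ "max K0 (a * K1 + b * K2)"]) (auto simp: le_max_iff_disj)
  qed (use Y C S AB in \<open>auto simp: yr_def zr_def intro!: holomorphic_intros\<close>)
  then show ?thesis using Y(2,3) by (rule that)
qed

text \<open>Instead of a second iteration starting at \<pi>, Cramer's rule selects the right
  combination of two solutions normalized at 0. Their determinant at \<pi> is the Wronskian, equal
  to 1 for every \<lambda>, so the coefficients \<open>p\<close> and \<open>r\<close> stay
  entire.\<close>

lemma sl_family_exists_pi:
  assumes q: "q absolutely_integrable_on {0..pi}" and d: "0 < d" "d < pi" and \<beta>: "\<beta> \<noteq> 0"
  obtains yl zl yr zr where "sl_family q d \<beta> \<gamma> yl zl yr zr" "\<And>lam. yr lam pi = c0" "\<And>lam. zr lam pi = c1"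
proof -
  obtain cl cl' cr cr' where C: "sl_family q d \<beta> \<gamma> cl cl' cr cr'" "\<And>lam. cl lam 0 = 1" "\<And>lam. cl' lam 0 = 0"
    using sl_family_exists_0[OF q d] by metis
  obtain sl sl' sr sr' where S: "sl_family q d \<beta> \<gamma> sl sl' sr sr'" "\<And>lam. sl lam 0 = 0" "\<And>lam. sl' lam 0 = 1"
    using sl_family_exists_0[OF q d] by metis
  have W: "cr lam pi * sr' lam pi - cr' lam pi * sr lam pi = 1" for lam
  proof -
    have "jump_pair q d \<beta> \<gamma> lam (cl lam) (cl' lam) (cr lam) (cr' lam)" "jump_pair q d \<beta> \<gamma> lam (sl lam) (sl' lam) (sr lam) (sr' lam)"
      using C(1) S(1) unfolding sl_family_def by blast+
    from wronskian_jump_pair(2)[OF this q d \<beta>, of pi] show ?thesis using C(2,3) S(2,3) d by simp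
  qed
  define p where "p lam = c0 * sr' lam pi - c1 * sr lam pi" for lam
  define r where "r lam = c1 * cr lam pi - c0 * cr' lam pi" for lam
  have hol: "p holomorphic_on UNIV" "r holomorphic_on UNIV"
  proof -
    have "pi \<in> {d..pi}" using d by simp
    then have "(\<lambda>lam. cr lam pi) holomorphic_on UNIV" "(\<lambda>lam. cr' lam pi) holomorphic_on UNIV"
      "(\<lambda>lam. sr lam pi) holomorphic_on UNIV" "(\<lambda>lam. sr' lam pi) holomorphic_on UNIV"
      using C(1) S(1) unfolding sl_family_def by blast+
    then show "p holomorphic_on UNIV" "r holomorphic_on UNIV" unfolding p_def r_def by (auto intro!: holomorphic_intros)
  qed
  show ?thesis
  proof (rule that[OF sl_family_lincomb[OF C(1) S(1) q d hol]])
    fix lam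
    have "p lam * cr lam pi + r lam * sr lam pi = c0 * (cr lam pi * sr' lam pi - cr' lam pi * sr lam pi)"
      unfolding p_def r_def by (simp add: algebra_simps)
    then show "p lam * cr lam pi + r lam * sr lam pi = c0" using W by simp
    have "p lam * cr' lam pi + r lam * sr' lam pi = c1 * (cr lam pi * sr' lam pi - cr' lam pi * sr lam pi)"
      unfolding p_def r_def by (simp add: algebra_simps)
    then show "p lam * cr' lam pi + r lam * sr' lam pi = c1" using W by simp
  qed
qed

text \<open>A vector of the plane whose determinants with two vectors of determinant 1 both vanish
  is zero; the identities below express y and z through these determinants.\<close>

lemma wronskian_zero_imp_zero:
  fixes y z u u' s s' :: complex
  assumes "u * s' - u' * s = 1" "y * u' - z * u = 0" "y * s' - z * s = 0"
  shows "y = 0" "z = 0"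
proof -
  have "y = s * (- (y * u' - z * u)) + u * (y * s' - z * s) + y * (1 - (u * s' - u' * s))" by (simp add: algebra_simps)
  then show "y = 0" using assms by simp
  have "z = u' * (y * s' - z * s) - s' * (y * u' - z * u) + z * (1 - (u * s' - u' * s))" by (simp add: algebra_simps)
  then show "z = 0" using assms by simp
qed

text \<open>Uniqueness without a Gronwall argument: the Wronskians with a fundamental system are
  constant across the jump, and zero data at either end make them vanish everywhere.\<close>

lemma jump_pair_zero:
  assumes p: "jump_pair q d \<beta> \<gamma> lam yl zl yr zr"
    and q: "q absolutely_integrable_on {0..pi}" and d: "0 < d" "d < pi" and \<beta>: "\<beta> \<noteq> 0"
    and zero: "yl 0 = 0 \<and> zl 0 = 0 \<or> yr pi = 0 \<and> zr pi = 0"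
  shows "x \<in> {0..d} \<Longrightarrow> yl x = 0 \<and> zl x = 0" "x \<in> {d..pi} \<Longrightarrow> yr x = 0 \<and> zr x = 0"
proof -
  obtain cl cl' cr cr' where C: "sl_family q d \<beta> \<gamma> cl cl' cr cr'" "\<And>lam. cl lam 0 = 1" "\<And>lam. cl' lam 0 = 0"
    using sl_family_exists_0[OF q d] by metis
  obtain sl sl' sr sr' where S: "sl_family q d \<beta> \<gamma> sl sl' sr sr'" "\<And>lam. sl lam 0 = 0" "\<And>lam. sl' lam 0 = 1"
    using sl_family_exists_0[OF q d] by metis
  have Cp: "jump_pair q d \<beta> \<gamma> lam (cl lam) (cl' lam) (cr lam) (cr' lam)" and Sp: "jump_pair q d \<beta> \<gamma> lam (sl lam) (sl' lam) (sr lam) (sr' lam)"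
    using C(1) S(1) unfolding sl_family_def by blast+
  note W = wronskian_jump_pair[OF Cp Sp q d \<beta>] and WC = wronskian_jump_pair[OF p Cp q d \<beta>] and WS = wronskian_jump_pair[OF p Sp q d \<beta>]
  have pi: "pi \<in> {d..pi}" using d by simp
  have 0: "yl 0 * cl' lam 0 - zl 0 * cl lam 0 = 0" "yl 0 * sl' lam 0 - zl 0 * sl lam 0 = 0"
    using zero WC(2)[OF pi] WS(2)[OF pi] by auto
  have 1: "cl lam 0 * sl' lam 0 - cl' lam 0 * sl lam 0 = 1" using C S by simp
  show "x \<in> {0..d} \<Longrightarrow> yl x = 0 \<and> zl x = 0"
    using wronskian_zero_imp_zero[of "cl lam x" "sl' lam x" "cl' lam x" "sl lam x" "yl x" "zl x"] W(1) WC(1) WS(1) 0 1 by metis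
  show "x \<in> {d..pi} \<Longrightarrow> yr x = 0 \<and> zr x = 0"
    using wronskian_zero_imp_zero[of "cr lam x" "sr' lam x" "cr' lam x" "sr lam x" "yr x" "zr x"] W(2) WC(2) WS(2) 0 1 by metis
qed

lemma jump_pair_unique:
  assumes p: "jump_pair q d \<beta> \<gamma> lam yl zl yr zr" and p': "jump_pair q d \<beta> \<gamma> lam yl' zl' yr' zr'"
    and q: "q absolutely_integrable_on {0..pi}" and d: "0 < d" "d < pi" and \<beta>: "\<beta> \<noteq> 0"
    and eq: "yl 0 = yl' 0 \<and> zl 0 = zl' 0 \<or> yr pi = yr' pi \<and> zr pi = zr' pi"
  shows "x \<in> {0..d} \<Longrightarrow> yl x = yl' x \<and> zl x = zl' x" "x \<in> {d..pi} \<Longrightarrow> yr x = yr' x \<and> zr x = zr' x"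
  using jump_pair_zero[OF jump_pair_lincomb[OF p p' q d, of 1 "-1"] q d \<beta>, of x] eq by auto

text \<open>Ties an arbitrary function satisfying the definition to the constructed family. The
  point \<open>d\<close> is excluded because a jump solution may take any value there.\<close>

lemma jump_solution_eq_family:
  assumes q: "q absolutely_integrable_on {0..pi}" and d: "0 < d" "d < pi" and \<beta>: "\<beta> \<noteq> 0"
    and f: "sl_family q d \<beta> \<gamma> yl zl yr zr" and y: "jump_solution q d \<beta> \<gamma> lam y"
    and eq: "y 0 = yl lam 0 \<and> dx y 0 = zl lam 0 \<or> y pi = yr lam pi \<and> dx y pi = zr lam pi"
  shows "x \<in> {0..<d} \<Longrightarrow> y x = yl lam x \<and> dx y x = zl lam x"
    "x \<in> {d<..pi} \<Longrightarrow> y x = yr lam x \<and> dx y x = zr lam x"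
proof -
  obtain vl wl vr wr where v: "jump_pair q d \<beta> \<gamma> lam vl wl vr wr"
    "\<And>x. x \<in> {0..<d} \<Longrightarrow> y x = vl x" "\<And>x. x \<in> {0..<d} \<Longrightarrow> dx y x = wl x"
    "\<And>x. x \<in> {d<..pi} \<Longrightarrow> y x = vr x" "\<And>x. x \<in> {d<..pi} \<Longrightarrow> dx y x = wr x"
    by (rule jump_solution_imp_jump_pair[OF q d y]) (rule that)
  have p: "jump_pair q d \<beta> \<gamma> lam (yl lam) (zl lam) (yr lam) (zr lam)" using f unfolding sl_family_def by blast
  have "vl 0 = yl lam 0 \<and> wl 0 = zl lam 0 \<or> vr pi = yr lam pi \<and> wr pi = zr lam pi"
    using eq v(2,3)[of 0] v(4,5)[of pi] d by simp
  note u = jump_pair_unique[OF v(1) p q d \<beta> this]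
  show "x \<in> {0..<d} \<Longrightarrow> y x = yl lam x \<and> dx y x = zl lam x" using v(2,3) u(1)[of x] by simp
  show "x \<in> {d<..pi} \<Longrightarrow> y x = yr lam x \<and> dx y x = zr lam x" using v(4,5) u(2)[of x] by simp
qed

lemma family_jump_solution:
  assumes q: "q absolutely_integrable_on {0..pi}" and d: "0 < d" "d < pi"
    and f: "sl_family q d \<beta> \<gamma> yl zl yr zr"
  obtains y where "jump_solution q d \<beta> \<gamma> lam y" "y 0 = yl lam 0" "dx y 0 = zl lam 0" "y pi = yr lam pi" "dx y pi = zr lam pi"
proof -
  define y where "y x = (if x < d then yl lam x else yr lam x)" for x
  have p: "jump_pair q d \<beta> \<gamma> lam (yl lam) (zl lam) (yr lam) (zr lam)" using f unfolding sl_family_def by blast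
  have yl: "\<And>x. x \<in> {0..<d} \<Longrightarrow> y x = yl lam x" and yr: "\<And>x. x \<in> {d<..pi} \<Longrightarrow> y x = yr lam x"
    by (auto simp: y_def)
  show ?thesis
    using that[OF jump_pair_imp_jump_solution[OF q d p yl yr]] jump_pair_dx[OF d p yl yr, of 0] jump_pair_dx[OF d p yl yr, of pi] yl[of 0] yr[of pi] d
    by simp
qed

text \<open>Existence makes the choice in \<open>phi\<close> meaningful, uniqueness identifies its
  outcome. Points to the right of \<open>d\<close> are stated because the characteristic functions
  read \<open>phi\<close> at \<pi>.\<close>

lemma phi_eq_family:
  assumes q: "q absolutely_integrable_on {0..pi}" and d: "0 < d" "d < pi" and \<beta>: "\<beta> \<noteq> 0"
    and f: "sl_family q d \<beta> \<gamma> yl zl yr zr" "\<And>lam. yl lam 0 = 1" "\<And>lam. zl lam 0 = h"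
  shows "x \<in> {d<..pi} \<Longrightarrow> phi q h \<beta> \<gamma> d lam x = yr lam x" "x \<in> {d<..pi} \<Longrightarrow> dx (phi q h \<beta> \<gamma> d lam) x = zr lam x"
proof -
  obtain y where "jump_solution q d \<beta> \<gamma> lam y" "y 0 = yl lam 0" "dx y 0 = zl lam 0"
    using family_jump_solution[OF q d f(1)] by metis
  then have "\<exists>y. jump_solution q d \<beta> \<gamma> lam y \<and> y 0 = 1 \<and> dx y 0 = h" using f(2,3) by auto
  then have s: "jump_solution q d \<beta> \<gamma> lam (phi q h \<beta> \<gamma> d lam) \<and> phi q h \<beta> \<gamma> d lam 0 = 1 \<and> dx (phi q h \<beta> \<gamma> d lam) 0 = h"
    unfolding phi_def by (rule someI_ex)
  then have "phi q h \<beta> \<gamma> d lam 0 = yl lam 0 \<and> dx (phi q h \<beta> \<gamma> d lam) 0 = zl lam 0" by (simp add: f(2,3))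
  then have "phi q h \<beta> \<gamma> d lam 0 = yl lam 0 \<and> dx (phi q h \<beta> \<gamma> d lam) 0 = zl lam 0 \<or> phi q h \<beta> \<gamma> d lam pi = yr lam pi \<and> dx (phi q h \<beta> \<gamma> d lam) pi = zr lam pi" by blast
  note u = jump_solution_eq_family[OF q d \<beta> f(1) conjunct1[OF s] this]
  show "x \<in> {d<..pi} \<Longrightarrow> phi q h \<beta> \<gamma> d lam x = yr lam x" "x \<in> {d<..pi} \<Longrightarrow> dx (phi q h \<beta> \<gamma> d lam) x = zr lam x"
    using u(2)[of x] by blast+
qed

lemma psi_eq_family:
  assumes q: "q absolutely_integrable_on {0..pi}" and d: "0 < d" "d < pi" and \<beta>: "\<beta> \<noteq> 0"
    and f: "sl_family q d \<beta> \<gamma> yl zl yr zr" "\<And>lam. yr lam pi = 1" "\<And>lam. zr lam pi = - H"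
  shows "x \<in> {0..<d} \<Longrightarrow> psi q H \<beta> \<gamma> d lam x = yl lam x" "x \<in> {d<..pi} \<Longrightarrow> psi q H \<beta> \<gamma> d lam x = yr lam x"
proof -
  obtain y where "jump_solution q d \<beta> \<gamma> lam y" "y pi = yr lam pi" "dx y pi = zr lam pi"
    using family_jump_solution[OF q d f(1)] by metis
  then have "\<exists>y. jump_solution q d \<beta> \<gamma> lam y \<and> y pi = 1 \<and> dx y pi = - H" using f(2,3) by auto
  then have s: "jump_solution q d \<beta> \<gamma> lam (psi q H \<beta> \<gamma> d lam) \<and> psi q H \<beta> \<gamma> d lam pi = 1 \<and> dx (psi q H \<beta> \<gamma> d lam) pi = - H"
    unfolding psi_def by (rule someI_ex)
  then have "psi q H \<beta> \<gamma> d lam pi = yr lam pi \<and> dx (psi q H \<beta> \<gamma> d lam) pi = zr lam pi" by (simp add: f(2,3))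
  then have "psi q H \<beta> \<gamma> d lam 0 = yl lam 0 \<and> dx (psi q H \<beta> \<gamma> d lam) 0 = zl lam 0 \<or> psi q H \<beta> \<gamma> d lam pi = yr lam pi \<and> dx (psi q H \<beta> \<gamma> d lam) pi = zr lam pi" by blast
  note u = jump_solution_eq_family[OF q d \<beta> f(1) conjunct1[OF s] this]
  show "x \<in> {0..<d} \<Longrightarrow> psi q H \<beta> \<gamma> d lam x = yl lam x" "x \<in> {d<..pi} \<Longrightarrow> psi q H \<beta> \<gamma> d lam x = yr lam x"
    using u(1)[of x] u(2)[of x] by blast+
qed

lemma psi_inf_eq_family:
  assumes q: "q absolutely_integrable_on {0..pi}" and d: "0 < d" "d < pi" and \<beta>: "\<beta> \<noteq> 0"
    and f: "sl_family q d \<beta> \<gamma> yl zl yr zr" "\<And>lam. yr lam pi = 0" "\<And>lam. zr lam pi = 1"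
  shows "x \<in> {0..<d} \<Longrightarrow> psi_inf q \<beta> \<gamma> d lam x = yl lam x" "x \<in> {d<..pi} \<Longrightarrow> psi_inf q \<beta> \<gamma> d lam x = yr lam x"
proof -
  obtain y where "jump_solution q d \<beta> \<gamma> lam y" "y pi = yr lam pi" "dx y pi = zr lam pi"
    using family_jump_solution[OF q d f(1)] by metis
  then have "\<exists>y. jump_solution q d \<beta> \<gamma> lam y \<and> y pi = 0 \<and> dx y pi = 1" using f(2,3) by auto
  then have s: "jump_solution q d \<beta> \<gamma> lam (psi_inf q \<beta> \<gamma> d lam) \<and> psi_inf q \<beta> \<gamma> d lam pi = 0 \<and> dx (psi_inf q \<beta> \<gamma> d lam) pi = 1"
    unfolding psi_inf_def by (rule someI_ex)
  then have "psi_inf q \<beta> \<gamma> d lam pi = yr lam pi \<and> dx (psi_inf q \<beta> \<gamma> d lam) pi = zr lam pi" by (simp add: f(2,3))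
  then have "psi_inf q \<beta> \<gamma> d lam 0 = yl lam 0 \<and> dx (psi_inf q \<beta> \<gamma> d lam) 0 = zl lam 0 \<or> psi_inf q \<beta> \<gamma> d lam pi = yr lam pi \<and> dx (psi_inf q \<beta> \<gamma> d lam) pi = zr lam pi" by blast
  note u = jump_solution_eq_family[OF q d \<beta> f(1) conjunct1[OF s] this]
  show "x \<in> {0..<d} \<Longrightarrow> psi_inf q \<beta> \<gamma> d lam x = yl lam x" "x \<in> {d<..pi} \<Longrightarrow> psi_inf q \<beta> \<gamma> d lam x = yr lam x"
    using u(1)[of x] u(2)[of x] by blast+
qed

subsection \<open>Exponential estimates of solutions\<close>

lemma norm_exp_i_le:
  fixes \<rho> :: complex and s :: real
  shows "norm (exp (\<i> * \<rho> * of_real s)) \<le> exp (\<bar>Im \<rho>\<bar> * \<bar>s\<bar>)"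
proof -
  have "- (Im \<rho> * s) \<le> \<bar>Im \<rho>\<bar> * \<bar>s\<bar>" by (metis abs_ge_minus_self abs_mult)
  then show ?thesis by (simp add: norm_exp_eq_Re)
qed

lemma norm_cos_sin_le:
  fixes \<rho> :: complex and s :: real
  shows "norm (cos (\<rho> * of_real s)) \<le> exp (\<bar>Im \<rho>\<bar> * \<bar>s\<bar>)" "norm (sin (\<rho> * of_real s)) \<le> exp (\<bar>Im \<rho>\<bar> * \<bar>s\<bar>)"
proof -
  have 1: "norm (exp (\<i> * (\<rho> * of_real s))) \<le> exp (\<bar>Im \<rho>\<bar> * \<bar>s\<bar>)"
    using norm_exp_i_le[of \<rho> s] by (simp add: mult.assoc)
  have 2: "norm (exp (- (\<i> * (\<rho> * of_real s)))) \<le> exp (\<bar>Im \<rho>\<bar> * \<bar>s\<bar>)"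
    using norm_exp_i_le[of "-\<rho>" s] by (simp add: mult.assoc)
  let ?A = "exp (\<i> * (\<rho> * of_real s))" and ?B = "exp (- (\<i> * (\<rho> * of_real s)))"
  have "norm (?A + ?B) \<le> 2 * exp (\<bar>Im \<rho>\<bar> * \<bar>s\<bar>)" "norm (?A - ?B) \<le> 2 * exp (\<bar>Im \<rho>\<bar> * \<bar>s\<bar>)"
    using norm_triangle_ineq[of ?A ?B] norm_triangle_ineq4[of ?A ?B] 1 2 by linarith+
  then show "norm (cos (\<rho> * of_real s)) \<le> exp (\<bar>Im \<rho>\<bar> * \<bar>s\<bar>)" "norm (sin (\<rho> * of_real s)) \<le> exp (\<bar>Im \<rho>\<bar> * \<bar>s\<bar>)"
    unfolding cos_exp_eq sin_exp_eq by (simp_all add: norm_divide norm_mult)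
qed

text \<open>The component \<open>(y' / \<rho> + \<i> y) exp (- \<i> \<rho> x)\<close> is constant for \<open>q = 0\<close>, so its increments only see \<open>q y / \<rho>\<close>.\<close>

lemma exponential_component_increment:
  assumes p: "sl_piece q (\<rho>\<^sup>2) a b y z" and q: "q absolutely_integrable_on {a..b}" and \<rho>: "\<rho> \<noteq> 0"
    and uv: "a \<le> u" "u \<le> v" "v \<le> b"
  shows "((\<lambda>t. q t * y t / \<rho> * exp (- (\<i> * \<rho> * of_real t))) has_integral
    (z v / \<rho> + \<i> * y v) * exp (- (\<i> * \<rho> * of_real v)) - (z u / \<rho> + \<i> * y u) * exp (- (\<i> * \<rho> * of_real u))) {u..v}"
proof -
  note ac = sl_piece_ac_deriv[OF p q]
  have e: "ac_deriv a b (\<lambda>t. exp (- (\<i> * \<rho> * of_real t))) (\<lambda>t. - (\<i> * \<rho>) * exp (- (\<i> * \<rho> * of_real t)))"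
  proof (rule ac_deriv_C1)
    fix x assume "x \<in> {a..b}"
    have "((\<lambda>w. exp (- (\<i> * \<rho> * w))) has_field_derivative - (\<i> * \<rho>) * exp (- (\<i> * \<rho> * of_real x))) (at (of_real x))"
      by (auto intro!: derivative_eq_intros)
    then show "((\<lambda>t. exp (- (\<i> * \<rho> * of_real t))) has_vector_derivative - (\<i> * \<rho>) * exp (- (\<i> * \<rho> * of_real x))) (at x within {a..b})"
      by (rule has_vector_derivative_real_field)
  qed (intro continuous_intros)
  have "ac_deriv a b (\<lambda>t. (z t / \<rho> + \<i> * y t) * exp (- (\<i> * \<rho> * of_real t))) (\<lambda>t. q t * y t / \<rho> * exp (- (\<i> * \<rho> * of_real t)))"
  proof (rule ac_deriv_cong[OF ac_deriv_mult[OF ac_deriv_add[OF ac_deriv_cmult[OF ac(2), of "1 / \<rho>"] ac_deriv_cmult[OF ac(1), of "\<i>"]] e]])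
    show "(z t / \<rho> + \<i> * y t) * exp (- (\<i> * \<rho> * of_real t)) = (1 / \<rho> * z t + \<i> * y t) * exp (- (\<i> * \<rho> * of_real t))" for t
      by simp
    show "q t * y t / \<rho> * exp (- (\<i> * \<rho> * of_real t)) = (1 / \<rho> * z t + \<i> * y t) * (- (\<i> * \<rho>) * exp (- (\<i> * \<rho> * of_real t))) +
        (1 / \<rho> * ((q t - \<rho>\<^sup>2) * y t) + \<i> * z t) * exp (- (\<i> * \<rho> * of_real t))" for t
    proof -
      have "q t * y t / \<rho> = (1 / \<rho> * z t + \<i> * y t) * (- (\<i> * \<rho>)) + (1 / \<rho> * ((q t - \<rho>\<^sup>2) * y t) + \<i> * z t)"
        using \<rho> by (simp add: field_simps power2_eq_square)
      then show ?thesis by (simp only: distrib_right mult.assoc)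
    qed
  qed
  then have "ac_deriv u v (\<lambda>t. (z t / \<rho> + \<i> * y t) * exp (- (\<i> * \<rho> * of_real t))) (\<lambda>t. q t * y t / \<rho> * exp (- (\<i> * \<rho> * of_real t)))"
    by (rule ac_deriv_subinterval) (use uv in auto)
  from ac_deriv_has_integral[OF this uv(2)] show ?thesis .
qed

text \<open>Undoing the factor exp(-i \<rho> t) gives the kernel exp(i \<rho> (x - t)). For t
  between c and x the distances |x - t| and |t - c| add up to |x - c|, so the kernel and the assumed
  growth of y combine to exactly the growth claimed. The base point \<open>c\<close> may lie on
  either side of x, which serves both directions of integration.\<close>

lemma exponential_component_estimate:
  assumes p: "sl_piece q (\<rho>\<^sup>2) a b y z" and q: "q absolutely_integrable_on {a..b}" and \<rho>: "\<rho> \<noteq> 0"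
    and S: "\<And>t. t \<in> {a..b} \<Longrightarrow> norm (y t) \<le> S * exp (\<bar>Im \<rho>\<bar> * \<bar>t - c\<bar>)" and c: "c \<in> {a..b}" and x: "x \<in> {a..b}"
  shows "norm ((z x / \<rho> + \<i> * y x) - exp (\<i> * \<rho> * of_real (x - c)) * (z c / \<rho> + \<i> * y c))
     \<le> integral {a..b} (\<lambda>t. norm (q t)) * S / norm \<rho> * exp (\<bar>Im \<rho>\<bar> * \<bar>x - c\<bar>)"
proof -
  define f where "f t = q t * y t / \<rho> * exp (- (\<i> * \<rho> * of_real t))" for t
  define G where "G t = (z t / \<rho> + \<i> * y t) * exp (- (\<i> * \<rho> * of_real t))" for t
  define u v where "u = min x c" "v = max x c"
  have uv: "a \<le> u" "u \<le> v" "v \<le> b" using x c by (auto simp: u_v_def)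
  have hi: "(f has_integral G v - G u) {u..v}"
    unfolding f_def G_def by (rule exponential_component_increment[OF p q \<rho> uv])
  have "norm (y c) \<le> S" using S[OF c] by simp
  then have S0: "0 \<le> S" using norm_ge_zero order_trans by blast
  have nq: "(\<lambda>t. norm (q t)) integrable_on {a..b}" using q by (simp add: absolutely_integrable_on_def)
  have nq': "(\<lambda>t. norm (q t)) integrable_on {u..v}" by (rule integrable_on_subinterval[OF nq]) (use uv in auto)
  have e: "exp (\<i> * \<rho> * of_real x) * exp (- (\<i> * \<rho> * of_real t)) = exp (\<i> * \<rho> * of_real (x - t))" for t
    by (simp add: exp_add[symmetric] algebra_simps)
  have "(z x / \<rho> + \<i> * y x) = exp (\<i> * \<rho> * of_real x) * G x"
    unfolding G_def using e[of x] by simp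
  moreover have "exp (\<i> * \<rho> * of_real (x - c)) * (z c / \<rho> + \<i> * y c) = exp (\<i> * \<rho> * of_real x) * G c"
    unfolding G_def e[symmetric] by simp
  ultimately have "(z x / \<rho> + \<i> * y x) - exp (\<i> * \<rho> * of_real (x - c)) * (z c / \<rho> + \<i> * y c) = exp (\<i> * \<rho> * of_real x) * (G x - G c)"
    by (simp add: algebra_simps)
  then have "norm ((z x / \<rho> + \<i> * y x) - exp (\<i> * \<rho> * of_real (x - c)) * (z c / \<rho> + \<i> * y c)) = norm (exp (\<i> * \<rho> * of_real x) * (G v - G u))"
    unfolding u_v_def by (cases "x \<le> c") (auto simp: norm_mult norm_minus_commute)
  also have "exp (\<i> * \<rho> * of_real x) * (G v - G u) = integral {u..v} (\<lambda>t. exp (\<i> * \<rho> * of_real x) * f t)"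
    by (rule integral_unique[OF has_integral_mult_right[OF hi], symmetric])
  also have "norm \<dots> \<le> integral {u..v} (\<lambda>t. norm (q t) * (S / norm \<rho> * exp (\<bar>Im \<rho>\<bar> * \<bar>x - c\<bar>)))"
  proof (rule Henstock_Kurzweil_Integration.integral_norm_bound_integral)
    show "(\<lambda>t. exp (\<i> * \<rho> * of_real x) * f t) integrable_on {u..v}" using hi by (blast intro: integrable_on_mult_right)
    show "(\<lambda>t. norm (q t) * (S / norm \<rho> * exp (\<bar>Im \<rho>\<bar> * \<bar>x - c\<bar>))) integrable_on {u..v}" using nq' by (rule integrable_on_mult_left)
    fix t assume t: "t \<in> {u..v}"
    have "\<bar>x - t\<bar> + \<bar>t - c\<bar> = \<bar>x - c\<bar>" using t by (auto simp: u_v_def min_def max_def split: if_splits)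
    then have ee: "exp (\<bar>Im \<rho>\<bar> * \<bar>x - t\<bar>) * exp (\<bar>Im \<rho>\<bar> * \<bar>t - c\<bar>) = exp (\<bar>Im \<rho>\<bar> * \<bar>x - c\<bar>)"
      by (simp add: exp_add[symmetric] distrib_left[symmetric])
    have "exp (\<i> * \<rho> * of_real x) * f t = q t * y t / \<rho> * exp (\<i> * \<rho> * of_real (x - t))"
      unfolding f_def e[symmetric] by simp
    then have "norm (exp (\<i> * \<rho> * of_real x) * f t) = norm (q t) * norm (y t) / norm \<rho> * norm (exp (\<i> * \<rho> * of_real (x - t)))"
      by (simp add: norm_mult norm_divide)
    also have "\<dots> \<le> norm (q t) * (S * exp (\<bar>Im \<rho>\<bar> * \<bar>t - c\<bar>)) / norm \<rho> * exp (\<bar>Im \<rho>\<bar> * \<bar>x - t\<bar>)"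
      using S[of t] t uv S0 by (intro mult_mono divide_right_mono mult_left_mono norm_exp_i_le) auto
    also have "\<dots> = norm (q t) * (S / norm \<rho> * exp (\<bar>Im \<rho>\<bar> * \<bar>x - c\<bar>))"
      unfolding ee[symmetric] by simp
    finally show "norm (exp (\<i> * \<rho> * of_real x) * f t) \<le> norm (q t) * (S / norm \<rho> * exp (\<bar>Im \<rho>\<bar> * \<bar>x - c\<bar>))" .
  qed
  also have "\<dots> = integral {u..v} (\<lambda>t. norm (q t)) * (S / norm \<rho> * exp (\<bar>Im \<rho>\<bar> * \<bar>x - c\<bar>))" by simp
  also have "\<dots> \<le> integral {a..b} (\<lambda>t. norm (q t)) * (S / norm \<rho> * exp (\<bar>Im \<rho>\<bar> * \<bar>x - c\<bar>))"
    using uv S0 by (intro mult_right_mono integral_subset_le nq nq') auto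
  finally show ?thesis by simp
qed

text \<open>Here e and e' stand for exp(i \<rho> (x - c)) and exp(-i \<rho> (x - c)), and v, w for
  y'/\<rho> at x and at c. Deviations from the trigonometric solution are thereby expressed through
  those of the two exponential components.\<close>

lemma euler_combination:
  fixes y v c w e e' :: complex
  shows "y - (c * ((e + e') / 2) + w * ((e - e') / (2 * \<i>))) =
      (((v + \<i> * y) - e * (w + \<i> * c)) - ((v - \<i> * y) - e' * (w - \<i> * c))) / (2 * \<i>)"
    "v - (w * ((e + e') / 2) - c * ((e - e') / (2 * \<i>))) =
      (((v + \<i> * y) - e * (w + \<i> * c)) + ((v - \<i> * y) - e' * (w - \<i> * c))) / 2"
  by (simp_all add: field_simps)

text \<open>Absorption in place of iteration: let S be the maximum of |y| divided by the expected
  exponential. The component estimates yield S \<le> E + Q S / |\<rho>| with Q the integral of |q|,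
  and for 2 Q \<le> |\<rho>| this gives S \<le> 2 E. The same estimates then become the remainder
  bounds.\<close>

lemma sl_piece_estimate:
  assumes p: "sl_piece q (\<rho>\<^sup>2) a b y z" and q: "q absolutely_integrable_on {a..b}" and \<rho>: "\<rho> \<noteq> 0"
    and large: "2 * integral {a..b} (\<lambda>t. norm (q t)) \<le> norm \<rho>" and c: "c \<in> {a..b}" and x: "x \<in> {a..b}"
  defines "E \<equiv> norm (y c) + norm (z c / \<rho>)"
  shows "norm (y x) \<le> 2 * E * exp (\<bar>Im \<rho>\<bar> * \<bar>x - c\<bar>)"
    "norm (z x / \<rho>) \<le> 2 * E * exp (\<bar>Im \<rho>\<bar> * \<bar>x - c\<bar>)"
    "norm (y x - (y c * cos (\<rho> * of_real (x - c)) + z c / \<rho> * sin (\<rho> * of_real (x - c))))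
      \<le> 2 * integral {a..b} (\<lambda>t. norm (q t)) * E / norm \<rho> * exp (\<bar>Im \<rho>\<bar> * \<bar>x - c\<bar>)"
    "norm (z x / \<rho> - (z c / \<rho> * cos (\<rho> * of_real (x - c)) - y c * sin (\<rho> * of_real (x - c))))
      \<le> 2 * integral {a..b} (\<lambda>t. norm (q t)) * E / norm \<rho> * exp (\<bar>Im \<rho>\<bar> * \<bar>x - c\<bar>)"
proof -
  define Q where "Q = integral {a..b} (\<lambda>t. norm (q t))"
  define T where "T = \<bar>Im \<rho>\<bar>"
  have Q0: "0 \<le> Q" unfolding Q_def using q by (intro Henstock_Kurzweil_Integration.integral_nonneg) (auto simp: absolutely_integrable_on_def)
  have "continuous_on {a..b} (\<lambda>t. norm (y t) * exp (- (T * \<bar>t - c\<bar>)))"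
    using sl_piece_continuous(1)[OF p] by (intro continuous_intros)
  then obtain t0 where t0: "t0 \<in> {a..b}" "\<And>t. t \<in> {a..b} \<Longrightarrow> norm (y t) * exp (- (T * \<bar>t - c\<bar>)) \<le> norm (y t0) * exp (- (T * \<bar>t0 - c\<bar>))"
    using continuous_attains_sup[of "{a..b}" "\<lambda>t. norm (y t) * exp (- (T * \<bar>t - c\<bar>))"] c by auto
  define S where "S = norm (y t0) * exp (- (T * \<bar>t0 - c\<bar>))"
  have S: "norm (y t) \<le> S * exp (T * \<bar>t - c\<bar>)" if "t \<in> {a..b}" for t
    using t0(2)[OF that] unfolding S_def[symmetric] by (simp add: exp_minus field_simps)
  have e1: "norm ((z t / \<rho> + \<i> * y t) - exp (\<i> * \<rho> * of_real (t - c)) * (z c / \<rho> + \<i> * y c)) \<le> Q * S / norm \<rho> * exp (T * \<bar>t - c\<bar>)"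
    if "t \<in> {a..b}" for t
    unfolding Q_def T_def by (rule exponential_component_estimate[OF p q \<rho> S[unfolded T_def] c that])
  \<comment> \<open>The component of opposite sign obeys the same estimate with -\<rho> in place of
    \<rho>, since only the square of \<rho> enters the equation.\<close>
  have e2: "norm ((z t / \<rho> - \<i> * y t) - exp (- (\<i> * \<rho> * of_real (t - c))) * (z c / \<rho> - \<i> * y c)) \<le> Q * S / norm \<rho> * exp (T * \<bar>t - c\<bar>)"
    if "t \<in> {a..b}" for t
  proof -
    have "sl_piece q ((-\<rho>)\<^sup>2) a b y z" using p by simp
    moreover have "norm (y t) \<le> S * exp (\<bar>Im (-\<rho>)\<bar> * \<bar>t - c\<bar>)" if "t \<in> {a..b}" for t using S[OF that] by (simp add: T_def)
    ultimately have *: "norm ((z t / (-\<rho>) + \<i> * y t) - exp (\<i> * (-\<rho>) * of_real (t - c)) * (z c / (-\<rho>) + \<i> * y c)) \<le> Q * S / norm (-\<rho>) * exp (\<bar>Im (-\<rho>)\<bar> * \<bar>t - c\<bar>)"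
      unfolding Q_def using \<rho> by (intro exponential_component_estimate[OF _ q _ _ c that]) auto
    have "(z t / \<rho> - \<i> * y t) - exp (- (\<i> * \<rho> * of_real (t - c))) * (z c / \<rho> - \<i> * y c) =
      - ((z t / (-\<rho>) + \<i> * y t) - exp (\<i> * (-\<rho>) * of_real (t - c)) * (z c / (-\<rho>) + \<i> * y c))"
      by (simp add: algebra_simps)
    then show ?thesis using * by (simp only: norm_minus_cancel T_def uminus_complex.sel abs_minus_cancel)
  qed
  define ep where "ep t = (z t / \<rho> + \<i> * y t) - exp (\<i> * \<rho> * of_real (t - c)) * (z c / \<rho> + \<i> * y c)" for t
  define em where "em t = (z t / \<rho> - \<i> * y t) - exp (- (\<i> * \<rho> * of_real (t - c))) * (z c / \<rho> - \<i> * y c)" for t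
  have yeq: "y t - (y c * cos (\<rho> * of_real (t - c)) + z c / \<rho> * sin (\<rho> * of_real (t - c))) = (ep t - em t) / (2 * \<i>)" for t
    unfolding ep_def em_def cos_exp_eq sin_exp_eq mult.assoc by (rule euler_combination)
  have zeq: "z t / \<rho> - (z c / \<rho> * cos (\<rho> * of_real (t - c)) - y c * sin (\<rho> * of_real (t - c))) = (ep t + em t) / 2" for t
    unfolding ep_def em_def cos_exp_eq sin_exp_eq mult.assoc by (rule euler_combination)
  have ny: "norm (y t - (y c * cos (\<rho> * of_real (t - c)) + z c / \<rho> * sin (\<rho> * of_real (t - c)))) \<le> Q * S / norm \<rho> * exp (T * \<bar>t - c\<bar>)"
    if "t \<in> {a..b}" for t
  proof -
    have "norm (ep t - em t) \<le> 2 * (Q * S / norm \<rho> * exp (T * \<bar>t - c\<bar>))"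
      using e1[OF that, folded ep_def] e2[OF that, folded em_def] norm_triangle_ineq4[of "ep t" "em t"] by linarith
    moreover have "norm ((ep t - em t) / (2 * \<i>)) = norm (ep t - em t) / 2" by (simp add: norm_divide norm_mult)
    ultimately show ?thesis unfolding yeq by linarith
  qed
  have nz: "norm (z t / \<rho> - (z c / \<rho> * cos (\<rho> * of_real (t - c)) - y c * sin (\<rho> * of_real (t - c)))) \<le> Q * S / norm \<rho> * exp (T * \<bar>t - c\<bar>)"
    if "t \<in> {a..b}" for t
  proof -
    have "norm (ep t + em t) \<le> 2 * (Q * S / norm \<rho> * exp (T * \<bar>t - c\<bar>))"
      using e1[OF that, folded ep_def] e2[OF that, folded em_def] norm_triangle_ineq[of "ep t" "em t"] by linarith
    moreover have "norm ((ep t + em t) / 2) = norm (ep t + em t) / 2" by (simp add: norm_divide)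
    ultimately show ?thesis unfolding zeq by linarith
  qed
  have main: "norm (y c * cos (\<rho> * of_real (t - c)) + z c / \<rho> * sin (\<rho> * of_real (t - c))) \<le> E * exp (T * \<bar>t - c\<bar>)"
    "norm (z c / \<rho> * cos (\<rho> * of_real (t - c)) - y c * sin (\<rho> * of_real (t - c))) \<le> E * exp (T * \<bar>t - c\<bar>)" for t
  proof -
    note cs = norm_cos_sin_le[of \<rho> "t - c", folded T_def]
    have "norm (y c * cos (\<rho> * of_real (t - c))) \<le> norm (y c) * exp (T * \<bar>t - c\<bar>)" "norm (z c / \<rho> * sin (\<rho> * of_real (t - c))) \<le> norm (z c / \<rho>) * exp (T * \<bar>t - c\<bar>)"
      unfolding norm_mult using cs by (intro mult_left_mono; simp)+
    then show "norm (y c * cos (\<rho> * of_real (t - c)) + z c / \<rho> * sin (\<rho> * of_real (t - c))) \<le> E * exp (T * \<bar>t - c\<bar>)"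
      using norm_triangle_ineq[of "y c * cos (\<rho> * of_real (t - c))" "z c / \<rho> * sin (\<rho> * of_real (t - c))"]
      unfolding E_def distrib_right by linarith
    have "norm (z c / \<rho> * cos (\<rho> * of_real (t - c))) \<le> norm (z c / \<rho>) * exp (T * \<bar>t - c\<bar>)" "norm (y c * sin (\<rho> * of_real (t - c))) \<le> norm (y c) * exp (T * \<bar>t - c\<bar>)"
      unfolding norm_mult using cs by (intro mult_left_mono; simp)+
    then show "norm (z c / \<rho> * cos (\<rho> * of_real (t - c)) - y c * sin (\<rho> * of_real (t - c))) \<le> E * exp (T * \<bar>t - c\<bar>)"
      using norm_triangle_ineq4[of "z c / \<rho> * cos (\<rho> * of_real (t - c))" "y c * sin (\<rho> * of_real (t - c))"]
      unfolding E_def distrib_right by linarith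
  qed
  have S0: "0 \<le> S" unfolding S_def by simp
  have half: "Q * S / norm \<rho> \<le> S / 2"
  proof -
    have "Q / norm \<rho> \<le> 1 / 2" using large \<rho> unfolding Q_def by (simp add: field_simps)
    from mult_right_mono[OF this S0] show ?thesis by simp
  qed
  have "norm (y t0) \<le> (E + Q * S / norm \<rho>) * exp (T * \<bar>t0 - c\<bar>)"
    using ny[OF t0(1)] main(1)[of t0] norm_triangle_sub[of "y t0" "y c * cos (\<rho> * of_real (t0 - c)) + z c / \<rho> * sin (\<rho> * of_real (t0 - c))"]
    unfolding distrib_right by linarith
  then have "S \<le> E + Q * S / norm \<rho>" unfolding S_def exp_minus by (simp add: field_simps)
  then have SE: "S \<le> 2 * E" using half by linarith
  have pos: "0 < exp (T * \<bar>x - c\<bar>)" by simp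
  have "Q * S / norm \<rho> \<le> Q * (2 * E) / norm \<rho>" using SE Q0 by (intro divide_right_mono mult_left_mono) auto
  then have fin: "Q * S / norm \<rho> * exp (T * \<bar>x - c\<bar>) \<le> 2 * Q * E / norm \<rho> * exp (T * \<bar>x - c\<bar>)" using pos by (intro mult_right_mono) (auto simp: mult_ac)
  show "norm (y x) \<le> 2 * E * exp (\<bar>Im \<rho>\<bar> * \<bar>x - c\<bar>)"
    using order_trans[OF S[OF x] mult_right_mono[OF SE, of "exp (T * \<bar>x - c\<bar>)"]] by (simp add: T_def)
  have "norm (z x / \<rho>) \<le> (E + Q * S / norm \<rho>) * exp (T * \<bar>x - c\<bar>)"
    using nz[OF x] main(2)[of x] norm_triangle_sub[of "z x / \<rho>" "z c / \<rho> * cos (\<rho> * of_real (x - c)) - y c * sin (\<rho> * of_real (x - c))"]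
    unfolding distrib_right by linarith
  also have "\<dots> \<le> 2 * E * exp (T * \<bar>x - c\<bar>)"
  proof (rule mult_right_mono)
    show "E + Q * S / norm \<rho> \<le> 2 * E" using half SE by linarith
  qed simp
  finally show "norm (z x / \<rho>) \<le> 2 * E * exp (\<bar>Im \<rho>\<bar> * \<bar>x - c\<bar>)" by (simp add: T_def)
  show "norm (y x - (y c * cos (\<rho> * of_real (x - c)) + z c / \<rho> * sin (\<rho> * of_real (x - c))))
      \<le> 2 * integral {a..b} (\<lambda>t. norm (q t)) * E / norm \<rho> * exp (\<bar>Im \<rho>\<bar> * \<bar>x - c\<bar>)"
    using ny[OF x] fin unfolding T_def Q_def by linarith
  show "norm (z x / \<rho> - (z c / \<rho> * cos (\<rho> * of_real (x - c)) - y c * sin (\<rho> * of_real (x - c))))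
      \<le> 2 * integral {a..b} (\<lambda>t. norm (q t)) * E / norm \<rho> * exp (\<bar>Im \<rho>\<bar> * \<bar>x - c\<bar>)"
    using nz[OF x] fin unfolding T_def Q_def by linarith
qed

lemma integral_norm_mono:
  fixes q :: "real \<Rightarrow> complex"
  assumes q: "q absolutely_integrable_on {a..b}" and "{u..v} \<subseteq> {a..b}"
  shows "integral {u..v} (\<lambda>t. norm (q t)) \<le> integral {a..b} (\<lambda>t. norm (q t))" "0 \<le> integral {u..v} (\<lambda>t. norm (q t))"
proof -
  have i: "(\<lambda>t. norm (q t)) integrable_on {a..b}" using q by (simp add: absolutely_integrable_on_def)
  then have i': "(\<lambda>t. norm (q t)) integrable_on {u..v}" using assms(2) by (rule integrable_on_subinterval)
  show "integral {u..v} (\<lambda>t. norm (q t)) \<le> integral {a..b} (\<lambda>t. norm (q t))"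
    by (intro integral_subset_le assms(2) i i') auto
  show "0 \<le> integral {u..v} (\<lambda>t. norm (q t))" by (intro Henstock_Kurzweil_Integration.integral_nonneg i') auto
qed

text \<open>The one-sided estimates are chained through the jump. In terms of y and y'/\<rho> the
  parameter \<gamma> appears as \<gamma>/\<rho>, so to leading order the jump only multiplies the
  two components by \<beta> and 1/\<beta>; this produces the trigonometric main terms at \<pi>. The
  constants are uniform in \<rho>.\<close>

lemma jump_pair_forward_estimate:
  assumes q: "q absolutely_integrable_on {0..pi}" and d: "0 < d" "d < pi" and \<beta>: "0 < \<beta>"
  obtains C r0 where "0 < C" "1 \<le> r0"
    "\<And>\<rho> yl zl yr zr. r0 \<le> norm \<rho> \<Longrightarrow> jump_pair q d \<beta> \<gamma> (\<rho>\<^sup>2) yl zl yr zr \<Longrightarrow> yl 0 = 1 \<Longrightarrow> zl 0 = h \<Longrightarrow>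
      (\<forall>x\<in>{0..d}. norm (yl x) \<le> C * exp (\<bar>Im \<rho>\<bar> * x) \<and> norm (zl x / \<rho>) \<le> C * exp (\<bar>Im \<rho>\<bar> * x)) \<and>
      (\<forall>x\<in>{d..pi}. norm (yr x) \<le> C * exp (\<bar>Im \<rho>\<bar> * x) \<and> norm (zr x / \<rho>) \<le> C * exp (\<bar>Im \<rho>\<bar> * x)) \<and>
      norm (yr pi - (of_real \<beta> * cos (\<rho> * of_real d) * cos (\<rho> * of_real (pi - d)) - of_real (inverse \<beta>) * sin (\<rho> * of_real d) * sin (\<rho> * of_real (pi - d))))
        \<le> C / norm \<rho> * exp (\<bar>Im \<rho>\<bar> * pi) \<and>
      norm (zr pi / \<rho> + (of_real (inverse \<beta>) * sin (\<rho> * of_real d) * cos (\<rho> * of_real (pi - d)) + of_real \<beta> * cos (\<rho> * of_real d) * sin (\<rho> * of_real (pi - d))))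
        \<le> C / norm \<rho> * exp (\<bar>Im \<rho>\<bar> * pi)"
proof -
  define Q where "Q = integral {0..pi} (\<lambda>t. norm (q t))"
  have ql: "q absolutely_integrable_on {0..d}" and qr: "q absolutely_integrable_on {d..pi}"
    using q d by (auto intro: absolutely_integrable_on_subinterval)
  have Q: "integral {0..d} (\<lambda>t. norm (q t)) \<le> Q" "integral {d..pi} (\<lambda>t. norm (q t)) \<le> Q" "0 \<le> integral {0..d} (\<lambda>t. norm (q t))" "0 \<le> integral {d..pi} (\<lambda>t. norm (q t))"
    unfolding Q_def using d by (auto intro!: integral_norm_mono[OF q])
  have Q0: "0 \<le> Q" using Q by linarith
  define E where "E = 1 + norm h"
  define B where "B = \<beta> + inverse \<beta> + norm \<gamma>"
  \<comment> \<open>In units of e^(|Im \<rho>| d) / |\<rho>|, \<open>A\<close> bounds the deviation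
    of the left piece at \<open>d\<close> from cos and -sin, and \<open>A'\<close> the sum of the
    two deviations just after the jump. The remainder arising to the right of \<open>d\<close> costs
    4 Q E B, and \<open>C\<close> majorizes all constants in use.\<close>
  define A where "A = norm h + 2 * Q * E"
  define A' where "A' = (\<beta> + inverse \<beta>) * A + norm \<gamma> * (2 * E)"
  define C where "C = 2 * E + 4 * E * B + 4 * Q * E * B + A' + 1"
  have pos: "1 \<le> E" "0 < B" "0 \<le> A" "0 \<le> A'" using \<beta> Q0 add_pos_nonneg[OF add_pos_pos[OF \<beta> positive_imp_inverse_positive[OF \<beta>]] norm_ge_zero[of \<gamma>]] by (auto simp: E_def B_def A_def A'_def)
  have C: "0 < C" "2 * E \<le> C" "4 * E * B \<le> C" "4 * Q * E * B + A' \<le> C"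
    using pos Q0 unfolding C_def by (auto intro!: add_nonneg_pos add_nonneg_nonneg)
  \<comment> \<open>The summand 1 gives |\<rho>| \<ge> 1, so that h/\<rho> and \<gamma>/\<rho> are
    bounded by h and \<gamma>; the summand 2 Q meets the largeness hypothesis of
    \<open>sl_piece_estimate\<close> on both sides of \<open>d\<close>.\<close>
  define r0 where "r0 = 2 * Q + 1"
  show ?thesis
  proof (rule that[of C r0])
    fix \<rho> yl zl yr zr
    assume \<rho>: "r0 \<le> norm \<rho>" and p: "jump_pair q d \<beta> \<gamma> (\<rho>\<^sup>2) yl zl yr zr" and init: "yl 0 = 1" "zl 0 = h"
    define T where "T = \<bar>Im \<rho>\<bar>"
    have \<rho>1: "1 \<le> norm \<rho>" "2 * Q \<le> norm \<rho>" using \<rho> Q0 by (auto simp: r0_def)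
    then have \<rho>0: "\<rho> \<noteq> 0" by auto
    have pl: "sl_piece q (\<rho>\<^sup>2) 0 d yl zl" and pr: "sl_piece q (\<rho>\<^sup>2) d pi yr zr"
      and j: "yr d = of_real \<beta> * yl d" "zr d = of_real (inverse \<beta>) * zl d + \<gamma> * yl d"
      using p unfolding jump_pair_def by blast+
    have h\<rho>: "norm (h / \<rho>) \<le> norm h" using \<rho>1 by (simp add: norm_divide divide_le_eq mult_le_cancel_left1)
    have l0: "2 * integral {0..d} (\<lambda>t. norm (q t)) \<le> norm \<rho>" "0 \<in> {0..d}" and r0': "2 * integral {d..pi} (\<lambda>t. norm (q t)) \<le> norm \<rho>" "d \<in> {d..pi}"
      using Q \<rho>1 d by auto
    note el = sl_piece_estimate[OF pl ql \<rho>0 l0, folded T_def, unfolded init]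
    note er = sl_piece_estimate[OF pr qr \<rho>0 r0', folded T_def]
    have E0: "norm (1::complex) + norm (h / \<rho>) \<le> E" using h\<rho> by (simp add: E_def)
    have L: "norm (yl x) \<le> 2 * E * exp (T * x)" "norm (zl x / \<rho>) \<le> 2 * E * exp (T * x)" if x: "x \<in> {0..d}" for x
    proof -
      have "2 * (norm (1::complex) + norm (h / \<rho>)) * exp (T * \<bar>x - 0\<bar>) \<le> 2 * E * exp (T * x)"
        using E0 x pos(1) by (intro mult_mono) auto
      then show "norm (yl x) \<le> 2 * E * exp (T * x)" "norm (zl x / \<rho>) \<le> 2 * E * exp (T * x)" using el(1,2)[OF x] by linarith+
    qed
    define X where "X = exp (T * d)"
    define Y where "Y = exp (T * (pi - d))"
    have XY: "X * Y = exp (T * pi)" "0 < X" "0 < Y" by (auto simp: X_def Y_def exp_add[symmetric] algebra_simps)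
    have d0: "d \<in> {0..d}" using d by simp
    have Ld: "norm (yl d) \<le> 2 * E * X" "norm (zl d / \<rho>) \<le> 2 * E * X" using L[OF d0] by (auto simp: X_def)
    have zrd: "zr d / \<rho> = of_real (inverse \<beta>) * (zl d / \<rho>) + \<gamma> / \<rho> * yl d"
      unfolding j using \<rho>0 by (simp add: field_simps)
    have g\<rho>: "norm (\<gamma> / \<rho>) \<le> norm \<gamma>" using \<rho>1 by (simp add: norm_divide divide_le_eq mult_le_cancel_left1)
    have E1: "norm (yr d) + norm (zr d / \<rho>) \<le> 2 * E * B * X"
    proof -
      have "norm (yr d) = \<beta> * norm (yl d)" unfolding j using \<beta> by (simp add: norm_mult)
      also have "\<dots> \<le> \<beta> * (2 * E * X)" using Ld \<beta> by (intro mult_left_mono) auto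
      finally have 1: "norm (yr d) \<le> \<beta> * (2 * E * X)" .
      have "norm (of_real (inverse \<beta>) * (zl d / \<rho>)) \<le> inverse \<beta> * (2 * E * X)"
        unfolding norm_mult using Ld(2) \<beta> by (intro mult_mono) (auto simp: norm_inverse)
      moreover have "norm (\<gamma> / \<rho> * yl d) \<le> norm \<gamma> * (2 * E * X)"
        unfolding norm_mult using Ld(1) g\<rho> by (intro mult_mono) auto
      ultimately have "norm (zr d / \<rho>) \<le> inverse \<beta> * (2 * E * X) + norm \<gamma> * (2 * E * X)"
        unfolding zrd using norm_triangle_ineq[of "of_real (inverse \<beta>) * (zl d / \<rho>)" "\<gamma> / \<rho> * yl d"] by linarith
      with 1 show ?thesis unfolding B_def by (simp add: algebra_simps)
    qed
    have R: "norm (yr x) \<le> 4 * E * B * exp (T * x)" "norm (zr x / \<rho>) \<le> 4 * E * B * exp (T * x)" if x: "x \<in> {d..pi}" for x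
    proof -
      have "2 * (norm (yr d) + norm (zr d / \<rho>)) * exp (T * \<bar>x - d\<bar>) \<le> 2 * (2 * E * B * X) * exp (T * (x - d))"
        using E1 x pos XY by (intro mult_mono) auto
      also have "\<dots> = 4 * E * B * (X * exp (T * (x - d)))" by simp
      also have "X * exp (T * (x - d)) = exp (T * x)" by (simp add: X_def exp_add[symmetric] algebra_simps)
      finally show "norm (yr x) \<le> 4 * E * B * exp (T * x)" "norm (zr x / \<rho>) \<le> 4 * E * B * exp (T * x)" using er(1,2)[OF x] by linarith+
    qed
    have cs: "norm (cos (\<rho> * of_real d)) \<le> X" "norm (sin (\<rho> * of_real d)) \<le> X" "norm (cos (\<rho> * of_real (pi - d))) \<le> Y" "norm (sin (\<rho> * of_real (pi - d))) \<le> Y"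
      using norm_cos_sin_le[of \<rho> d] norm_cos_sin_le[of \<rho> "pi - d"] d by (auto simp: X_def Y_def T_def)
    have rem: "2 * integral {0..d} (\<lambda>t. norm (q t)) * (norm (1::complex) + norm (h / \<rho>)) / norm \<rho> * exp (T * \<bar>d - 0\<bar>) \<le> 2 * Q * E / norm \<rho> * X"
      unfolding X_def using Q E0 d Q0 pos(1) by (intro mult_mono divide_right_mono) auto
    have hs: "norm (h / \<rho> * s) \<le> norm h / norm \<rho> * X" if "norm s \<le> X" for s
      unfolding norm_mult norm_divide using that by (intro mult_left_mono) auto
    have aux: "2 * Q * E / norm \<rho> * X + norm h / norm \<rho> * X = A / norm \<rho> * X" by (simp add: A_def add_divide_distrib algebra_simps)
    have Y1: "norm (yl d - cos (\<rho> * of_real d)) \<le> A / norm \<rho> * X"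
    proof -
      have "yl d - cos (\<rho> * of_real d) = (yl d - (1 * cos (\<rho> * of_real (d - 0)) + h / \<rho> * sin (\<rho> * of_real (d - 0)))) + h / \<rho> * sin (\<rho> * of_real d)" by simp
      then have "norm (yl d - cos (\<rho> * of_real d)) \<le> norm (yl d - (1 * cos (\<rho> * of_real (d - 0)) + h / \<rho> * sin (\<rho> * of_real (d - 0)))) + norm (h / \<rho> * sin (\<rho> * of_real d))"
        by (metis norm_triangle_ineq)
      then show ?thesis using el(3)[OF d0] rem hs[OF cs(2)] aux by linarith
    qed
    have Z1: "norm (zl d / \<rho> + sin (\<rho> * of_real d)) \<le> A / norm \<rho> * X"
    proof -
      have "zl d / \<rho> + sin (\<rho> * of_real d) = (zl d / \<rho> - (h / \<rho> * cos (\<rho> * of_real (d - 0)) - 1 * sin (\<rho> * of_real (d - 0)))) + h / \<rho> * cos (\<rho> * of_real d)" by simp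
      then have "norm (zl d / \<rho> + sin (\<rho> * of_real d)) \<le> norm (zl d / \<rho> - (h / \<rho> * cos (\<rho> * of_real (d - 0)) - 1 * sin (\<rho> * of_real (d - 0)))) + norm (h / \<rho> * cos (\<rho> * of_real d))"
        by (metis norm_triangle_ineq)
      then show ?thesis using el(4)[OF d0] rem hs[OF cs(1)] aux by linarith
    qed
    define y1 where "y1 = yr d - of_real \<beta> * cos (\<rho> * of_real d)"
    define z1 where "z1 = zr d / \<rho> + of_real (inverse \<beta>) * sin (\<rho> * of_real d)"
    have yz1: "norm y1 + norm z1 \<le> A' / norm \<rho> * X"
    proof -
      have "y1 = of_real \<beta> * (yl d - cos (\<rho> * of_real d))" unfolding y1_def j by (simp add: algebra_simps)
      then have "norm y1 = \<beta> * norm (yl d - cos (\<rho> * of_real d))" using \<beta> by (simp add: norm_mult)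
      also have "\<dots> \<le> \<beta> * (A / norm \<rho> * X)" using Y1 \<beta> by (intro mult_left_mono) auto
      finally have 1: "norm y1 \<le> \<beta> * (A / norm \<rho> * X)" .
      have z1: "z1 = of_real (inverse \<beta>) * (zl d / \<rho> + sin (\<rho> * of_real d)) + \<gamma> / \<rho> * yl d" unfolding z1_def zrd by (simp add: algebra_simps)
      have "norm (of_real (inverse \<beta>) * (zl d / \<rho> + sin (\<rho> * of_real d))) \<le> inverse \<beta> * (A / norm \<rho> * X)"
        unfolding norm_mult using Z1 \<beta> by (intro mult_mono) (auto simp: norm_inverse)
      moreover have "norm (\<gamma> / \<rho> * yl d) \<le> norm \<gamma> / norm \<rho> * (2 * E * X)"
        unfolding norm_mult norm_divide using Ld(1) by (intro mult_left_mono) auto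
      ultimately have "norm z1 \<le> inverse \<beta> * (A / norm \<rho> * X) + norm \<gamma> / norm \<rho> * (2 * E * X)"
        unfolding z1 using norm_triangle_ineq[of "of_real (inverse \<beta>) * (zl d / \<rho> + sin (\<rho> * of_real d))" "\<gamma> / \<rho> * yl d"] by linarith
      moreover have "\<beta> * (A / norm \<rho> * X) + (inverse \<beta> * (A / norm \<rho> * X) + norm \<gamma> / norm \<rho> * (2 * E * X)) = A' / norm \<rho> * X"
        unfolding A'_def by (simp add: add_divide_distrib algebra_simps)
      ultimately show ?thesis using 1 by linarith
    qed
    have pid: "pi \<in> {d..pi}" using d by simp
    have rem2: "2 * integral {d..pi} (\<lambda>t. norm (q t)) * (norm (yr d) + norm (zr d / \<rho>)) / norm \<rho> * exp (T * \<bar>pi - d\<bar>) \<le> (4 * Q * E * B) / norm \<rho> * exp (T * pi)"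
    proof -
      have "2 * integral {d..pi} (\<lambda>t. norm (q t)) * (norm (yr d) + norm (zr d / \<rho>)) / norm \<rho> * exp (T * \<bar>pi - d\<bar>) \<le> 2 * Q * (2 * E * B * X) / norm \<rho> * Y"
        unfolding Y_def using Q E1 d Q0 pos XY by (intro mult_mono divide_right_mono) auto
      also have "\<dots> = (4 * Q * E * B) / norm \<rho> * (X * Y)" by simp
      finally show ?thesis unfolding XY .
    qed
    have comb: "norm (y1 * s + z1 * t) \<le> A' / norm \<rho> * exp (T * pi)" if "norm s \<le> Y" "norm t \<le> Y" for s t
    proof -
      have "norm (y1 * s + z1 * t) \<le> norm y1 * Y + norm z1 * Y"
        using norm_lincomb_le[of y1 "norm y1" z1 "norm z1" s Y t Y] that by simp
      also have "\<dots> \<le> A' / norm \<rho> * X * Y" using mult_right_mono[OF yz1, of Y] XY(3) by (simp only: distrib_right less_imp_le)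
      finally show ?thesis unfolding XY(1)[symmetric] by (simp add: mult.assoc)
    qed
    have fin: "(4 * Q * E * B) / norm \<rho> * exp (T * pi) + A' / norm \<rho> * exp (T * pi) \<le> C / norm \<rho> * exp (T * pi)"
    proof -
      have "(4 * Q * E * B) / norm \<rho> * exp (T * pi) + A' / norm \<rho> * exp (T * pi) = (4 * Q * E * B + A') / norm \<rho> * exp (T * pi)"
        by (simp add: add_divide_distrib distrib_right)
      also have "\<dots> \<le> C / norm \<rho> * exp (T * pi)" using C(4) by (intro mult_right_mono divide_right_mono) auto
      finally show ?thesis .
    qed
    have yy: "norm (yr pi - (of_real \<beta> * cos (\<rho> * of_real d) * cos (\<rho> * of_real (pi - d)) - of_real (inverse \<beta>) * sin (\<rho> * of_real d) * sin (\<rho> * of_real (pi - d))))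
        \<le> C / norm \<rho> * exp (T * pi)"
    proof -
      have "yr pi - (of_real \<beta> * cos (\<rho> * of_real d) * cos (\<rho> * of_real (pi - d)) - of_real (inverse \<beta>) * sin (\<rho> * of_real d) * sin (\<rho> * of_real (pi - d)))
        = (yr pi - (yr d * cos (\<rho> * of_real (pi - d)) + zr d / \<rho> * sin (\<rho> * of_real (pi - d)))) + (y1 * cos (\<rho> * of_real (pi - d)) + z1 * sin (\<rho> * of_real (pi - d)))"
        unfolding y1_def z1_def by (simp add: algebra_simps)
      also have "norm \<dots> \<le> norm (yr pi - (yr d * cos (\<rho> * of_real (pi - d)) + zr d / \<rho> * sin (\<rho> * of_real (pi - d)))) + norm (y1 * cos (\<rho> * of_real (pi - d)) + z1 * sin (\<rho> * of_real (pi - d)))"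
        by (rule norm_triangle_ineq)
      finally show ?thesis using er(3)[OF pid] rem2 comb[OF cs(3,4)] fin by linarith
    qed
    have zz: "norm (zr pi / \<rho> + (of_real (inverse \<beta>) * sin (\<rho> * of_real d) * cos (\<rho> * of_real (pi - d)) + of_real \<beta> * cos (\<rho> * of_real d) * sin (\<rho> * of_real (pi - d))))
        \<le> C / norm \<rho> * exp (T * pi)"
    proof -
      have "zr pi / \<rho> + (of_real (inverse \<beta>) * sin (\<rho> * of_real d) * cos (\<rho> * of_real (pi - d)) + of_real \<beta> * cos (\<rho> * of_real d) * sin (\<rho> * of_real (pi - d)))
        = (zr pi / \<rho> - (zr d / \<rho> * cos (\<rho> * of_real (pi - d)) - yr d * sin (\<rho> * of_real (pi - d)))) + (y1 * - sin (\<rho> * of_real (pi - d)) + z1 * cos (\<rho> * of_real (pi - d)))"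
        unfolding y1_def z1_def by (simp add: algebra_simps)
      also have "norm \<dots> \<le> norm (zr pi / \<rho> - (zr d / \<rho> * cos (\<rho> * of_real (pi - d)) - yr d * sin (\<rho> * of_real (pi - d)))) + norm (y1 * - sin (\<rho> * of_real (pi - d)) + z1 * cos (\<rho> * of_real (pi - d)))"
        by (rule norm_triangle_ineq)
      finally show ?thesis using er(4)[OF pid] rem2 comb[of "- sin (\<rho> * of_real (pi - d))" "cos (\<rho> * of_real (pi - d))"] cs(3,4) fin by simp
    qed
    have up: "2 * E * exp (T * x) \<le> C * exp (T * x)" "4 * E * B * exp (T * x) \<le> C * exp (T * x)" for x
      using C by (auto intro!: mult_right_mono)
    show "(\<forall>x\<in>{0..d}. norm (yl x) \<le> C * exp (\<bar>Im \<rho>\<bar> * x) \<and> norm (zl x / \<rho>) \<le> C * exp (\<bar>Im \<rho>\<bar> * x)) \<and>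
      (\<forall>x\<in>{d..pi}. norm (yr x) \<le> C * exp (\<bar>Im \<rho>\<bar> * x) \<and> norm (zr x / \<rho>) \<le> C * exp (\<bar>Im \<rho>\<bar> * x)) \<and>
      norm (yr pi - (of_real \<beta> * cos (\<rho> * of_real d) * cos (\<rho> * of_real (pi - d)) - of_real (inverse \<beta>) * sin (\<rho> * of_real d) * sin (\<rho> * of_real (pi - d))))
        \<le> C / norm \<rho> * exp (\<bar>Im \<rho>\<bar> * pi) \<and>
      norm (zr pi / \<rho> + (of_real (inverse \<beta>) * sin (\<rho> * of_real d) * cos (\<rho> * of_real (pi - d)) + of_real \<beta> * cos (\<rho> * of_real d) * sin (\<rho> * of_real (pi - d))))
        \<le> C / norm \<rho> * exp (\<bar>Im \<rho>\<bar> * pi)"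
      unfolding T_def[symmetric] by (intro conjI ballI yy zz) (meson L R up order_trans)+
  qed (use C Q0 in \<open>auto simp: r0_def\<close>)
qed

text \<open>The inverse jump has the entries 1/\<beta>, \<beta> and -\<gamma>, so the same
  \<open>B\<close> bounds it. Growth is now measured by the distance to \<pi>, where the data are
  prescribed.\<close>

lemma jump_pair_backward_estimate:
  assumes q: "q absolutely_integrable_on {0..pi}" and d: "0 < d" "d < pi" and \<beta>: "0 < \<beta>"
  obtains C r0 where "0 < C" "1 \<le> r0"
    "\<And>\<rho> yl zl yr zr. r0 \<le> norm \<rho> \<Longrightarrow> jump_pair q d \<beta> \<gamma> (\<rho>\<^sup>2) yl zl yr zr \<Longrightarrow> yr pi = c1 \<Longrightarrow> zr pi = c2 \<Longrightarrow>
      (\<forall>x\<in>{0..d}. norm (yl x) \<le> C * exp (\<bar>Im \<rho>\<bar> * (pi - x))) \<and>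
      (\<forall>x\<in>{d..pi}. norm (yr x) \<le> C * exp (\<bar>Im \<rho>\<bar> * (pi - x)))"
proof -
  define Q where "Q = integral {0..pi} (\<lambda>t. norm (q t))"
  have ql: "q absolutely_integrable_on {0..d}" and qr: "q absolutely_integrable_on {d..pi}"
    using q d by (auto intro: absolutely_integrable_on_subinterval)
  have Q: "integral {0..d} (\<lambda>t. norm (q t)) \<le> Q" "integral {d..pi} (\<lambda>t. norm (q t)) \<le> Q" "0 \<le> integral {0..d} (\<lambda>t. norm (q t))" "0 \<le> integral {d..pi} (\<lambda>t. norm (q t))"
    unfolding Q_def using d by (auto intro!: integral_norm_mono[OF q])
  have Q0: "0 \<le> Q" using Q by linarith
  define E where "E = norm c1 + norm c2"
  define B where "B = \<beta> + inverse \<beta> + norm \<gamma>"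
  define C where "C = 2 * E + 4 * E * B + 1"
  have pos: "0 \<le> E" "0 < B" using \<beta> add_pos_nonneg[OF add_pos_pos[OF \<beta> positive_imp_inverse_positive[OF \<beta>]] norm_ge_zero[of \<gamma>]] by (auto simp: E_def B_def)
  have C: "0 < C" "2 * E \<le> C" "4 * E * B \<le> C"
    using pos unfolding C_def by (auto intro!: add_nonneg_pos)
  define r0 where "r0 = 2 * Q + 1"
  show ?thesis
  proof (rule that[of C r0])
    fix \<rho> yl zl yr zr
    assume \<rho>: "r0 \<le> norm \<rho>" and p: "jump_pair q d \<beta> \<gamma> (\<rho>\<^sup>2) yl zl yr zr" and init: "yr pi = c1" "zr pi = c2"
    define T where "T = \<bar>Im \<rho>\<bar>"
    have \<rho>1: "1 \<le> norm \<rho>" "2 * Q \<le> norm \<rho>" using \<rho> Q0 by (auto simp: r0_def)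
    then have \<rho>0: "\<rho> \<noteq> 0" by auto
    have pl: "sl_piece q (\<rho>\<^sup>2) 0 d yl zl" and pr: "sl_piece q (\<rho>\<^sup>2) d pi yr zr"
      and j: "yr d = of_real \<beta> * yl d" "zr d = of_real (inverse \<beta>) * zl d + \<gamma> * yl d"
      using p unfolding jump_pair_def by blast+
    have c\<rho>: "norm (c2 / \<rho>) \<le> norm c2" using \<rho>1 by (simp add: norm_divide divide_le_eq mult_le_cancel_left1)
    have l0: "2 * integral {0..d} (\<lambda>t. norm (q t)) \<le> norm \<rho>" "d \<in> {0..d}" and r0': "2 * integral {d..pi} (\<lambda>t. norm (q t)) \<le> norm \<rho>" "pi \<in> {d..pi}"
      using Q \<rho>1 d by auto
    note el = sl_piece_estimate[OF pl ql \<rho>0 l0, folded T_def]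
    note er = sl_piece_estimate[OF pr qr \<rho>0 r0', folded T_def, unfolded init]
    have E0: "norm c1 + norm (c2 / \<rho>) \<le> E" using c\<rho> by (simp add: E_def)
    have R: "norm (yr x) \<le> 2 * E * exp (T * (pi - x))" "norm (zr x / \<rho>) \<le> 2 * E * exp (T * (pi - x))" if x: "x \<in> {d..pi}" for x
    proof -
      have "2 * (norm c1 + norm (c2 / \<rho>)) * exp (T * \<bar>x - pi\<bar>) \<le> 2 * E * exp (T * (pi - x))"
        using E0 x pos by (intro mult_mono) auto
      then show "norm (yr x) \<le> 2 * E * exp (T * (pi - x))" "norm (zr x / \<rho>) \<le> 2 * E * exp (T * (pi - x))" using er(1,2)[OF x] by linarith+
    qed
    define X where "X = exp (T * (pi - d))"
    have "d \<in> {d..pi}" using d by simp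
    note Rd = R[OF this, folded X_def]
    have yld: "yl d = of_real (inverse \<beta>) * yr d" unfolding j using \<beta> by simp
    have g\<rho>: "norm (\<gamma> / \<rho>) \<le> norm \<gamma>" using \<rho>1 by (simp add: norm_divide divide_le_eq mult_le_cancel_left1)
    have zld: "zl d / \<rho> = of_real \<beta> * (zr d / \<rho>) - \<gamma> / \<rho> * yr d"
      unfolding j using \<rho>0 \<beta> by (simp add: field_simps)
    have E1: "norm (yl d) + norm (zl d / \<rho>) \<le> 2 * E * B * X"
    proof -
      have 1: "norm (yl d) \<le> inverse \<beta> * (2 * E * X)"
        unfolding yld norm_mult using Rd \<beta> by (intro mult_mono) (auto simp: norm_inverse)
      have "norm (of_real \<beta> * (zr d / \<rho>)) \<le> \<beta> * (2 * E * X)"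
        unfolding norm_mult using Rd(2) \<beta> by (intro mult_mono) auto
      moreover have "norm (\<gamma> / \<rho> * yr d) \<le> norm \<gamma> * (2 * E * X)"
        unfolding norm_mult using Rd(1) g\<rho> by (intro mult_mono) auto
      ultimately have "norm (zl d / \<rho>) \<le> \<beta> * (2 * E * X) + norm \<gamma> * (2 * E * X)"
        unfolding zld using norm_triangle_ineq4[of "of_real \<beta> * (zr d / \<rho>)" "\<gamma> / \<rho> * yr d"] by linarith
      with 1 show ?thesis unfolding B_def by (simp add: algebra_simps)
    qed
    have L: "norm (yl x) \<le> 4 * E * B * exp (T * (pi - x))" if x: "x \<in> {0..d}" for x
    proof -
      have "2 * (norm (yl d) + norm (zl d / \<rho>)) * exp (T * \<bar>x - d\<bar>) \<le> 2 * (2 * E * B * X) * exp (T * (d - x))"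
        using E1 x pos by (intro mult_mono) (auto simp: X_def)
      also have "\<dots> = 4 * E * B * (X * exp (T * (d - x)))" by simp
      also have "X * exp (T * (d - x)) = exp (T * (pi - x))" by (simp add: X_def exp_add[symmetric] algebra_simps)
      finally show "norm (yl x) \<le> 4 * E * B * exp (T * (pi - x))" using el(1)[OF x] by linarith
    qed
    have up: "2 * E * exp (T * x) \<le> C * exp (T * x)" "4 * E * B * exp (T * x) \<le> C * exp (T * x)" for x
      using C by (auto intro!: mult_right_mono)
    show "(\<forall>x\<in>{0..d}. norm (yl x) \<le> C * exp (\<bar>Im \<rho>\<bar> * (pi - x))) \<and>
      (\<forall>x\<in>{d..pi}. norm (yr x) \<le> C * exp (\<bar>Im \<rho>\<bar> * (pi - x)))"
      unfolding T_def[symmetric] by (meson L R up order_trans)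
  qed (use C Q0 in \<open>auto simp: r0_def\<close>)
qed

subsection \<open>Lower bounds for the characteristic functions\<close>

definition square_norm :: "complex \<Rightarrow> real" where
  "square_norm z = max \<bar>Re z\<bar> \<bar>Im z\<bar>"

text \<open>Squares are convenient contours: on their sides either \<open>|Im \<rho>|\<close> is large or \<open>Re \<rho>\<close> is half an integer (an integer), which keeps \<open>sin (\<rho> \<pi>)\<close> (or \<open>cos (\<rho> \<pi>)\<close>) of full size.\<close>

lemma square_norm_le_norm: "square_norm z \<le> norm z"
  unfolding square_norm_def using abs_Re_le_cmod[of z] abs_Im_le_cmod[of z] by simp

lemma norm_le_square_norm: "norm z \<le> 2 * square_norm z"
  unfolding square_norm_def using cmod_le[of z] by linarith

lemma cosh_scaled_le:
  fixes t s :: real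
  assumes "\<bar>s\<bar> \<le> pi"
  shows "cosh (t * s) \<le> cosh (t * pi)"
proof -
  have "\<bar>t * s\<bar> \<le> \<bar>t * pi\<bar>" using assms by (simp add: abs_mult mult_left_mono)
  then have "cosh \<bar>t * s\<bar> \<le> cosh \<bar>t * pi\<bar>" by (subst cosh_real_nonneg_le_iff) auto
  then show ?thesis by simp
qed

lemma norm_sin_cos_le_cosh:
  fixes z :: complex
  shows "norm (sin z) \<le> cosh (Im z)" "norm (cos z) \<le> cosh (Im z)"
proof -
  have e: "norm (exp (\<i> * z)) = exp (- Im z)" "norm (exp (- (\<i> * z))) = exp (Im z)" by (simp_all add: norm_exp_eq_Re)
  have c: "exp (- Im z) + exp (Im z) = 2 * cosh (Im z)" by (simp add: cosh_field_def)
  have "norm (exp (\<i> * z) - exp (- (\<i> * z))) \<le> 2 * cosh (Im z)" "norm (exp (\<i> * z) + exp (- (\<i> * z))) \<le> 2 * cosh (Im z)"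
    using norm_triangle_ineq[of "exp (\<i> * z)" "exp (- (\<i> * z))"] norm_triangle_ineq4[of "exp (\<i> * z)" "exp (- (\<i> * z))"] e c by linarith+
  then show "norm (sin z) \<le> cosh (Im z)" "norm (cos z) \<le> cosh (Im z)"
    unfolding sin_exp_eq cos_exp_eq by (simp_all add: norm_divide norm_mult)
qed

lemma sin_cos_norm_squares:
  fixes z :: complex
  shows "norm (sin z) ^ 2 = sin (Re z) ^ 2 + sinh (Im z) ^ 2" "norm (cos z) ^ 2 = cos (Re z) ^ 2 + sinh (Im z) ^ 2"
proof -
  have s: "sinh (Im z) ^ 2 = (exp (2 * Im z) + inverse (exp (2 * Im z)) - 2) / 4"
  proof -
    have e: "exp (2 * Im z) = exp (Im z) * exp (Im z)" by (simp add: exp_add[symmetric])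
    show ?thesis unfolding sinh_field_def exp_minus e power2_eq_square by (simp add: field_simps)
  qed
  show "norm (sin z) ^ 2 = sin (Re z) ^ 2 + sinh (Im z) ^ 2"
    unfolding norm_sin_squared s cos_double_sin by (simp add: field_simps)
  have "(exp (Im z) - inverse (exp (Im z))) ^ 2 / 4 = sinh (Im z) ^ 2"
    unfolding sinh_field_def exp_minus by (simp add: power_divide)
  then show "norm (cos z) ^ 2 = cos (Re z) ^ 2 + sinh (Im z) ^ 2"
    unfolding norm_cos_squared by simp
qed

text \<open>The ratio of |sinh| to cosh tends to 1; the crude bound exp(s) \<ge> 1 + s turns this
  into an explicit threshold.\<close>

lemma sinh_ge_cosh:
  fixes t \<epsilon> :: real
  assumes "0 < \<epsilon>" "2 / \<epsilon> \<le> 2 * \<bar>t\<bar>"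
  shows "(1 - \<epsilon>) * cosh t \<le> \<bar>sinh t\<bar>"
proof -
  define s where "s = \<bar>t\<bar>"
  have "2 / \<epsilon> \<le> exp (2 * s)" using assms(2) exp_ge_add_one_self[of "2 * s"] unfolding s_def by linarith
  then have "2 \<le> \<epsilon> * exp (2 * s)" using assms(1) by (simp add: field_simps)
  then have "2 * exp (- s) \<le> \<epsilon> * exp (2 * s) * exp (- s)" by (intro mult_right_mono) auto
  also have "\<epsilon> * exp (2 * s) * exp (- s) = \<epsilon> * exp s" by (simp add: mult.assoc exp_add[symmetric])
  finally have 1: "2 * exp (- s) \<le> \<epsilon> * exp s" .
  have "(1 - \<epsilon>) * cosh s \<le> sinh s"
    unfolding cosh_field_def sinh_field_def using 1 mult_pos_pos[OF assms(1) exp_gt_zero[of "- s"]] by (simp add: field_simps)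
  moreover have "cosh s = cosh t" "sinh s = \<bar>sinh t\<bar>" by (simp_all add: s_def sinh_real_abs)
  ultimately show ?thesis by simp
qed

text \<open>The factor 1 - \<epsilon> with arbitrary \<epsilon> matters: the main terms contain a
  second wave whose amplitude may be close to that of the first one, so a lower bound with some
  unspecified constant would not dominate it. On vertical sides the modulus equals cosh, on
  horizontal ones it is at least |sinh|.\<close>

lemma trig_ge_cosh_on_squares:
  assumes "0 < \<epsilon>"
  obtains n0 where "\<And>n \<rho>. n0 \<le> n \<Longrightarrow> square_norm \<rho> = real n + 1/2 \<Longrightarrow> (1 - \<epsilon>) * cosh (Im \<rho> * pi) \<le> norm (sin (\<rho> * of_real pi))"
    "\<And>n \<rho>. n0 \<le> n \<Longrightarrow> square_norm \<rho> = real n \<Longrightarrow> (1 - \<epsilon>) * cosh (Im \<rho> * pi) \<le> norm (cos (\<rho> * of_real pi))"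
proof -
  define n0 where "n0 = nat \<lceil>1 / \<epsilon>\<rceil>"
  have im: "(1 - \<epsilon>) * cosh (Im \<rho> * pi) \<le> \<bar>sinh (Im \<rho> * pi)\<bar>" if "n0 \<le> n" "real n \<le> \<bar>Im \<rho>\<bar>" for n \<rho>
  proof (rule sinh_ge_cosh[OF assms])
    have "1 / \<epsilon> \<le> real n0" unfolding n0_def by linarith
    also have "\<dots> \<le> \<bar>Im \<rho>\<bar>" using that by linarith
    also have "\<dots> \<le> \<bar>Im \<rho>\<bar> * pi" using pi_ge_two by (intro mult_le_cancel_left1[THEN iffD2]) auto
    finally show "2 / \<epsilon> \<le> 2 * \<bar>Im \<rho> * pi\<bar>" by (simp add: abs_mult)
  qed
  have re: "(1 - \<epsilon>) * cosh (Im \<rho> * pi) \<le> x" if "x ^ 2 = 1 + sinh (Im \<rho> * pi) ^ 2" "0 \<le> x" for x \<rho>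
  proof -
    have "x ^ 2 = cosh (Im \<rho> * pi) ^ 2" using that(1) by (simp add: cosh_square_eq)
    then have "x = cosh (Im \<rho> * pi)" using that(2) by (simp add: power2_eq_iff_nonneg)
    then show ?thesis using assms mult_right_mono[of "1 - \<epsilon>" 1 "cosh (Im \<rho> * pi)"] by simp
  qed
  have gen: "\<bar>sinh t\<bar> \<le> x" if "x ^ 2 = y ^ 2 + sinh t ^ 2" "0 \<le> x" for x y t :: real
  proof -
    have "\<bar>sinh t\<bar> ^ 2 \<le> x ^ 2" using that(1) by simp
    then show ?thesis using that(2) by (rule power2_le_imp_le)
  qed
  have sin1: "sin (t * pi) ^ 2 = 1" if "\<bar>t\<bar> = real n + 1/2" for t n
  proof -
    have "\<bar>sin (t * pi)\<bar> = \<bar>sin (\<bar>t\<bar> * pi)\<bar>" by (cases "t \<ge> 0") auto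
    also have "\<bar>t\<bar> * pi = pi / 2 + real n * pi" unfolding that by (simp add: field_simps)
    also have "\<bar>sin (pi / 2 + real n * pi)\<bar> = 1" by (simp add: sin_add)
    finally show ?thesis by (metis one_power2 power2_abs)
  qed
  have cos1: "cos (t * pi) ^ 2 = 1" if "\<bar>t\<bar> = real n" for t n
  proof -
    have "cos (t * pi) = cos (\<bar>t\<bar> * pi)" by (cases "t \<ge> 0") auto
    also have "\<dots> = (-1) ^ n" unfolding that by simp
    finally show ?thesis by (simp add: power_mult[symmetric] mult.commute)
  qed
  show ?thesis
  proof (rule that[of n0])
    fix n \<rho> assume n: "n0 \<le> n" "square_norm \<rho> = real n + 1/2"
    have N: "norm (sin (\<rho> * of_real pi)) ^ 2 = sin (Re \<rho> * pi) ^ 2 + sinh (Im \<rho> * pi) ^ 2" by (simp add: sin_cos_norm_squares)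
    from n(2) consider "\<bar>Re \<rho>\<bar> = real n + 1/2" | "\<bar>Im \<rho>\<bar> = real n + 1/2" unfolding square_norm_def max_def by (metis (full_types))
    then show "(1 - \<epsilon>) * cosh (Im \<rho> * pi) \<le> norm (sin (\<rho> * of_real pi))"
    proof cases
      case 1
      then show ?thesis using N sin1[of "Re \<rho>" n] by (intro re) auto
    next
      case 2
      then have "(1 - \<epsilon>) * cosh (Im \<rho> * pi) \<le> \<bar>sinh (Im \<rho> * pi)\<bar>" using im[OF n(1), of \<rho>] by simp
      also have "\<dots> \<le> norm (sin (\<rho> * of_real pi))" by (rule gen[OF N]) simp
      finally show ?thesis .
    qed
  next
    fix n \<rho> assume n: "n0 \<le> n" "square_norm \<rho> = real n"
    have N: "norm (cos (\<rho> * of_real pi)) ^ 2 = cos (Re \<rho> * pi) ^ 2 + sinh (Im \<rho> * pi) ^ 2" by (simp add: sin_cos_norm_squares)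
    from n(2) consider "\<bar>Re \<rho>\<bar> = real n" | "\<bar>Im \<rho>\<bar> = real n" unfolding square_norm_def max_def by (metis (full_types))
    then show "(1 - \<epsilon>) * cosh (Im \<rho> * pi) \<le> norm (cos (\<rho> * of_real pi))"
    proof cases
      case 1
      then show ?thesis using N cos1[of "Re \<rho>" n] by (intro re) auto
    next
      case 2
      then have "(1 - \<epsilon>) * cosh (Im \<rho> * pi) \<le> \<bar>sinh (Im \<rho> * pi)\<bar>" using im[OF n(1), of \<rho>] by simp
      also have "\<dots> \<le> norm (cos (\<rho> * of_real pi))" by (rule gen[OF N]) simp
      finally show ?thesis .
    qed
  qed
qed

text \<open>With s1, c1 for sine and cosine at \<rho> d and s2, c2 for those at \<rho> (\<pi> - d),
  the right-hand sides separate the frequencies \<pi> and \<pi> - 2 d.\<close>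

lemma product_to_sum_combination:
  fixes x x' s1 c1 s2 c2 :: complex
  shows "x' * s1 * c2 + x * c1 * s2 = (x + x') / 2 * (s1 * c2 + c1 * s2) + (x - x') / 2 * (s2 * c1 - c2 * s1)"
    "x * c1 * c2 - x' * s1 * s2 = (x + x') / 2 * (c1 * c2 - s1 * s2) + (x - x') / 2 * (c2 * c1 + s2 * s1)"
  by (simp_all add: field_simps)

text \<open>The second wave of the product-to-sum formula is dominated since \<open>|\<beta> - 1/\<beta>| < \<beta> + 1/\<beta>\<close>.\<close>

lemma dominant_trig_lower_bound:
  fixes \<beta> :: real
  assumes \<beta>: "0 < \<beta>" and d: "0 < d" "d < pi"
  obtains c n0 where "0 < c"
    "\<And>n \<rho>. n0 \<le> n \<Longrightarrow> square_norm \<rho> = real n + 1/2 \<Longrightarrow> c * exp (\<bar>Im \<rho>\<bar> * pi) \<le>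
      norm (of_real (inverse \<beta>) * sin (\<rho> * of_real d) * cos (\<rho> * of_real (pi - d)) + of_real \<beta> * cos (\<rho> * of_real d) * sin (\<rho> * of_real (pi - d)))"
    "\<And>n \<rho>. n0 \<le> n \<Longrightarrow> square_norm \<rho> = real n \<Longrightarrow> c * exp (\<bar>Im \<rho>\<bar> * pi) \<le>
      norm (of_real \<beta> * cos (\<rho> * of_real d) * cos (\<rho> * of_real (pi - d)) - of_real (inverse \<beta>) * sin (\<rho> * of_real d) * sin (\<rho> * of_real (pi - d)))"
proof -
  define b1 where "b1 = (\<beta> + inverse \<beta>) / 2"
  define b2 where "b2 = (\<beta> - inverse \<beta>) / 2"
  have ib: "0 < inverse \<beta>" using \<beta> by simp
  have b: "\<bar>b2\<bar> < b1" using \<beta> ib by (simp add: b1_def b2_def abs_less_iff)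
  \<comment> \<open>Chosen so that (1 - \<epsilon>) b1 still exceeds |b2| by half of the gap b1 -
    |b2|.\<close>
  define \<epsilon> where "\<epsilon> = (b1 - \<bar>b2\<bar>) / (2 * b1)"
  have b10: "0 < b1" using b by linarith
  have e: "0 < \<epsilon>" "b1 * \<epsilon> = (b1 - \<bar>b2\<bar>) / 2" using b b10 by (auto simp: \<epsilon>_def)
  obtain n0 where n0: "\<And>n \<rho>. n0 \<le> n \<Longrightarrow> square_norm \<rho> = real n + 1/2 \<Longrightarrow> (1 - \<epsilon>) * cosh (Im \<rho> * pi) \<le> norm (sin (\<rho> * of_real pi))"
    "\<And>n \<rho>. n0 \<le> n \<Longrightarrow> square_norm \<rho> = real n \<Longrightarrow> (1 - \<epsilon>) * cosh (Im \<rho> * pi) \<le> norm (cos (\<rho> * of_real pi))"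
    using trig_ge_cosh_on_squares[OF e(1)] by blast
  \<comment> \<open>A quarter of the gap: one factor 1/2 is lost to \<epsilon>, the other to the
    passage from cosh to the exponential.\<close>
  define c where "c = (b1 - \<bar>b2\<bar>) / 4"
  have comb: "c * exp (\<bar>Im \<rho>\<bar> * pi) \<le> norm (of_real b1 * s + of_real b2 * t)"
    if "(1 - \<epsilon>) * cosh (Im \<rho> * pi) \<le> norm s" "norm t \<le> cosh (Im \<rho> * pi)" for \<rho> s t :: complex
  proof -
    have "b1 * ((1 - \<epsilon>) * cosh (Im \<rho> * pi)) \<le> b1 * norm s" using that(1) b10 by (intro mult_left_mono) auto
    moreover have "b1 * ((1 - \<epsilon>) * cosh (Im \<rho> * pi)) = (b1 - b1 * \<epsilon>) * cosh (Im \<rho> * pi)" by (simp add: algebra_simps)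
    moreover have "norm (of_real b2 * t) \<le> \<bar>b2\<bar> * cosh (Im \<rho> * pi)"
      unfolding norm_mult using that(2) by (simp add: mult_left_mono)
    moreover have "norm (of_real b1 * s) = b1 * norm s" using b10 by (simp add: norm_mult)
    ultimately have "(b1 - b1 * \<epsilon>) * cosh (Im \<rho> * pi) - \<bar>b2\<bar> * cosh (Im \<rho> * pi) \<le> norm (of_real b1 * s + of_real b2 * t)"
      using norm_diff_ineq[of "of_real b1 * s" "of_real b2 * t"] by linarith
    moreover have "(b1 - b1 * \<epsilon>) * cosh (Im \<rho> * pi) - \<bar>b2\<bar> * cosh (Im \<rho> * pi) = 2 * c * cosh (Im \<rho> * pi)"
      unfolding e(2) c_def by (simp add: field_simps)
    moreover have "exp (\<bar>Im \<rho>\<bar> * pi) \<le> 2 * cosh (Im \<rho> * pi)" by (cases "Im \<rho> \<ge> 0") (auto simp: cosh_field_def)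
    then have "c * exp (\<bar>Im \<rho>\<bar> * pi) \<le> c * (2 * cosh (Im \<rho> * pi))" using b by (intro mult_left_mono) (auto simp: c_def)
    ultimately show ?thesis by (simp only: mult_ac)
  qed
  show ?thesis
  proof (rule that[of c n0])
    show "0 < c" using b by (simp add: c_def)
    fix n \<rho> assume n: "n0 \<le> n" "square_norm \<rho> = real n + 1/2"
    \<comment> \<open>The second wave has frequency \<pi> - 2 d, which does not exceed \<pi> in
      modulus, so its growth is bounded by the cosh of the first.\<close>
    have "\<bar>pi - d - d\<bar> \<le> pi" using d by linarith
    then have i: "norm (sin (\<rho> * of_real (pi - d - d))) \<le> cosh (Im \<rho> * pi)"
      using norm_sin_cos_le_cosh(1)[of "\<rho> * of_real (pi - d - d)"] cosh_scaled_le[of "pi - d - d" "Im \<rho>"] d by simp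
    have eq: "of_real (inverse \<beta>) * sin (\<rho> * of_real d) * cos (\<rho> * of_real (pi - d)) + of_real \<beta> * cos (\<rho> * of_real d) * sin (\<rho> * of_real (pi - d))
      = of_real b1 * sin (\<rho> * of_real pi) + of_real b2 * sin (\<rho> * of_real (pi - d - d))"
    proof -
      have "sin (\<rho> * of_real pi) = sin (\<rho> * of_real d + \<rho> * of_real (pi - d))" "sin (\<rho> * of_real (pi - d - d)) = sin (\<rho> * of_real (pi - d) - \<rho> * of_real d)"
        by (simp_all add: algebra_simps)
      moreover have "complex_of_real b1 = (of_real \<beta> + of_real (inverse \<beta>)) / 2" "complex_of_real b2 = (of_real \<beta> - of_real (inverse \<beta>)) / 2"
        by (simp_all add: b1_def b2_def)
      ultimately show ?thesis by (simp only: sin_add sin_diff product_to_sum_combination)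
    qed
    show "c * exp (\<bar>Im \<rho>\<bar> * pi) \<le> norm (of_real (inverse \<beta>) * sin (\<rho> * of_real d) * cos (\<rho> * of_real (pi - d)) + of_real \<beta> * cos (\<rho> * of_real d) * sin (\<rho> * of_real (pi - d)))"
      unfolding eq by (rule comb[OF n0(1)[OF n] i])
  next
    fix n \<rho> assume n: "n0 \<le> n" "square_norm \<rho> = real n"
    have "\<bar>pi - d - d\<bar> \<le> pi" using d by linarith
    then have i: "norm (cos (\<rho> * of_real (pi - d - d))) \<le> cosh (Im \<rho> * pi)"
      using norm_sin_cos_le_cosh(2)[of "\<rho> * of_real (pi - d - d)"] cosh_scaled_le[of "pi - d - d" "Im \<rho>"] d by simp
    have eq: "of_real \<beta> * cos (\<rho> * of_real d) * cos (\<rho> * of_real (pi - d)) - of_real (inverse \<beta>) * sin (\<rho> * of_real d) * sin (\<rho> * of_real (pi - d))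
      = of_real b1 * cos (\<rho> * of_real pi) + of_real b2 * cos (\<rho> * of_real (pi - d - d))"
    proof -
      have "cos (\<rho> * of_real pi) = cos (\<rho> * of_real d + \<rho> * of_real (pi - d))" "cos (\<rho> * of_real (pi - d - d)) = cos (\<rho> * of_real (pi - d) - \<rho> * of_real d)"
        by (simp_all add: algebra_simps)
      moreover have "complex_of_real b1 = (of_real \<beta> + of_real (inverse \<beta>)) / 2" "complex_of_real b2 = (of_real \<beta> - of_real (inverse \<beta>)) / 2"
        by (simp_all add: b1_def b2_def)
      ultimately show ?thesis by (simp only: cos_add cos_diff product_to_sum_combination)
    qed
    show "c * exp (\<bar>Im \<rho>\<bar> * pi) \<le> norm (of_real \<beta> * cos (\<rho> * of_real d) * cos (\<rho> * of_real (pi - d)) - of_real (inverse \<beta>) * sin (\<rho> * of_real d) * sin (\<rho> * of_real (pi - d)))"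
      unfolding eq by (rule comb[OF n0(2)[OF n] i])
  qed
qed

text \<open>The remainders are smaller than the main terms by a factor of order 1/|\<rho>|, hence at
  most half of them on large squares. The main term at \<pi> is sine-like for y'/\<rho> and
  cosine-like for y, so the two functions use squares of half-integer and of integer size
  respectively.\<close>

lemma jump_pair_lower_bounds:
  assumes q: "q absolutely_integrable_on {0..pi}" and d: "0 < d" "d < pi" and \<beta>: "0 < \<beta>"
  obtains c n0 where "0 < c"
    "\<And>n \<rho> yl zl yr zr. n0 \<le> n \<Longrightarrow> square_norm \<rho> = real n + 1/2 \<Longrightarrow> jump_pair q d \<beta> \<gamma> (\<rho>\<^sup>2) yl zl yr zr \<Longrightarrow> yl 0 = 1 \<Longrightarrow> zl 0 = h \<Longrightarrow>
      c * norm \<rho> * exp (\<bar>Im \<rho>\<bar> * pi) \<le> norm (zr pi + H * yr pi)"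
    "\<And>n \<rho> yl zl yr zr. n0 \<le> n \<Longrightarrow> square_norm \<rho> = real n \<Longrightarrow> jump_pair q d \<beta> \<gamma> (\<rho>\<^sup>2) yl zl yr zr \<Longrightarrow> yl 0 = 1 \<Longrightarrow> zl 0 = h \<Longrightarrow>
      c * exp (\<bar>Im \<rho>\<bar> * pi) \<le> norm (yr pi)"
proof -
  obtain C r0 where C: "0 < C" "1 \<le> r0" and est:
    "\<And>\<rho> yl zl yr zr. r0 \<le> norm \<rho> \<Longrightarrow> jump_pair q d \<beta> \<gamma> (\<rho>\<^sup>2) yl zl yr zr \<Longrightarrow> yl 0 = 1 \<Longrightarrow> zl 0 = h \<Longrightarrow>
      (\<forall>x\<in>{0..d}. norm (yl x) \<le> C * exp (\<bar>Im \<rho>\<bar> * x) \<and> norm (zl x / \<rho>) \<le> C * exp (\<bar>Im \<rho>\<bar> * x)) \<and>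
      (\<forall>x\<in>{d..pi}. norm (yr x) \<le> C * exp (\<bar>Im \<rho>\<bar> * x) \<and> norm (zr x / \<rho>) \<le> C * exp (\<bar>Im \<rho>\<bar> * x)) \<and>
      norm (yr pi - (of_real \<beta> * cos (\<rho> * of_real d) * cos (\<rho> * of_real (pi - d)) - of_real (inverse \<beta>) * sin (\<rho> * of_real d) * sin (\<rho> * of_real (pi - d))))
        \<le> C / norm \<rho> * exp (\<bar>Im \<rho>\<bar> * pi) \<and>
      norm (zr pi / \<rho> + (of_real (inverse \<beta>) * sin (\<rho> * of_real d) * cos (\<rho> * of_real (pi - d)) + of_real \<beta> * cos (\<rho> * of_real d) * sin (\<rho> * of_real (pi - d))))
        \<le> C / norm \<rho> * exp (\<bar>Im \<rho>\<bar> * pi)"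
    using jump_pair_forward_estimate[OF q d \<beta>, of \<gamma> h] by metis
  obtain c n1 where c: "0 < c" and low: "\<And>n \<rho>. n1 \<le> n \<Longrightarrow> square_norm \<rho> = real n + 1/2 \<Longrightarrow> c * exp (\<bar>Im \<rho>\<bar> * pi) \<le>
      norm (of_real (inverse \<beta>) * sin (\<rho> * of_real d) * cos (\<rho> * of_real (pi - d)) + of_real \<beta> * cos (\<rho> * of_real d) * sin (\<rho> * of_real (pi - d)))"
    "\<And>n \<rho>. n1 \<le> n \<Longrightarrow> square_norm \<rho> = real n \<Longrightarrow> c * exp (\<bar>Im \<rho>\<bar> * pi) \<le>
      norm (of_real \<beta> * cos (\<rho> * of_real d) * cos (\<rho> * of_real (pi - d)) - of_real (inverse \<beta>) * sin (\<rho> * of_real d) * sin (\<rho> * of_real (pi - d)))"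
    using dominant_trig_lower_bound[OF \<beta> d] by metis
  \<comment> \<open>From here on the remainder together with the term H y(\<pi>) / \<rho> takes at
    most half of the bound \<open>c\<close>.\<close>
  define r where "r = max r0 (2 * (C + norm H * C) / c)"
  define n0 where "n0 = max n1 (nat \<lceil>r\<rceil>)"
  have big: "r0 \<le> norm \<rho>" "(C + norm H * C) / norm \<rho> \<le> c / 2" "1 \<le> norm \<rho>" "C / norm \<rho> \<le> c / 2" if "n0 \<le> n" "real n \<le> square_norm \<rho>" for n \<rho>
  proof -
    have "r \<le> real n0" unfolding n0_def by linarith
    then have r: "r \<le> norm \<rho>" using that square_norm_le_norm[of \<rho>] by linarith
    then show 1: "r0 \<le> norm \<rho>" by (simp add: r_def)
    then show 2: "1 \<le> norm \<rho>" using C by linarith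
    have "2 * (C + norm H * C) / c \<le> norm \<rho>" using r by (simp add: r_def)
    then show 3: "(C + norm H * C) / norm \<rho> \<le> c / 2"
    proof -
      have "C + norm H * C \<le> c / 2 * norm \<rho>" using \<open>2 * (C + norm H * C) / c \<le> norm \<rho>\<close> c by (simp add: field_simps)
      then show ?thesis using 2 by (subst pos_divide_le_eq) auto
    qed
    have "C / norm \<rho> \<le> (C + norm H * C) / norm \<rho>" using C by (intro divide_right_mono) auto
    with 3 show "C / norm \<rho> \<le> c / 2" by linarith
  qed
  show ?thesis
  proof (rule that[of "c / 2" n0])
    show "0 < c / 2" using c by simp
    fix n \<rho> yl zl yr zr
    assume n: "n0 \<le> n" "square_norm \<rho> = real n + 1/2" and p: "jump_pair q d \<beta> \<gamma> (\<rho>\<^sup>2) yl zl yr zr" "yl 0 = 1" "zl 0 = h"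
    define X where "X = exp (\<bar>Im \<rho>\<bar> * pi)"
    let ?M = "of_real (inverse \<beta>) * sin (\<rho> * of_real d) * cos (\<rho> * of_real (pi - d)) + of_real \<beta> * cos (\<rho> * of_real d) * sin (\<rho> * of_real (pi - d))"
    have b: "r0 \<le> norm \<rho>" "(C + norm H * C) / norm \<rho> \<le> c / 2" "1 \<le> norm \<rho>" using big[OF n(1), of \<rho>] n(2) by auto
    have X: "0 < X" by (simp add: X_def)
    have 1: "norm (zr pi / \<rho> + ?M) \<le> C / norm \<rho> * X" "norm (yr pi) \<le> C * X" using est[OF b(1) p] d by (auto simp: X_def)
    have 2: "c * X \<le> norm ?M" unfolding X_def by (rule low(1)[OF _ n(2)]) (use n(1) in \<open>simp add: n0_def\<close>)
    have 3: "norm (H * yr pi / \<rho>) \<le> norm H * C / norm \<rho> * X"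
      using mult_left_mono[OF 1(2), of "norm H / norm \<rho>"] by (simp add: norm_mult norm_divide)
    have "norm ?M \<le> norm (zr pi / \<rho> + ?M) + (norm (H * yr pi / \<rho>) + norm (zr pi / \<rho> + H * yr pi / \<rho>))"
    proof -
      have "?M = (zr pi / \<rho> + ?M) + (H * yr pi / \<rho> - (zr pi / \<rho> + H * yr pi / \<rho>))" by simp
      then show ?thesis by (metis norm_triangle_le norm_triangle_ineq4 add_left_mono)
    qed
    then have "c * X - (C / norm \<rho> * X + norm H * C / norm \<rho> * X) \<le> norm (zr pi / \<rho> + H * yr pi / \<rho>)" using 1 2 3 by linarith
    moreover have "C / norm \<rho> * X + norm H * C / norm \<rho> * X = (C + norm H * C) / norm \<rho> * X" by (simp add: add_divide_distrib distrib_right)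
    moreover have "(C + norm H * C) / norm \<rho> * X \<le> c / 2 * X" using b(2) X by (intro mult_right_mono) auto
    ultimately have "c / 2 * X \<le> norm (zr pi / \<rho> + H * yr pi / \<rho>)" by linarith
    also have "zr pi / \<rho> + H * yr pi / \<rho> = (zr pi + H * yr pi) / \<rho>" by (simp add: add_divide_distrib)
    finally have "c / 2 * X \<le> norm (zr pi + H * yr pi) / norm \<rho>" unfolding norm_divide .
    then have "c / 2 * X * norm \<rho> \<le> norm (zr pi + H * yr pi)" using b(3) by (subst (asm) pos_le_divide_eq) auto
    then show "c / 2 * norm \<rho> * exp (\<bar>Im \<rho>\<bar> * pi) \<le> norm (zr pi + H * yr pi)"
      by (simp only: X_def mult_ac)
  next
    fix n \<rho> yl zl yr zr
    assume n: "n0 \<le> n" "square_norm \<rho> = real n" and p: "jump_pair q d \<beta> \<gamma> (\<rho>\<^sup>2) yl zl yr zr" "yl 0 = 1" "zl 0 = h"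
    define X where "X = exp (\<bar>Im \<rho>\<bar> * pi)"
    let ?M = "of_real \<beta> * cos (\<rho> * of_real d) * cos (\<rho> * of_real (pi - d)) - of_real (inverse \<beta>) * sin (\<rho> * of_real d) * sin (\<rho> * of_real (pi - d))"
    have b: "r0 \<le> norm \<rho>" "C / norm \<rho> \<le> c / 2" "1 \<le> norm \<rho>" using big[OF n(1), of \<rho>] n(2) by auto
    have X: "0 < X" by (simp add: X_def)
    have 1: "norm (yr pi - ?M) \<le> C / norm \<rho> * X" using est[OF b(1) p] d by (auto simp: X_def)
    have 2: "c * X \<le> norm ?M" unfolding X_def by (rule low(2)[OF _ n(2)]) (use n(1) in \<open>simp add: n0_def\<close>)
    have "C / norm \<rho> * X \<le> c / 2 * X" using b(2) X by (intro mult_right_mono) auto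
    then show "c / 2 * exp (\<bar>Im \<rho>\<bar> * pi) \<le> norm (yr pi)"
      using 1 2 norm_triangle_sub[of ?M "yr pi"] norm_minus_commute[of ?M "yr pi"] unfolding X_def by linarith
  qed
qed

subsection \<open>Entire functions bounded on expanding squares\<close>

lemma maximum_modulus_square:
  assumes g: "g holomorphic_on UNIV" and s: "0 < s" and B: "\<And>\<rho>. square_norm \<rho> = s \<Longrightarrow> norm (g \<rho>) \<le> B"
    and z: "square_norm z \<le> s"
  shows "norm (g z) \<le> B"
proof -
  define S where "S = cbox (Complex (-s) (-s)) (Complex s s)"
  have S: "w \<in> S \<longleftrightarrow> square_norm w \<le> s" for w
    unfolding S_def in_cbox_complex_iff square_norm_def by auto
  show ?thesis
  proof (rule maximum_modulus_frontier[of g S])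
    show "g holomorphic_on interior S" "continuous_on (closure S) g"
      using g by (auto intro: holomorphic_on_subset holomorphic_on_imp_continuous_on)
    show "bounded S" by (simp add: S_def)
    show "z \<in> S" using z S by simp
    fix w assume "w \<in> frontier S"
    then have w: "w \<in> S" "w \<notin> box (Complex (-s) (-s)) (Complex s s)"
      unfolding frontier_def S_def by auto
    then have "square_norm w = s"
      using S[of w] unfolding in_box_complex_iff square_norm_def by auto
    then show "norm (g w) \<le> B" by (rule B)
  qed
qed

lemma entire_small_on_squares_imp_zero:
  assumes g: "g holomorphic_on UNIV" and s: "s \<ge> 0" and small: "\<And>e. 0 < e \<Longrightarrow> \<exists>n0. \<forall>n\<ge>n0. \<forall>\<rho>. square_norm \<rho> = real n + s \<longrightarrow> norm (g \<rho>) \<le> e"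
  shows "g z = 0"
proof -
  have le: "norm (g z) \<le> 0 + e" if e: "0 < e" for e
  proof -
    obtain n0 where n0: "\<And>n \<rho>. n \<ge> n0 \<Longrightarrow> square_norm \<rho> = real n + s \<Longrightarrow> norm (g \<rho>) \<le> e" using small[OF e] by blast
    define n where "n = max (Suc n0) (nat \<lceil>square_norm z\<rceil>)"
    have "square_norm z \<le> real n" unfolding n_def by linarith
    show ?thesis unfolding add_0
    proof (rule maximum_modulus_square[OF g, of "real n + s"])
      show "norm (g \<rho>) \<le> e" if "square_norm \<rho> = real n + s" for \<rho>
        by (rule n0[OF _ that]) (simp add: n_def)
      show "0 < real n + s" using s by (simp add: n_def)
      show "square_norm z \<le> real n + s" using \<open>square_norm z \<le> real n\<close> s by linarith
    qed
  qed
  have "norm (g z) \<le> 0" by (rule field_le_epsilon) (rule le)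
  then show ?thesis by simp
qed

text \<open>The growth bound on the squares spreads inward by the maximum modulus principle, so
  Liouville gives a polynomial. A polynomial that tends to 0 along one unbounded sequence is zero.
  This division of labour requires decay only on the imaginary axis.\<close>

lemma entire_polynomial_on_squares_imp_zero:
  assumes g: "g holomorphic_on UNIV" and s: "0 \<le> s" "s \<le> 1" and B: "0 \<le> B"
    and bound: "\<And>n \<rho>. n \<ge> n0 \<Longrightarrow> square_norm \<rho> = real n + s \<Longrightarrow> norm (g \<rho>) \<le> B * norm \<rho> ^ p"
    and lim: "(\<lambda>n. g (\<i> * of_real (real n + s))) \<longlonglongrightarrow> 0"
  shows "g z = 0"
proof -
  define A where "A = real n0 + 2"
  have poly: "g z = (\<Sum>k\<le>p. (deriv ^^ k) g 0 / fact k * z ^ k)" for z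
  proof (rule Liouville_polynomial[OF g, of A "B * 6 ^ p"])
    fix z :: complex assume z: "A \<le> norm z"
    define n where "n = nat \<lceil>norm z\<rceil>"
    have n: "norm z \<le> real n" "real n \<le> norm z + 1" unfolding n_def using norm_ge_zero[of z] by linarith+
    have n1: "n \<ge> n0" "real n \<ge> 2" using n z unfolding A_def by linarith+
    have "norm (g z) \<le> B * (2 * (real n + s)) ^ p"
    proof (rule maximum_modulus_square[OF g, of "real n + s"])
      show "square_norm z \<le> real n + s" using square_norm_le_norm[of z] n s by linarith
      fix \<rho> assume \<rho>: "square_norm \<rho> = real n + s"
      have "norm (g \<rho>) \<le> B * norm \<rho> ^ p" by (rule bound[OF n1(1) \<rho>])
      also have "\<dots> \<le> B * (2 * (real n + s)) ^ p"
        using norm_le_square_norm[of \<rho>] \<rho> B by (intro mult_left_mono power_mono) auto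
      finally show "norm (g \<rho>) \<le> B * (2 * (real n + s)) ^ p" .
    qed (use n1 s in auto)
    also have "\<dots> \<le> B * (6 * norm z) ^ p"
    proof (intro mult_left_mono power_mono B)
      have "0 \<le> real n0" by simp
      then have "2 \<le> norm z" using z unfolding A_def by linarith
      then show "2 * (real n + s) \<le> 6 * norm z" unfolding distrib_left using n s by linarith
    qed (use s in simp)
    finally show "norm (g z) \<le> B * 6 ^ p * norm z ^ p" by (simp add: power_mult_distrib mult.assoc)
  qed
  define c where "c k = (deriv ^^ k) g 0 / fact k" for k
  have inf: "filterlim (\<lambda>n. \<i> * complex_of_real (real n + s)) at_infinity sequentially"
  proof -
    have "filterlim (\<lambda>n. norm (\<i> * complex_of_real (real n + s))) at_top sequentially"
    proof (rule filterlim_at_top_mono[OF filterlim_real_sequentially])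
      show "\<forall>\<^sub>F n in sequentially. real n \<le> norm (\<i> * complex_of_real (real n + s))"
        using s by (intro always_eventually allI) (simp add: norm_mult del: of_real_add)
    qed
    then show ?thesis by (rule filterlim_norm_at_top_imp_at_infinity)
  qed
  have c0: "c k = 0" if "k \<noteq> 0" "k \<le> p" for k
  proof (rule ccontr)
    assume "c k \<noteq> 0"
    \<comment> \<open>A nonconstant polynomial is bounded below by 1 near infinity, which
      contradicts the decay along the imaginary axis.\<close>
    then have "\<forall>\<^sub>F z in at_infinity. norm (\<Sum>i\<le>p. c i * z ^ i) \<ge> 1"
      using that by (intro polyfun_extremal) auto
    then have "\<forall>\<^sub>F n in sequentially. norm (g (\<i> * complex_of_real (real n + s))) \<ge> 1"
      using inf unfolding filterlim_iff poly[folded c_def] by blast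
    moreover have "\<forall>\<^sub>F n in sequentially. norm (g (\<i> * complex_of_real (real n + s))) < 1"
      using lim order_tendstoD(2)[OF tendsto_norm_zero[OF lim], of 1] by simp
    ultimately have "\<forall>\<^sub>F n in sequentially. False" by eventually_elim linarith
    then show False by simp
  qed
  have const: "g z = c 0" for z
  proof -
    have "g z = (\<Sum>k\<in>{0}. c k * z ^ k)"
      unfolding poly[folded c_def] by (rule sum.mono_neutral_right) (use c0 in auto)
    then show ?thesis by simp
  qed
  have "(\<lambda>n::nat. c 0) \<longlonglongrightarrow> 0" using lim unfolding const .
  then have "c 0 = 0" using LIMSEQ_const_iff by blast
  then show ?thesis using const by simp
qed

subsection \<open>Norming constants as Taylor coefficients\<close>

text \<open>The analytic replacement h may change from point to point: each one shows that the
  singularity is isolated and that the limit exists, which is all that \<open>remove_sings\<close>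
  needs.\<close>

lemma remove_sings_entire:
  assumes "\<And>z. \<exists>h. h analytic_on {z} \<and> (\<forall>\<^sub>F w in at z. f w = h w)"
  shows "remove_sings f holomorphic_on UNIV"
proof -
  have "remove_sings f analytic_on {z}" for z
  proof -
    obtain h where h: "h analytic_on {z}" "\<forall>\<^sub>F w in at z. f w = h w" using assms by blast
    obtain A where A: "open A" "z \<in> A" "h holomorphic_on A" using h(1) analytic_at by blast
    obtain B where B: "open B" "z \<in> B" "\<And>w. w \<in> B \<Longrightarrow> w \<noteq> z \<Longrightarrow> f w = h w"
      using h(2) unfolding eventually_at_topological by blast
    have "f holomorphic_on (A \<inter> B) - {z}"
      by (rule holomorphic_transform[of h]) (use A B in \<open>auto intro: holomorphic_on_subset\<close>)
    then have iso: "isolated_singularity_at f z"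
      using A B by (intro isolated_singularity_at_holomorphic[of f "A \<inter> B"]) auto
    have "isCont h z" using h(1) analytic_at_imp_isCont by blast
    then have "h \<midarrow>z\<rightarrow> h z" by (rule isContD)
    then have "f \<midarrow>z\<rightarrow> h z" using tendsto_cong[OF h(2)] by blast
    with iso show ?thesis by (rule remove_sings_analytic_at)
  qed
  then show ?thesis using analytic_on_analytic_at analytic_imp_holomorphic by blast
qed

text \<open>The difference of quotients is (N F' - N' F) / (X^k F F'), with F and F' invertible.
  Multiply the numerator by A A': since A N and A' N' are 1 modulo X^k, it becomes A' F' - A F
  modulo X^k. The first j coefficients of A F and A' F' agree, so X^j divides the numerator and the
  pole has order at most k - j.\<close>

lemma quotient_difference_removable:
  fixes n f n' f' :: "complex \<Rightarrow> complex"
  assumes e: "n has_fps_expansion N" "f has_fps_expansion (F * fps_X ^ k)" "n' has_fps_expansion N'" "f' has_fps_expansion (F' * fps_X ^ k)"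
    and u: "fps_nth F 0 \<noteq> 0" "fps_nth F' 0 \<noteq> 0"
    and rel: "A * N = 1 - (F * fps_X ^ k) * G" "A' * N' = 1 - (F' * fps_X ^ k) * G'" and jk: "j \<le> k"
    and A: "fps_nth A 0 \<noteq> 0" "fps_nth A' 0 \<noteq> 0"
    and coeff: "\<And>\<nu>. \<nu> < j \<Longrightarrow> fps_nth (A * F) \<nu> = fps_nth (A' * F') \<nu>"
  shows "\<exists>h. h analytic_on {0} \<and> (\<forall>\<^sub>F w in at 0. w ^ (k - j) * (n w / f w - n' w / f' w) = h w)"
proof -
  have sub: "subdegree (F * fps_X ^ k) = k" "subdegree (F' * fps_X ^ k) = k"
    using u by (auto intro!: subdegreeI simp: fps_X_power_mult_right_nth)
  define d where "d w = (if w = 0 then fps_nth (F * fps_X ^ k) k else f w / w ^ k)" for w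
  define d' where "d' w = (if w = 0 then fps_nth (F' * fps_X ^ k) k else f' w / w ^ k)" for w
  have d: "d has_fps_expansion F" "d' has_fps_expansion F'"
    using has_fps_expansion_shift[OF e(2), of k] has_fps_expansion_shift[OF e(4), of k] sub
    by (auto simp: d_def[abs_def] d'_def[abs_def] fps_shift_times_fps_X_power)
  define Z where "Z = N * F' - N' * F"
  define zf where "zf w = n w * d' w - n' w * d w" for w
  have z: "zf has_fps_expansion Z" unfolding zf_def Z_def by (intro fps_expansion_intros e d)
  have "fps_X ^ j dvd Z"
  proof -
    have "A * A' * Z = (A * N) * (A' * F') - (A' * N') * (A * F)" unfolding Z_def by (simp add: algebra_simps)
    also have "\<dots> = (A' * F' - A * F) + fps_X ^ k * (F' * G' * (A * F) - F * G * (A' * F'))"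
      unfolding rel by (simp add: algebra_simps)
    finally have eq: "A * A' * Z = (A' * F' - A * F) + fps_X ^ k * (F' * G' * (A * F) - F * G * (A' * F'))" .
    have "fps_X ^ j dvd (A' * F' - A * F)"
    proof (cases "A' * F' - A * F = 0")
      case False
      then have "j \<le> subdegree (A' * F' - A * F)" using coeff by (intro subdegree_geI) auto
      then show ?thesis using False by (subst fps_dvd_iff) auto
    qed simp
    moreover have "fps_X ^ j dvd (fps_X ^ k :: complex fps)" using jk by (rule le_imp_power_dvd)
    ultimately have "fps_X ^ j dvd A * A' * Z" unfolding eq by (intro dvd_add dvd_mult2)
    moreover have "is_unit (A * A')" using A by simp
    ultimately show ?thesis by (simp only: dvd_mult_unit_iff')
  qed
  have F0: "d 0 \<noteq> 0" "d' 0 \<noteq> 0" unfolding d_def d'_def using u by (auto simp: fps_mult_nth_0 fps_X_power_mult_right_nth)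
  have cont: "isCont d 0" "isCont d' 0" using d has_fps_expansion_imp_continuous by blast+
  have nz: "\<forall>\<^sub>F w in at 0. d w \<noteq> 0 \<and> d' w \<noteq> 0"
    using cont F0 by (auto simp: isCont_def intro!: eventually_conj tendsto_imp_eventually_ne)
  have key: "\<forall>\<^sub>F w in at 0. w ^ (k - j) * (n w / f w - n' w / f' w) = (zf w / w ^ j) / (d w * d' w)"
  proof -
    have "\<forall>\<^sub>F w in at (0::complex). w \<noteq> 0" by (auto simp: eventually_at_filter)
    with nz show ?thesis
    proof eventually_elim
      case (elim w)
      have fw: "f w = w ^ k * d w" "f' w = w ^ k * d' w" using elim by (auto simp: d_def d'_def)
      have wk: "w ^ k = w ^ j * w ^ (k - j)" using jk by (simp add: power_add[symmetric])
      show ?case unfolding fw zf_def wk using elim by (simp add: field_simps)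
    qed
  qed
  show ?thesis
  \<comment> \<open>The zero series has subdegree 0 by convention, so divisibility by X^j says
    nothing about its subdegree; it is treated apart.\<close>
  proof (cases "Z = 0")
    case True
    have "\<forall>\<^sub>F w in nhds 0. zf w = 0" using z unfolding True has_fps_expansion_0_iff .
    then have "\<forall>\<^sub>F w in at 0. zf w = 0" by (simp add: eventually_at_filter eventually_mono)
    with key have "\<forall>\<^sub>F w in at 0. w ^ (k - j) * (n w / f w - n' w / f' w) = 0"
      by eventually_elim simp
    then show ?thesis by (intro exI[of _ "\<lambda>_. 0"]) auto
  next
    case False
    then have "j \<le> subdegree Z" using \<open>fps_X ^ j dvd Z\<close> by (subst (asm) fps_dvd_iff) auto
    then have s: "(\<lambda>w. if w = 0 then fps_nth Z j else zf w / w ^ j) has_fps_expansion fps_shift j Z"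
      using has_fps_expansion_shift[OF z] by simp
    have "fps_nth (F * F') 0 \<noteq> 0" using u by simp
    then have "(\<lambda>w. (if w = 0 then fps_nth Z j else zf w / w ^ j) / (d w * d' w)) has_fps_expansion fps_shift j Z / (F * F')"
      by (intro has_fps_expansion_divide' s has_fps_expansion_mult d)
    then have "(\<lambda>w. (if w = 0 then fps_nth Z j else zf w / w ^ j) / (d w * d' w)) analytic_on {0}"
      by (rule has_fps_expansion_imp_analytic_0)
    moreover have "\<forall>\<^sub>F w in at 0. w ^ (k - j) * (n w / f w - n' w / f' w) = (if w = 0 then fps_nth Z j else zf w / w ^ j) / (d w * d' w)"
    proof -
      have "\<forall>\<^sub>F w in at (0::complex). w \<noteq> 0" by (auto simp: eventually_at_filter)
      with key show ?thesis by eventually_elim simp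
    qed
    ultimately show ?thesis by blast
  qed
qed

text \<open>Admits a root function as a factor under the integral: bounded and integrable, but
  possibly discontinuous at \<open>d\<close>.\<close>

lemma param_family_mult:
  assumes pf: "param_family S f (\<lambda>_. 1)" and S: "S \<in> sets lebesgue"
    and u: "u absolutely_integrable_on S" "\<And>x. x \<in> S \<Longrightarrow> norm (u x) \<le> B"
  shows "param_family S (\<lambda>x z. u x * f x z) (\<lambda>_. 1)"
  unfolding param_family_def
proof (intro conjI ballI allI)
  show "(\<lambda>z. u x * f x z) holomorphic_on UNIV" if "x \<in> S" for x
    using pf that unfolding param_family_def by (intro holomorphic_intros) blast
  show "(\<lambda>x. u x * f x z) absolutely_integrable_on S" for z
  proof (rule absolutely_integrable_bounded_measurable_product[of times])
    show "bilinear (times :: complex \<Rightarrow> complex \<Rightarrow> complex)"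
      by (simp add: bilinear_conv_bounded_bilinear bounded_bilinear_mult)
    show "u \<in> borel_measurable (lebesgue_on S)" using u(1) S by (rule absolutely_integrable_imp_borel_measurable)
    show "bounded (u ` S)" using u(2) by (auto simp: bounded_iff)
    show "(\<lambda>x. f x z) absolutely_integrable_on S" using pf unfolding param_family_def by blast
  qed (rule S)
  fix R
  obtain K where K: "\<forall>x\<in>S. \<forall>z. norm z \<le> R \<longrightarrow> norm (f x z) \<le> K * 1" using pf unfolding param_family_def by blast
  have "norm (u x * f x z) \<le> (\<bar>B\<bar> * \<bar>K\<bar>) * 1" if "x \<in> S" "norm z \<le> R" for x z
  proof -
    have "norm (f x z) \<le> \<bar>K\<bar>" using K that by fastforce
    moreover have "norm (u x) \<le> \<bar>B\<bar>" using u(2)[OF that(1)] by linarith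
    ultimately show ?thesis unfolding norm_mult mult_1_right by (intro mult_mono) auto
  qed
  then show "\<exists>K. \<forall>x\<in>S. \<forall>z. norm z \<le> R \<longrightarrow> norm (u x * f x z) \<le> K * 1" by blast
qed (use pf in \<open>auto simp: param_family_def\<close>)

lemma param_family_bounded:
  assumes "param_family S f (\<lambda>_. 1)"
  obtains B where "\<And>x. x \<in> S \<Longrightarrow> norm (f x z) \<le> B"
  using assms unfolding param_family_def by (metis mult_1_right order_refl)

text \<open>The two-parameter identity is expanded in one parameter at z0 while mu stays free, which
  gives a recursion for \<open>A i mu\<close>, the integral of \<open>r i\<close> against the
  solution at mu. Solving it gives (mu - z0)^(i+1) \<open>A i mu\<close> = - Delta(mu) times the
  Taylor polynomial of \<open>a\<close> of degree i. Expanding this in mu as well and comparing one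
  coefficient yields the norming constant.\<close>

lemma norming_coefficients_fps:
  fixes \<psi> :: "complex \<Rightarrow> real \<Rightarrow> complex" and S :: "real set"
  assumes pf: "param_family S (\<lambda>x z. \<psi> z x) (\<lambda>_. 1)" and S: "S \<in> sets lebesgue"
    and hol: "a holomorphic_on UNIV" "\<Delta> holomorphic_on UNIV"
    and ident: "\<And>lam mu. (lam - mu) * integral S (\<lambda>x. \<psi> lam x * \<psi> mu x) = \<Delta> mu * a lam - \<Delta> lam * a mu"
    and zero: "fps_expansion \<Delta> z0 = D * fps_X ^ k" and \<nu>: "\<nu> < k"
  defines "r \<equiv> \<lambda>i x. (deriv ^^ i) (\<lambda>z. \<psi> z x) z0 / fact i"
  shows "integral S (\<lambda>x. r \<nu> x * r (k - 1) x) = - fps_nth (fps_expansion a z0 * D) \<nu>"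
proof -
  have hder: "(\<lambda>x. (deriv ^^ i) (\<lambda>z. \<psi> z x) z0) absolutely_integrable_on S" for i
    using param_family_higher_deriv(1)[OF pf, of i] unfolding param_family_def by blast
  have rint: "r i absolutely_integrable_on S" for i
    unfolding r_def using set_integrable_mult_left[OF hder[of i], of "1 / fact i"] by simp
  have rbd: "\<exists>B. \<forall>x\<in>S. norm (r i x) \<le> B" for i
  proof -
    obtain B where "\<And>x. x \<in> S \<Longrightarrow> norm ((deriv ^^ i) (\<lambda>z. \<psi> z x) z0) \<le> B"
      using param_family_bounded[OF param_family_higher_deriv(1)[OF pf, of i], of z0] by blast
    then have "\<forall>x\<in>S. norm (r i x) \<le> B / fact i" unfolding r_def by (auto simp: norm_divide intro!: divide_right_mono)
    then show ?thesis by blast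
  qed
  define A where "A i mu = integral S (\<lambda>x. r i x * \<psi> mu x)" for i mu
  have pfr: "param_family S (\<lambda>x z. r i x * \<psi> z x) (\<lambda>_. 1)" for i
    using rbd[of i] by (auto intro: param_family_mult[OF pf S rint])
  have Ahol: "A i holomorphic_on UNIV" for i
    unfolding A_def[abs_def] by (rule param_family_holomorphic[OF pfr])
  have coeff_cmult: "(deriv ^^ n) (\<lambda>z. c * \<psi> z x) z0 = c * (deriv ^^ n) (\<lambda>z. \<psi> z x) z0" if "x \<in> S" for c n x
    using pf that unfolding param_family_def by (intro higher_deriv_cmult[of _ UNIV]) auto
  have Acoeff: "fps_nth (fps_expansion (A i) z0) n = integral S (\<lambda>x. r i x * r n x)" for i n
  proof -
    have "(deriv ^^ n) (A i) z0 = integral S (\<lambda>x. (deriv ^^ n) (\<lambda>z. r i x * \<psi> z x) z0)"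
      unfolding A_def[abs_def] using param_family_higher_deriv(2)[OF pfr[of i], of n] by simp
    also have "\<dots> = integral S (\<lambda>x. r i x * (deriv ^^ n) (\<lambda>z. \<psi> z x) z0)"
      by (rule Henstock_Kurzweil_Integration.integral_cong) (simp add: coeff_cmult)
    finally have "(deriv ^^ n) (A i) z0 / fact n = integral S (\<lambda>x. r i x * (deriv ^^ n) (\<lambda>z. \<psi> z x) z0 / fact n)" by simp
    then show ?thesis by (simp add: fps_expansion_def r_def)
  qed
  define F where "F mu lam = integral S (\<lambda>x. \<psi> mu x * \<psi> lam x)" for mu lam
  have \<psi>int: "\<psi> mu absolutely_integrable_on S" for mu using pf unfolding param_family_def by blast
  have pfF: "param_family S (\<lambda>x z. \<psi> mu x * \<psi> z x) (\<lambda>_. 1)" for mu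
    using param_family_bounded[OF pf, of mu] by (metis param_family_mult[OF pf S \<psi>int])
  have Fhol: "F mu holomorphic_on UNIV" for mu unfolding F_def[abs_def] by (rule param_family_holomorphic[OF pfF])
  have Fcoeff: "fps_nth (fps_expansion (F mu) z0) n = A n mu" for mu n
  proof -
    have "(deriv ^^ n) (F mu) z0 = integral S (\<lambda>x. (deriv ^^ n) (\<lambda>z. \<psi> mu x * \<psi> z x) z0)"
      unfolding F_def[abs_def] using param_family_higher_deriv(2)[OF pfF[of mu], of n] by simp
    also have "\<dots> = integral S (\<lambda>x. \<psi> mu x * (deriv ^^ n) (\<lambda>z. \<psi> z x) z0)"
      by (rule Henstock_Kurzweil_Integration.integral_cong) (simp add: coeff_cmult)
    finally have "(deriv ^^ n) (F mu) z0 / fact n = integral S (\<lambda>x. \<psi> mu x * (deriv ^^ n) (\<lambda>z. \<psi> z x) z0 / fact n)" by simp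
    then show ?thesis by (simp add: fps_expansion_def A_def r_def mult_ac)
  qed
  have ex: "(\<lambda>w. f (z0 + w)) has_fps_expansion fps_expansion f z0" if "f holomorphic_on UNIV" for f
    using that by (intro analytic_at_imp_has_fps_expansion) (auto simp: analytic_at)
  have Fid: "(fps_X + fps_const (z0 - mu)) * fps_expansion (F mu) z0
      = fps_const (\<Delta> mu) * fps_expansion a z0 - fps_const (a mu) * fps_expansion \<Delta> z0" for mu
  proof (rule fps_expansion_unique_complex)
    show "(\<lambda>w. (w + (z0 - mu)) * F mu (z0 + w)) has_fps_expansion (fps_X + fps_const (z0 - mu)) * fps_expansion (F mu) z0"
      by (intro has_fps_expansion_mult has_fps_expansion_add has_fps_expansion_fps_X has_fps_expansion_const ex Fhol)
    have "(w + (z0 - mu)) * F mu (z0 + w) = \<Delta> mu * a (z0 + w) - a mu * \<Delta> (z0 + w)" for w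
      using ident[of "z0 + w" mu] unfolding F_def by (simp add: algebra_simps)
    then show "(\<lambda>w. (w + (z0 - mu)) * F mu (z0 + w)) has_fps_expansion fps_const (\<Delta> mu) * fps_expansion a z0 - fps_const (a mu) * fps_expansion \<Delta> z0"
      by (simp only:) (intro has_fps_expansion_diff has_fps_expansion_mult has_fps_expansion_const ex hol)
  qed
  define ah where "ah = fps_nth (fps_expansion a z0)"
  \<comment> \<open>For i < k the i-th Taylor coefficient of Delta at z0 vanishes, so only the term
    with Delta(mu) survives in the i-th coefficient of \<open>Fid\<close>.\<close>
  have step: "(mu - z0) * A i mu = (if i = 0 then 0 else A (i - 1) mu) - \<Delta> mu * ah i" if "i < k" for i mu
  proof -
    have "fps_nth (fps_expansion \<Delta> z0) i = 0" unfolding zero using that by (simp add: fps_X_power_mult_right_nth)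
    then have "fps_nth (fps_const (\<Delta> mu) * fps_expansion a z0 - fps_const (a mu) * fps_expansion \<Delta> z0) i = \<Delta> mu * ah i"
      by (simp add: ah_def)
    moreover have "fps_nth ((fps_X + fps_const (z0 - mu)) * fps_expansion (F mu) z0) i = (if i = 0 then 0 else A (i - 1) mu) + (z0 - mu) * A i mu"
      by (simp add: distrib_right Fcoeff)
    ultimately have "(if i = 0 then 0 else A (i - 1) mu) + (z0 - mu) * A i mu = \<Delta> mu * ah i" unfolding Fid by simp
    then show ?thesis by (simp add: algebra_simps)
  qed
  have closed: "(mu - z0) ^ Suc i * A i mu = - (\<Delta> mu * (\<Sum>j\<le>i. ah j * (mu - z0) ^ j))" if "i < k" for i mu
    using that
  proof (induction i)
    case 0
    then show ?case using step[of 0 mu] by simp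
  next
    case (Suc i)
    have "(mu - z0) ^ Suc (Suc i) * A (Suc i) mu = (mu - z0) ^ Suc i * ((mu - z0) * A (Suc i) mu)" by simp
    also have "\<dots> = (mu - z0) ^ Suc i * A i mu - \<Delta> mu * ah (Suc i) * (mu - z0) ^ Suc i"
      unfolding step[OF Suc.prems] by (simp add: algebra_simps)
    also have "(mu - z0) ^ Suc i * A i mu = - (\<Delta> mu * (\<Sum>j\<le>i. ah j * (mu - z0) ^ j))" using Suc by simp
    finally show ?case by (simp add: algebra_simps)
  qed
  define T where "T = (\<Sum>j\<le>\<nu>. fps_const (ah j) * fps_X ^ j)"
  have T: "fps_nth T i = ah i" if "i \<le> \<nu>" for i
  proof -
    have "fps_nth T i = (\<Sum>j\<le>\<nu>. if j = i then ah j else 0)" unfolding T_def fps_sum_nth by (intro sum.cong) auto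
    then show ?thesis using that by simp
  qed
  have "fps_X ^ Suc \<nu> * fps_expansion (A \<nu>) z0 = - (fps_expansion \<Delta> z0 * T)"
  proof (rule fps_expansion_unique_complex)
    show "(\<lambda>w. w ^ Suc \<nu> * A \<nu> (z0 + w)) has_fps_expansion fps_X ^ Suc \<nu> * fps_expansion (A \<nu>) z0"
      by (intro has_fps_expansion_mult has_fps_expansion_fps_X_power ex Ahol)
    have "w ^ Suc \<nu> * A \<nu> (z0 + w) = - (\<Delta> (z0 + w) * (\<Sum>j\<le>\<nu>. ah j * w ^ j))" for w
      using closed[OF \<nu>, of "z0 + w"] by simp
    then show "(\<lambda>w. w ^ Suc \<nu> * A \<nu> (z0 + w)) has_fps_expansion - (fps_expansion \<Delta> z0 * T)"
      unfolding T_def by (simp only:) (intro has_fps_expansion_minus has_fps_expansion_mult has_fps_expansion_sum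
        has_fps_expansion_const has_fps_expansion_fps_X_power ex hol)
  qed
  \<comment> \<open>On the left the index \<nu> + k, lowered by \<nu> + 1, is the coefficient k - 1
    of \<open>A \<nu>\<close>, that is, the integral of \<open>r \<nu>\<close> against
    \<open>r (k - 1)\<close>. On the right, lowered by k, it is the coefficient \<nu> of D T, where
    T may be replaced by the full series of \<open>a\<close>.\<close>
  then have "fps_nth (fps_X ^ Suc \<nu> * fps_expansion (A \<nu>) z0) (\<nu> + k) = - fps_nth (D * T * fps_X ^ k) (\<nu> + k)"
    unfolding zero by (simp add: mult_ac)
  moreover have "fps_nth (fps_X ^ Suc \<nu> * fps_expansion (A \<nu>) z0) (\<nu> + k) = fps_nth (fps_expansion (A \<nu>) z0) (k - 1)"
    unfolding fps_X_power_mult_nth using \<nu> by (simp add: Suc_diff_Suc)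
  moreover have "fps_nth (D * T * fps_X ^ k) (\<nu> + k) = fps_nth (D * T) \<nu>"
    unfolding fps_X_power_mult_right_nth by simp
  moreover have "fps_nth (D * T) \<nu> = fps_nth (fps_expansion a z0 * D) \<nu>"
    unfolding mult.commute[of "fps_expansion a z0" D] fps_mult_nth by (intro sum.cong) (auto simp: T ah_def)
  ultimately show ?thesis using Acoeff[of \<nu> "k - 1"] by simp
qed

section \<open>Norming constants of the jump problem\<close>

definition join :: "real \<Rightarrow> (complex \<Rightarrow> real \<Rightarrow> complex) \<Rightarrow> (complex \<Rightarrow> real \<Rightarrow> complex) \<Rightarrow> complex \<Rightarrow> real \<Rightarrow> complex" where
  "join d yl yr lam x = (if x < d then yl lam x else yr lam x)"

lemma sl_family_continuous:
  assumes "sl_family q d \<beta> \<gamma> yl zl yr zr"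
  shows "continuous_on {0..d} (yl lam)" "continuous_on {d..pi} (yr lam)"
  using assms sl_piece_continuous(1) unfolding sl_family_def jump_pair_def by blast+

lemma join_integral:
  fixes d :: real and u v :: "real \<Rightarrow> complex"
  assumes d: "0 < d" "d < pi" and c: "continuous_on {0..d} u" "continuous_on {d..pi} v"
  shows "(\<lambda>x. if x < d then u x else v x) absolutely_integrable_on {0..pi}"
    "integral {0..pi} (\<lambda>x. if x < d then u x else v x) = integral {0..d} u + integral {d..pi} v"
proof -
  let ?f = "\<lambda>x. if x < d then u x else v x"
  have n: "negligible {d}" by simp
  have l: "?f absolutely_integrable_on {0..d}"
    by (rule absolutely_integrable_spike[OF absolutely_integrable_continuous_real[OF c(1)] n]) auto
  have r: "?f absolutely_integrable_on {d..pi}"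
    by (rule absolutely_integrable_spike[OF absolutely_integrable_continuous_real[OF c(2)] n]) auto
  have "?f absolutely_integrable_on {0..d} \<union> {d..pi}" by (rule set_integrable_Un[OF l r]) auto
  moreover have "{0..d} \<union> {d..pi} = {0..pi}" using d by auto
  ultimately show a: "?f absolutely_integrable_on {0..pi}" by simp
  have "integral {0..pi} ?f = integral {0..d} ?f + integral {d..pi} ?f"
    using a d by (intro Henstock_Kurzweil_Integration.integral_combine[symmetric] set_lebesgue_integral_eq_integral(1)) auto
  also have "integral {0..d} ?f = integral {0..d} u" by (rule integral_spike[OF n]) auto
  also have "integral {d..pi} ?f = integral {d..pi} v" by (rule integral_spike[OF n]) auto
  finally show "integral {0..pi} ?f = integral {0..d} u + integral {d..pi} v" .
qed

lemma join_param_family: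
  assumes d: "0 < d" "d < pi" and f: "sl_family q d \<beta> \<gamma> yl zl yr zr"
  shows "param_family {0..pi} (\<lambda>x z. join d yl yr z x) (\<lambda>_. 1)"
  unfolding param_family_def
proof (intro conjI ballI allI)
  show "(\<lambda>z. join d yl yr z x) holomorphic_on UNIV" if "x \<in> {0..pi}" for x
    using f that unfolding join_def sl_family_def by (cases "x < d") auto
  show "(\<lambda>x. join d yl yr z x) absolutely_integrable_on {0..pi}" for z
    unfolding join_def by (rule join_integral(1)[OF d sl_family_continuous[OF f]])
  fix R
  obtain K where K: "\<forall>lam. norm lam \<le> R \<longrightarrow> (\<forall>x\<in>{0..d}. norm (yl lam x) \<le> K) \<and> (\<forall>x\<in>{d..pi}. norm (yr lam x) \<le> K)"
    using f unfolding sl_family_def by blast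
  have "norm (join d yl yr z x) \<le> K * 1" if "x \<in> {0..pi}" "norm z \<le> R" for x z
    using K that unfolding join_def by auto
  then show "\<exists>K. \<forall>x\<in>{0..pi}. \<forall>z. norm z \<le> R \<longrightarrow> norm (join d yl yr z x) \<le> K * 1" by blast
qed auto

lemma join_product_integral:
  assumes d: "0 < d" "d < pi" and f: "sl_family q d \<beta> \<gamma> yl zl yr zr"
  shows "integral {0..pi} (\<lambda>x. join d yl yr lam x * join d yl yr mu x) =
    integral {0..d} (\<lambda>x. yl lam x * yl mu x) + integral {d..pi} (\<lambda>x. yr lam x * yr mu x)"
proof -
  have "(\<lambda>x. join d yl yr lam x * join d yl yr mu x) = (\<lambda>x. if x < d then yl lam x * yl mu x else yr lam x * yr mu x)"
    by (auto simp: join_def)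
  then show ?thesis using join_integral(2)[OF d, of "\<lambda>x. yl lam x * yl mu x" "\<lambda>x. yr lam x * yr mu x"]
    by (simp add: continuous_on_mult sl_family_continuous[OF f])
qed

text \<open>The solution inside \<open>norming_const\<close> is arbitrary at \<open>d\<close>, so
  its parameter derivatives there are uncontrolled; being a null set, \<open>d\<close> can be
  ignored. Absolute integrability of the product is established before passing from the Lebesgue
  integral of the definition to the gauge integral.\<close>

lemma norming_const_eq_coefficient:
  assumes d: "0 < d" "d < pi" and f: "sl_family q d \<beta> \<gamma> yl zl yr zr"
    and \<psi>: "\<And>z x. x \<in> {0..<d} \<Longrightarrow> \<psi> z x = yl z x" "\<And>z x. x \<in> {d<..pi} \<Longrightarrow> \<psi> z x = yr z x"
    and hol: "a holomorphic_on UNIV" "\<Delta> holomorphic_on UNIV"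
    and ident: "\<And>lam mu. (lam - mu) * (integral {0..d} (\<lambda>x. yl lam x * yl mu x) + integral {d..pi} (\<lambda>x. yr lam x * yr mu x)) = \<Delta> mu * a lam - \<Delta> lam * a mu"
    and zero: "fps_expansion \<Delta> (l n) = D * fps_X ^ k" and k: "alg_mult F l n = k" and \<nu>: "\<nu> < k"
  shows "norming_const F \<psi> l n \<nu> = - fps_nth (fps_expansion a (l n) * D) \<nu>"
proof -
  define r where "r i x = (deriv ^^ i) (\<lambda>z. join d yl yr z x) (l n) / fact i" for i x
  note pf = join_param_family[OF d f]
  have eq: "integral {0..pi} (\<lambda>x. r \<nu> x * r (k - 1) x) = - fps_nth (fps_expansion a (l n) * D) \<nu>"
    unfolding r_def
    by (rule norming_coefficients_fps[OF pf _ hol _ zero \<nu>]) (simp_all add: join_product_integral[OF d f] ident)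
  have hder: "(\<lambda>x. (deriv ^^ i) (\<lambda>z. join d yl yr z x) (l n)) absolutely_integrable_on {0..pi}" for i
    using param_family_higher_deriv(1)[OF pf, of i] unfolding param_family_def by blast
  have rint: "r i absolutely_integrable_on {0..pi}" for i
    unfolding r_def[abs_def] using set_integrable_mult_left[OF hder[of i], of "1 / fact i"] by simp
  obtain B where B: "\<And>x. x \<in> {0..pi} \<Longrightarrow> norm ((deriv ^^ \<nu>) (\<lambda>z. join d yl yr z x) (l n)) \<le> B"
    using param_family_bounded[OF param_family_higher_deriv(1)[OF pf, of \<nu>], of "l n"] by blast
  have prod: "(\<lambda>x. r \<nu> x * r (k - 1) x) absolutely_integrable_on {0..pi}"
  proof (rule absolutely_integrable_bounded_measurable_product[of times])
    show "bilinear (times :: complex \<Rightarrow> complex \<Rightarrow> complex)"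
      by (simp add: bilinear_conv_bounded_bilinear bounded_bilinear_mult)
    show "r \<nu> \<in> borel_measurable (lebesgue_on {0..pi})" by (rule absolutely_integrable_imp_borel_measurable[OF rint]) simp
    have "\<forall>x\<in>{0..pi}. norm (r \<nu> x) \<le> B / fact \<nu>" unfolding r_def using B by (auto simp: norm_divide intro!: divide_right_mono)
    then show "bounded (r \<nu> ` {0..pi})" by (auto simp: bounded_iff)
  qed (use rint in auto)
  have root: "root_fun \<psi> l n i x = r i x" if "x \<in> {0..pi} - {d}" for i x
  proof -
    have "(\<lambda>z. \<psi> z x) = (\<lambda>z. join d yl yr z x)" using that \<psi> by (auto simp: join_def fun_eq_iff)
    then show ?thesis by (simp add: root_fun_def r_def)
  qed
  have n: "negligible {d}" by simp
  have "(\<lambda>x. root_fun \<psi> l n \<nu> x * root_fun \<psi> l n (k - 1) x) absolutely_integrable_on {0..pi}"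
    by (rule absolutely_integrable_spike[OF prod n]) (simp add: root)
  then have "norming_const F \<psi> l n \<nu> = integral {0..pi} (\<lambda>x. root_fun \<psi> l n \<nu> x * root_fun \<psi> l n (k - 1) x)"
    unfolding norming_const_def k by (rule set_lebesgue_integral_eq_integral(2))
  also have "\<dots> = integral {0..pi} (\<lambda>x. r \<nu> x * r (k - 1) x)"
    by (rule integral_spike[OF n]) (simp add: root)
  finally show ?thesis using eq by simp
qed

lemma entire_fps_at_zero:
  assumes "\<Delta> holomorphic_on UNIV" "\<Delta> w \<noteq> 0"
  obtains D where "fps_expansion \<Delta> z = D * fps_X ^ nat (zorder \<Delta> z)" "fps_nth D 0 \<noteq> 0"
proof -
  have e: "(\<lambda>x. \<Delta> (z + x)) has_fps_expansion fps_expansion \<Delta> z"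
    using assms(1) by (intro analytic_at_imp_has_fps_expansion) (auto simp: analytic_at)
  have nz: "fps_expansion \<Delta> z \<noteq> 0"
  proof
    assume "fps_expansion \<Delta> z = 0"
    then have "\<forall>\<^sub>F x in nhds 0. \<Delta> (z + x) = 0" using e has_fps_expansion_0_iff by metis
    then obtain S where S: "open S" "0 \<in> S" "\<And>x. x \<in> S \<Longrightarrow> \<Delta> (z + x) = 0" unfolding eventually_nhds by blast
    have "\<Delta> (z + (w - z)) = 0"
    proof (rule analytic_continuation_open[of S UNIV "\<lambda>x. \<Delta> (z + x)" "\<lambda>_. 0" "w - z"])
      show "(\<lambda>x. \<Delta> (z + x)) holomorphic_on UNIV"
        using holomorphic_on_compose_gen[of "\<lambda>x. z + x" UNIV \<Delta> UNIV] assms(1) by (simp add: o_def holomorphic_on_add)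
    qed (use S in auto)
    then show False using assms(2) by simp
  qed
  have z: "nat (zorder \<Delta> z) = subdegree (fps_expansion \<Delta> z)" using has_fps_expansion_zorder[OF e nz] by simp
  show ?thesis
  proof (rule that)
    show "fps_expansion \<Delta> z = fps_shift (subdegree (fps_expansion \<Delta> z)) (fps_expansion \<Delta> z) * fps_X ^ nat (zorder \<Delta> z)"
      unfolding z by (rule subdegree_decompose)
    show "fps_nth (fps_shift (subdegree (fps_expansion \<Delta> z)) (fps_expansion \<Delta> z)) 0 \<noteq> 0" using nz by simp
  qed
qed

section \<open>Finiteness of the exceptional eigenvalues and removal of the poles\<close>

lemma finite_sum_le_infsum_ennreal:
  fixes f :: "'a \<Rightarrow> ennreal"
  assumes "finite B" "B \<subseteq> A"
  shows "sum f B \<le> infsum f A"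
proof -
  have "infsum f A = (SUP F\<in>{F. finite F \<and> F \<subseteq> A}. sum f F)" by (rule nonneg_infsum_complete) simp
  then show ?thesis using assms by (auto intro: SUP_upper)
qed

text \<open>Positive natural numbers are at least 1, so a finite total leaves room for finitely many
  of them. Hence only finitely many eigenvalues are exceptional and the product \<open>Q\<close>
  built from them is a polynomial.\<close>

lemma ennreal_infsum_nat_bound:
  fixes f :: "'a \<Rightarrow> nat"
  assumes "infsum (\<lambda>n. of_nat (f n) :: ennreal) A \<le> of_nat N"
  shows "finite {n \<in> A. 0 < f n}" "\<And>B. finite B \<Longrightarrow> B \<subseteq> A \<Longrightarrow> sum f B \<le> N"
proof -
  show b: "sum f B \<le> N" if "finite B" "B \<subseteq> A" for B
  proof -
    have "(\<Sum>n\<in>B. of_nat (f n) :: ennreal) \<le> infsum (\<lambda>n. of_nat (f n)) A"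
      by (rule finite_sum_le_infsum_ennreal[OF that])
    with assms have "(of_nat (sum f B) :: ennreal) \<le> of_nat N" by simp
    then show ?thesis by (simp only: of_nat_le_iff)
  qed
  show "finite {n \<in> A. 0 < f n}"
  proof (rule ccontr)
    assume "infinite {n \<in> A. 0 < f n}"
    then obtain B where B: "B \<subseteq> {n \<in> A. 0 < f n}" "finite B" "card B = Suc N" using infinite_arbitrarily_large by blast
    have "card B = sum (\<lambda>_. 1) B" by simp
    also have "\<dots> \<le> sum f B" using B by (intro sum_mono) auto
    also have "\<dots> \<le> N" using B by (intro b) auto
    finally show False using B by simp
  qed
qed

text \<open>Stated for abstract \<open>M\<close>, \<open>a\<close> and \<open>G\<close> so that both
  cases are instances: (Delta, N, \<psi>(0), \<psi>-infinity(0)) and (-N, Delta, \<psi>-infinity(0),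
  -\<psi>(0)) in the places of (Delta, M, a, G). The relation \<open>rel\<close> makes a M equal to
  1 modulo Delta, and in particular \<open>a\<close> nonzero at every eigenvalue, which is what the
  local comparison of quotients requires.\<close>

lemma spectral_data_agree_imp_entire:
  fixes \<Delta> \<Delta>' M M' a a' G G' :: "complex \<Rightarrow> complex"
  assumes hol: "\<Delta> holomorphic_on UNIV" "\<Delta>' holomorphic_on UNIV" "M holomorphic_on UNIV" "M' holomorphic_on UNIV"
     "a holomorphic_on UNIV" "a' holomorphic_on UNIV" "G holomorphic_on UNIV" "G' holomorphic_on UNIV"
    and rel: "\<And>z. a z * M z = 1 - \<Delta> z * G z" "\<And>z. a' z * M' z = 1 - \<Delta>' z * G' z"
    and nz: "\<Delta> w0 \<noteq> 0" "\<Delta>' w0' \<noteq> 0"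
    and l: "eigenvalue_seq \<Delta> l" "eigenvalue_seq \<Delta>' l'"
    and nc: "\<And>n D k \<nu>. fps_expansion \<Delta> (l n) = D * fps_X ^ k \<Longrightarrow> alg_mult \<Delta> l n = k \<Longrightarrow> \<nu> < k \<Longrightarrow>
        norming_const \<Delta> \<psi> l n \<nu> = - fps_nth (fps_expansion a (l n) * D) \<nu>"
    and nc': "\<And>n D k \<nu>. fps_expansion \<Delta>' (l' n) = D * fps_X ^ k \<Longrightarrow> alg_mult \<Delta>' l' n = k \<Longrightarrow> \<nu> < k \<Longrightarrow>
        norming_const \<Delta>' \<psi>' l' n \<nu> = - fps_nth (fps_expansion a' (l' n) * D) \<nu>"
    and agree: "spectral_data_agree \<Delta> \<psi> l \<Delta>' \<psi>' l' N"
  obtains Q C where "Q holomorphic_on UNIV" "\<And>z. norm (Q z) \<le> C * (1 + norm z) ^ N" "0 \<le> C" "\<exists>z. Q z \<noteq> 0"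
    "remove_sings (\<lambda>z. Q z * (M z / \<Delta> z - M' z / \<Delta>' z)) holomorphic_on UNIV"
proof -
  have ll: "l = l'" using agree unfolding spectral_data_agree_def by auto
  obtain \<Lambda> K where \<Lambda>: "\<Lambda> \<subseteq> block_starts l" and K: "\<And>n. n \<in> block_starts l - \<Lambda> \<Longrightarrow> K n \<le> alg_mult \<Delta> l n - 1"
    and sums: "infsum (\<lambda>n. of_nat (alg_mult \<Delta> l n) :: ennreal) \<Lambda> + infsum (\<lambda>n. of_nat (alg_mult \<Delta> l n - K n - 1)) (block_starts l - \<Lambda>) = of_nat N"
    and eq: "\<And>n \<nu>. n \<in> block_starts l - \<Lambda> \<Longrightarrow> \<nu> \<le> K n \<Longrightarrow> norming_const \<Delta> \<psi> l n \<nu> = norming_const \<Delta>' \<psi>' l' n \<nu>"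
  proof -
    obtain \<Lambda> K where *: "\<Lambda> \<subseteq> block_starts l" "\<forall>n\<in>block_starts l - \<Lambda>. K n \<le> alg_mult \<Delta> l n - 1"
      "infsum (\<lambda>n. of_nat (alg_mult \<Delta> l n) :: ennreal) \<Lambda> + infsum (\<lambda>n. of_nat (alg_mult \<Delta> l n - K n - 1)) (block_starts l - \<Lambda>) = of_nat N"
      "\<forall>n\<in>block_starts l - \<Lambda>. \<forall>\<nu>\<in>{0..K n}. norming_const \<Delta> \<psi> l n \<nu> = norming_const \<Delta>' \<psi>' l' n \<nu>"
      using agree unfolding spectral_data_agree_def by (elim conjE exE) (rule that)
    show ?thesis
    proof (rule that[OF *(1) _ *(3)])
      show "K n \<le> alg_mult \<Delta> l n - 1" if "n \<in> block_starts l - \<Lambda>" for n using *(2) that by blast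
      show "norming_const \<Delta> \<psi> l n \<nu> = norming_const \<Delta>' \<psi>' l' n \<nu>" if "n \<in> block_starts l - \<Lambda>" "\<nu> \<le> K n" for n \<nu>
        using *(4) that by simp
    qed
  qed
  \<comment> \<open>The order of the pole that may be left at the n-th eigenvalue: all of its
    multiplicity on \<Lambda>, otherwise the number of norming constants not known to agree.\<close>
  define e where "e n = (if n \<in> \<Lambda> then alg_mult \<Delta> l n else alg_mult \<Delta> l n - K n - 1)" for n
  have zeros: "\<Delta> z = 0 \<longleftrightarrow> z \<in> range l" "\<Delta>' z = 0 \<longleftrightarrow> z \<in> range l" for z
  proof -
    have "range l = {z. \<Delta> z = 0}" "range l' = {z. \<Delta>' z = 0}" using l[unfolded eigenvalue_seq_def, THEN conjunct1] .
    then show "\<Delta> z = 0 \<longleftrightarrow> z \<in> range l" "\<Delta>' z = 0 \<longleftrightarrow> z \<in> range l" unfolding ll by blast+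
  qed
  \<comment> \<open>The orders of the zero for both problems coincide because each equals the number
    of repetitions in the common sequence \<open>l\<close>.\<close>
  have zo: "zorder \<Delta> (l n) = zorder \<Delta>' (l n)" "0 < zorder \<Delta> (l n)" for n
  proof -
    have 1: "\<Delta> (l n) = 0" "\<Delta>' (l n) = 0" using zeros by auto
    then have c: "int (card {j. l j = l n}) = zorder \<Delta> (l n)" "int (card {j. l j = l n}) = zorder \<Delta>' (l n)" "finite {j. l j = l n}"
    proof -
      have *: "\<forall>z. \<Delta> z = 0 \<longrightarrow> finite {j. l j = z} \<and> int (card {j. l j = z}) = zorder \<Delta> z"
        "\<forall>z. \<Delta>' z = 0 \<longrightarrow> finite {j. l' j = z} \<and> int (card {j. l' j = z}) = zorder \<Delta>' z"
        using l[unfolded eigenvalue_seq_def, THEN conjunct2, THEN conjunct1] .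
      show "int (card {j. l j = l n}) = zorder \<Delta> (l n)" "finite {j. l j = l n}" using *(1) 1(1) by simp_all
      show "int (card {j. l j = l n}) = zorder \<Delta>' (l n)" using *(2) 1(2) unfolding ll by simp
    qed
    then show "zorder \<Delta> (l n) = zorder \<Delta>' (l n)" by simp
    have "card {j. l j = l n} > 0" using c(3) by (auto simp: card_gt_0_iff)
    then show "0 < zorder \<Delta> (l n)" using c(1) by simp
  qed
  \<comment> \<open>The true exceptions: block starts with positive exponent. They form a finite
    set, whose exponents sum to at most \<open>N\<close>.\<close>
  define P where "P = {n \<in> block_starts l. 0 < e n}"
  have sums_le: "infsum (\<lambda>n. of_nat (alg_mult \<Delta> l n) :: ennreal) \<Lambda> \<le> of_nat N" "infsum (\<lambda>n. of_nat (alg_mult \<Delta> l n - K n - 1) :: ennreal) (block_starts l - \<Lambda>) \<le> of_nat N"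
    unfolding sums[symmetric] by simp_all
  have PU: "P \<subseteq> {n \<in> \<Lambda>. 0 < alg_mult \<Delta> l n} \<union> {n \<in> block_starts l - \<Lambda>. 0 < alg_mult \<Delta> l n - K n - 1}"
    unfolding P_def e_def using \<Lambda> by auto
  have finP: "finite P" by (rule finite_subset[OF PU]) (use ennreal_infsum_nat_bound(1)[OF sums_le(1)] ennreal_infsum_nat_bound(1)[OF sums_le(2)] in auto)
  have sumP: "sum e P \<le> N"
  proof -
    have "(of_nat (sum e P) :: ennreal) = (\<Sum>n\<in>P \<inter> \<Lambda>. of_nat (e n)) + (\<Sum>n\<in>P - \<Lambda>. of_nat (e n))"
      using sum.Int_Diff[OF finP, of "\<lambda>n. of_nat (e n) :: ennreal" \<Lambda>] by simp
    also have "(\<Sum>n\<in>P \<inter> \<Lambda>. of_nat (e n) :: ennreal) = (\<Sum>n\<in>P \<inter> \<Lambda>. of_nat (alg_mult \<Delta> l n))" by (rule sum.cong) (auto simp: e_def)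
    also have "(\<Sum>n\<in>P - \<Lambda>. of_nat (e n) :: ennreal) = (\<Sum>n\<in>P - \<Lambda>. of_nat (alg_mult \<Delta> l n - K n - 1))" by (rule sum.cong) (auto simp: e_def)
    also have "(\<Sum>n\<in>P \<inter> \<Lambda>. of_nat (alg_mult \<Delta> l n) :: ennreal) + (\<Sum>n\<in>P - \<Lambda>. of_nat (alg_mult \<Delta> l n - K n - 1)) \<le> of_nat N"
      unfolding sums[symmetric]
      by (intro add_mono finite_sum_le_infsum_ennreal) (use finP in \<open>auto simp: P_def\<close>)
    finally show ?thesis by (simp only: of_nat_le_iff)
  qed
  define Q where "Q z = (\<Prod>n\<in>P. (z - l n) ^ e n)" for z
  define C where "C = (\<Prod>n\<in>P. (1 + norm (l n)) ^ e n)"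
  have Qhol: "Q holomorphic_on UNIV" unfolding Q_def by (intro holomorphic_intros)
  have C0: "0 \<le> C" unfolding C_def by (intro prod_nonneg) auto
  have Qbound: "norm (Q z) \<le> C * (1 + norm z) ^ N" for z
  proof -
    have "norm (Q z) = (\<Prod>n\<in>P. norm (z - l n) ^ e n)" unfolding Q_def by (simp add: prod_norm[symmetric] norm_power)
    also have "\<dots> \<le> (\<Prod>n\<in>P. ((1 + norm (l n)) * (1 + norm z)) ^ e n)"
    proof (intro prod_mono conjI power_mono)
      fix n
      have "norm (z - l n) \<le> norm z + norm (l n)" by (rule norm_triangle_ineq4)
      also have "\<dots> \<le> (1 + norm (l n)) * (1 + norm z)" by (simp add: algebra_simps)
      finally show "norm (z - l n) \<le> (1 + norm (l n)) * (1 + norm z)" .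
    qed auto
    also have "\<dots> = C * (1 + norm z) ^ sum e P" unfolding C_def by (simp add: power_mult_distrib prod.distrib power_sum)
    also have "\<dots> \<le> C * (1 + norm z) ^ N" using sumP C0 by (intro mult_left_mono power_increasing) auto
    finally show ?thesis .
  qed
  have Qnz: "\<exists>z. Q z \<noteq> 0"
  proof -
    have "infinite (UNIV - l ` P)" using finP by (simp add: infinite_UNIV_char_0)
    then obtain z where "z \<notin> l ` P" by (metis Diff_iff finite.emptyI all_not_in_conv)
    then have "Q z \<noteq> 0" unfolding Q_def using finP by (auto simp: prod_zero_iff)
    then show ?thesis by blast
  qed
  have an: "f analytic_on {z}" if "f holomorphic_on UNIV" for f :: "complex \<Rightarrow> complex" and z using that by (auto simp: analytic_at)
  have ex: "(\<lambda>w. f (z + w)) has_fps_expansion fps_expansion f z" if "f holomorphic_on UNIV" for f and z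
    using that by (intro analytic_at_imp_has_fps_expansion an)
  have "\<exists>h. h analytic_on {z} \<and> (\<forall>\<^sub>F w in at z. Q w * (M w / \<Delta> w - M' w / \<Delta>' w) = h w)" for z
  proof (cases "z \<in> range l")
    case False
    then have "(\<lambda>z. Q z * (M z / \<Delta> z - M' z / \<Delta>' z)) analytic_on {z}"
      using zeros by (intro analytic_intros an Qhol hol) auto
    then show ?thesis by (intro exI[of _ "\<lambda>z. Q z * (M z / \<Delta> z - M' z / \<Delta>' z)"]) auto
  next
    case True
    \<comment> \<open>The first index carrying the value z is a block start, and agreement of the
      norming constants is assumed at block starts.\<close>
    define n where "n = (LEAST n. l n = z)"
    have ln: "l n = z" unfolding n_def using True by (metis (mono_tags, lifting) LeastI rangeE)
    have nb: "n \<in> block_starts l"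
    proof (cases "n = 0")
      case False
      then have "l (n - 1) \<noteq> z" using not_less_Least[of "n - 1" "\<lambda>n. l n = z"] unfolding n_def by simp
      then show ?thesis using ln False unfolding block_starts_def by auto
    qed (simp add: block_starts_def)
    define k where "k = nat (zorder \<Delta> z)"
    have k: "alg_mult \<Delta> l n = k" "alg_mult \<Delta>' l' n = k" "0 < k" "nat (zorder \<Delta>' z) = k"
      using zo[of n] ln unfolding alg_mult_def k_def ll[symmetric] by auto
    obtain D where D: "fps_expansion \<Delta> z = D * fps_X ^ k" "fps_nth D 0 \<noteq> 0"
      using entire_fps_at_zero[OF hol(1) nz(1)] unfolding k_def by blast
    obtain D' where D': "fps_expansion \<Delta>' z = D' * fps_X ^ k" "fps_nth D' 0 \<noteq> 0"
      using entire_fps_at_zero[OF hol(2) nz(2)] k(4) by metis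
    \<comment> \<open>The number of agreeing norming constants: none on \<Lambda>, and
      \<open>K n\<close> + 1 elsewhere since \<nu> runs from 0 to \<open>K n\<close> inclusive. Thus
      k - j is the exponent \<open>e n\<close>.\<close>
    define j where "j = (if n \<in> \<Lambda> then 0 else Suc (K n))"
    have jk: "j \<le> k" "e n = k - j" using K[of n] nb k by (auto simp: j_def e_def)
    have relz: "fps_expansion a z * fps_expansion M z = 1 - (D * fps_X ^ k) * fps_expansion G z"
      unfolding D(1)[symmetric]
    proof (rule fps_expansion_unique_complex)
      show "(\<lambda>w. a (z + w) * M (z + w)) has_fps_expansion fps_expansion a z * fps_expansion M z"
        by (intro has_fps_expansion_mult ex hol)
      show "(\<lambda>w. a (z + w) * M (z + w)) has_fps_expansion 1 - fps_expansion \<Delta> z * fps_expansion G z"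
        unfolding rel by (intro has_fps_expansion_diff has_fps_expansion_mult has_fps_expansion_1 ex hol)
    qed
    have relz': "fps_expansion a' z * fps_expansion M' z = 1 - (D' * fps_X ^ k) * fps_expansion G' z"
      unfolding D'(1)[symmetric]
    proof (rule fps_expansion_unique_complex)
      show "(\<lambda>w. a' (z + w) * M' (z + w)) has_fps_expansion fps_expansion a' z * fps_expansion M' z"
        by (intro has_fps_expansion_mult ex hol)
      show "(\<lambda>w. a' (z + w) * M' (z + w)) has_fps_expansion 1 - fps_expansion \<Delta>' z * fps_expansion G' z"
        unfolding rel by (intro has_fps_expansion_diff has_fps_expansion_mult has_fps_expansion_1 ex hol)
    qed
    have "\<Delta> z = 0" "\<Delta>' z = 0" using True zeros by auto
    then have "a z \<noteq> 0" "a' z \<noteq> 0" using rel[of z] by auto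
    then have a0: "fps_nth (fps_expansion a z) 0 \<noteq> 0" "fps_nth (fps_expansion a' z) 0 \<noteq> 0" by (auto simp: fps_expansion_def)
    have coeff: "fps_nth (fps_expansion a z * D) \<nu> = fps_nth (fps_expansion a' z * D') \<nu>" if "\<nu> < j" for \<nu>
    proof -
      have n: "n \<in> block_starts l - \<Lambda>" "\<nu> \<le> K n" using that nb by (auto simp: j_def split: if_splits)
      have "\<nu> < k" using that jk by simp
      then show ?thesis using eq[OF n] nc[of n D k \<nu>] nc'[of n D' k \<nu>] D(1) D'(1) k ln unfolding ll[symmetric] by simp
    qed
    obtain h where h: "h analytic_on {0}" "\<forall>\<^sub>F w in at 0. w ^ (k - j) * (M (z + w) / \<Delta> (z + w) - M' (z + w) / \<Delta>' (z + w)) = h w"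
      using quotient_difference_removable[OF ex[OF hol(3)] ex[OF hol(1), of z, unfolded D(1)] ex[OF hol(4)] ex[OF hol(2), of z, unfolded D'(1)] D(2) D'(2) relz relz' jk(1) a0 coeff]
      by blast
    \<comment> \<open>The factors of \<open>Q\<close> that belong to the other exceptions; they are
      holomorphic at z and do no harm.\<close>
    define R where "R w = (\<Prod>i\<in>P - {n}. (w - l i) ^ e i)" for w
    have QR: "Q w = (w - z) ^ (k - j) * R w" for w
    proof (cases "n \<in> P")
      case True
      then show ?thesis unfolding Q_def R_def using prod.remove[OF finP True, of "\<lambda>n. (w - l n) ^ e n"] ln jk by simp
    next
      case False
      then have "e n = 0" using nb unfolding P_def by auto
      then show ?thesis unfolding Q_def R_def using False jk by simp
    qed
    have Rhol: "R holomorphic_on UNIV" unfolding R_def by (intro holomorphic_intros)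
    have "(h \<circ> (\<lambda>w. w - z)) analytic_on {z}"
      by (intro analytic_on_compose_gen[of _ _ _ "{0}"] h(1) analytic_intros) auto
    then have "(\<lambda>w. h (w - z)) analytic_on {z}" by (simp add: o_def)
    with an[OF Rhol] have "(\<lambda>w. R w * h (w - z)) analytic_on {z}" by (rule analytic_on_mult)
    moreover have "\<forall>\<^sub>F w in at z. Q w * (M w / \<Delta> w - M' w / \<Delta>' w) = R w * h (w - z)"
    proof -
      have "\<forall>\<^sub>F w in at z. (w - z) ^ (k - j) * (M w / \<Delta> w - M' w / \<Delta>' w) = h (w - z)"
        using h(2) by (subst at_to_0) (simp add: eventually_filtermap add.commute)
      then show ?thesis by eventually_elim (simp add: QR mult_ac)
    qed
    ultimately show ?thesis by blast
  qed
  then have "remove_sings (\<lambda>z. Q z * (M z / \<Delta> z - M' z / \<Delta>' z)) holomorphic_on UNIV" by (rule remove_sings_entire)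
  with Qhol Qbound C0 Qnz show ?thesis by (rule that)
qed

subsection \<open>Decay from the agreement of the potentials near the endpoint\<close>

lemma C_near_pi_dx:
  assumes "C_near_pi (int (Suc m)) q"
  shows "C_near_pi (int m) (dx q)"
proof -
  obtain \<delta> where \<delta>: "0 < \<delta>" "\<delta> < pi"
    "\<And>j x. int j < int (Suc m) \<Longrightarrow> x \<in> {pi - \<delta>..pi} \<Longrightarrow> (dx ^^ j) q differentiable (at x within {0..pi})"
    "\<And>j. int j \<le> int (Suc m) \<Longrightarrow> continuous_on {pi - \<delta>..pi} ((dx ^^ j) q)"
    using assms unfolding C_near_pi_def by blast
  have e: "(dx ^^ j) (dx q) = (dx ^^ Suc j) q" for j by (simp add: funpow_swap1)
  show ?thesis unfolding C_near_pi_def e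
    using \<delta>(3)[of "Suc j" for j] \<delta>(4)[of "Suc j" for j] by (intro exI[of _ \<delta>] conjI \<delta>(1,2)) auto
qed

text \<open>Induction on the order in place of Taylor's formula: the bound for the derivatives is
  propagated from \<pi>, where the difference vanishes, by the mean value inequality, and each step
  gains one factor \<pi> - x.\<close>

lemma C_near_pi_difference_small:
  assumes "C_near_pi (int m) q" "C_near_pi (int m) qt" "\<And>j. j \<le> m \<Longrightarrow> (dx ^^ j) q pi = (dx ^^ j) qt pi" "0 < e"
  shows "\<exists>\<eta>. 0 < \<eta> \<and> \<eta> < pi \<and> (\<forall>x\<in>{pi - \<eta>..pi}. norm (qt x - q x) \<le> e * (pi - x) ^ m)"
  using assms
proof (induction m arbitrary: q qt)
  case 0
  obtain \<delta> where \<delta>: "0 < \<delta>" "\<delta> < pi" "continuous_on {pi - \<delta>..pi} q"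
    using 0(1) unfolding C_near_pi_def by (metis funpow_0 order_refl of_nat_0)
  obtain \<delta>' where \<delta>': "0 < \<delta>'" "\<delta>' < pi" "continuous_on {pi - \<delta>'..pi} qt"
    using 0(2) unfolding C_near_pi_def by (metis funpow_0 order_refl of_nat_0)
  define \<delta>0 where "\<delta>0 = min \<delta> \<delta>'"
  have "continuous_on {pi - \<delta>0..pi} (\<lambda>x. qt x - q x)"
    by (intro continuous_on_diff continuous_on_subset[OF \<delta>(3)] continuous_on_subset[OF \<delta>'(3)]) (auto simp: \<delta>0_def)
  moreover have pi0: "pi \<in> {pi - \<delta>0..pi}" using \<delta> \<delta>' by (auto simp: \<delta>0_def)
  ultimately obtain r where r: "r > 0" "\<And>x. x \<in> {pi - \<delta>0..pi} \<Longrightarrow> dist x pi < r \<Longrightarrow> dist (qt x - q x) (qt pi - q pi) < e"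
    unfolding continuous_on_iff using 0(4) by metis
  have z: "qt pi - q pi = 0" using 0(3)[of 0] by simp
  define \<eta> where "\<eta> = min \<delta>0 (r / 2)"
  have "norm (qt x - q x) \<le> e * (pi - x) ^ 0" if "x \<in> {pi - \<eta>..pi}" for x
  proof -
    have "x \<in> {pi - \<delta>0..pi}" "dist x pi < r" using that r(1) by (auto simp: \<eta>_def dist_real_def)
    from r(2)[OF this] show ?thesis unfolding z by simp
  qed
  then show ?case using \<delta> \<delta>' r by (intro exI[of _ \<eta>]) (auto simp: \<eta>_def \<delta>0_def)
next
  case (Suc m)
  have "\<And>j. j \<le> m \<Longrightarrow> (dx ^^ j) (dx q) pi = (dx ^^ j) (dx qt) pi"
    using Suc.prems(3)[of "Suc j" for j] by (simp add: funpow_swap1)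
  from Suc.IH[OF C_near_pi_dx[OF Suc.prems(1)] C_near_pi_dx[OF Suc.prems(2)] this Suc.prems(4)]
  obtain \<eta> where \<eta>: "0 < \<eta>" "\<eta> < pi" "\<And>x. x \<in> {pi - \<eta>..pi} \<Longrightarrow> norm (dx qt x - dx q x) \<le> e * (pi - x) ^ m" by blast
  have "\<exists>\<delta>>0. \<delta> < pi \<and> (\<forall>x\<in>{pi - \<delta>..pi}. f differentiable (at x within {0..pi}))" if f: "C_near_pi (int (Suc m)) f" for f
  proof -
    obtain \<delta> where \<delta>: "0 < \<delta>" "\<delta> < pi" "\<forall>j::nat. int j < int (Suc m) \<longrightarrow> (\<forall>x\<in>{pi - \<delta>..pi}. (dx ^^ j) f differentiable (at x within {0..pi}))"
      using f unfolding C_near_pi_def by blast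
    from \<delta>(3)[THEN spec, of 0] have "\<forall>x\<in>{pi - \<delta>..pi}. f differentiable (at x within {0..pi})" by simp
    with \<delta>(1,2) show ?thesis by blast
  qed
  from this[OF Suc.prems(1)] this[OF Suc.prems(2)] obtain \<delta> \<delta>' where \<delta>: "0 < \<delta>" "\<delta> < pi" "0 < \<delta>'" "\<delta>' < pi" and
    diff: "\<And>x. x \<in> {pi - \<delta>..pi} \<Longrightarrow> q differentiable (at x within {0..pi})" "\<And>x. x \<in> {pi - \<delta>'..pi} \<Longrightarrow> qt differentiable (at x within {0..pi})"
    by blast
  define \<eta>0 where "\<eta>0 = min \<eta> (min \<delta> \<delta>')"
  have der: "((\<lambda>x. qt x - q x) has_vector_derivative (dx qt x - dx q x)) (at x within {0..pi})" if "x \<in> {pi - \<eta>0..pi}" for x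
    unfolding dx_def by (intro has_vector_derivative_diff vector_derivative_works[THEN iffD1] diff) (use that in \<open>auto simp: \<eta>0_def\<close>)
  have z: "qt pi - q pi = 0" using Suc.prems(3)[of 0] by simp
  have "norm (qt x - q x) \<le> e * (pi - x) ^ Suc m" if x: "x \<in> {pi - \<eta>0..pi}" for x
  proof -
    have "norm ((qt pi - q pi) - (qt x - q x)) \<le> (e * (pi - x) ^ m) * norm (pi - x)"
    proof (rule differentiable_bound[of "{x..pi}" "\<lambda>x. qt x - q x" "\<lambda>t h. h *\<^sub>R (dx qt t - dx q t)"])
      fix t assume t: "t \<in> {x..pi}"
      have t': "t \<in> {pi - \<eta>0..pi}" "{x..pi} \<subseteq> {0..pi}" using t x \<eta> by (auto simp: \<eta>0_def)
      show "((\<lambda>x. qt x - q x) has_derivative (\<lambda>h. h *\<^sub>R (dx qt t - dx q t))) (at t within {x..pi})"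
        using has_vector_derivative_within_subset[OF der[OF t'(1)] t'(2)] by (simp add: has_vector_derivative_def)
      have "norm (dx qt t - dx q t) \<le> e * (pi - t) ^ m" using t'(1) by (intro \<eta>(3)) (auto simp: \<eta>0_def)
      also have "\<dots> \<le> e * (pi - x) ^ m" using t Suc.prems(4) by (intro mult_left_mono power_mono) auto
      finally have B: "norm (dx qt t - dx q t) \<le> e * (pi - x) ^ m" .
      show "onorm (\<lambda>h. h *\<^sub>R (dx qt t - dx q t)) \<le> e * (pi - x) ^ m"
        using B by (intro onorm_bound) (auto simp: mult.commute[of "e * _"] mult_left_mono intro: order_trans[OF norm_ge_zero])
    qed (use x in auto)
    then show ?thesis unfolding z using x by (simp add: norm_minus_commute mult_ac)
  qed
  then show ?case using \<eta> \<delta> by (intro exI[of _ \<eta>0]) (auto simp: \<eta>0_def)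
qed

text \<open>For m = -1 only the smallness of the integral of |q~ - q| near \<pi> is available. For m
  = k \<ge> 0, half of the exponential weight absorbs (\<pi> - x)^k at the price k! / \<kappa>^k,
  and integrating the other half gains one more 1/\<kappa>. In both cases \<open>\<eta>\<close> is
  fixed before \<kappa>.\<close>

lemma weighted_difference_small:
  assumes q: "q absolutely_integrable_on {0..pi}" "qt absolutely_integrable_on {0..pi}" and m: "m \<ge> -1"
    and C: "C_near_pi m q" "C_near_pi m qt" "\<And>j::nat. int j \<le> m \<Longrightarrow> (dx ^^ j) q pi = (dx ^^ j) qt pi"
    and e: "0 < e" and \<eta>0: "0 < \<eta>0" "\<eta>0 < pi"
  obtains \<eta> where "0 < \<eta>" "\<eta> \<le> \<eta>0"
    "\<And>\<kappa>. 0 < \<kappa> \<Longrightarrow> integral {pi - \<eta>..pi} (\<lambda>x. norm (qt x - q x) * exp (2 * \<kappa> * x)) \<le> e / \<kappa> ^ nat (m + 1) * exp (2 * \<kappa> * pi)"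
proof -
  have r: "(\<lambda>x. qt x - q x) absolutely_integrable_on {0..pi}" using q by (intro set_integral_diff(1))
  have rint: "(\<lambda>x. norm (qt x - q x)) integrable_on {0..pi}" using r by (simp add: absolutely_integrable_on_def)
  have wint: "(\<lambda>x. norm (qt x - q x) * exp (2 * \<kappa> * x)) integrable_on {pi - \<eta>..pi}" if "0 < \<eta>" "\<eta> < pi" for \<eta> \<kappa>
  proof -
    have "(\<lambda>x. (qt x - q x) * complex_of_real (exp (2 * \<kappa> * x))) absolutely_integrable_on {0..pi}"
      by (intro absolutely_integrable_mult_continuous r continuous_intros)
    then have "(\<lambda>x. norm ((qt x - q x) * complex_of_real (exp (2 * \<kappa> * x)))) integrable_on {0..pi}" by (simp only: absolutely_integrable_on_def)
    then have "(\<lambda>x. norm (qt x - q x) * exp (2 * \<kappa> * x)) integrable_on {0..pi}" by (simp add: norm_mult)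
    then show ?thesis by (rule integrable_on_subinterval) (use that in auto)
  qed
  have "m = -1 \<or> (\<exists>k. m = int k)"
  proof (cases "m = -1")
    case False
    then have "0 \<le> m" using m by linarith
    then show ?thesis using nonneg_int_cases by blast
  qed simp
  then consider "m = -1" | k where "m = int k" by blast
  then show ?thesis
  proof cases
    case 1
    have "continuous_on {0..pi} (\<lambda>x. integral {x..pi} (\<lambda>x. norm (qt x - q x)))" by (rule indefinite_integral_continuous_1'[OF rint])
    moreover have "pi \<in> {0..pi}" by simp
    ultimately have "\<exists>\<delta>>0. \<forall>x\<in>{0..pi}. dist x pi < \<delta> \<longrightarrow> dist (integral {x..pi} (\<lambda>x. norm (qt x - q x))) (integral {pi..pi} (\<lambda>x. norm (qt x - q x))) < e"
      unfolding continuous_on_iff using e by (blast)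
    then obtain \<delta> where \<delta>: "\<delta> > 0" "\<And>x. x \<in> {0..pi} \<Longrightarrow> dist x pi < \<delta> \<Longrightarrow> dist (integral {x..pi} (\<lambda>x. norm (qt x - q x))) (integral {pi..pi} (\<lambda>x. norm (qt x - q x))) < e"
      by blast
    define \<eta> where "\<eta> = min \<eta>0 (\<delta> / 2)"
    have \<eta>: "0 < \<eta>" "\<eta> \<le> \<eta>0" "\<eta> < pi" "\<eta> < \<delta>" using \<eta>0 \<delta>(1) by (auto simp: \<eta>_def)
    have small: "integral {pi - \<eta>..pi} (\<lambda>x. norm (qt x - q x)) \<le> e"
      using \<delta>(2)[of "pi - \<eta>"] \<eta> by (auto simp: dist_real_def)
    have rint': "(\<lambda>x. norm (qt x - q x)) integrable_on {pi - \<eta>..pi}" by (rule integrable_on_subinterval[OF rint]) (use \<eta> in auto)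
    show ?thesis
    proof (rule that[OF \<eta>(1,2)])
      fix \<kappa> :: real assume \<kappa>: "0 < \<kappa>"
      have "integral {pi - \<eta>..pi} (\<lambda>x. norm (qt x - q x) * exp (2 * \<kappa> * x)) \<le> integral {pi - \<eta>..pi} (\<lambda>x. norm (qt x - q x) * exp (2 * \<kappa> * pi))"
        using \<kappa> by (intro Henstock_Kurzweil_Integration.integral_le wint \<eta> integrable_on_mult_left rint') (auto intro!: mult_left_mono)
      also have "\<dots> = integral {pi - \<eta>..pi} (\<lambda>x. norm (qt x - q x)) * exp (2 * \<kappa> * pi)" by simp
      also have "\<dots> \<le> e * exp (2 * \<kappa> * pi)" using small by (intro mult_right_mono) auto
      finally show "integral {pi - \<eta>..pi} (\<lambda>x. norm (qt x - q x) * exp (2 * \<kappa> * x)) \<le> e / \<kappa> ^ nat (m + 1) * exp (2 * \<kappa> * pi)" using 1 by simp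
    qed
  next
    case (2 k)
    \<comment> \<open>The division by k! compensates in advance the factor k! in the bound of t^k by
      the exponential.\<close>
    have "0 < e / fact k" using e by simp
    then obtain \<eta>1 where \<eta>1: "0 < \<eta>1" "\<eta>1 < pi" "\<And>x. x \<in> {pi - \<eta>1..pi} \<Longrightarrow> norm (qt x - q x) \<le> e / fact k * (pi - x) ^ k"
      using C_near_pi_difference_small[of k q qt "e / fact k"] C 2 by auto
    define \<eta> where "\<eta> = min \<eta>0 \<eta>1"
    have \<eta>: "0 < \<eta>" "\<eta> \<le> \<eta>0" "\<eta> < pi" "\<eta> \<le> \<eta>1" using \<eta>0 \<eta>1 by (auto simp: \<eta>_def)
    show ?thesis
    proof (rule that[OF \<eta>(1,2)])
      fix \<kappa> :: real assume \<kappa>: "0 < \<kappa>"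
      have pw: "norm (qt x - q x) * exp (2 * \<kappa> * x) \<le> e / \<kappa> ^ k * exp (\<kappa> * pi) * exp (\<kappa> * x)" if x: "x \<in> {pi - \<eta>..pi}" for x
      proof -
        define t where "t = pi - x"
        have t: "0 \<le> t" using x by (simp add: t_def)
        have "(\<kappa> * t) ^ k / fact k \<le> exp (\<kappa> * t)"
        proof -
          \<comment> \<open>One term of the exponential series is at most the whole sum.\<close>
          have "(\<Sum>n\<in>{k}. (\<kappa> * t) ^ n /\<^sub>R fact n) \<le> (\<Sum>n. (\<kappa> * t) ^ n /\<^sub>R fact n)"
            using t \<kappa> by (intro sum_le_suminf summable_exp_generic) auto
          then show ?thesis by (simp add: exp_def divide_inverse mult.commute)
        qed
        then have tk: "t ^ k \<le> fact k / \<kappa> ^ k * exp (\<kappa> * t)" using \<kappa> by (simp add: power_mult_distrib field_simps)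
        have "norm (qt x - q x) \<le> e / fact k * t ^ k" unfolding t_def using x \<eta> by (intro \<eta>1(3)) auto
        also have "\<dots> \<le> e / fact k * (fact k / \<kappa> ^ k * exp (\<kappa> * t))" using tk e by (intro mult_left_mono) auto
        also have "\<dots> = e / \<kappa> ^ k * exp (\<kappa> * t)" by simp
        finally have "norm (qt x - q x) * exp (2 * \<kappa> * x) \<le> e / \<kappa> ^ k * exp (\<kappa> * t) * exp (2 * \<kappa> * x)" by (intro mult_right_mono) auto
        also have "\<dots> = e / \<kappa> ^ k * (exp (\<kappa> * t) * exp (2 * \<kappa> * x))" by simp
        also have "exp (\<kappa> * t) * exp (2 * \<kappa> * x) = exp (\<kappa> * pi) * exp (\<kappa> * x)" unfolding t_def exp_add[symmetric] by (simp add: algebra_simps)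
        finally show ?thesis by (simp add: mult.assoc)
      qed
      have ei: "((\<lambda>x. exp (\<kappa> * x)) has_integral exp (\<kappa> * pi) / \<kappa> - exp (\<kappa> * (pi - \<eta>)) / \<kappa>) {pi - \<eta>..pi}"
        using \<kappa> \<eta> by (intro fundamental_theorem_of_calculus) (auto intro!: derivative_eq_intros simp: has_real_derivative_iff_has_vector_derivative[symmetric])
      have "integral {pi - \<eta>..pi} (\<lambda>x. norm (qt x - q x) * exp (2 * \<kappa> * x)) \<le> integral {pi - \<eta>..pi} (\<lambda>x. e / \<kappa> ^ k * exp (\<kappa> * pi) * exp (\<kappa> * x))"
        using ei pw by (intro Henstock_Kurzweil_Integration.integral_le wint \<eta> integrable_on_mult_right) auto
      also have "\<dots> = e / \<kappa> ^ k * exp (\<kappa> * pi) * (exp (\<kappa> * pi) / \<kappa> - exp (\<kappa> * (pi - \<eta>)) / \<kappa>)" using integral_unique[OF ei] by simp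
      also have "\<dots> \<le> e / \<kappa> ^ k * exp (\<kappa> * pi) * (exp (\<kappa> * pi) / \<kappa>)" using e \<kappa> by (intro mult_left_mono) auto
      also have "\<dots> = e / (\<kappa> ^ k * \<kappa>) * (exp (\<kappa> * pi) * exp (\<kappa> * pi))" by simp
      also have "exp (\<kappa> * pi) * exp (\<kappa> * pi) = exp (2 * \<kappa> * pi)" unfolding exp_add[symmetric] by simp
      also have "\<kappa> ^ k * \<kappa> = \<kappa> ^ nat (m + 1)" using 2 by (simp add: nat_add_distrib mult.commute)
      finally show "integral {pi - \<eta>..pi} (\<lambda>x. norm (qt x - q x) * exp (2 * \<kappa> * x)) \<le> e / \<kappa> ^ nat (m + 1) * exp (2 * \<kappa> * pi)" .
    qed
  qed
qed

text \<open>The Wronskian at \<pi> is its value at \<pi> - \<eta> plus the integral of (q~ - q) y y~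
  over the remaining interval. The first part is smaller than e^(2 \<kappa> \<pi>) by the factor
  e^(-2 \<kappa> \<eta>), up to a power of \<kappa>; only the second feels the agreement of the
  potentials.\<close>

lemma wronskian_bound:
  assumes p: "sl_piece q lam d pi y z" "sl_piece qt lam d pi y' z'"
    and q: "q absolutely_integrable_on {d..pi}" "qt absolutely_integrable_on {d..pi}"
    and \<eta>: "0 < \<eta>" "d \<le> pi - \<eta>" and C: "0 \<le> C" "0 < \<kappa>"
    and b: "\<And>x. x \<in> {d..pi} \<Longrightarrow> norm (y x) \<le> C * exp (\<kappa> * x)" "\<And>x. x \<in> {d..pi} \<Longrightarrow> norm (z x) \<le> C * \<kappa> * exp (\<kappa> * x)"
      "\<And>x. x \<in> {d..pi} \<Longrightarrow> norm (y' x) \<le> C * exp (\<kappa> * x)" "\<And>x. x \<in> {d..pi} \<Longrightarrow> norm (z' x) \<le> C * \<kappa> * exp (\<kappa> * x)"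
    and I: "integral {pi - \<eta>..pi} (\<lambda>x. norm (qt x - q x) * exp (2 * \<kappa> * x)) \<le> I"
  shows "norm (y pi * z' pi - z pi * y' pi) \<le> 2 * C ^ 2 * \<kappa> * exp (2 * \<kappa> * (pi - \<eta>)) + C ^ 2 * I"
proof -
  define x0 where "x0 = pi - \<eta>"
  have x0: "x0 \<in> {d..pi}" "d \<le> x0" "x0 \<le> pi" using \<eta> by (auto simp: x0_def)
  have W: "((\<lambda>t. ((qt t - lam) - (q t - lam)) * (y t * y' t)) has_integral (y pi * z' pi - z pi * y' pi) - (y x0 * z' x0 - z x0 * y' x0)) {x0..pi}"
    by (rule wronskian_piece[OF p q x0(2,3)]) simp
  have sq: "exp (\<kappa> * x) * exp (\<kappa> * x) = exp (2 * \<kappa> * x)" for x by (simp add: exp_add[symmetric])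
  have 1: "norm (y x0 * z' x0 - z x0 * y' x0) \<le> 2 * C ^ 2 * \<kappa> * exp (2 * \<kappa> * x0)"
  proof -
    have "norm (y x0 * z' x0) \<le> (C * exp (\<kappa> * x0)) * (C * \<kappa> * exp (\<kappa> * x0))" "norm (z x0 * y' x0) \<le> (C * \<kappa> * exp (\<kappa> * x0)) * (C * exp (\<kappa> * x0))"
      unfolding norm_mult using b[OF x0(1)] C by (auto intro!: mult_mono)
    then have "norm (y x0 * z' x0 - z x0 * y' x0) \<le> 2 * C ^ 2 * \<kappa> * (exp (\<kappa> * x0) * exp (\<kappa> * x0))"
      using norm_triangle_ineq4[of "y x0 * z' x0" "z x0 * y' x0"] by (simp add: power2_eq_square mult_ac)
    then show ?thesis unfolding sq .
  qed
  have ri: "(\<lambda>x. qt x - q x) absolutely_integrable_on {x0..pi}"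
    using q x0 by (intro set_integral_diff(1)) (auto intro: absolutely_integrable_on_subinterval)
  have "(\<lambda>x. (qt x - q x) * complex_of_real (exp (2 * \<kappa> * x))) absolutely_integrable_on {x0..pi}"
    by (intro absolutely_integrable_mult_continuous ri continuous_intros)
  then have "(\<lambda>x. norm ((qt x - q x) * complex_of_real (exp (2 * \<kappa> * x)))) integrable_on {x0..pi}" by (simp only: absolutely_integrable_on_def)
  then have wi: "(\<lambda>x. norm (qt x - q x) * exp (2 * \<kappa> * x)) integrable_on {x0..pi}" by (simp add: norm_mult)
  have "norm (integral {x0..pi} (\<lambda>t. ((qt t - lam) - (q t - lam)) * (y t * y' t))) \<le> integral {x0..pi} (\<lambda>x. C ^ 2 * (norm (qt x - q x) * exp (2 * \<kappa> * x)))"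
  proof (rule Henstock_Kurzweil_Integration.integral_norm_bound_integral)
    show "(\<lambda>t. ((qt t - lam) - (q t - lam)) * (y t * y' t)) integrable_on {x0..pi}" using W by blast
    show "(\<lambda>x. C ^ 2 * (norm (qt x - q x) * exp (2 * \<kappa> * x))) integrable_on {x0..pi}" by (intro integrable_on_mult_right wi)
    fix t assume "t \<in> {x0..pi}"
    then have t: "t \<in> {d..pi}" using x0 by auto
    have "norm (y t * y' t) \<le> (C * exp (\<kappa> * t)) * (C * exp (\<kappa> * t))"
      unfolding norm_mult using b[OF t] C by (auto intro!: mult_mono)
    also have "\<dots> = C ^ 2 * exp (2 * \<kappa> * t)" unfolding sq[symmetric] by (simp add: power2_eq_square)
    finally have "norm (qt t - q t) * norm (y t * y' t) \<le> norm (qt t - q t) * (C ^ 2 * exp (2 * \<kappa> * t))" by (intro mult_left_mono) auto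
    then show "norm (((qt t - lam) - (q t - lam)) * (y t * y' t)) \<le> C ^ 2 * (norm (qt t - q t) * exp (2 * \<kappa> * t))"
      unfolding norm_mult by (simp add: mult_ac)
  qed
  also have "\<dots> = C ^ 2 * integral {x0..pi} (\<lambda>x. norm (qt x - q x) * exp (2 * \<kappa> * x))" by simp
  also have "\<dots> \<le> C ^ 2 * I" using I unfolding x0_def by (intro mult_left_mono) auto
  finally have 2: "norm ((y pi * z' pi - z pi * y' pi) - (y x0 * z' x0 - z x0 * y' x0)) \<le> C ^ 2 * I" unfolding integral_unique[OF W] .
  have "norm (y pi * z' pi - z pi * y' pi) \<le> norm (y x0 * z' x0 - z x0 * y' x0) + norm ((y pi * z' pi - z pi * y' pi) - (y x0 * z' x0 - z x0 * y' x0))"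
    by (rule norm_triangle_sub)
  then show ?thesis using 1 2 unfolding x0_def by linarith
qed

subsection \<open>Characteristic functions of a pair of problems\<close>

text \<open>The functions \<open>u\<close>, \<open>v\<close>, \<open>w\<close> stand for \<open>\<phi>\<close>, \<open>\<psi>\<close>, \<open>\<psi>\<^sup>\<infinity>\<close>; the letters \<open>l\<close> and \<open>r\<close> refer to the left and right of \<open>d\<close>.\<close>

locale jump_problem =
  fixes q :: "real \<Rightarrow> complex" and d \<beta> :: real and \<gamma> h H :: complex
    and ul ul' ur ur' vl vl' vr vr' wl wl' wr wr' :: "complex \<Rightarrow> real \<Rightarrow> complex"
  assumes q: "q absolutely_integrable_on {0..pi}" and d: "0 < d" "d < pi" and \<beta>: "0 < \<beta>"
    and u: "sl_family q d \<beta> \<gamma> ul ul' ur ur'" "\<And>lam. ul lam 0 = 1" "\<And>lam. ul' lam 0 = h"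
    and v: "sl_family q d \<beta> \<gamma> vl vl' vr vr'" "\<And>lam. vr lam pi = 1" "\<And>lam. vr' lam pi = - H"
    and w: "sl_family q d \<beta> \<gamma> wl wl' wr wr'" "\<And>lam. wr lam pi = 0" "\<And>lam. wr' lam pi = 1"
begin

definition N :: "complex \<Rightarrow> complex" where "N lam = ur lam pi"

definition \<Delta> :: "complex \<Rightarrow> complex" where "\<Delta> lam = ur' lam pi + H * ur lam pi"

lemma u_pair: "jump_pair q d \<beta> \<gamma> lam (ul lam) (ul' lam) (ur lam) (ur' lam)"
  and v_pair: "jump_pair q d \<beta> \<gamma> lam (vl lam) (vl' lam) (vr lam) (vr' lam)"
  and w_pair: "jump_pair q d \<beta> \<gamma> lam (wl lam) (wl' lam) (wr lam) (wr' lam)"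
  using u(1) v(1) w(1) by (simp_all add: sl_family_def)

lemma characteristic_functions_entire:
  shows "N holomorphic_on UNIV" "\<Delta> holomorphic_on UNIV" "(\<lambda>lam. vl lam 0) holomorphic_on UNIV" "(\<lambda>lam. wl lam 0) holomorphic_on UNIV"
proof -
  have e: "(\<lambda>lam. ur lam pi) holomorphic_on UNIV" "(\<lambda>lam. ur' lam pi) holomorphic_on UNIV"
    using u(1) d unfolding sl_family_def by auto
  then show "N holomorphic_on UNIV" unfolding N_def[abs_def] by blast
  show "\<Delta> holomorphic_on UNIV" unfolding \<Delta>_def[abs_def] using e by (intro holomorphic_intros)
  show "(\<lambda>lam. vl lam 0) holomorphic_on UNIV" "(\<lambda>lam. wl lam 0) holomorphic_on UNIV"
    using v(1) w(1) d unfolding sl_family_def by auto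
qed

lemma \<beta>0: "\<beta> \<noteq> 0" using \<beta> by simp

text \<open>Evaluating the constant Wronskians of \<phi> with \<psi> and with \<psi>-infinity at
  both ends expresses the derivatives at 0 through the characteristic functions.\<close>

lemma v'_0: "vl' lam 0 = h * vl lam 0 - \<Delta> lam"
    and w'_0: "wl' lam 0 = h * wl lam 0 + N lam"
  using wronskian_jump_pair(2)[OF u_pair v_pair q d \<beta>0, of pi lam] wronskian_jump_pair(2)[OF u_pair w_pair q d \<beta>0, of pi lam] d
  by (simp_all add: u v w N_def \<Delta>_def algebra_simps)

text \<open>The Wronskian of \<psi> and \<psi>-infinity is 1 at \<pi>, hence also at 0, where the
  derivatives are replaced by the preceding formulas.\<close>

lemma value_relation: "vl lam 0 * N lam = 1 - \<Delta> lam * wl lam 0"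
  using wronskian_jump_pair(2)[OF v_pair w_pair q d \<beta>0, of pi lam] d
  by (simp add: v w v'_0 w'_0 algebra_simps)

lemma v_spectral: "(lam - mu) * (integral {0..d} (\<lambda>x. vl lam x * vl mu x) + integral {d..pi} (\<lambda>x. vr lam x * vr mu x)) =
    \<Delta> mu * vl lam 0 - \<Delta> lam * vl mu 0"
  using wronskian_jump_pair_spectral[OF v_pair v_pair q d \<beta>0, of lam mu] by (simp add: v v'_0 algebra_simps)

lemma w_spectral: "(lam - mu) * (integral {0..d} (\<lambda>x. wl lam x * wl mu x) + integral {d..pi} (\<lambda>x. wr lam x * wr mu x)) =
    (- N mu) * wl lam 0 - (- N lam) * wl mu 0"
  using wronskian_jump_pair_spectral[OF w_pair w_pair q d \<beta>0, of lam mu] by (simp add: w w'_0 algebra_simps)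

lemma Delta_eq: "Delta q h H \<beta> \<gamma> d = \<Delta>"
  using phi_eq_family[OF q d \<beta>0 u] d by (simp add: fun_eq_iff Delta_def \<Delta>_def)

lemma Delta_inf_eq: "Delta_inf q h \<beta> \<gamma> d = (\<lambda>z. - N z)"
  using phi_eq_family(1)[OF q d \<beta>0 u] d by (simp add: fun_eq_iff Delta_inf_def N_def)

lemma norming_psi:
  assumes "fps_expansion \<Delta> (l n) = D * fps_X ^ k" "alg_mult \<Delta> l n = k" "\<nu> < k"
  shows "norming_const \<Delta> (psi q H \<beta> \<gamma> d) l n \<nu> = - fps_nth (fps_expansion (\<lambda>z. vl z 0) (l n) * D) \<nu>"
  using assms psi_eq_family[OF q d \<beta>0 v]
  by (intro norming_const_eq_coefficient[OF d v(1) _ _ characteristic_functions_entire(3) characteristic_functions_entire(2) v_spectral]) auto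

lemma norming_psi_inf:
  assumes "fps_expansion (\<lambda>z. - N z) (l n) = D * fps_X ^ k" "alg_mult (\<lambda>z. - N z) l n = k" "\<nu> < k"
  shows "norming_const (\<lambda>z. - N z) (psi_inf q \<beta> \<gamma> d) l n \<nu> = - fps_nth (fps_expansion (\<lambda>z. wl z 0) (l n) * D) \<nu>"
  using assms psi_inf_eq_family[OF q d \<beta>0 w] holomorphic_on_minus[OF characteristic_functions_entire(1)]
  by (intro norming_const_eq_coefficient[OF d w(1) _ _ characteristic_functions_entire(4) _ w_spectral]) auto

text \<open>One threshold \<open>n0\<close> serves both as the least index of the squares and as the
  least modulus of \<rho>, so that all later estimates can be combined on the same contours.\<close>

lemma solution_bounds:
  obtains c C n0 where "0 < c" "0 < C"
    "\<And>n \<rho>. n0 \<le> n \<Longrightarrow> square_norm \<rho> = real n + 1/2 \<Longrightarrow> c * norm \<rho> * exp (\<bar>Im \<rho>\<bar> * pi) \<le> norm (\<Delta> (\<rho>\<^sup>2))"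
    "\<And>n \<rho>. n0 \<le> n \<Longrightarrow> square_norm \<rho> = real n \<Longrightarrow> c * exp (\<bar>Im \<rho>\<bar> * pi) \<le> norm (N (\<rho>\<^sup>2))"
    "\<And>\<rho>. real n0 \<le> norm \<rho> \<Longrightarrow> norm (N (\<rho>\<^sup>2)) \<le> C * exp (\<bar>Im \<rho>\<bar> * pi)"
    "\<And>\<rho>. real n0 \<le> norm \<rho> \<Longrightarrow> norm (\<Delta> (\<rho>\<^sup>2)) \<le> C * norm \<rho> * exp (\<bar>Im \<rho>\<bar> * pi)"
    "\<And>\<rho> x. real n0 \<le> norm \<rho> \<Longrightarrow> x \<in> {0..d} \<Longrightarrow> norm (ul (\<rho>\<^sup>2) x) \<le> C * exp (\<bar>Im \<rho>\<bar> * x)"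
    "\<And>\<rho> x. real n0 \<le> norm \<rho> \<Longrightarrow> x \<in> {d..pi} \<Longrightarrow> norm (ur (\<rho>\<^sup>2) x) \<le> C * exp (\<bar>Im \<rho>\<bar> * x)"
    "\<And>\<rho> x. real n0 \<le> norm \<rho> \<Longrightarrow> x \<in> {d..pi} \<Longrightarrow> norm (ur' (\<rho>\<^sup>2) x) \<le> C * norm \<rho> * exp (\<bar>Im \<rho>\<bar> * x)"
    "\<And>\<rho> x. real n0 \<le> norm \<rho> \<Longrightarrow> x \<in> {0..d} \<Longrightarrow> norm (vl (\<rho>\<^sup>2) x) \<le> C * exp (\<bar>Im \<rho>\<bar> * (pi - x))"
    "\<And>\<rho> x. real n0 \<le> norm \<rho> \<Longrightarrow> x \<in> {d..pi} \<Longrightarrow> norm (vr (\<rho>\<^sup>2) x) \<le> C * exp (\<bar>Im \<rho>\<bar> * (pi - x))"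
proof -
  obtain c n1 where c: "0 < c" and low:
    "\<And>n \<rho>. n1 \<le> n \<Longrightarrow> square_norm \<rho> = real n + 1/2 \<Longrightarrow> c * norm \<rho> * exp (\<bar>Im \<rho>\<bar> * pi) \<le> norm (\<Delta> (\<rho>\<^sup>2))"
    "\<And>n \<rho>. n1 \<le> n \<Longrightarrow> square_norm \<rho> = real n \<Longrightarrow> c * exp (\<bar>Im \<rho>\<bar> * pi) \<le> norm (N (\<rho>\<^sup>2))"
    unfolding \<Delta>_def N_def
    by (rule jump_pair_lower_bounds[OF q d \<beta>, of \<gamma> h H]) (use u_pair u(2,3) in blast)
  obtain C1 r1 where C1: "0 < C1" "1 \<le> r1" and fwd:
    "\<And>\<rho>. r1 \<le> norm \<rho> \<Longrightarrow>
      (\<forall>x\<in>{0..d}. norm (ul (\<rho>\<^sup>2) x) \<le> C1 * exp (\<bar>Im \<rho>\<bar> * x)) \<and>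
      (\<forall>x\<in>{d..pi}. norm (ur (\<rho>\<^sup>2) x) \<le> C1 * exp (\<bar>Im \<rho>\<bar> * x) \<and> norm (ur' (\<rho>\<^sup>2) x / \<rho>) \<le> C1 * exp (\<bar>Im \<rho>\<bar> * x))"
    by (rule jump_pair_forward_estimate[OF q d \<beta>, of \<gamma> h]) (use u_pair u(2,3) in blast)
  obtain C2 r2 where C2: "0 < C2" "1 \<le> r2" and bwd:
    "\<And>\<rho>. r2 \<le> norm \<rho> \<Longrightarrow>
      (\<forall>x\<in>{0..d}. norm (vl (\<rho>\<^sup>2) x) \<le> C2 * exp (\<bar>Im \<rho>\<bar> * (pi - x))) \<and>
      (\<forall>x\<in>{d..pi}. norm (vr (\<rho>\<^sup>2) x) \<le> C2 * exp (\<bar>Im \<rho>\<bar> * (pi - x)))"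
    by (rule jump_pair_backward_estimate[OF q d \<beta>, of \<gamma> 1 "- H"]) (use v_pair v(2,3) in blast)
  define C where "C = C1 + norm H * C1 + C2"
  define n0 where "n0 = max n1 (nat \<lceil>max r1 r2\<rceil>)"
  have n0: "n1 \<le> n0" "max r1 r2 \<le> real n0" unfolding n0_def by linarith+
  have C: "C1 \<le> C" "C1 + norm H * C1 \<le> C" "C2 \<le> C" "0 < C" using C1 C2 by (auto simp: C_def add_nonneg_pos)
  have ex: "t \<le> C * e" if "t \<le> c' * e" "c' \<le> C" "0 \<le> e" for t c' e :: real
    using that by (meson mult_right_mono order_trans)
  have ur': "norm (ur' (\<rho>\<^sup>2) x) \<le> C1 * norm \<rho> * exp (\<bar>Im \<rho>\<bar> * x)" if "real n0 \<le> norm \<rho>" "x \<in> {d..pi}" for \<rho> x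
  proof -
    have r: "r1 \<le> norm \<rho>" "0 < norm \<rho>" using that n0 C1 by linarith+
    then have "norm (ur' (\<rho>\<^sup>2) x) / norm \<rho> \<le> C1 * exp (\<bar>Im \<rho>\<bar> * x)" using fwd[of \<rho>] that by (simp add: norm_divide)
    then show ?thesis using r by (simp add: field_simps)
  qed
  show ?thesis
  proof (rule that[OF c C(4), of n0])
    show "c * norm \<rho> * exp (\<bar>Im \<rho>\<bar> * pi) \<le> norm (\<Delta> (\<rho>\<^sup>2))" if "n0 \<le> n" "square_norm \<rho> = real n + 1/2" for n and \<rho> :: complex
      using that n0 by (intro low(1)[of n]) auto
    show "c * exp (\<bar>Im \<rho>\<bar> * pi) \<le> norm (N (\<rho>\<^sup>2))" if "n0 \<le> n" "square_norm \<rho> = real n" for n and \<rho> :: complex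
      using that n0 by (intro low(2)[of n]) auto
  next
    fix \<rho> :: complex assume \<rho>: "real n0 \<le> norm \<rho>"
    then have r: "r1 \<le> norm \<rho>" "r2 \<le> norm \<rho>" "1 \<le> norm \<rho>" using n0 C1 by linarith+
    have p: "pi \<in> {d..pi}" using d by simp
    show "norm (N (\<rho>\<^sup>2)) \<le> C * exp (\<bar>Im \<rho>\<bar> * pi)"
      unfolding N_def by (rule ex[OF _ C(1)]) (use fwd[OF r(1)] p in auto)
    have "norm (\<Delta> (\<rho>\<^sup>2)) \<le> norm (ur' (\<rho>\<^sup>2) pi) + norm H * norm (ur (\<rho>\<^sup>2) pi)"
      unfolding \<Delta>_def by (metis norm_mult norm_triangle_ineq)
    also have "\<dots> \<le> C1 * norm \<rho> * exp (\<bar>Im \<rho>\<bar> * pi) + norm H * (C1 * (norm \<rho> * exp (\<bar>Im \<rho>\<bar> * pi)))"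
    proof (intro add_mono mult_left_mono ur'[OF \<rho> p] norm_ge_zero)
      have "norm (ur (\<rho>\<^sup>2) pi) \<le> C1 * (1 * exp (\<bar>Im \<rho>\<bar> * pi))" using fwd[OF r(1)] p by auto
      also have "\<dots> \<le> C1 * (norm \<rho> * exp (\<bar>Im \<rho>\<bar> * pi))" using C1 r by (intro mult_left_mono mult_right_mono) auto
      finally show "norm (ur (\<rho>\<^sup>2) pi) \<le> C1 * (norm \<rho> * exp (\<bar>Im \<rho>\<bar> * pi))" .
    qed
    also have "\<dots> = (C1 + norm H * C1) * (norm \<rho> * exp (\<bar>Im \<rho>\<bar> * pi))" by (simp add: algebra_simps)
    finally show "norm (\<Delta> (\<rho>\<^sup>2)) \<le> C * norm \<rho> * exp (\<bar>Im \<rho>\<bar> * pi)" unfolding mult.assoc by (rule ex[OF _ C(2)]) simp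
    show "norm (ul (\<rho>\<^sup>2) x) \<le> C * exp (\<bar>Im \<rho>\<bar> * x)" if "x \<in> {0..d}" for x
      by (rule ex[OF _ C(1)]) (use fwd[OF r(1)] that in auto)
    show "norm (ur (\<rho>\<^sup>2) x) \<le> C * exp (\<bar>Im \<rho>\<bar> * x)" if "x \<in> {d..pi}" for x
      by (rule ex[OF _ C(1)]) (use fwd[OF r(1)] that in auto)
    show "norm (ur' (\<rho>\<^sup>2) x) \<le> C * norm \<rho> * exp (\<bar>Im \<rho>\<bar> * x)" if "x \<in> {d..pi}" for x
      unfolding mult.assoc by (rule ex[OF _ C(1)]) (use ur'[OF \<rho> that] in \<open>auto simp: mult.assoc\<close>)
    show "norm (vl (\<rho>\<^sup>2) x) \<le> C * exp (\<bar>Im \<rho>\<bar> * (pi - x))" if "x \<in> {0..d}" for x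
      by (rule ex[OF _ C(3)]) (use bwd[OF r(2)] that in auto)
    show "norm (vr (\<rho>\<^sup>2) x) \<le> C * exp (\<bar>Im \<rho>\<bar> * (pi - x))" if "x \<in> {d..pi}" for x
      by (rule ex[OF _ C(3)]) (use bwd[OF r(2)] that in auto)
  qed
qed

lemma characteristic_functions_nonzero:
  shows "\<exists>z. \<Delta> z \<noteq> 0" "\<exists>z. N z \<noteq> 0"
proof -
  obtain c C n0 where c: "0 < c" and low:
    "\<And>n \<rho>. n0 \<le> n \<Longrightarrow> square_norm \<rho> = real n + 1/2 \<Longrightarrow> c * norm \<rho> * exp (\<bar>Im \<rho>\<bar> * pi) \<le> norm (\<Delta> (\<rho>\<^sup>2))"
    "\<And>n \<rho>. n0 \<le> n \<Longrightarrow> square_norm \<rho> = real n \<Longrightarrow> c * exp (\<bar>Im \<rho>\<bar> * pi) \<le> norm (N (\<rho>\<^sup>2))"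
    using solution_bounds by metis
  define z1 z2 :: complex where "z1 = of_real (real n0 + 1/2)" and "z2 = of_real (real n0)"
  have "square_norm z1 = real n0 + 1/2" "square_norm z2 = real n0" by (simp_all add: square_norm_def z1_def z2_def)
  then have le: "c * norm z1 * exp (\<bar>Im z1\<bar> * pi) \<le> norm (\<Delta> (z1\<^sup>2))" "c * exp (\<bar>Im z2\<bar> * pi) \<le> norm (N (z2\<^sup>2))"
    using low by blast+
  have "norm z1 = real n0 + 1/2" unfolding z1_def norm_of_real by simp
  then have "0 < c * norm z1 * exp (\<bar>Im z1\<bar> * pi)" "0 < c * exp (\<bar>Im z2\<bar> * pi)" using c by simp_all
  with le have "\<Delta> (z1\<^sup>2) \<noteq> 0" "N (z2\<^sup>2) \<noteq> 0" by force+
  then show "\<exists>z. \<Delta> z \<noteq> 0" "\<exists>z. N z \<noteq> 0" by blast+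
qed

end

locale two_problems =
  A: jump_problem q d \<beta> \<gamma> h H ul ul' ur ur' vl vl' vr vr' wl wl' wr wr' +
  B: jump_problem qt d \<beta>t \<gamma>t ht H Ul Ul' Ur Ur' Vl Vl' Vr Vr' Wl Wl' Wr Wr'
  for q qt :: "real \<Rightarrow> complex" and d \<beta> \<beta>t :: real and \<gamma> \<gamma>t h ht H :: complex
    and ul ul' ur ur' vl vl' vr vr' wl wl' wr wr' Ul Ul' Ur Ur' Vl Vl' Vr Vr' Wl Wl' Wr Wr' :: "complex \<Rightarrow> real \<Rightarrow> complex"
begin

text \<open>The factors measure the Wronskian against its trivial growth at \<rho> = i \<kappa>,
  that is at \<lambda> = -\<kappa>^2. The terms with H cancel because both problems share H, so the
  combination of characteristic functions is the Wronskian of \<phi> and \<phi>~ at \<pi>.\<close>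

lemma wronskian_at_pi_decay:
  assumes m: "m \<ge> -1" and C: "C_near_pi m q" "C_near_pi m qt" "\<And>j::nat. int j \<le> m \<Longrightarrow> (dx ^^ j) q pi = (dx ^^ j) qt pi"
  shows "((\<lambda>\<kappa>. norm (A.N (-(of_real \<kappa>)\<^sup>2) * B.\<Delta> (-(of_real \<kappa>)\<^sup>2) - A.\<Delta> (-(of_real \<kappa>)\<^sup>2) * B.N (-(of_real \<kappa>)\<^sup>2))
     * \<kappa> ^ nat (m + 1) * exp (- (2 * \<kappa> * pi))) \<longlongrightarrow> 0) at_top"
    (is "((\<lambda>\<kappa>. norm (?W \<kappa>) * \<kappa> ^ ?M * _) \<longlongrightarrow> 0) at_top")
proof (rule tendstoI)
  fix e :: real assume e: "0 < e"
  obtain C1 n1 where C1: "0 < C1"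
    "\<And>\<rho> x. real n1 \<le> norm \<rho> \<Longrightarrow> x \<in> {d..pi} \<Longrightarrow> norm (ur (\<rho>\<^sup>2) x) \<le> C1 * exp (\<bar>Im \<rho>\<bar> * x)"
    "\<And>\<rho> x. real n1 \<le> norm \<rho> \<Longrightarrow> x \<in> {d..pi} \<Longrightarrow> norm (ur' (\<rho>\<^sup>2) x) \<le> C1 * norm \<rho> * exp (\<bar>Im \<rho>\<bar> * x)"
    by (rule A.solution_bounds) blast
  obtain C2 n2 where C2: "0 < C2"
    "\<And>\<rho> x. real n2 \<le> norm \<rho> \<Longrightarrow> x \<in> {d..pi} \<Longrightarrow> norm (Ur (\<rho>\<^sup>2) x) \<le> C2 * exp (\<bar>Im \<rho>\<bar> * x)"
    "\<And>\<rho> x. real n2 \<le> norm \<rho> \<Longrightarrow> x \<in> {d..pi} \<Longrightarrow> norm (Ur' (\<rho>\<^sup>2) x) \<le> C2 * norm \<rho> * exp (\<bar>Im \<rho>\<bar> * x)"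
    by (rule B.solution_bounds) blast
  define K where "K = max C1 C2"
  have K: "C1 \<le> K" "C2 \<le> K" "0 < K" using C1(1) by (auto simp: K_def)
  \<comment> \<open>The integral enters \<open>wronskian_bound\<close> multiplied by K^2; it
    receives one half of \<open>e\<close>, and the other half is for the exponentially small
    boundary term at \<pi> - \<eta>.\<close>
  define e' where "e' = e / (2 * K ^ 2)"
  have e': "0 < e'" using e K by (simp add: e'_def)
  \<comment> \<open>Limiting \<eta> to half the distance from \<open>d\<close> to \<pi> keeps the
    interval strictly to the right of \<open>d\<close>, where the possibly different jump conditions
    do not interfere.\<close>
  have "0 < (pi - d) / 2" "(pi - d) / 2 < pi" using A.d by auto
  from weighted_difference_small[OF A.q B.q m C e' this]
  obtain \<eta> where \<eta>: "0 < \<eta>" "\<eta> \<le> (pi - d) / 2"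
    "\<And>\<kappa>. 0 < \<kappa> \<Longrightarrow> integral {pi - \<eta>..pi} (\<lambda>x. norm (qt x - q x) * exp (2 * \<kappa> * x)) \<le> e' / \<kappa> ^ ?M * exp (2 * \<kappa> * pi)"
    by blast
  have \<eta>d: "d \<le> pi - \<eta>" using \<eta>(2) A.d by (simp add: field_simps)
  have "((\<lambda>\<kappa>. 2 * K ^ 2 * (\<kappa> ^ (?M + 1) * exp (- (2 * \<kappa> * \<eta>)))) \<longlongrightarrow> 0) at_top"
    using \<eta>(1) by real_asymp
  then have "\<forall>\<^sub>F \<kappa> in at_top. 2 * K ^ 2 * (\<kappa> ^ (?M + 1) * exp (- (2 * \<kappa> * \<eta>))) < e / 2"
    by (rule order_tendstoD) (use e in simp)
  moreover have "\<forall>\<^sub>F \<kappa> in at_top. max 1 (max (real n1) (real n2)) \<le> \<kappa>" by (rule eventually_ge_at_top)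
  ultimately show "\<forall>\<^sub>F \<kappa> in at_top. dist (norm (?W \<kappa>) * \<kappa> ^ ?M * exp (- (2 * \<kappa> * pi))) 0 < e"
  proof eventually_elim
    case (elim \<kappa>)
    define \<rho> where "\<rho> = \<i> * complex_of_real \<kappa>"
    have \<rho>: "\<rho>\<^sup>2 = -(of_real \<kappa>)\<^sup>2" "norm \<rho> = \<kappa>" "\<bar>Im \<rho>\<bar> = \<kappa>" "0 < \<kappa>"
      using elim(2) by (auto simp: \<rho>_def power_mult_distrib norm_mult)
    have n: "real n1 \<le> norm \<rho>" "real n2 \<le> norm \<rho>" using elim(2) \<rho> by auto
    have ex: "t \<le> K * f" if "t \<le> c' * f" "c' \<le> K" "0 \<le> f" for t c' f :: real
      using that by (meson mult_right_mono order_trans)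
    have p: "sl_piece q (\<rho>\<^sup>2) d pi (ur (\<rho>\<^sup>2)) (ur' (\<rho>\<^sup>2))" "sl_piece qt (\<rho>\<^sup>2) d pi (Ur (\<rho>\<^sup>2)) (Ur' (\<rho>\<^sup>2))"
      using A.u_pair B.u_pair unfolding jump_pair_def by blast+
    have qr: "q absolutely_integrable_on {d..pi}" "qt absolutely_integrable_on {d..pi}"
      using A.q B.q A.d by (auto intro: absolutely_integrable_on_subinterval)
    have "norm (ur (\<rho>\<^sup>2) pi * Ur' (\<rho>\<^sup>2) pi - ur' (\<rho>\<^sup>2) pi * Ur (\<rho>\<^sup>2) pi)
        \<le> 2 * K ^ 2 * \<kappa> * exp (2 * \<kappa> * (pi - \<eta>)) + K ^ 2 * (e' / \<kappa> ^ ?M * exp (2 * \<kappa> * pi))"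
    proof (rule wronskian_bound[OF p qr \<eta>(1) \<eta>d])
      fix x assume x: "x \<in> {d..pi}"
      show "norm (ur (\<rho>\<^sup>2) x) \<le> K * exp (\<kappa> * x)" using C1(2)[OF n(1) x] unfolding \<rho>(3) by (rule ex[OF _ K(1)]) simp
      show "norm (Ur (\<rho>\<^sup>2) x) \<le> K * exp (\<kappa> * x)" using C2(2)[OF n(2) x] unfolding \<rho>(3) by (rule ex[OF _ K(2)]) simp
      show "norm (ur' (\<rho>\<^sup>2) x) \<le> K * \<kappa> * exp (\<kappa> * x)"
        using C1(3)[OF n(1) x] \<rho>(4) unfolding \<rho>(2,3) mult.assoc by (intro ex[OF _ K(1)]) auto
      show "norm (Ur' (\<rho>\<^sup>2) x) \<le> K * \<kappa> * exp (\<kappa> * x)"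
        using C2(3)[OF n(2) x] \<rho>(4) unfolding \<rho>(2,3) mult.assoc by (intro ex[OF _ K(2)]) auto
    qed (use K \<rho> \<eta>(3) in auto)
    moreover have "ur (\<rho>\<^sup>2) pi * Ur' (\<rho>\<^sup>2) pi - ur' (\<rho>\<^sup>2) pi * Ur (\<rho>\<^sup>2) pi = ?W \<kappa>"
      unfolding A.N_def B.N_def A.\<Delta>_def B.\<Delta>_def \<rho>(1) by (simp add: algebra_simps)
    ultimately have "norm (?W \<kappa>) \<le> 2 * K ^ 2 * \<kappa> * exp (2 * \<kappa> * (pi - \<eta>)) + K ^ 2 * (e' / \<kappa> ^ ?M * exp (2 * \<kappa> * pi))" by simp
    then have "norm (?W \<kappa>) * (\<kappa> ^ ?M * exp (- (2 * \<kappa> * pi)))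
        \<le> (2 * K ^ 2 * \<kappa> * exp (2 * \<kappa> * (pi - \<eta>)) + K ^ 2 * (e' / \<kappa> ^ ?M * exp (2 * \<kappa> * pi))) * (\<kappa> ^ ?M * exp (- (2 * \<kappa> * pi)))"
      using \<rho>(4) by (intro mult_right_mono) auto
    also have "\<dots> = 2 * K ^ 2 * (\<kappa> ^ ?M * \<kappa> * (exp (2 * \<kappa> * (pi - \<eta>)) * exp (- (2 * \<kappa> * pi)))) + K ^ 2 * e' * (exp (2 * \<kappa> * pi) * exp (- (2 * \<kappa> * pi)))"
    proof -
      have "(2 * k * \<kappa> * E1 + k * (e' / p * E2)) * (p * F) = 2 * k * (p * \<kappa> * (E1 * F)) + k * e' * (E2 * F)" if "p \<noteq> 0" for k p E1 E2 F :: real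
        using that by (simp add: distrib_right)
      then show ?thesis using \<rho>(4) by simp
    qed
    finally have fin: "norm (?W \<kappa>) * (\<kappa> ^ ?M * exp (- (2 * \<kappa> * pi)))
        \<le> 2 * K ^ 2 * (\<kappa> ^ ?M * \<kappa> * (exp (2 * \<kappa> * (pi - \<eta>)) * exp (- (2 * \<kappa> * pi)))) + K ^ 2 * e' * (exp (2 * \<kappa> * pi) * exp (- (2 * \<kappa> * pi)))" .
    have ee: "exp (2 * \<kappa> * (pi - \<eta>)) * exp (- (2 * \<kappa> * pi)) = exp (- (2 * \<kappa> * \<eta>))" "exp (2 * \<kappa> * pi) * exp (- (2 * \<kappa> * pi)) = 1"
      unfolding exp_add[symmetric] by (simp_all add: algebra_simps)
    have ke: "K ^ 2 * e' = e / 2" using K by (simp add: e'_def)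
    have kk: "\<kappa> ^ ?M * \<kappa> = \<kappa> ^ (?M + 1)" by simp
    have "norm (?W \<kappa>) * (\<kappa> ^ ?M * exp (- (2 * \<kappa> * pi))) \<le> 2 * K ^ 2 * (\<kappa> ^ (?M + 1) * exp (- (2 * \<kappa> * \<eta>))) + e / 2"
      using fin unfolding ee kk ke mult_1_right .
    also have "\<dots> < e" using elim(1) by linarith
    finally have "norm (?W \<kappa>) * (\<kappa> ^ ?M * exp (- (2 * \<kappa> * pi))) < e" .
    moreover have "0 \<le> norm (?W \<kappa>) * (\<kappa> ^ ?M * exp (- (2 * \<kappa> * pi)))" using \<rho>(4) by simp
    ultimately show ?case unfolding dist_real_def diff_zero mult.assoc by (metis abs_of_nonneg)
  qed
qed

end

section \<open>Equality of the quotients of characteristic functions\<close>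

lemma entire_mult_eq_zero:
  assumes hol: "f holomorphic_on UNIV" "g holomorphic_on UNIV" and fg: "\<And>z. f z * g z = 0" and w: "f w \<noteq> (0::complex)"
  shows "g z = 0"
proof -
  define U where "U = {z. f z \<noteq> 0}"
  have "open U" unfolding U_def using hol(1) by (intro open_Collect_neq) (auto intro: holomorphic_on_imp_continuous_on)
  moreover have "w \<in> U" using w by (simp add: U_def)
  ultimately have lim: "w islimpt U" by (simp add: interior_limit_point interior_open)
  show ?thesis
    by (rule analytic_continuation[OF hol(2) open_UNIV connected_UNIV _ _ lim]) (use fg in \<open>auto simp: U_def\<close>)
qed

text \<open>The common end of both cases. In \<rho> the extended product is a polynomial of degree
  at most 2 N + p; the bound \<open>decay\<close> already carries the factor \<kappa>^(2N) by which
  Q may grow at \<lambda> = -\<kappa>^2. After it is shown to vanish, denominators are cleared and Q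
  is cancelled by the identity theorem.\<close>

lemma quotients_eq_of_decay:
  fixes \<Delta> \<Delta>' M M' Q :: "complex \<Rightarrow> complex" and E :: "real \<Rightarrow> real"
  assumes hol: "\<Delta> holomorphic_on UNIV" "\<Delta>' holomorphic_on UNIV" "M holomorphic_on UNIV" "M' holomorphic_on UNIV" "Q holomorphic_on UNIV"
    and Q: "\<And>z. norm (Q z) \<le> C * (1 + norm z) ^ N" "0 \<le> C" "\<exists>z. Q z \<noteq> 0"
    and g0: "remove_sings (\<lambda>z. Q z * (M z / \<Delta> z - M' z / \<Delta>' z)) holomorphic_on UNIV"
    and s: "0 \<le> s" "s \<le> 1" and B: "0 \<le> B"
    and nz: "\<And>n \<rho>. n \<ge> n0 \<Longrightarrow> square_norm \<rho> = real n + s \<Longrightarrow> \<Delta> (\<rho>\<^sup>2) \<noteq> 0 \<and> \<Delta>' (\<rho>\<^sup>2) \<noteq> 0"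
    and bd: "\<And>n \<rho>. n \<ge> n0 \<Longrightarrow> square_norm \<rho> = real n + s \<Longrightarrow> norm (M (\<rho>\<^sup>2) / \<Delta> (\<rho>\<^sup>2) - M' (\<rho>\<^sup>2) / \<Delta>' (\<rho>\<^sup>2)) \<le> B * norm \<rho> ^ p"
    and decay: "\<And>n \<kappa>. n \<ge> n0 \<Longrightarrow> \<kappa> = real n + s \<Longrightarrow> norm (M (-(of_real \<kappa>)\<^sup>2) / \<Delta> (-(of_real \<kappa>)\<^sup>2) - M' (-(of_real \<kappa>)\<^sup>2) / \<Delta>' (-(of_real \<kappa>)\<^sup>2)) * \<kappa> ^ (2 * N) \<le> E \<kappa>"
    and E: "(E \<longlongrightarrow> 0) at_top"
  shows "M z * \<Delta>' z = M' z * \<Delta> z"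
proof -
  define f where "f z = Q z * (M z / \<Delta> z - M' z / \<Delta>' z)" for z
  have g0': "remove_sings f holomorphic_on UNIV" using g0 unfolding f_def[abs_def] .
  have feq: "remove_sings f z = f z" if "\<Delta> z \<noteq> 0" "\<Delta>' z \<noteq> 0" for z
  proof (rule remove_sings_at_analytic)
    have "h analytic_on {z}" if "h holomorphic_on UNIV" for h using that by (simp add: analytic_on_holomorphic) (metis UNIV_I open_UNIV)
    then show "f analytic_on {z}" unfolding f_def[abs_def] using that hol by (intro analytic_intros) auto
  qed
  \<comment> \<open>Ensures |\<rho>| \<ge> 1, so that 1 + |\<rho>|^2 is at most 2
    |\<rho>|^2.\<close>
  define n1 where "n1 = max n0 1"
  have Qb: "norm (Q (\<rho>\<^sup>2)) \<le> C * 2 ^ N * norm \<rho> ^ (2 * N)" if "1 \<le> norm \<rho>" for \<rho>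
  proof -
    have "norm (Q (\<rho>\<^sup>2)) \<le> C * (1 + (norm \<rho>)\<^sup>2) ^ N" using Q(1)[of "\<rho>\<^sup>2"] by (simp add: norm_power)
    also have "\<dots> \<le> C * (2 * (norm \<rho>)\<^sup>2) ^ N" using that Q(2) one_le_power[OF that, of 2] by (intro mult_left_mono power_mono) auto
    finally show ?thesis by (simp add: power_mult_distrib power_mult)
  qed
  have fb: "norm (remove_sings f (\<rho>\<^sup>2)) \<le> C * 2 ^ N * norm \<rho> ^ (2 * N) * norm (M (\<rho>\<^sup>2) / \<Delta> (\<rho>\<^sup>2) - M' (\<rho>\<^sup>2) / \<Delta>' (\<rho>\<^sup>2))"
    if n: "n1 \<le> n" "square_norm \<rho> = real n + s" for n \<rho>
  proof -
    have "1 \<le> norm \<rho>" using square_norm_le_norm[of \<rho>] n s unfolding n1_def by linarith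
    from mult_right_mono[OF Qb[OF this] norm_ge_zero, of "M (\<rho>\<^sup>2) / \<Delta> (\<rho>\<^sup>2) - M' (\<rho>\<^sup>2) / \<Delta>' (\<rho>\<^sup>2)"]
    show ?thesis using feq[of "\<rho>\<^sup>2"] nz[of n \<rho>] n by (simp add: f_def norm_mult n1_def)
  qed
  have zero: "remove_sings f (\<rho>\<^sup>2) = 0" for \<rho>
  proof (rule entire_polynomial_on_squares_imp_zero[where g = "\<lambda>\<rho>. remove_sings f (\<rho>\<^sup>2)" and s = s and B = "C * 2 ^ N * B" and p = "2 * N + p" and ?n0.0 = n1])
    show "(\<lambda>\<rho>. remove_sings f (\<rho>\<^sup>2)) holomorphic_on UNIV"
      using holomorphic_on_compose_gen[OF _ g0', of "\<lambda>\<rho>. \<rho>\<^sup>2" UNIV] by (simp add: o_def holomorphic_on_power)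
    show "0 \<le> C * 2 ^ N * B" using Q(2) B by simp
    fix n \<rho> assume n: "n1 \<le> n" "square_norm \<rho> = real n + s"
    have "norm (remove_sings f (\<rho>\<^sup>2)) \<le> C * 2 ^ N * norm \<rho> ^ (2 * N) * (B * norm \<rho> ^ p)"
      using fb[OF n] bd[of n \<rho>] n Q(2) by (auto simp: n1_def intro!: order_trans[OF fb[OF n]] mult_left_mono)
    then show "norm (remove_sings f (\<rho>\<^sup>2)) \<le> C * 2 ^ N * B * norm \<rho> ^ (2 * N + p)" by (simp add: power_add mult_ac)
  next
    have "filterlim (\<lambda>n. real n + s) at_top sequentially" by real_asymp
    from tendsto_mult_right_zero[OF filterlim_compose[OF E this], of "C * 2 ^ N"]
    have lim: "(\<lambda>n. C * 2 ^ N * E (real n + s)) \<longlonglongrightarrow> 0" .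
    show "(\<lambda>n. remove_sings f ((\<i> * complex_of_real (real n + s))\<^sup>2)) \<longlonglongrightarrow> 0"
    proof (rule Lim_null_comparison[OF _ lim], rule eventually_sequentiallyI[of n1])
      fix n assume n: "n1 \<le> n"
      define \<rho> where "\<rho> = \<i> * complex_of_real (real n + s)"
      have \<rho>: "square_norm \<rho> = real n + s" "norm \<rho> = real n + s" "\<rho>\<^sup>2 = -(of_real (real n + s))\<^sup>2"
        using s by (auto simp: \<rho>_def square_norm_def norm_mult power_mult_distrib simp del: of_real_add)
      have "norm (remove_sings f (\<rho>\<^sup>2)) \<le> C * 2 ^ N * (norm (M (\<rho>\<^sup>2) / \<Delta> (\<rho>\<^sup>2) - M' (\<rho>\<^sup>2) / \<Delta>' (\<rho>\<^sup>2)) * (real n + s) ^ (2 * N))"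
        using fb[OF n \<rho>(1)] unfolding \<rho>(2) by (simp add: mult_ac)
      also have "\<dots> \<le> C * 2 ^ N * E (real n + s)"
        unfolding \<rho>(3) using n Q(2) by (intro mult_left_mono decay[of n]) (auto simp: n1_def)
      finally show "norm (remove_sings f ((\<i> * complex_of_real (real n + s))\<^sup>2)) \<le> C * 2 ^ N * E (real n + s)" unfolding \<rho>_def .
    qed
  qed (use s in auto)
  obtain zQ where zQ: "Q zQ \<noteq> 0" using Q(3) by blast
  have zero': "\<Delta> z * \<Delta>' z * (M z * \<Delta>' z - M' z * \<Delta> z) = 0" for z
  proof (rule entire_mult_eq_zero[where g = "\<lambda>z. \<Delta> z * \<Delta>' z * (M z * \<Delta>' z - M' z * \<Delta> z)", OF hol(5) _ _ zQ])
    show "(\<lambda>z. \<Delta> z * \<Delta>' z * (M z * \<Delta>' z - M' z * \<Delta> z)) holomorphic_on UNIV" using hol by (intro holomorphic_intros)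
    fix z
    show "Q z * (\<Delta> z * \<Delta>' z * (M z * \<Delta>' z - M' z * \<Delta> z)) = 0"
    proof (cases "\<Delta> z = 0 \<or> \<Delta>' z = 0")
      case False
      \<comment> \<open>Every z is the square of \<open>csqrt z\<close>, so vanishing in the
        variable \<rho> is vanishing at every z.\<close>
      then have "f z = 0" using zero[of "csqrt z"] feq[of z] by simp
      then have "Q z = 0 \<or> M z * \<Delta>' z - M' z * \<Delta> z = 0" using False unfolding f_def by (simp add: field_simps)
      then show ?thesis by auto
    qed auto
  qed
  have "\<exists>w. \<Delta> w * \<Delta>' w \<noteq> 0"
    using nz[of n0 "of_real (real n0 + s)"] s by (auto simp: square_norm_def simp del: of_real_add)
  then obtain w where w: "\<Delta> w * \<Delta>' w \<noteq> 0" by blast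
  have "M z * \<Delta>' z - M' z * \<Delta> z = 0"
    by (rule entire_mult_eq_zero[where f = "\<lambda>z. \<Delta> z * \<Delta>' z" and g = "\<lambda>z. M z * \<Delta>' z - M' z * \<Delta> z", OF _ _ zero' w])
      (intro holomorphic_intros hol)+
  then show ?thesis by simp
qed

context two_problems
begin

text \<open>Squares of half-integer size, where Delta has full size. N / Delta is bounded there, so
  no power of \<rho> beyond that of Q arises.\<close>

lemma quotients_eq_of_spectral_data:
  assumes m: "m \<ge> -1" and C: "C_near_pi m q" "C_near_pi m qt" "\<And>j::nat. int j \<le> m \<Longrightarrow> (dx ^^ j) q pi = (dx ^^ j) qt pi"
    and l: "eigenvalue_seq A.\<Delta> l" "eigenvalue_seq B.\<Delta> lt"
    and agree: "spectral_data_agree A.\<Delta> (psi q H \<beta> \<gamma> d) l B.\<Delta> (psi qt H \<beta>t \<gamma>t d) lt (nat ((m + 3) div 2))"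
  shows "A.N z * B.\<Delta> z = B.N z * A.\<Delta> z"
proof -
  define N where "N = nat ((m + 3) div 2)"
  \<comment> \<open>The number 2 N is at most m + 3: the power m + 1 comes from the Wronskian, and
    the 2 from the factor \<kappa> in the lower bound of each Delta.\<close>
  have N: "2 * N \<le> nat (m + 1) + 2" using m by (simp add: N_def)
  obtain w0 w0' where w: "A.\<Delta> w0 \<noteq> 0" "B.\<Delta> w0' \<noteq> 0" using A.characteristic_functions_nonzero B.characteristic_functions_nonzero by blast
  obtain Q K where Q: "Q holomorphic_on UNIV" "\<And>z. norm (Q z) \<le> K * (1 + norm z) ^ N" "0 \<le> K" "\<exists>z. Q z \<noteq> 0"
    "remove_sings (\<lambda>z. Q z * (A.N z / A.\<Delta> z - B.N z / B.\<Delta> z)) holomorphic_on UNIV"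
    by (rule spectral_data_agree_imp_entire[OF A.characteristic_functions_entire(2) B.characteristic_functions_entire(2) A.characteristic_functions_entire(1) B.characteristic_functions_entire(1) A.characteristic_functions_entire(3) B.characteristic_functions_entire(3) A.characteristic_functions_entire(4) B.characteristic_functions_entire(4)
      A.value_relation B.value_relation w l A.norming_psi B.norming_psi agree[folded N_def]]) blast+
  obtain c C n1 where A: "0 < c" "0 < C"
    "\<And>n \<rho>. n1 \<le> n \<Longrightarrow> square_norm \<rho> = real n + 1/2 \<Longrightarrow> c * norm \<rho> * exp (\<bar>Im \<rho>\<bar> * pi) \<le> norm (A.\<Delta> (\<rho>\<^sup>2))"
    "\<And>\<rho>. real n1 \<le> norm \<rho> \<Longrightarrow> norm (A.N (\<rho>\<^sup>2)) \<le> C * exp (\<bar>Im \<rho>\<bar> * pi)"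
    by (rule A.solution_bounds) blast
  obtain c' C' n2 where B: "0 < c'" "0 < C'"
    "\<And>n \<rho>. n2 \<le> n \<Longrightarrow> square_norm \<rho> = real n + 1/2 \<Longrightarrow> c' * norm \<rho> * exp (\<bar>Im \<rho>\<bar> * pi) \<le> norm (B.\<Delta> (\<rho>\<^sup>2))"
    "\<And>\<rho>. real n2 \<le> norm \<rho> \<Longrightarrow> norm (B.N (\<rho>\<^sup>2)) \<le> C' * exp (\<bar>Im \<rho>\<bar> * pi)"
    by (rule B.solution_bounds) blast
  define n0 where "n0 = max 1 (max n1 n2)"
  have low: "1 \<le> norm \<rho>" "real n1 \<le> norm \<rho>" "real n2 \<le> norm \<rho>"
    "0 < c * norm \<rho> * exp (\<bar>Im \<rho>\<bar> * pi)" "c * norm \<rho> * exp (\<bar>Im \<rho>\<bar> * pi) \<le> norm (A.\<Delta> (\<rho>\<^sup>2))"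
    "0 < c' * norm \<rho> * exp (\<bar>Im \<rho>\<bar> * pi)" "c' * norm \<rho> * exp (\<bar>Im \<rho>\<bar> * pi) \<le> norm (B.\<Delta> (\<rho>\<^sup>2))"
    if "n0 \<le> n" "square_norm \<rho> = real n + 1/2" for n \<rho>
  proof -
    have n: "1 \<le> real n" "n1 \<le> n" "n2 \<le> n" using that by (auto simp: n0_def)
    then show r: "1 \<le> norm \<rho>" "real n1 \<le> norm \<rho>" "real n2 \<le> norm \<rho>" using square_norm_le_norm[of \<rho>] that(2) by linarith+
    have "0 < norm \<rho>" using r(1) by linarith
    then show "0 < c * norm \<rho> * exp (\<bar>Im \<rho>\<bar> * pi)" "0 < c' * norm \<rho> * exp (\<bar>Im \<rho>\<bar> * pi)" using A(1) B(1) by simp_all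
    show "c * norm \<rho> * exp (\<bar>Im \<rho>\<bar> * pi) \<le> norm (A.\<Delta> (\<rho>\<^sup>2))" "c' * norm \<rho> * exp (\<bar>Im \<rho>\<bar> * pi) \<le> norm (B.\<Delta> (\<rho>\<^sup>2))"
      using A(3)[OF n(2) that(2)] B(3)[OF n(3) that(2)] .
  qed
  define E where "E \<kappa> = norm (A.N (-(of_real \<kappa>)\<^sup>2) * B.\<Delta> (-(of_real \<kappa>)\<^sup>2) - A.\<Delta> (-(of_real \<kappa>)\<^sup>2) * B.N (-(of_real \<kappa>)\<^sup>2))
     * \<kappa> ^ nat (m + 1) * exp (- (2 * \<kappa> * pi))" for \<kappa> :: real
  show ?thesis
  proof (rule quotients_eq_of_decay[OF A.characteristic_functions_entire(2) B.characteristic_functions_entire(2) A.characteristic_functions_entire(1) B.characteristic_functions_entire(1) Q, of "1/2" "C / c + C' / c'" n0 0 "\<lambda>\<kappa>. E \<kappa> / (c * c')"])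
    show "((\<lambda>\<kappa>. E \<kappa> / (c * c')) \<longlongrightarrow> 0) at_top"
      using tendsto_divide[OF wronskian_at_pi_decay[OF m C] tendsto_const, of "c * c'"] A(1) B(1) unfolding E_def by simp
    fix n \<rho> assume n: "n0 \<le> n" "square_norm \<rho> = real n + 1/2"
    show "A.\<Delta> (\<rho>\<^sup>2) \<noteq> 0 \<and> B.\<Delta> (\<rho>\<^sup>2) \<noteq> 0" using low(4-7)[OF n] by auto
    have qb: "x / y \<le> K / k" if "x \<le> K * e" "k * r * e \<le> y" "1 \<le> r" "0 < e" "0 < k" "0 < K" for x y K k r e :: real
    proof -
      have "k * e * 1 \<le> k * e * r" using that by (intro mult_left_mono) auto
      then have "k * e \<le> y" using that(2) by (simp add: mult_ac)
      then have "x / y \<le> (K * e) / (k * e)" using that by (intro frac_le) auto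
      then show ?thesis using that by simp
    qed
    have "norm (A.N (\<rho>\<^sup>2) / A.\<Delta> (\<rho>\<^sup>2)) \<le> C / c" "norm (B.N (\<rho>\<^sup>2) / B.\<Delta> (\<rho>\<^sup>2)) \<le> C' / c'"
      unfolding norm_divide using low[OF n] A B by (intro qb[of _ _ "exp (\<bar>Im \<rho>\<bar> * pi)" _ "norm \<rho>"]; simp)+
    then show "norm (A.N (\<rho>\<^sup>2) / A.\<Delta> (\<rho>\<^sup>2) - B.N (\<rho>\<^sup>2) / B.\<Delta> (\<rho>\<^sup>2)) \<le> (C / c + C' / c') * norm \<rho> ^ 0"
      using norm_triangle_ineq4[of "A.N (\<rho>\<^sup>2) / A.\<Delta> (\<rho>\<^sup>2)" "B.N (\<rho>\<^sup>2) / B.\<Delta> (\<rho>\<^sup>2)"] by simp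
  next
    fix n and \<kappa> :: real assume n: "n0 \<le> n" and \<kappa>: "\<kappa> = real n + 1/2"
    define \<rho> where "\<rho> = \<i> * complex_of_real \<kappa>"
    have k0: "1 \<le> \<kappa>" using n \<kappa> by (simp add: n0_def)
    then have \<rho>: "square_norm \<rho> = real n + 1/2" "norm \<rho> = \<kappa>" "\<rho>\<^sup>2 = -(of_real \<kappa>)\<^sup>2" "\<bar>Im \<rho>\<bar> = \<kappa>"
      using \<kappa> by (auto simp: \<rho>_def square_norm_def norm_mult power_mult_distrib simp del: of_real_add)
    note L = low(4-7)[OF n \<rho>(1), unfolded \<rho>(2,4)]
    let ?W = "norm (A.N (\<rho>\<^sup>2) * B.\<Delta> (\<rho>\<^sup>2) - A.\<Delta> (\<rho>\<^sup>2) * B.N (\<rho>\<^sup>2))"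
    have nz: "A.\<Delta> (\<rho>\<^sup>2) \<noteq> 0" "B.\<Delta> (\<rho>\<^sup>2) \<noteq> 0" using L by auto
    then have "A.N (\<rho>\<^sup>2) / A.\<Delta> (\<rho>\<^sup>2) - B.N (\<rho>\<^sup>2) / B.\<Delta> (\<rho>\<^sup>2) = (A.N (\<rho>\<^sup>2) * B.\<Delta> (\<rho>\<^sup>2) - A.\<Delta> (\<rho>\<^sup>2) * B.N (\<rho>\<^sup>2)) / (A.\<Delta> (\<rho>\<^sup>2) * B.\<Delta> (\<rho>\<^sup>2))"
      by (simp add: field_simps)
    then have "norm (A.N (\<rho>\<^sup>2) / A.\<Delta> (\<rho>\<^sup>2) - B.N (\<rho>\<^sup>2) / B.\<Delta> (\<rho>\<^sup>2)) = ?W / (norm (A.\<Delta> (\<rho>\<^sup>2)) * norm (B.\<Delta> (\<rho>\<^sup>2)))"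
      by (simp add: norm_divide norm_mult)
    also have "\<dots> \<le> ?W / ((c * \<kappa> * exp (\<kappa> * pi)) * (c' * \<kappa> * exp (\<kappa> * pi)))"
    proof (intro divide_left_mono mult_mono mult_pos_pos L)
      show "0 < norm (A.\<Delta> (\<rho>\<^sup>2))" "0 < norm (B.\<Delta> (\<rho>\<^sup>2))" using nz by auto
    qed (use L k0 A(1) B(1) in auto)
    also have "\<dots> = ?W / (c * c') / \<kappa> ^ 2 * exp (- (2 * \<kappa> * pi))"
    proof -
      have "exp (- (2 * \<kappa> * pi)) = 1 / (exp (\<kappa> * pi) * exp (\<kappa> * pi))" by (simp add: exp_minus exp_add[symmetric] inverse_eq_divide)
      then show ?thesis by (simp add: power2_eq_square)
    qed
    finally have "norm (A.N (\<rho>\<^sup>2) / A.\<Delta> (\<rho>\<^sup>2) - B.N (\<rho>\<^sup>2) / B.\<Delta> (\<rho>\<^sup>2)) * \<kappa> ^ (2 * N)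
        \<le> ?W / (c * c') / \<kappa> ^ 2 * exp (- (2 * \<kappa> * pi)) * \<kappa> ^ (nat (m + 1) + 2)"
      using k0 A(1) B(1) by (intro mult_mono power_increasing[OF N]) auto
    also have "\<dots> = E \<kappa> / (c * c')"
    proof -
      have "\<kappa> \<noteq> 0" using k0 by simp
      then show ?thesis unfolding E_def \<rho>(3) power_add by simp
    qed
    finally show "norm (A.N (- (complex_of_real \<kappa>)\<^sup>2) / A.\<Delta> (- (complex_of_real \<kappa>)\<^sup>2) - B.N (- (complex_of_real \<kappa>)\<^sup>2) / B.\<Delta> (- (complex_of_real \<kappa>)\<^sup>2)) * \<kappa> ^ (2 * N) \<le> E \<kappa> / (c * c')"
      unfolding \<rho>(3) .
  qed (use A(1,2) B(1,2) in auto)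
qed

text \<open>The denominators are now -N and -N~, which have full size on squares of integer size but
  without the factor \<kappa>; this costs two powers of decay and explains the smaller number of
  exceptions. The quotient Delta / N may grow like |\<rho>|, hence the exponent 1 in the growth
  bound.\<close>

lemma quotients_eq_of_spectral_data_inf:
  assumes m: "m \<ge> -1" and C: "C_near_pi m q" "C_near_pi m qt" "\<And>j::nat. int j \<le> m \<Longrightarrow> (dx ^^ j) q pi = (dx ^^ j) qt pi"
    and l: "eigenvalue_seq (\<lambda>z. - A.N z) l" "eigenvalue_seq (\<lambda>z. - B.N z) lt"
    and agree: "spectral_data_agree (\<lambda>z. - A.N z) (psi_inf q \<beta> \<gamma> d) l (\<lambda>z. - B.N z) (psi_inf qt \<beta>t \<gamma>t d) lt (nat ((m + 1) div 2))"
  shows "A.N z * B.\<Delta> z = B.N z * A.\<Delta> z"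
proof -
  define N where "N = nat ((m + 1) div 2)"
  have N: "2 * N \<le> nat (m + 1)" using m by (simp add: N_def)
  obtain w0 w0' where w: "- A.N w0 \<noteq> 0" "- B.N w0' \<noteq> 0" using A.characteristic_functions_nonzero B.characteristic_functions_nonzero by auto
  have rel: "wl z 0 * A.\<Delta> z = 1 - (- A.N z) * (- vl z 0)" "Wl z 0 * B.\<Delta> z = 1 - (- B.N z) * (- Vl z 0)" for z
    using A.value_relation[of z] B.value_relation[of z] by (simp_all add: algebra_simps)
  obtain Q K where Q: "Q holomorphic_on UNIV" "\<And>z. norm (Q z) \<le> K * (1 + norm z) ^ N" "0 \<le> K" "\<exists>z. Q z \<noteq> 0"
    "remove_sings (\<lambda>z. Q z * (A.\<Delta> z / (- A.N z) - B.\<Delta> z / (- B.N z))) holomorphic_on UNIV"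
    by (rule spectral_data_agree_imp_entire[OF holomorphic_on_minus[OF A.characteristic_functions_entire(1)] holomorphic_on_minus[OF B.characteristic_functions_entire(1)] A.characteristic_functions_entire(2) B.characteristic_functions_entire(2) A.characteristic_functions_entire(4) B.characteristic_functions_entire(4)
      holomorphic_on_minus[OF A.characteristic_functions_entire(3)] holomorphic_on_minus[OF B.characteristic_functions_entire(3)] rel w l A.norming_psi_inf B.norming_psi_inf agree[folded N_def]]) blast+
  obtain c C n1 where A: "0 < c" "0 < C"
    "\<And>n \<rho>. n1 \<le> n \<Longrightarrow> square_norm \<rho> = real n \<Longrightarrow> c * exp (\<bar>Im \<rho>\<bar> * pi) \<le> norm (A.N (\<rho>\<^sup>2))"
    "\<And>\<rho>. real n1 \<le> norm \<rho> \<Longrightarrow> norm (A.\<Delta> (\<rho>\<^sup>2)) \<le> C * norm \<rho> * exp (\<bar>Im \<rho>\<bar> * pi)"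
    by (rule A.solution_bounds) blast
  obtain c' C' n2 where B: "0 < c'" "0 < C'"
    "\<And>n \<rho>. n2 \<le> n \<Longrightarrow> square_norm \<rho> = real n \<Longrightarrow> c' * exp (\<bar>Im \<rho>\<bar> * pi) \<le> norm (B.N (\<rho>\<^sup>2))"
    "\<And>\<rho>. real n2 \<le> norm \<rho> \<Longrightarrow> norm (B.\<Delta> (\<rho>\<^sup>2)) \<le> C' * norm \<rho> * exp (\<bar>Im \<rho>\<bar> * pi)"
    by (rule B.solution_bounds) blast
  define n0 where "n0 = max 1 (max n1 n2)"
  have low: "real n1 \<le> norm \<rho>" "real n2 \<le> norm \<rho>"
    "0 < c * exp (\<bar>Im \<rho>\<bar> * pi)" "c * exp (\<bar>Im \<rho>\<bar> * pi) \<le> norm (A.N (\<rho>\<^sup>2))"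
    "0 < c' * exp (\<bar>Im \<rho>\<bar> * pi)" "c' * exp (\<bar>Im \<rho>\<bar> * pi) \<le> norm (B.N (\<rho>\<^sup>2))"
    if "n0 \<le> n" "square_norm \<rho> = real n + 0" for n \<rho>
  proof -
    have n: "n1 \<le> n" "n2 \<le> n" "square_norm \<rho> = real n" using that by (auto simp: n0_def)
    then show "real n1 \<le> norm \<rho>" "real n2 \<le> norm \<rho>" using square_norm_le_norm[of \<rho>] by linarith+
    show "0 < c * exp (\<bar>Im \<rho>\<bar> * pi)" "0 < c' * exp (\<bar>Im \<rho>\<bar> * pi)" using A(1) B(1) by auto
    show "c * exp (\<bar>Im \<rho>\<bar> * pi) \<le> norm (A.N (\<rho>\<^sup>2))" "c' * exp (\<bar>Im \<rho>\<bar> * pi) \<le> norm (B.N (\<rho>\<^sup>2))"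
      using A(3)[OF n(1,3)] B(3)[OF n(2,3)] .
  qed
  define E where "E \<kappa> = norm (A.N (-(of_real \<kappa>)\<^sup>2) * B.\<Delta> (-(of_real \<kappa>)\<^sup>2) - A.\<Delta> (-(of_real \<kappa>)\<^sup>2) * B.N (-(of_real \<kappa>)\<^sup>2))
     * \<kappa> ^ nat (m + 1) * exp (- (2 * \<kappa> * pi))" for \<kappa> :: real
  have "A.\<Delta> z * (- B.N z) = B.\<Delta> z * (- A.N z)"
  proof (rule quotients_eq_of_decay[OF holomorphic_on_minus[OF A.characteristic_functions_entire(1)] holomorphic_on_minus[OF B.characteristic_functions_entire(1)] A.characteristic_functions_entire(2) B.characteristic_functions_entire(2) Q,
        of 0 "C / c + C' / c'" n0 1 "\<lambda>\<kappa>. E \<kappa> / (c * c')"])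
    show "((\<lambda>\<kappa>. E \<kappa> / (c * c')) \<longlongrightarrow> 0) at_top"
      using tendsto_divide[OF wronskian_at_pi_decay[OF m C] tendsto_const, of "c * c'"] A(1) B(1) unfolding E_def by simp
    fix n \<rho> assume n: "n0 \<le> n" "square_norm \<rho> = real n + 0"
    show "- A.N (\<rho>\<^sup>2) \<noteq> 0 \<and> - B.N (\<rho>\<^sup>2) \<noteq> 0" using low(3-6)[OF n] by auto
    have qb: "x / y \<le> K / k * r" if "x \<le> K * r * e" "k * e \<le> y" "0 \<le> r" "0 < e" "0 < k" "0 < K" for x y K k r e :: real
    proof -
      have "x / y \<le> (K * r * e) / (k * e)" using that by (intro frac_le) auto
      then show ?thesis using that by simp
    qed
    have "norm (A.\<Delta> (\<rho>\<^sup>2) / - A.N (\<rho>\<^sup>2)) \<le> C / c * norm \<rho>" "norm (B.\<Delta> (\<rho>\<^sup>2) / - B.N (\<rho>\<^sup>2)) \<le> C' / c' * norm \<rho>"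
      unfolding norm_divide norm_minus_cancel using low[OF n] A B by (intro qb[of _ _ _ "exp (\<bar>Im \<rho>\<bar> * pi)"]; simp)+
    then show "norm (A.\<Delta> (\<rho>\<^sup>2) / - A.N (\<rho>\<^sup>2) - B.\<Delta> (\<rho>\<^sup>2) / - B.N (\<rho>\<^sup>2)) \<le> (C / c + C' / c') * norm \<rho> ^ 1"
      using norm_triangle_ineq4[of "A.\<Delta> (\<rho>\<^sup>2) / - A.N (\<rho>\<^sup>2)" "B.\<Delta> (\<rho>\<^sup>2) / - B.N (\<rho>\<^sup>2)"] unfolding power_one_right distrib_right by linarith
  next
    fix n and \<kappa> :: real assume n: "n0 \<le> n" and \<kappa>: "\<kappa> = real n + 0"
    define \<rho> where "\<rho> = \<i> * complex_of_real \<kappa>"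
    have k0: "1 \<le> \<kappa>" using n \<kappa> by (simp add: n0_def)
    then have \<rho>: "square_norm \<rho> = real n + 0" "norm \<rho> = \<kappa>" "\<rho>\<^sup>2 = -(of_real \<kappa>)\<^sup>2" "\<bar>Im \<rho>\<bar> = \<kappa>"
      using \<kappa> by (auto simp: \<rho>_def square_norm_def norm_mult power_mult_distrib simp del: of_real_add)
    note L = low(3-6)[OF n \<rho>(1), unfolded \<rho>(2,4)]
    let ?W = "norm (A.N (\<rho>\<^sup>2) * B.\<Delta> (\<rho>\<^sup>2) - A.\<Delta> (\<rho>\<^sup>2) * B.N (\<rho>\<^sup>2))"
    have nz: "A.N (\<rho>\<^sup>2) \<noteq> 0" "B.N (\<rho>\<^sup>2) \<noteq> 0" using L by auto
    then have "A.\<Delta> (\<rho>\<^sup>2) / - A.N (\<rho>\<^sup>2) - B.\<Delta> (\<rho>\<^sup>2) / - B.N (\<rho>\<^sup>2) = (A.N (\<rho>\<^sup>2) * B.\<Delta> (\<rho>\<^sup>2) - A.\<Delta> (\<rho>\<^sup>2) * B.N (\<rho>\<^sup>2)) / (A.N (\<rho>\<^sup>2) * B.N (\<rho>\<^sup>2))"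
      by (simp add: field_simps)
    then have "norm (A.\<Delta> (\<rho>\<^sup>2) / - A.N (\<rho>\<^sup>2) - B.\<Delta> (\<rho>\<^sup>2) / - B.N (\<rho>\<^sup>2)) = ?W / (norm (A.N (\<rho>\<^sup>2)) * norm (B.N (\<rho>\<^sup>2)))"
      by (simp add: norm_divide norm_mult)
    also have "\<dots> \<le> ?W / ((c * exp (\<kappa> * pi)) * (c' * exp (\<kappa> * pi)))"
    proof (intro divide_left_mono mult_mono mult_pos_pos L)
      show "0 < norm (A.N (\<rho>\<^sup>2))" "0 < norm (B.N (\<rho>\<^sup>2))" using nz by auto
    qed (use L A(1) B(1) in auto)
    also have "\<dots> = ?W / (c * c') * exp (- (2 * \<kappa> * pi))"
    proof -
      have "exp (- (2 * \<kappa> * pi)) = 1 / (exp (\<kappa> * pi) * exp (\<kappa> * pi))" by (simp add: exp_minus exp_add[symmetric] inverse_eq_divide)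
      then show ?thesis by simp
    qed
    finally have "norm (A.\<Delta> (\<rho>\<^sup>2) / - A.N (\<rho>\<^sup>2) - B.\<Delta> (\<rho>\<^sup>2) / - B.N (\<rho>\<^sup>2)) * \<kappa> ^ (2 * N)
        \<le> ?W / (c * c') * exp (- (2 * \<kappa> * pi)) * \<kappa> ^ nat (m + 1)"
      using k0 A(1) B(1) by (intro mult_mono power_increasing[OF N]) auto
    also have "\<dots> = E \<kappa> / (c * c')" unfolding E_def \<rho>(3) by simp
    finally show "norm (A.\<Delta> (- (complex_of_real \<kappa>)\<^sup>2) / - A.N (- (complex_of_real \<kappa>)\<^sup>2) - B.\<Delta> (- (complex_of_real \<kappa>)\<^sup>2) / - B.N (- (complex_of_real \<kappa>)\<^sup>2)) * \<kappa> ^ (2 * N) \<le> E \<kappa> / (c * c')"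
      unfolding \<rho>(3) .
  qed (use A(1,2) B(1,2) in auto)
  then show ?thesis by (simp add: mult.commute)
qed

end

subsection \<open>Recovery of the coefficients from the Weyl function\<close>

text \<open>From w V = v W and both Wronskians being 1, the pair (V, W) is a multiple P of (v, w)
  with P^2 = 1. A continuous function with values 1 and -1 is constant, so derivatives are
  proportional as well, and comparing second derivatives gives equal potentials wherever v or w is
  nonzero, which is everywhere. All this takes place at a single \<lambda>.\<close>

lemma sl_piece_proportional:
  assumes ab: "a < b" and p: "sl_piece q lam a b v v'" "sl_piece q lam a b w w'" "sl_piece qt lam a b V V'" "sl_piece qt lam a b W W'"
    and q: "q absolutely_integrable_on {a..b}" "qt absolutely_integrable_on {a..b}"
    and wr: "\<And>x. x \<in> {a..b} \<Longrightarrow> v x * w' x - v' x * w x = 1" "\<And>x. x \<in> {a..b} \<Longrightarrow> V x * W' x - V' x * W x = 1"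
    and eq: "\<And>x. x \<in> {a..b} \<Longrightarrow> w x * V x = v x * W x"
  shows "\<exists>s. (s = 1 \<or> s = - 1) \<and>
    (\<forall>x\<in>{a..b}. V x = s * v x \<and> V' x = s * v' x \<and> W x = s * w x \<and> W' x = s * w' x) \<and>
    negligible {x \<in> {a..b}. q x \<noteq> qt x}"
proof -
  note D = sl_piece_derivative[OF p(1)] sl_piece_derivative[OF p(2)] sl_piece_derivative[OF p(3)] sl_piece_derivative[OF p(4)]
  have unique: "f' = g'" if "(f has_vector_derivative f') (at x within {a..b})" "(g has_vector_derivative g') (at x within {a..b})"
    "x \<in> {a..b}" "\<And>x. x \<in> {a..b} \<Longrightarrow> f x = g x" for f g :: "real \<Rightarrow> complex" and f' g' x
  proof -
    have "(f has_vector_derivative g') (at x within {a..b})"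
      by (rule has_vector_derivative_transform[OF that(3) that(4) that(2)])
    then show ?thesis using that(1,3) ab vector_derivative_unique_within_closed_interval[of a b x f f' g'] by simp
  qed
  have deq: "w x * V' x + w' x * V x = v x * W' x + v' x * W x" if x: "x \<in> {a..b}" for x
    by (rule unique[OF has_vector_derivative_mult[OF D(2,3)[OF x]] has_vector_derivative_mult[OF D(1,4)[OF x]] x eq])
  \<comment> \<open>If V = P v and W = P w, then multiplying v w' - v' w = 1 by P leaves exactly
    this expression.\<close>
  define P where "P x = V x * w' x - v' x * W x" for x
  have P: "V x = P x * v x" "W x = P x * w x" "P x * P x = 1" if x: "x \<in> {a..b}" for x
  proof -
    \<comment> \<open>The differentiated relation rewrites P with the roles of the two systems
      exchanged; the second Wronskian then gives P V = v and P W = w, hence P^2 = 1.\<close>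
    have P2: "P x = v x * W' x - w x * V' x" unfolding P_def using deq[OF x] by (simp add: algebra_simps)
    have e: "v x * W x = w x * V x" using eq[OF x] by simp
    have "P x * v x = V x * (v x * w' x) - v' x * (v x * W x)" "P x * w x = (w x * V x) * w' x - v' x * W x * w x"
      unfolding P_def by (simp_all add: algebra_simps)
    then have "P x * v x = V x * (v x * w' x) - v' x * (w x * V x)" "P x * w x = (v x * W x) * w' x - v' x * W x * w x"
      unfolding e .
    then have "P x * v x = V x * (v x * w' x - v' x * w x)" "P x * w x = W x * (v x * w' x - v' x * w x)"
      by (simp_all add: algebra_simps)
    then show 1: "V x = P x * v x" "W x = P x * w x" unfolding wr(1)[OF x] by simp_all
    have "P x * V x = v x * (V x * W' x) - V' x * (w x * V x)" "P x * W x = (v x * W x) * W' x - V' x * W x * w x"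
      unfolding P2 by (simp_all add: algebra_simps)
    then have "P x * V x = v x * (V x * W' x) - V' x * (v x * W x)" "P x * W x = (w x * V x) * W' x - V' x * W x * w x"
      unfolding e .
    then have "P x * V x = v x * (V x * W' x - V' x * W x)" "P x * W x = w x * (V x * W' x - V' x * W x)"
      by (simp_all add: algebra_simps)
    then have "P x * V x = v x" "P x * W x = w x" unfolding wr(2)[OF x] by simp_all
    then have "P x * P x * v x = v x" "P x * P x * w x = w x" unfolding 1 by (simp_all add: mult.assoc)
    moreover have "v x \<noteq> 0 \<or> w x \<noteq> 0" using wr(1)[OF x] by auto
    ultimately show "P x * P x = 1" by auto
  qed
  have "continuous_on {a..b} P" unfolding P_def[abs_def]
    by (intro continuous_intros sl_piece_continuous p) (auto intro: p sl_piece_continuous)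
  moreover have "finite (P ` {a..b})"
  proof (rule finite_subset)
    show "P ` {a..b} \<subseteq> {1, -1}" using P(3) by (fastforce simp: square_eq_1_iff)
  qed simp
  ultimately have "P constant_on {a..b}" by (intro continuous_finite_range_constant) auto
  then obtain s where s: "\<And>x. x \<in> {a..b} \<Longrightarrow> P x = s" unfolding constant_on_def by blast
  have "a \<in> {a..b}" using ab by simp
  with P(3)[OF this] s have s1: "s = 1 \<or> s = - 1" by (simp add: square_eq_1_iff)
  have val: "V x = s * v x" "W x = s * w x" if "x \<in> {a..b}" for x using P(1,2)[OF that] s[OF that] by auto
  have der: "V' x = s * v' x" "W' x = s * w' x" if x: "x \<in> {a..b}" for x
    using unique[OF D(3)[OF x] has_vector_derivative_mult_right[OF D(1)[OF x]] x val(1)]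
      unique[OF D(4)[OF x] has_vector_derivative_mult_right[OF D(2)[OF x]] x val(2)] by simp_all
  have second: "\<exists>N. negligible N \<and> (\<forall>x\<in>{a..b} - N. (z has_vector_derivative (p x - lam) * y x) (at x within {a..b}))"
    if "sl_piece p lam a b y z" "p absolutely_integrable_on {a..b}" for p y z
    using sl_piece_ac_deriv(2)[OF that] unfolding ac_deriv_def by blast
  obtain N1 where N1: "negligible N1" "\<forall>x\<in>{a..b} - N1. (v' has_vector_derivative (q x - lam) * v x) (at x within {a..b})"
    using second[OF p(1) q(1)] by blast
  obtain N2 where N2: "negligible N2" "\<forall>x\<in>{a..b} - N2. (w' has_vector_derivative (q x - lam) * w x) (at x within {a..b})"
    using second[OF p(2) q(1)] by blast
  obtain N3 where N3: "negligible N3" "\<forall>x\<in>{a..b} - N3. (V' has_vector_derivative (qt x - lam) * V x) (at x within {a..b})"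
    using second[OF p(3) q(2)] by blast
  obtain N4 where N4: "negligible N4" "\<forall>x\<in>{a..b} - N4. (W' has_vector_derivative (qt x - lam) * W x) (at x within {a..b})"
    using second[OF p(4) q(2)] by blast
  have qeq: "q x = qt x" if x: "x \<in> {a..b} - (N1 \<union> N2 \<union> N3 \<union> N4)" for x
  proof -
    have x': "x \<in> {a..b}" using x by blast
    have "(qt x - lam) * V x = s * ((q x - lam) * v x)"
      by (rule unique[OF N3(2)[rule_format] has_vector_derivative_mult_right[OF N1(2)[rule_format]] x' der(1)]) (use x in auto)
    moreover have "(qt x - lam) * W x = s * ((q x - lam) * w x)"
      by (rule unique[OF N4(2)[rule_format] has_vector_derivative_mult_right[OF N2(2)[rule_format]] x' der(2)]) (use x in auto)
    ultimately have "s * ((qt x - q x) * v x) = 0" "s * ((qt x - q x) * w x) = 0" unfolding val[OF x'] by (simp_all add: algebra_simps)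
    moreover have "v x \<noteq> 0 \<or> w x \<noteq> 0" using wr(1)[OF x'] by auto
    ultimately show ?thesis using s1 by auto
  qed
  have "negligible (N1 \<union> N2 \<union> N3 \<union> N4)" using N1(1) N2(1) N3(1) N4(1) by simp
  then have "negligible {x \<in> {a..b}. q x \<noteq> qt x}" by (rule negligible_subset) (use qeq in blast)
  then show ?thesis using s1 val der by blast
qed

context jump_problem
begin

text \<open>Both sides solve the same problem and have the same data at \<pi>, namely N and Delta -
  H N for the value and the derivative.\<close>

lemma u_combination:
  shows "x \<in> {0..d} \<Longrightarrow> ul lam x = \<Delta> lam * wl lam x + N lam * vl lam x"
    "x \<in> {d..pi} \<Longrightarrow> ur lam x = \<Delta> lam * wr lam x + N lam * vr lam x"
  using jump_pair_unique[OF u_pair jump_pair_lincomb[OF w_pair v_pair q d, of lam "\<Delta> lam" "N lam"] q d \<beta>0, of x]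
  by (simp_all add: v w N_def \<Delta>_def)

lemma vw_wronskian:
  shows "x \<in> {0..d} \<Longrightarrow> vl lam x * wl' lam x - vl' lam x * wl lam x = 1"
    "x \<in> {d..pi} \<Longrightarrow> vr lam x * wr' lam x - vr' lam x * wr lam x = 1"
  using wronskian_jump_pair[OF v_pair w_pair q d \<beta>0, of x lam] wronskian_jump_pair(2)[OF v_pair w_pair q d \<beta>0, of pi lam] d
  by (simp_all add: v w)

end

text \<open>Expressing \<psi>-infinity through \<phi> and \<psi>, the difference g equals u V /
  Delta - v U / Delta~, the N-terms cancelling by \<open>NE\<close>. The growths e^(|Im \<rho>| x)
  and e^(|Im \<rho>| (\<pi> - x)) multiply to that of Delta without its factor |\<rho>|, so g is
  O(1/|\<rho>|) on the squares. Since g is entire from the outset, no poles need to be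
  discussed.\<close>

lemma entire_eq_of_quotients_eq:
  fixes u v w U V W \<Delta> \<Delta>' N N' :: "complex \<Rightarrow> complex"
  assumes hol: "v holomorphic_on UNIV" "w holomorphic_on UNIV" "V holomorphic_on UNIV" "W holomorphic_on UNIV"
    and comb: "\<And>z. u z = \<Delta> z * w z + N z * v z" "\<And>z. U z = \<Delta>' z * W z + N' z * V z"
    and NE: "\<And>z. N z * \<Delta>' z = N' z * \<Delta> z"
    and pos: "0 < c" "0 < c'" "0 < C" "0 < C'"
    and bounds: "\<And>n \<rho>. n0 \<le> n \<Longrightarrow> square_norm \<rho> = real n + 1/2 \<Longrightarrow>
       c * norm \<rho> * exp (\<bar>Im \<rho>\<bar> * pi) \<le> norm (\<Delta> (\<rho>\<^sup>2)) \<and> c' * norm \<rho> * exp (\<bar>Im \<rho>\<bar> * pi) \<le> norm (\<Delta>' (\<rho>\<^sup>2)) \<and>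
       norm (u (\<rho>\<^sup>2)) \<le> C * exp (\<bar>Im \<rho>\<bar> * x) \<and> norm (U (\<rho>\<^sup>2)) \<le> C' * exp (\<bar>Im \<rho>\<bar> * x) \<and>
       norm (v (\<rho>\<^sup>2)) \<le> C * exp (\<bar>Im \<rho>\<bar> * (pi - x)) \<and> norm (V (\<rho>\<^sup>2)) \<le> C' * exp (\<bar>Im \<rho>\<bar> * (pi - x))"
  shows "w z * V z = v z * W z"
proof -
  define g where "g z = w z * V z - v z * W z" for z
  define K where "K = C * C' / c + C * C' / c'"
  have K: "0 < K" using pos by (simp add: K_def add_pos_pos)
  have g: "g holomorphic_on UNIV" unfolding g_def[abs_def] using hol by (intro holomorphic_intros)
  have gb: "norm (g (\<rho>\<^sup>2)) \<le> K / norm \<rho>" if n: "n0 \<le> n" "square_norm \<rho> = real n + 1/2" for n \<rho>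
  proof -
    note b = bounds[OF n]
    have r: "0 < norm \<rho>" using square_norm_le_norm[of \<rho>] n by linarith
    have nz: "\<Delta> (\<rho>\<^sup>2) \<noteq> 0" "\<Delta>' (\<rho>\<^sup>2) \<noteq> 0"
      using b r pos by (auto simp: mult_le_0_iff)
    have "\<Delta> z * \<Delta>' z * g z = \<Delta>' z * u z * V z - \<Delta> z * v z * U z" for z
    proof -
      have "\<Delta>' z * u z * V z - \<Delta> z * v z * U z = \<Delta> z * \<Delta>' z * g z + (N z * \<Delta>' z - N' z * \<Delta> z) * (v z * V z)"
        unfolding comb g_def by (simp add: algebra_simps)
      then show ?thesis by (simp add: NE)
    qed
    then have "g (\<rho>\<^sup>2) = u (\<rho>\<^sup>2) * V (\<rho>\<^sup>2) / \<Delta> (\<rho>\<^sup>2) - v (\<rho>\<^sup>2) * U (\<rho>\<^sup>2) / \<Delta>' (\<rho>\<^sup>2)"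
      using nz by (simp add: field_simps)
    then have "norm (g (\<rho>\<^sup>2)) \<le> norm (u (\<rho>\<^sup>2)) * norm (V (\<rho>\<^sup>2)) / norm (\<Delta> (\<rho>\<^sup>2)) + norm (v (\<rho>\<^sup>2)) * norm (U (\<rho>\<^sup>2)) / norm (\<Delta>' (\<rho>\<^sup>2))"
      by (metis norm_triangle_ineq4 norm_mult norm_divide)
    also have "\<dots> \<le> (C * exp (\<bar>Im \<rho>\<bar> * x)) * (C' * exp (\<bar>Im \<rho>\<bar> * (pi - x))) / (c * norm \<rho> * exp (\<bar>Im \<rho>\<bar> * pi))
        + (C * exp (\<bar>Im \<rho>\<bar> * (pi - x))) * (C' * exp (\<bar>Im \<rho>\<bar> * x)) / (c' * norm \<rho> * exp (\<bar>Im \<rho>\<bar> * pi))"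
      using b pos r by (intro add_mono frac_le mult_mono) auto
    also have "\<dots> = K / norm \<rho>"
    proof -
      have ee: "exp (\<bar>Im \<rho>\<bar> * pi) = exp (\<bar>Im \<rho>\<bar> * x) * exp (\<bar>Im \<rho>\<bar> * (pi - x))" unfolding exp_add[symmetric] by (simp add: algebra_simps)
      have gen: "(C * a) * (C' * b) / (c * norm \<rho> * (a * b)) + (C * b) * (C' * a) / (c' * norm \<rho> * (a * b)) = K / norm \<rho>"
        if "a \<noteq> 0" "b \<noteq> 0" for a b :: real
        using that by (simp add: K_def add_divide_distrib)
      show ?thesis unfolding ee by (rule gen) simp_all
    qed
    finally show ?thesis .
  qed
  have "g (\<rho>\<^sup>2) = 0" for \<rho>
  proof (rule entire_small_on_squares_imp_zero[where g = "\<lambda>\<rho>. g (\<rho>\<^sup>2)" and s = "1/2"])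
    show "(\<lambda>\<rho>. g (\<rho>\<^sup>2)) holomorphic_on UNIV"
      using holomorphic_on_compose_gen[OF _ g, of "\<lambda>\<rho>. \<rho>\<^sup>2" UNIV] by (simp add: o_def holomorphic_on_power)
    fix e :: real assume e: "0 < e"
    have "norm (g (\<rho>\<^sup>2)) \<le> e" if n: "max n0 (nat \<lceil>K / e\<rceil>) \<le> n" "square_norm \<rho> = real n + 1/2" for n \<rho>
    proof -
      have "K / e \<le> real n" using n by linarith
      then have "K / e \<le> norm \<rho>" "0 < norm \<rho>" using square_norm_le_norm[of \<rho>] n(2) by linarith+
      then have "K / norm \<rho> \<le> e" using e by (simp add: field_simps)
      then show ?thesis using gb[of n \<rho>] n by simp
    qed
    then show "\<exists>n0. \<forall>n\<ge>n0. \<forall>\<rho>. square_norm \<rho> = real n + 1/2 \<longrightarrow> norm (g (\<rho>\<^sup>2)) \<le> e" by blast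
  qed simp
  from this[of "csqrt z"] show ?thesis by (simp add: g_def)
qed

context two_problems
begin

lemma Weyl_solutions_proportional:
  assumes NE: "\<And>z. A.N z * B.\<Delta> z = B.N z * A.\<Delta> z"
  shows "x \<in> {0..d} \<Longrightarrow> wl z x * Vl z x = vl z x * Wl z x" "x \<in> {d..pi} \<Longrightarrow> wr z x * Vr z x = vr z x * Wr z x"
proof -
  obtain c C n1 where A: "0 < c" "0 < C"
    "\<And>n \<rho>. n1 \<le> n \<Longrightarrow> square_norm \<rho> = real n + 1/2 \<Longrightarrow> c * norm \<rho> * exp (\<bar>Im \<rho>\<bar> * pi) \<le> norm (A.\<Delta> (\<rho>\<^sup>2))"
    "\<And>\<rho> x. real n1 \<le> norm \<rho> \<Longrightarrow> x \<in> {0..d} \<Longrightarrow> norm (ul (\<rho>\<^sup>2) x) \<le> C * exp (\<bar>Im \<rho>\<bar> * x)"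
    "\<And>\<rho> x. real n1 \<le> norm \<rho> \<Longrightarrow> x \<in> {d..pi} \<Longrightarrow> norm (ur (\<rho>\<^sup>2) x) \<le> C * exp (\<bar>Im \<rho>\<bar> * x)"
    "\<And>\<rho> x. real n1 \<le> norm \<rho> \<Longrightarrow> x \<in> {0..d} \<Longrightarrow> norm (vl (\<rho>\<^sup>2) x) \<le> C * exp (\<bar>Im \<rho>\<bar> * (pi - x))"
    "\<And>\<rho> x. real n1 \<le> norm \<rho> \<Longrightarrow> x \<in> {d..pi} \<Longrightarrow> norm (vr (\<rho>\<^sup>2) x) \<le> C * exp (\<bar>Im \<rho>\<bar> * (pi - x))"
    by (rule A.solution_bounds) blast
  obtain c' C' n2 where B: "0 < c'" "0 < C'"
    "\<And>n \<rho>. n2 \<le> n \<Longrightarrow> square_norm \<rho> = real n + 1/2 \<Longrightarrow> c' * norm \<rho> * exp (\<bar>Im \<rho>\<bar> * pi) \<le> norm (B.\<Delta> (\<rho>\<^sup>2))"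
    "\<And>\<rho> x. real n2 \<le> norm \<rho> \<Longrightarrow> x \<in> {0..d} \<Longrightarrow> norm (Ul (\<rho>\<^sup>2) x) \<le> C' * exp (\<bar>Im \<rho>\<bar> * x)"
    "\<And>\<rho> x. real n2 \<le> norm \<rho> \<Longrightarrow> x \<in> {d..pi} \<Longrightarrow> norm (Ur (\<rho>\<^sup>2) x) \<le> C' * exp (\<bar>Im \<rho>\<bar> * x)"
    "\<And>\<rho> x. real n2 \<le> norm \<rho> \<Longrightarrow> x \<in> {0..d} \<Longrightarrow> norm (Vl (\<rho>\<^sup>2) x) \<le> C' * exp (\<bar>Im \<rho>\<bar> * (pi - x))"
    "\<And>\<rho> x. real n2 \<le> norm \<rho> \<Longrightarrow> x \<in> {d..pi} \<Longrightarrow> norm (Vr (\<rho>\<^sup>2) x) \<le> C' * exp (\<bar>Im \<rho>\<bar> * (pi - x))"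
    by (rule B.solution_bounds) blast
  have n: "n1 \<le> n" "n2 \<le> n" "real n1 \<le> norm \<rho>" "real n2 \<le> norm \<rho>" if "max n1 n2 \<le> n" "square_norm \<rho> = real n + 1/2" for n \<rho>
    using that square_norm_le_norm[of \<rho>] by auto
  have hol: "(\<lambda>lam. vl lam x) holomorphic_on UNIV" "(\<lambda>lam. wl lam x) holomorphic_on UNIV" "(\<lambda>lam. Vl lam x) holomorphic_on UNIV" "(\<lambda>lam. Wl lam x) holomorphic_on UNIV" if "x \<in> {0..d}" for x
    using A.v(1) A.w(1) B.v(1) B.w(1) that by (simp_all add: sl_family_def)
  have hor: "(\<lambda>lam. vr lam x) holomorphic_on UNIV" "(\<lambda>lam. wr lam x) holomorphic_on UNIV" "(\<lambda>lam. Vr lam x) holomorphic_on UNIV" "(\<lambda>lam. Wr lam x) holomorphic_on UNIV" if "x \<in> {d..pi}" for x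
    using A.v(1) A.w(1) B.v(1) B.w(1) that by (simp_all add: sl_family_def)
  show "wl z x * Vl z x = vl z x * Wl z x" if x: "x \<in> {0..d}"
    by (rule entire_eq_of_quotients_eq[OF hol[OF x] A.u_combination(1)[OF x] B.u_combination(1)[OF x] NE A(1) B(1) A(2) B(2), of "max n1 n2" x])
      (use A(3)[OF n(1)] B(3)[OF n(2)] A(4)[OF n(3) x] B(4)[OF n(4) x] A(6)[OF n(3) x] B(6)[OF n(4) x] in blast)
  show "wr z x * Vr z x = vr z x * Wr z x" if x: "x \<in> {d..pi}"
    by (rule entire_eq_of_quotients_eq[OF hor[OF x] A.u_combination(2)[OF x] B.u_combination(2)[OF x] NE A(1) B(1) A(2) B(2), of "max n1 n2" x])
      (use A(3)[OF n(1)] B(3)[OF n(2)] A(5)[OF n(3) x] B(5)[OF n(4) x] A(7)[OF n(3) x] B(7)[OF n(4) x] in blast)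
qed

text \<open>One value of \<lambda>, here 0, is enough to read off the coefficients. The values of
  \<psi> and \<psi>-infinity at \<open>d\<close> do not both vanish, so the jump conditions written
  for these two solutions determine \<beta> up to a sign, and then \<gamma>.\<close>

theorem coefficients_eq:
  assumes NE: "\<And>z. A.N z * B.\<Delta> z = B.N z * A.\<Delta> z"
  shows "h = ht \<and> \<beta> = \<beta>t \<and> \<gamma> = \<gamma>t \<and> (AE x in lebesgue. x \<in> {0..pi} \<longrightarrow> q x = qt x)"
proof -
  have pA: "sl_piece q 0 0 d (vl 0) (vl' 0)" "sl_piece q 0 d pi (vr 0) (vr' 0)" "sl_piece q 0 0 d (wl 0) (wl' 0)" "sl_piece q 0 d pi (wr 0) (wr' 0)"
    and jA: "vr 0 d = of_real \<beta> * vl 0 d" "vr' 0 d = of_real (inverse \<beta>) * vl' 0 d + \<gamma> * vl 0 d"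
      "wr 0 d = of_real \<beta> * wl 0 d" "wr' 0 d = of_real (inverse \<beta>) * wl' 0 d + \<gamma> * wl 0 d"
    using A.v_pair[of 0] A.w_pair[of 0] by (simp_all add: jump_pair_def)
  have pB: "sl_piece qt 0 0 d (Vl 0) (Vl' 0)" "sl_piece qt 0 d pi (Vr 0) (Vr' 0)" "sl_piece qt 0 0 d (Wl 0) (Wl' 0)" "sl_piece qt 0 d pi (Wr 0) (Wr' 0)"
    and jB: "Vr 0 d = of_real \<beta>t * Vl 0 d" "Vr' 0 d = of_real (inverse \<beta>t) * Vl' 0 d + \<gamma>t * Vl 0 d"
      "Wr 0 d = of_real \<beta>t * Wl 0 d" "Wr' 0 d = of_real (inverse \<beta>t) * Wl' 0 d + \<gamma>t * Wl 0 d"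
    using B.v_pair[of 0] B.w_pair[of 0] by (simp_all add: jump_pair_def)
  have ql: "q absolutely_integrable_on {0..d}" "qt absolutely_integrable_on {0..d}" and qr: "q absolutely_integrable_on {d..pi}" "qt absolutely_integrable_on {d..pi}"
    using A.q B.q A.d by (auto intro: absolutely_integrable_on_subinterval)
  obtain sl where sl: "sl = 1 \<or> sl = - 1"
    "\<And>x. x \<in> {0..d} \<Longrightarrow> Vl 0 x = sl * vl 0 x \<and> Vl' 0 x = sl * vl' 0 x \<and> Wl 0 x = sl * wl 0 x \<and> Wl' 0 x = sl * wl' 0 x"
    "negligible {x \<in> {0..d}. q x \<noteq> qt x}"
    using sl_piece_proportional[OF A.d(1) pA(1,3) pB(1,3) ql A.vw_wronskian(1) B.vw_wronskian(1) Weyl_solutions_proportional(1)[OF NE]] by blast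
  obtain sr where sr: "sr = 1 \<or> sr = - 1"
    "\<And>x. x \<in> {d..pi} \<Longrightarrow> Vr 0 x = sr * vr 0 x \<and> Vr' 0 x = sr * vr' 0 x \<and> Wr 0 x = sr * wr 0 x \<and> Wr' 0 x = sr * wr' 0 x"
    "negligible {x \<in> {d..pi}. q x \<noteq> qt x}"
    using sl_piece_proportional[OF A.d(2) pA(2,4) pB(2,4) qr A.vw_wronskian(2) B.vw_wronskian(2) Weyl_solutions_proportional(2)[OF NE]] by blast
  have "sr = 1" using sr(2)[of pi] A.d by (simp add: A.v B.v)
  then have r: "Vr 0 d = vr 0 d" "Vr' 0 d = vr' 0 d" "Wr 0 d = wr 0 d" "Wr' 0 d = wr' 0 d" using sr(2)[of d] A.d by auto
  have l: "Vl 0 d = sl * vl 0 d" "Vl' 0 d = sl * vl' 0 d" "Wl 0 d = sl * wl 0 d" "Wl' 0 d = sl * wl' 0 d" using sl(2)[of d] A.d by auto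
  have nz: "vl 0 d \<noteq> 0 \<or> wl 0 d \<noteq> 0" using A.vw_wronskian(1)[of d 0] A.d by auto
  have "of_real \<beta>t * (sl * vl 0 d) = of_real \<beta> * vl 0 d" "of_real \<beta>t * (sl * wl 0 d) = of_real \<beta> * wl 0 d"
    using r(1,3) unfolding jA jB l .
  then have bs: "complex_of_real \<beta> = of_real \<beta>t * sl" using nz by (auto simp: mult.assoc[symmetric])
  have s1: "sl = 1"
  proof (rule ccontr)
    assume "sl \<noteq> 1"
    then have "complex_of_real \<beta> = of_real (- \<beta>t)" using bs sl(1) by simp
    then show False using A.\<beta> B.\<beta> unfolding of_real_eq_iff by simp
  qed
  then have b: "\<beta> = \<beta>t" using bs by simp
  have "(\<gamma>t - \<gamma>) * vl 0 d = 0" "(\<gamma>t - \<gamma>) * wl 0 d = 0"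
    using r(2,4) unfolding jA jB l s1 b by (simp_all add: algebra_simps)
  then have g: "\<gamma> = \<gamma>t" using nz by auto
  have "Vl 0 0 = vl 0 0" "Vl' 0 0 = vl' 0 0" "Wl 0 0 = wl 0 0" "Wl' 0 0 = wl' 0 0" using sl(2)[of 0] A.d s1 by auto
  \<comment> \<open>With equal solutions at 0, only h can differ in the formulas for the derivatives
    there. Inserting the resulting changes of Delta and N into \<open>NE\<close> leaves (h~ - h)
    times \<psi>(0) N + Delta \<psi>-infinity(0), and that factor is 1 by
    \<open>value_relation\<close>.\<close>
  then have "B.\<Delta> 0 = A.\<Delta> 0 + (ht - h) * vl 0 0" "B.N 0 = A.N 0 - (ht - h) * wl 0 0"
    using A.v'_0[of 0] A.w'_0[of 0] B.v'_0[of 0] B.w'_0[of 0] by (simp_all add: algebra_simps)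
  with NE[of 0] have "(ht - h) * (vl 0 0 * A.N 0 + A.\<Delta> 0 * wl 0 0) = 0" by (simp add: algebra_simps)
  then have hh: "h = ht" using A.value_relation[of 0] by simp
  have "{x. \<not> (x \<in> {0..pi} \<longrightarrow> q x = qt x)} \<subseteq> {x \<in> {0..d}. q x \<noteq> qt x} \<union> {x \<in> {d..pi}. q x \<noteq> qt x}" by auto
  then have "negligible {x. \<not> (x \<in> {0..pi} \<longrightarrow> q x = qt x)}" by (rule negligible_subset[OF negligible_Un[OF sl(3) sr(3)]])
  then have "AE x in lebesgue. x \<in> {0..pi} \<longrightarrow> q x = qt x"
    by (intro AE_I[where N = "{x. \<not> (x \<in> {0..pi} \<longrightarrow> q x = qt x)}"]) (auto simp: negligible_iff_null_sets)
  with hh b g show ?thesis by blast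
qed

end

theorem corollary2:
  fixes q qt :: "real \<Rightarrow> complex" and h ht H \<gamma> \<gamma>t :: complex and \<beta> \<beta>t d :: real
    and l lt l_inf lt_inf :: "nat \<Rightarrow> complex" and m :: int
  assumes "set_integrable lebesgue {0..pi} q" "set_integrable lebesgue {0..pi} qt"
    and "0 < \<beta>" "0 < \<beta>t"
    and "0 < d" "d < pi"
    and "eigenvalue_seq (Delta q h H \<beta> \<gamma> d) l"
    and "eigenvalue_seq (Delta qt ht H \<beta>t \<gamma>t d) lt"
    and "eigenvalue_seq (Delta_inf q h \<beta> \<gamma> d) l_inf"
    and "eigenvalue_seq (Delta_inf qt ht \<beta>t \<gamma>t d) lt_inf"
    and "m \<ge> -1"
    and "C_near_pi m q" "C_near_pi m qt"
    and "\<forall>j::nat. int j \<le> m \<longrightarrow> (dx ^^ j) q pi = (dx ^^ j) qt pi"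
    and "spectral_data_agree (Delta q h H \<beta> \<gamma> d) (psi q H \<beta> \<gamma> d) l
           (Delta qt ht H \<beta>t \<gamma>t d) (psi qt H \<beta>t \<gamma>t d) lt (nat ((m + 3) div 2))
       \<or> spectral_data_agree (Delta_inf q h \<beta> \<gamma> d) (psi_inf q \<beta> \<gamma> d) l_inf
           (Delta_inf qt ht \<beta>t \<gamma>t d) (psi_inf qt \<beta>t \<gamma>t d) lt_inf (nat ((m + 1) div 2))"
  shows "h = ht \<and> \<beta> = \<beta>t \<and> \<gamma> = \<gamma>t \<and> (AE x in lebesgue. x \<in> {0..pi} \<longrightarrow> q x = qt x)"
proof -
  \<comment> \<open>Holomorphic families are constructed for each set of coefficients; through them
    the characteristic functions and norming constants of the statement become those of the
    locale.\<close>
  have families: "\<exists>ul ul' ur ur' vl vl' vr vr' wl wl' wr wr'. jump_problem q d \<beta> \<gamma> h H ul ul' ur ur' vl vl' vr vr' wl wl' wr wr'"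
    if q\<beta>: "set_integrable lebesgue {0..pi} q" "0 < \<beta>" for q \<beta> \<gamma> h
  proof -
    have \<beta>: "\<beta> \<noteq> 0" using q\<beta> by simp
    obtain ul ul' ur ur' where u: "sl_family q d \<beta> \<gamma> ul ul' ur ur'" "\<And>lam. ul lam 0 = 1" "\<And>lam. ul' lam 0 = h"
      by (rule sl_family_exists_0[where \<beta> = \<beta> and \<gamma> = \<gamma> and ?c0.0 = 1 and ?c1.0 = h, OF q\<beta>(1) assms(5,6)]) blast
    obtain vl vl' vr vr' where v: "sl_family q d \<beta> \<gamma> vl vl' vr vr'" "\<And>lam. vr lam pi = 1" "\<And>lam. vr' lam pi = - H"
      by (rule sl_family_exists_pi[where \<beta> = \<beta> and \<gamma> = \<gamma> and ?c0.0 = 1 and ?c1.0 = "- H", OF q\<beta>(1) assms(5,6) \<beta>]) blast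
    obtain wl wl' wr wr' where w: "sl_family q d \<beta> \<gamma> wl wl' wr wr'" "\<And>lam. wr lam pi = 0" "\<And>lam. wr' lam pi = 1"
      by (rule sl_family_exists_pi[where \<beta> = \<beta> and \<gamma> = \<gamma> and ?c0.0 = 0 and ?c1.0 = 1, OF q\<beta>(1) assms(5,6) \<beta>]) blast
    have "jump_problem q d \<beta> \<gamma> h H ul ul' ur ur' vl vl' vr vr' wl wl' wr wr'"
      by unfold_locales (use q\<beta> assms(5,6) u v w in auto)
    then show ?thesis by blast
  qed
  obtain ul ul' ur ur' vl vl' vr vr' wl wl' wr wr' where A: "jump_problem q d \<beta> \<gamma> h H ul ul' ur ur' vl vl' vr vr' wl wl' wr wr'"
    using families[of q \<beta> \<gamma> h, OF assms(1,3)] by blast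
  obtain Ul Ul' Ur Ur' Vl Vl' Vr Vr' Wl Wl' Wr Wr' where B: "jump_problem qt d \<beta>t \<gamma>t ht H Ul Ul' Ur Ur' Vl Vl' Vr Vr' Wl Wl' Wr Wr'"
    using families[of qt \<beta>t \<gamma>t ht, OF assms(2,4)] by blast
  interpret two_problems q qt d \<beta> \<beta>t \<gamma> \<gamma>t h ht H ul ul' ur ur' vl vl' vr vr' wl wl' wr wr' Ul Ul' Ur Ur' Vl Vl' Vr Vr' Wl Wl' Wr Wr'
    by (rule two_problems.intro[OF A B])
  have j: "\<And>j::nat. int j \<le> m \<Longrightarrow> (dx ^^ j) q pi = (dx ^^ j) qt pi" using assms(14) by blast
  have "A.N z * B.\<Delta> z = B.N z * A.\<Delta> z" for z
    using assms(7-10,15) quotients_eq_of_spectral_data[OF assms(11-13) j] quotients_eq_of_spectral_data_inf[OF assms(11-13) j]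
    unfolding A.Delta_eq B.Delta_eq A.Delta_inf_eq B.Delta_inf_eq by blast
  then show ?thesis by (rule coefficients_eq)
qed

end
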